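(* For all integers $n\ge 2$ and $d\ge 4$ we have $\mu^s(n,d)=\mu(n,d)=2n+1$. In particular, if $I\subset k[x_0,x_1,\dots,x_n]$ is a minimal (resp. smooth minimal) monomial Togliatti system of forms of degree $d$, then $\mu(I)\ge 2n+1$. In addition, all minimal monomial Togliatti systems $I\subset k[x_0,\dots,x_n]$ of forms of degree $d\ge 4$ with $\mu(I)=2n+1$ are trivial unless one of the following cases holds: (i) $(n,d)=(2,5)$ and, up to a permutation of the coordinates, $I=(x_0^5,x_1^5,x_2^5,x_0^3x_1x_2,x_0x_1^2x_2^2)$; (ii) $(n,d)=(2,4)$ and, up to a permutation of the coordinates, $I=(x_0^4,x_1^4,x_2^4,x_0x_1x_2^2,x_0^2x_1^2)$. Furthermore, the system in (i) is smooth and the system in (ii) is not smooth.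
   Context: $k$ is an algebraically closed field of characteristic zero and $R=k[x_0,\dots,x_n]$. Togliatti systems. Let $I\subset R$ be a homogeneous artinian ideal generated by $r$ forms $F_1,\dots,F_r$ of degree $d$, with $r\le\binom{n+d-1}{n-1}$. $I$ is a Togliatti system (of forms of degree $d$) if it satisfies the following (known to be equivalent) conditions: (1) $I$ fails the weak Lefschetz property in degree $d-1$, i.e. for a general linear form $L$ the multiplication map $\times L:(R/I)_{d-1}\to(R/I)_d$ does not have maximal rank (is neither injective nor surjective); (2) $F_1,\dots,F_r$ become $k$-linearly dependent on a general hyperplane of $\mathbb{P}^n$; (3) the variety $X$ associated to $I$ satisfies at least one Laplace equation of order $d-1$, i.e. its $(d-1)$-st osculating space at a general point has dimension less than $\binom{n+d-1}{d-1}-1$. It is monomial if $I$ is generated by monomials. For a monomial $I$, $X$ is the closure of the image of the rational map $\mathbb{P}^n\dashrightarrow\mathbb{P}^{\binom{n+d}{d}-r-1}$ given by all monomials of degree $d$ not in $I$ (here $r$ is the minimal number of generators). A monomial Togliatti system is smooth if $X$ is a smooth variety. It is minimal if, $I$ being generated by monomials $m_1,\dots,m_r$ of degree $d$, no proper subset of $\{m_1,\dots,m_r\}$ generates a monomial Togliatti system. A Togliatti system $I$ of forms of degree $d$ is trivial if there is a form $F$ of degree $d-1$ such that $I$ contains $x_0F,\dots,x_nF$. $\mu(I)$ is the minimal number of generators of $I$. $\mathcal{T}(n,d)$ is the set of all minimal monomial Togliatti systems $I\subset k[x_0,\dots,x_n]$ of forms of degree $d$, and $\mathcal{T}^s(n,d)\subset\mathcal{T}(n,d)$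 the subset of the smooth ones. $\mu(n,d)=\min\{\mu(I)\mid I\in\mathcal{T}(n,d)\}$ and $\mu^s(n,d)=\min\{\mu(I)\mid I\in\mathcal{T}^s(n,d)\}$. *)

theory Defs
  imports
    "HOL-Library.Poly_Mapping"
    "HOL-Library.Function_Algebras"
    "HOL-Algebra.QuotRing"
    "HOL-Computational_Algebra.Polynomial"
    "HOL-Combinatorics.Permutations"
begin

section \<open>Multivariate polynomials\<close>

text \<open>
  A monomial is a finitely supported exponent function, a polynomial a finitely supported map from
  monomials to coefficients; multiplication is the convolution product of
  \<^theory>\<open>HOL-Library.Poly_Mapping\<close>.
  The set \<open>V\<close> of variables is an explicit argument. The ring \<open>k[x_0,...,x_n]\<close> is the case
  \<open>V = {..n}\<close>; the homogeneous coordinate ring of the projective space that contains \<open>X\<close> is the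
  case where \<open>V\<close> is a set of monomials.
\<close>

type_synonym ('v, 'k) mpoly = "('v \<Rightarrow>\<^sub>0 nat) \<Rightarrow>\<^sub>0 'k"

definition mpoly_ring :: "'v set \<Rightarrow> ('v, 'k::comm_ring_1) mpoly ring" where
  "mpoly_ring V =
     \<lparr>carrier = {f. \<forall>m\<in>Poly_Mapping.keys f. Poly_Mapping.keys m \<subseteq> V},
      monoid.mult = (*), one = 1, zero = 0, add = (+)\<rparr>"

definition mdeg :: "('v \<Rightarrow>\<^sub>0 nat) \<Rightarrow> nat" where
  "mdeg m = (\<Sum>v\<in>Poly_Mapping.keys m. Poly_Mapping.lookup m v)"

text \<open>The zero polynomial is a form of every degree.\<close>

definition forms :: "'v set \<Rightarrow> nat \<Rightarrow> ('v, 'k::comm_ring_1) mpoly set" where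
  "forms V t = {f \<in> carrier (mpoly_ring V). \<forall>m\<in>Poly_Mapping.keys f. mdeg m = t}"

definition Var :: "'v \<Rightarrow> ('v, 'k::comm_ring_1) mpoly" where
  "Var v = Poly_Mapping.single (Poly_Mapping.single v 1) 1"

definition mon_eval :: "('v \<Rightarrow>\<^sub>0 nat) \<Rightarrow> ('v \<Rightarrow> 'k::comm_ring_1) \<Rightarrow> 'k" where
  "mon_eval m p = (\<Prod>v\<in>Poly_Mapping.keys m. p v ^ Poly_Mapping.lookup m v)"

definition mpoly_eval :: "('v, 'k::comm_ring_1) mpoly \<Rightarrow> ('v \<Rightarrow> 'k) \<Rightarrow> 'k" where
  "mpoly_eval f p = (\<Sum>m\<in>Poly_Mapping.keys f. Poly_Mapping.lookup f m * mon_eval m p)"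

text \<open>
  Subtraction of exponents is truncated, but the coefficient is zero whenever \<open>v\<close> does not occur
  in the monomial.
\<close>

definition mpoly_partial :: "'v \<Rightarrow> ('v, 'k::comm_ring_1) mpoly \<Rightarrow> ('v, 'k) mpoly" where
  "mpoly_partial v f =
     (\<Sum>m\<in>Poly_Mapping.keys f.
        Poly_Mapping.single (m - Poly_Mapping.single v 1)
          (of_nat (Poly_Mapping.lookup m v) * Poly_Mapping.lookup f m))"


section \<open>Togliatti systems\<close>

abbreviation polyR :: "nat \<Rightarrow> (nat, 'k::comm_ring_1) mpoly ring" where
  "polyR n \<equiv> mpoly_ring {..n}"

definition artinian_ring :: "('a, 'b) ring_scheme \<Rightarrow> bool" where
  "artinian_ring A \<longleftrightarrow>
     (\<forall>J :: nat \<Rightarrow> 'a set. (\<forall>i. ideal (J i) A) \<and> (\<forall>i. J (Suc i) \<subseteq> J i) \<longrightarrow>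
        (\<exists>N. \<forall>i\<ge>N. J i = J N))"

text \<open>\<open>(R/I)_t\<close> is the set of residue classes of the forms of degree \<open>t\<close>.\<close>

definition quot_comp :: "nat \<Rightarrow> (nat, 'k::comm_ring_1) mpoly set \<Rightarrow> nat \<Rightarrow> (nat, 'k) mpoly set set" where
  "quot_comp n I t = (\<lambda>f. I +>\<^bsub>polyR n\<^esub> f) ` forms {..n} t"

definition mult_map ::
  "nat \<Rightarrow> (nat, 'k::comm_ring_1) mpoly set \<Rightarrow> (nat, 'k) mpoly \<Rightarrow> (nat, 'k) mpoly set \<Rightarrow> (nat, 'k) mpoly set"
  where "mult_map n I L c = (I +>\<^bsub>polyR n\<^esub> L) \<otimes>\<^bsub>polyR n Quot I\<^esub> c"

text \<open>
  A property holds for a general linear form if it holds on a nonempty Zariski open subset of the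
  affine space of coefficient vectors. The sets \<open>g \<noteq> 0\<close>, for \<open>g\<close> a nonzero polynomial in the
  \<open>n+1\<close> coefficients, form a base of the nonempty Zariski open sets, as the field is infinite.
\<close>

definition general_linear_form :: "nat \<Rightarrow> ((nat, 'k::comm_ring_1) mpoly \<Rightarrow> bool) \<Rightarrow> bool" where
  "general_linear_form n P \<longleftrightarrow>
     (\<exists>g \<in> carrier (polyR n :: (nat, 'k) mpoly ring). g \<noteq> 0 \<and>
        (\<forall>L \<in> forms {..n} 1.
           mpoly_eval g (\<lambda>i. Poly_Mapping.lookup L (Poly_Mapping.single i 1)) \<noteq> 0 \<longrightarrow> P L))"

definition fails_WLP :: "nat \<Rightarrow> (nat, 'k::comm_ring_1) mpoly set \<Rightarrow> nat \<Rightarrow> bool" where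
  "fails_WLP n I t \<longleftrightarrow>
     general_linear_form n
       (\<lambda>L. \<not> inj_on (mult_map n I L) (quot_comp n I t) \<and>
            mult_map n I L ` quot_comp n I t \<noteq> quot_comp n I (t + 1))"

text \<open>
  Of the three equivalent conditions (failure of the weak Lefschetz property in degree \<open>d - 1\<close>,
  linear dependence of the generators on a general hyperplane, Laplace equation of order \<open>d - 1\<close>
  for \<open>X\<close>) the first one is taken as the definition.
\<close>

definition togliatti :: "nat \<Rightarrow> nat \<Rightarrow> (nat, 'k::comm_ring_1) mpoly set \<Rightarrow> bool" where
  "togliatti n d I \<longleftrightarrow>
     (\<exists>F \<subseteq> forms {..n} d. finite F \<and> card F \<le> (n + d - 1) choose (n - 1) \<and>
        I = Idl\<^bsub>polyR n\<^esub> F) \<and>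
     artinian_ring (polyR n Quot I) \<and>
     fails_WLP n I (d - 1)"

definition monomials :: "nat \<Rightarrow> (nat, 'k::comm_ring_1) mpoly set" where
  "monomials n = {Poly_Mapping.single m 1 | m. Poly_Mapping.keys m \<subseteq> {..n}}"

definition monomial_togliatti :: "nat \<Rightarrow> nat \<Rightarrow> (nat, 'k::comm_ring_1) mpoly set \<Rightarrow> bool" where
  "monomial_togliatti n d I \<longleftrightarrow>
     togliatti n d I \<and> (\<exists>M \<subseteq> monomials n. I = Idl\<^bsub>polyR n\<^esub> M)"

definition trivial_togliatti :: "nat \<Rightarrow> nat \<Rightarrow> (nat, 'k::comm_ring_1) mpoly set \<Rightarrow> bool" where
  "trivial_togliatti n d I \<longleftrightarrow>
     (\<exists>F \<in> forms {..n} (d - 1). F \<noteq> 0 \<and> (\<forall>i\<le>n. Var i * F \<in> I))"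

definition min_gens :: "nat \<Rightarrow> (nat, 'k::comm_ring_1) mpoly set \<Rightarrow> nat" where
  "min_gens n I =
     (LEAST r. \<exists>G \<subseteq> carrier (polyR n). finite G \<and> card G = r \<and> I = Idl\<^bsub>polyR n\<^esub> G)"

definition minimal_monomial_togliatti :: "nat \<Rightarrow> nat \<Rightarrow> (nat, 'k::comm_ring_1) mpoly set set" where
  "minimal_monomial_togliatti n d =
     {I. monomial_togliatti n d I \<and>
         (\<exists>M \<subseteq> monomials n \<inter> forms {..n} d. I = Idl\<^bsub>polyR n\<^esub> M \<and>
            (\<forall>M'. M' \<subset> M \<longrightarrow> \<not> monomial_togliatti n d (Idl\<^bsub>polyR n\<^esub> M')))}"


section \<open>Projective varieties and smoothness\<close>

text \<open>
  Points of the projective space with coordinates indexed by a finite set \<open>V\<close> are represented by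
  their vectors of homogeneous coordinates, so a subset of projective space is the set of all
  nonzero vectors on the corresponding lines.
\<close>

definition hcoords :: "'v set \<Rightarrow> ('v \<Rightarrow> 'k::zero) set" where
  "hcoords V = {p. (\<forall>v. v \<notin> V \<longrightarrow> p v = 0) \<and> (\<exists>v\<in>V. p v \<noteq> 0)}"

definition vanishing_forms :: "'v set \<Rightarrow> ('v \<Rightarrow> 'k::comm_ring_1) set \<Rightarrow> ('v, 'k) mpoly set" where
  "vanishing_forms V S = {f. (\<exists>t. f \<in> forms V t) \<and> (\<forall>p\<in>S. mpoly_eval f p = 0)}"

definition zariski_closure :: "'v set \<Rightarrow> ('v \<Rightarrow> 'k::comm_ring_1) set \<Rightarrow> ('v \<Rightarrow> 'k) set" where
  "zariski_closure V S = {p \<in> hcoords V. \<forall>f\<in>vanishing_forms V S. mpoly_eval f p = 0}"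

text \<open>
  The dimension of an irreducible projective variety \<open>X\<close> is the transcendence degree of its
  function field. A finite family of rational functions on \<open>X\<close> can be written as quotients of
  forms of the same degree with a common denominator \<open>G\<close> that does not vanish identically
  on \<open>X\<close>; as \<open>X\<close> is irreducible, a polynomial expression in them is zero in the function field
  iff it is zero at all points of \<open>X\<close> where \<open>G \<noteq> 0\<close>.
\<close>

definition alg_indep_on :: "'p set \<Rightarrow> nat \<Rightarrow> (nat \<Rightarrow> 'p \<Rightarrow> 'k::comm_ring_1) \<Rightarrow> bool" where
  "alg_indep_on D s f \<longleftrightarrow>
     (\<forall>h \<in> carrier (mpoly_ring {..<s} :: (nat, 'k) mpoly ring).
        h \<noteq> 0 \<longrightarrow> (\<exists>p\<in>D. mpoly_eval h (\<lambda>i. f i p) \<noteq> 0))"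

definition variety_dim :: "'v set \<Rightarrow> ('v \<Rightarrow> 'k::field) set \<Rightarrow> nat" where
  "variety_dim V X =
     Sup {s. \<exists>e. \<exists>G \<in> forms V e. \<exists>F. (\<exists>p\<in>X. mpoly_eval G p \<noteq> 0) \<and> (\<forall>i<s. F i \<in> forms V e) \<and>
        alg_indep_on {p \<in> X. mpoly_eval G p \<noteq> 0} s (\<lambda>i p. mpoly_eval (F i) p / mpoly_eval G p)}"

text \<open>
  The tangent space to the affine cone over \<open>X\<close>; its dimension is one more than that of the Zariski
  tangent space of \<open>X\<close> at the point \<open>p\<close>.
\<close>

definition cone_tangent_space :: "'v set \<Rightarrow> ('v \<Rightarrow> 'k::field) set \<Rightarrow> ('v \<Rightarrow> 'k) \<Rightarrow> ('v \<Rightarrow> 'k) set" where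
  "cone_tangent_space V X p =
     {w. (\<forall>v. v \<notin> V \<longrightarrow> w v = 0) \<and>
         (\<forall>f\<in>vanishing_forms V X. (\<Sum>v\<in>V. mpoly_eval (mpoly_partial v f) p * w v) = 0)}"

definition smooth_variety :: "'v set \<Rightarrow> ('v \<Rightarrow> 'k::field) set \<Rightarrow> bool" where
  "smooth_variety V X \<longleftrightarrow>
     (\<forall>p\<in>X. vector_space.dim (\<lambda>(c::'k) w v. c * w v) (cone_tangent_space V X p)
             = variety_dim V X + 1)"

text \<open>The coordinates of the space containing \<open>X\<close> are the monomials of degree \<open>d\<close> not in \<open>I\<close>.\<close>

definition remaining_monomials :: "nat \<Rightarrow> nat \<Rightarrow> (nat, 'k::comm_ring_1) mpoly set \<Rightarrow> (nat \<Rightarrow>\<^sub>0 nat) set" where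
  "remaining_monomials n d I =
     {m. Poly_Mapping.keys m \<subseteq> {..n} \<and> mdeg m = d \<and> Poly_Mapping.single m 1 \<notin> I}"

definition togliatti_variety ::
  "nat \<Rightarrow> nat \<Rightarrow> (nat, 'k::comm_ring_1) mpoly set \<Rightarrow> ((nat \<Rightarrow>\<^sub>0 nat) \<Rightarrow> 'k) set" where
  "togliatti_variety n d I =
     (let A = remaining_monomials n d I
      in zariski_closure A
           (hcoords A \<inter> (\<lambda>x m. if m \<in> A then mon_eval m x else 0) ` hcoords {..n}))"

definition smooth_togliatti :: "nat \<Rightarrow> nat \<Rightarrow> (nat, 'k::field) mpoly set \<Rightarrow> bool" where
  "smooth_togliatti n d I \<longleftrightarrow>
     smooth_variety (remaining_monomials n d I) (togliatti_variety n d I)"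

definition smooth_minimal_monomial_togliatti :: "nat \<Rightarrow> nat \<Rightarrow> (nat, 'k::field) mpoly set set" where
  "smooth_minimal_monomial_togliatti n d =
     {I \<in> minimal_monomial_togliatti n d. smooth_togliatti n d I}"


section \<open>The invariants and the two exceptional systems\<close>

text \<open>
  The invariants depend on the ground field, which is passed as a type. The infimum of a nonempty
  set of natural numbers is its minimum; for the empty set it is unspecified.
\<close>

definition mu :: "'k::field itself \<Rightarrow> nat \<Rightarrow> nat \<Rightarrow> nat" where
  "mu _ n d = Inf (min_gens n ` (minimal_monomial_togliatti n d :: (nat, 'k) mpoly set set))"

definition mu_smooth :: "'k::field itself \<Rightarrow> nat \<Rightarrow> nat \<Rightarrow> nat" where
  "mu_smooth _ n d =
     Inf (min_gens n ` (smooth_minimal_monomial_togliatti n d :: (nat, 'k) mpoly set set))"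

text \<open>The argument \<open>\<pi>\<close> is a permutation of the coordinates.\<close>

definition exceptional_2_5 :: "(nat \<Rightarrow> nat) \<Rightarrow> (nat, 'k::comm_ring_1) mpoly set" where
  "exceptional_2_5 \<pi> =
     (let x = (\<lambda>i. Var (\<pi> i))
      in Idl\<^bsub>polyR 2\<^esub> {x 0 ^ 5, x 1 ^ 5, x 2 ^ 5, x 0 ^ 3 * x 1 * x 2, x 0 * x 1 ^ 2 * x 2 ^ 2})"

definition exceptional_2_4 :: "(nat \<Rightarrow> nat) \<Rightarrow> (nat, 'k::comm_ring_1) mpoly set" where
  "exceptional_2_4 \<pi> =
     (let x = (\<lambda>i. Var (\<pi> i))
      in Idl\<^bsub>polyR 2\<^esub> {x 0 ^ 4, x 1 ^ 4, x 2 ^ 4, x 0 * x 1 * x 2 ^ 2, x 0 ^ 2 * x 1 ^ 2})"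

end

theory Submission
  imports Defs
begin

text \<open>
  Let \<open>I\<close> be generated by a set \<open>E\<close> of monomials of degree \<open>d\<close>. It is artinian iff \<open>E\<close> contains the pure
  powers, and after rescaling the variables it fails the weak Lefschetz property in degree \<open>d - 1\<close>
  iff some nonzero form \<open>F\<close> of degree \<open>d - 1\<close> satisfies: all monomials of \<open>(x_0 + \<dots> + x_n) F\<close> lie in \<open>E\<close>.
  So the lower bound says that such a multiple has at least \<open>n\<close> monomials besides the pure powers.
  If a variable divides \<open>F\<close>, one counts all monomials of the multiple. Otherwise setting a variable to
  zero and counting incidences of variables and monomials gives an induction on \<open>n\<close>, in which equality
  is impossible for \<open>n \<ge> 3\<close>. For \<open>n = 2\<close> the substitution \<open>(1, Y, -1 - Y)\<close> turns the existence
  of \<open>F\<close> into identities between binomial coefficients, whose only solutions are the two exceptional systems.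

  For smoothness, let \<open>A\<close> be the set of remaining monomials. A point of \<open>X\<close> has a nonzero coordinate at a vertex
  of the polytope of \<open>A\<close>, since \<open>p(m)^2 = p(m') p(m'')\<close> if \<open>m\<close> is the midpoint of \<open>m'\<close> and \<open>m''\<close>. At a vertex of a
  truncated simplex all coordinates are monomials in the \<open>n\<close> coordinates next to the vertex, so \<open>X\<close> is
  locally an affine space. In the exceptional system of degree 4 one vertex needs three such
  coordinates although \<open>X\<close> is a surface.
\<close>

section \<open>Multiplying by a sum of variables\<close>

text \<open>The incidence count: a monomial of the multiple that is not a pure power involves at
  least two variables, while setting a variable to zero shows that at most \<open>M + 1 - n\<close>
  of the \<open>M\<close> such monomials involve it. Hence
  \<open>2 M \<le> (n + 1) (M + 1 - n)\<close>, which excludes \<open>M \<le> n\<close>. The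
  induction cannot start below \<open>n = 2\<close>, because in two variables \<open>x + y\<close>
  divides \<open>x ^ d - (- y) ^ d\<close>, which has no mixed monomial. For \<open>n = 2\<close>
  the point \<open>(1, Y, -1 - Y)\<close> is a zero of \<open>x + y + z\<close>, so the multiple
  vanishes there; a power \<open>z ^ d\<close> becomes \<open>(1 + Y) ^ d\<close> up to sign, whose
  inner coefficients are all nonzero in characteristic zero and must be cancelled by at most two
  terms \<open>Y ^ b (1 + Y) ^ c\<close>.

  On the Lefschetz side the form \<open>F\<close> only contradicts injectivity. The bound on the
  number of generators says that \<open>(R/I)_d\<close> is at least as large as
  \<open>(R/I)_(d-1)\<close>, and a matrix with at least as many rows as columns and a nonzero
  kernel also has a nonzero left kernel; this contradicts surjectivity.\<close>

abbreviation (input) "lk \<equiv> Poly_Mapping.lookup"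
abbreviation (input) "sg \<equiv> Poly_Mapping.single"

definition expo :: "'v set \<Rightarrow> nat \<Rightarrow> ('v \<Rightarrow>\<^sub>0 nat) set" where
  "expo V d = {m. Poly_Mapping.keys m \<subseteq> V \<and> mdeg m = d}"

lemma mdeg_eq_sum: "finite V \<Longrightarrow> Poly_Mapping.keys m \<subseteq> V \<Longrightarrow> mdeg m = (\<Sum>v\<in>V. Poly_Mapping.lookup m v)"
  unfolding mdeg_def by (rule sum.mono_neutral_left) (auto simp: in_keys_iff)

lemma mdeg_add: "mdeg (m + m') = mdeg m + mdeg m'"
proof -
  let ?V = "Poly_Mapping.keys m \<union> Poly_Mapping.keys m'"
  have "Poly_Mapping.keys (m + m') \<subseteq> ?V" by (rule Poly_Mapping.keys_add)
  then show ?thesis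
    by (simp add: mdeg_eq_sum[of ?V] lookup_add sum.distrib)
qed

lemma mdeg_single [simp]: "mdeg (Poly_Mapping.single i k) = k"
  unfolding mdeg_def by simp

lemma mdeg_zero [simp]: "mdeg 0 = 0"
  unfolding mdeg_def by simp

lemma mdeg_eq_0_iff: "mdeg m = 0 \<longleftrightarrow> m = 0"
  by (rule iffI, rule poly_mapping_eqI) (auto simp: mdeg_def in_keys_iff)

lemma keys_add_nat: "Poly_Mapping.keys (m + m' :: 'v \<Rightarrow>\<^sub>0 nat) = Poly_Mapping.keys m \<union> Poly_Mapping.keys m'"
  by (auto simp: in_keys_iff lookup_add)

lemma keys_single_subset: "Poly_Mapping.keys (Poly_Mapping.single i k) \<subseteq> {i}"
  by simp

lemma keys_diff_nat: "Poly_Mapping.keys (m - m' :: 'v \<Rightarrow>\<^sub>0 nat) \<subseteq> Poly_Mapping.keys m"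
  by (auto simp: in_keys_iff lookup_minus)

lemma expo_add: "m \<in> expo V a \<Longrightarrow> m' \<in> expo V b \<Longrightarrow> m + m' \<in> expo V (a + b)"
  by (simp add: expo_def mdeg_add keys_add_nat)

lemma expo_single: "i \<in> V \<Longrightarrow> Poly_Mapping.single i k \<in> expo V k"
  by (auto simp: expo_def)

lemma lookup_le_mdeg: "Poly_Mapping.lookup m v \<le> mdeg m"
proof (cases "v \<in> Poly_Mapping.keys m")
  case True then show ?thesis unfolding mdeg_def by (simp add: member_le_sum)
qed (simp add: in_keys_iff)

lemma finite_expo: assumes "finite V" shows "finite (expo V d)"
proof -
  have "finite {f. \<forall>x. (x \<in> V \<longrightarrow> f x \<in> {..d}) \<and> (x \<notin> V \<longrightarrow> f x = (0::nat))}"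
    by (rule finite_set_of_finite_funs) (use assms in auto)
  moreover have "Poly_Mapping.lookup ` expo V d \<subseteq> {f. \<forall>x. (x \<in> V \<longrightarrow> f x \<in> {..d}) \<and> (x \<notin> V \<longrightarrow> f x = 0)}"
    using lookup_le_mdeg by (fastforce simp: expo_def in_keys_iff)
  ultimately have "finite (Poly_Mapping.lookup ` expo V d)" by (rule finite_subset[rotated])
  then show ?thesis
    by (rule finite_imageD) (rule inj_onI, rule poly_mapping_eqI, simp)
qed

lemma minus_single_add: "Poly_Mapping.lookup m i > 0 \<Longrightarrow> m - Poly_Mapping.single i 1 + Poly_Mapping.single i (1::nat) = m"
  by (rule poly_mapping_eqI) (auto simp: lookup_add lookup_minus lookup_single when_def)

lemma add_single_minus [simp]: "m + Poly_Mapping.single i (k::nat) - Poly_Mapping.single i k = m"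
  by (rule poly_mapping_eqI) (auto simp: lookup_add lookup_minus lookup_single when_def)

text \<open>The coefficient of \<open>a\<close> in the product of \<open>F\<close> with the sum of
  the variables in \<open>V\<close>. Forms are plain coefficient functions here, so that dividing by
  a variable and setting a variable to zero are pointwise operations.\<close>

definition lmul :: "'v set \<Rightarrow> (('v \<Rightarrow>\<^sub>0 nat) \<Rightarrow> 'k::comm_ring_1) \<Rightarrow> ('v \<Rightarrow>\<^sub>0 nat) \<Rightarrow> 'k" where
  "lmul V F a = (\<Sum>j\<in>V. if Poly_Mapping.lookup a j > 0 then F (a - Poly_Mapping.single j 1) else 0)"

definition homog :: "'v set \<Rightarrow> nat \<Rightarrow> (('v \<Rightarrow>\<^sub>0 nat) \<Rightarrow> 'k::zero) \<Rightarrow> bool" where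
  "homog V e F \<longleftrightarrow> (\<forall>m. F m \<noteq> 0 \<longrightarrow> m \<in> expo V e)"

definition lsupp :: "'v set \<Rightarrow> (('v \<Rightarrow>\<^sub>0 nat) \<Rightarrow> 'k::comm_ring_1) \<Rightarrow> ('v \<Rightarrow>\<^sub>0 nat) set" where
  "lsupp V F = {a. lmul V F a \<noteq> 0}"

lemma lmul_nonzeroE:
  assumes "lmul V F a \<noteq> 0"
  obtains j where "j \<in> V" "Poly_Mapping.lookup a j > 0" "F (a - Poly_Mapping.single j 1) \<noteq> 0"
proof -
  have "\<exists>j\<in>V. (if Poly_Mapping.lookup a j > 0 then F (a - Poly_Mapping.single j 1) else 0) \<noteq> 0"
    using assms sum.neutral[of V "\<lambda>j. if Poly_Mapping.lookup a j > 0 then F (a - Poly_Mapping.single j 1) else 0"]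
    unfolding lmul_def by blast
  then show ?thesis using that by (auto split: if_splits)
qed

lemma lsupp_subset_expo: assumes "homog V e F" shows "lsupp V F \<subseteq> expo V (e + 1)"
proof
  fix a assume "a \<in> lsupp V F"
  then obtain j where j: "j \<in> V" "Poly_Mapping.lookup a j > 0" "F (a - Poly_Mapping.single j 1) \<noteq> 0"
    unfolding lsupp_def by (auto elim: lmul_nonzeroE)
  then have "a - Poly_Mapping.single j 1 \<in> expo V e" using assms by (simp add: homog_def)
  from expo_add[OF this expo_single[OF j(1), of 1]] show "a \<in> expo V (e + 1)"
    using minus_single_add[OF j(2)] by simp
qed

lemma finite_lsupp: "finite V \<Longrightarrow> homog V e F \<Longrightarrow> finite (lsupp V F)"
  by (rule finite_subset[OF lsupp_subset_expo finite_expo])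

lemma lmul_shift:
  "lmul V (\<lambda>m. if Poly_Mapping.lookup m i > 0 then F (m - Poly_Mapping.single i 1) else 0)
    (a + Poly_Mapping.single i 1) = lmul V F a"
  unfolding lmul_def
proof (rule sum.cong[OF refl])
  fix j
  show "(if 0 < lk (a + sg i 1) j then if 0 < lk (a + sg i 1 - sg j 1) i then F (a + sg i 1 - sg j 1 - sg i 1) else 0
        else 0) = (if 0 < lk a j then F (a - sg j 1) else 0)"
  proof (cases "lk a j > 0")
    case True
    have "a + sg i 1 - sg j 1 - sg i 1 = a - sg j 1"
      by (rule poly_mapping_eqI) (auto simp: lookup_add lookup_minus lookup_single when_def)
    with True show ?thesis by (auto simp: lookup_add lookup_minus lookup_single when_def)
  next
    case False then show ?thesis by (auto simp: lookup_add lookup_minus lookup_single when_def)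
  qed
qed

lemma lmul_divides:
  assumes "\<And>m. F m \<noteq> 0 \<Longrightarrow> Poly_Mapping.lookup m i > 0" and "lmul V F a \<noteq> 0"
  shows "Poly_Mapping.lookup a i > 0"
proof -
  obtain j where j: "j \<in> V" "lk a j > 0" "F (a - sg j 1) \<noteq> 0"
    using assms(2) by (rule lmul_nonzeroE)
  from assms(1)[OF j(3)] show ?thesis by (auto simp: lookup_minus)
qed

text \<open>A variable that divides \<open>F\<close> is cancelled: the product is merely shifted, so
  its number of monomials stays the same while the degree drops. This is the induction step on
  \<open>e\<close> in the counting lemmas.\<close>

lemma divide_variable:
  assumes h: "homog V e F" and d: "\<And>m. F m \<noteq> 0 \<Longrightarrow> Poly_Mapping.lookup m i > 0"
    and i: "F m0 \<noteq> 0"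
  defines "F' \<equiv> \<lambda>m. F (m + Poly_Mapping.single i 1)"
  shows "e > 0" "homog V (e - 1) F'" "lsupp V F = (\<lambda>a. a + Poly_Mapping.single i 1) ` lsupp V F'"
    "F' (m0 - Poly_Mapping.single i 1) \<noteq> 0"
proof -
  have F: "F = (\<lambda>m. if lk m i > 0 then F' (m - sg i 1) else 0)"
  proof
    fix m show "F m = (if lk m i > 0 then F' (m - sg i 1) else 0)"
      using d[of m] minus_single_add[of m i] unfolding F'_def by (cases "F m = 0") auto
  qed
  have "m0 \<in> expo V e" using h i by (simp add: homog_def)
  then show "e > 0" using d[OF i] lookup_le_mdeg[of m0 i] by (simp add: expo_def)
  show "homog V (e - 1) F'"
    unfolding homog_def
  proof (intro allI impI)
    fix m assume "F' m \<noteq> 0"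
    then have "m + sg i 1 \<in> expo V e" using h by (simp add: homog_def F'_def)
    then show "m \<in> expo V (e - 1)" by (auto simp: expo_def mdeg_add keys_add_nat)
  qed
  have *: "lmul V F (a + sg i 1) = lmul V F' a" for a
    by (subst F) (rule lmul_shift)
  show "lsupp V F = (\<lambda>a. a + sg i 1) ` lsupp V F'"
  proof safe
    fix a assume a: "a \<in> lsupp V F"
    then have "lk a i > 0" using lmul_divides[OF d] unfolding lsupp_def by blast
    then have eq: "(a - sg i 1) + sg i 1 = a" by (rule minus_single_add)
    have "a - sg i 1 \<in> lsupp V F'"
      using *[of "a - sg i 1"] a unfolding eq lsupp_def by simp
    then show "a \<in> (\<lambda>a. a + sg i 1) ` lsupp V F'" using eq by (metis imageI)
  next
    fix a assume "a \<in> lsupp V F'" then show "a + sg i 1 \<in> lsupp V F" using * by (simp add: lsupp_def)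
  qed
  show "F' (m0 - sg i 1) \<noteq> 0" unfolding F'_def using minus_single_add[OF d[OF i]] i by simp
qed

text \<open>The form obtained by setting the variable \<open>i\<close> to zero.\<close>

definition vrestrict :: "'v \<Rightarrow> (('v \<Rightarrow>\<^sub>0 nat) \<Rightarrow> 'k::zero) \<Rightarrow> ('v \<Rightarrow>\<^sub>0 nat) \<Rightarrow> 'k" where
  "vrestrict i F m = (if Poly_Mapping.lookup m i = 0 then F m else 0)"

lemma homog_vrestrict: "homog V e F \<Longrightarrow> homog (V - {i}) e (vrestrict i F)"
  by (auto simp: homog_def vrestrict_def expo_def in_keys_iff split: if_splits)

text \<open>Setting \<open>i\<close> to zero is multiplicative and sends the sum over
  \<open>V\<close> to the sum over \<open>V - {i}\<close>, so what remains of the product are its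
  monomials free of \<open>i\<close>.\<close>

lemma lsupp_vrestrict:
  assumes "finite V"
  shows "homog V e F \<Longrightarrow> lsupp (V - {i}) (vrestrict i F) = {a \<in> lsupp V F. Poly_Mapping.lookup a i = 0}"
proof -
  assume h: "homog V e F"
  have 1: "lmul (V - {i}) (vrestrict i F) a = lmul V F a" if a: "lk a i = 0" for a
    unfolding lmul_def using assms a
    by (intro sum.mono_neutral_cong_left) (auto simp: vrestrict_def lookup_minus)
  moreover have "lk a i = 0" if "a \<in> lsupp (V - {i}) (vrestrict i F)" for a
    using that lsupp_subset_expo[OF homog_vrestrict[OF h, of i]]
    unfolding expo_def by (auto simp: subset_iff in_keys_iff)
  moreover have "a \<in> lsupp (V - {i}) (vrestrict i F) \<longleftrightarrow> a \<in> lsupp V F \<and> lk a i = 0" for a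
  proof (cases "lk a i = 0")
    case True then show ?thesis using 1[OF True] by (simp add: lsupp_def)
  next
    case False then show ?thesis using calculation(2)[of a] by auto
  qed
  then show ?thesis by auto
qed

lemma vrestrict_neq_0: "\<not> (\<forall>m. F m \<noteq> 0 \<longrightarrow> Poly_Mapping.lookup m i > 0) \<Longrightarrow> \<exists>m. vrestrict i F m \<noteq> 0"
  by (auto simp: vrestrict_def)

text \<open>Induction on the number of variables and, inside it, on the degree. A variable dividing
  \<open>F\<close> is cancelled; otherwise every restriction \<open>vrestrict i F\<close> is nonzero
  and already yields \<open>card V - 1\<close> product monomials free of \<open>i\<close>.\<close>

lemma card_lsupp_ge:
  assumes "finite V" "V \<noteq> {}" "homog V e F" "F m0 \<noteq> 0"
  shows "card V \<le> card (lsupp V F)"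
  using assms
proof (induction "card V" arbitrary: V e F m0 rule: less_induct)
  case less
  note outer = less.hyps
  show ?case using less.prems
  proof (induction e arbitrary: F m0)
    case 0
    have m0: "m = 0" if "F m \<noteq> 0" for m
    proof -
      have "m \<in> expo V 0" using 0(3) that unfolding homog_def by iprover
      then show "m = 0" by (simp add: expo_def mdeg_eq_0_iff)
    qed
    then have F: "F m = (if m = 0 then F 0 else 0)" for m by auto
    have F0: "F 0 \<noteq> 0" using 0(4) m0[OF 0(4)] by simp
    have "sg j 1 \<in> lsupp V F" if "j \<in> V" for j
    proof -
      have "sg j (1::nat) - sg j 1 = 0" by simp
      then have "lmul V F (sg j 1) = (\<Sum>i\<in>V. if i = j then F 0 else 0)"
        unfolding lmul_def by (intro sum.cong) (auto simp: lookup_single when_def)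
      then show ?thesis using that F0 \<open>finite V\<close> by (simp add: lsupp_def)
    qed
    then have "(\<lambda>j. sg j (1::nat)) ` V \<subseteq> lsupp V F" by auto
    then have "card ((\<lambda>j. sg j (1::nat)) ` V) \<le> card (lsupp V F)"
      using finite_lsupp[OF 0(1) 0(3)] by (rule card_mono[rotated])
    moreover have "inj_on (\<lambda>j. sg j (1::nat)) V"
      by (rule inj_onI) (metis lookup_single_eq lookup_single_not_eq zero_neq_one)
    ultimately show ?case by (simp add: card_image)
  next
    case (Suc e)
    show ?case
    proof (cases "\<exists>i\<in>V. \<forall>m. F m \<noteq> 0 \<longrightarrow> lk m i > 0")
      case True
      then obtain i where i: "i \<in> V" "\<And>m. F m \<noteq> 0 \<Longrightarrow> lk m i > 0" by blast
      let ?F' = "\<lambda>m. F (m + sg i 1)"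
      note dv = divide_variable[OF Suc.prems(3) i(2) Suc.prems(4)]
      have "card (lsupp V F) = card ((\<lambda>a. a + sg i 1) ` lsupp V ?F')"
        by (rule arg_cong[OF dv(3)])
      also have "\<dots> = card (lsupp V ?F')"
        by (rule card_image) (auto simp: inj_on_def)
      also have "\<dots> \<ge> card V"
      proof (rule Suc.IH[OF Suc.prems(1,2)])
        show "homog V e ?F'" using dv(2) by simp
        show "?F' (m0 - sg i 1) \<noteq> 0" by (rule dv(4))
      qed
      finally show ?thesis .
    next
      case False
      have fin: "finite (lsupp V F)" by (rule finite_lsupp[OF Suc.prems(1,3)])
      have res: "card V - 1 \<le> card {a \<in> lsupp V F. lk a i = 0} \<and> V - {i} \<noteq> {}" if i: "i \<in> V" for i
      proof -
        from False i have "\<not> (\<forall>m. F m \<noteq> 0 \<longrightarrow> lk m i > 0)" by blast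
        from vrestrict_neq_0[OF this] obtain m where m: "vrestrict i F m \<noteq> 0" by (rule exE)
        \<comment> \<open>With \<open>V = {i}\<close> the restriction would be a nonzero form of
          positive degree in no variables.\<close>
        have ne: "V - {i} \<noteq> {}"
        proof
          assume "V - {i} = {}"
          moreover have "m \<in> expo (V - {i}) (Suc e)"
            using m homog_vrestrict[OF Suc.prems(3), of i] by (simp add: homog_def)
          ultimately have "m \<in> expo {} (Suc e)" by (simp only:)
          then show False by (auto simp: expo_def)
        qed
        have "card (V - {i}) \<le> card (lsupp (V - {i}) (vrestrict i F))"
        proof (rule outer)
          show "card (V - {i}) < card V" using Suc.prems(1) i by (rule card_Diff1_less)
          show "homog (V - {i}) (Suc e) (vrestrict i F)" by (rule homog_vrestrict[OF Suc.prems(3)])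
          show "vrestrict i F m \<noteq> 0" by (rule m)
        qed (use Suc.prems(1) ne in simp_all)
        then show ?thesis using i ne lsupp_vrestrict[OF Suc.prems(1,3)] Suc.prems(1) by simp
      qed
      show ?thesis
      proof (rule ccontr)
        assume c: "\<not> card V \<le> card (lsupp V F)"
        \<comment> \<open>One short of the bound, the product has exactly \<open>card V - 1\<close>
          monomials, and each restriction accounts for all of them. So no variable divides any of
          them, although their degree is positive.\<close>
        have all0: "{a \<in> lsupp V F. lk a i = 0} = lsupp V F" if "i \<in> V" for i
        proof (rule card_subset_eq[OF fin])
          have "card {a \<in> lsupp V F. lk a i = 0} \<le> card (lsupp V F)" using fin by (intro card_mono) auto
          then show "card {a \<in> lsupp V F. lk a i = 0} = card (lsupp V F)" using res[OF that] c by linarith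
        qed auto
        obtain i where i: "i \<in> V" using Suc.prems(2) by blast
        have "V - {i} \<noteq> {}" using res[OF i] by (rule conjunct2)
        then have "card (V - {i}) > 0" using Suc.prems(1) by (meson card_gt_0_iff finite_Diff)
        moreover have "card (V - {i}) = card V - 1" using i by (rule card_Diff_singleton)
        moreover have "card V - 1 \<le> card (lsupp V F)" using conjunct1[OF res[OF i]] unfolding all0[OF i] .
        ultimately have "card (lsupp V F) \<noteq> 0" by linarith
        then obtain a where a: "a \<in> lsupp V F" by (metis card.empty ex_in_conv)
        then have "a \<in> expo V (Suc e + 1)" using lsupp_subset_expo[OF Suc.prems(3)] by blast
        moreover have "j \<notin> Poly_Mapping.keys a" if "j \<in> V" for j
        proof -
          have "a \<in> {a \<in> lsupp V F. lk a j = 0}" using a unfolding all0[OF that] .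
          then show ?thesis by (simp add: in_keys_iff)
        qed
        ultimately have "Poly_Mapping.keys a = {}" "mdeg a = Suc e + 1" unfolding expo_def by blast+
        then show False by simp
      qed
    qed
  qed
qed

section \<open>Vanishing of the product at the zeros of the linear form\<close>

lemma bij_betw_expo_shift:
  assumes "finite V" "j \<in> V"
  shows "bij_betw (\<lambda>b. b + Poly_Mapping.single j 1) (expo V e) {a \<in> expo V (e + 1). Poly_Mapping.lookup a j > 0}"
proof (rule bij_betw_byWitness[where f' = "\<lambda>a. a - Poly_Mapping.single j 1"])
  show "\<forall>a\<in>expo V e. a + sg j 1 - sg j 1 = a" by simp
  show "\<forall>a'\<in>{a \<in> expo V (e + 1). 0 < lk a j}. a' - sg j 1 + sg j 1 = a'"
  proof safe
    fix a :: "'a \<Rightarrow>\<^sub>0 nat" assume "0 < lk a j" then show "a - sg j 1 + sg j 1 = a" by (rule minus_single_add)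
  qed
  show "(\<lambda>b. b + sg j 1) ` expo V e \<subseteq> {a \<in> expo V (e + 1). 0 < lk a j}"
    using expo_add[OF _ expo_single[OF assms(2), of 1]] by (auto simp: lookup_add)
  show "(\<lambda>a. a - sg j 1) ` {a \<in> expo V (e + 1). 0 < lk a j} \<subseteq> expo V e"
  proof safe
    fix a assume a: "a \<in> expo V (e + 1)" "0 < lk a j"
    have "mdeg (a - sg j 1) + 1 = mdeg a"
      using arg_cong[OF minus_single_add[OF a(2)], of mdeg] by (simp add: mdeg_add)
    then show "a - sg j 1 \<in> expo V e" using a keys_diff_nat[of a "sg j 1"] by (auto simp: expo_def)
  qed
qed

text \<open>The values are univariate polynomials, so that a whole family of zeros of the linear
  form is substituted at once and coefficients can be compared afterwards.\<close>

lemma lmul_eval_zero: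
  fixes F :: "('v \<Rightarrow>\<^sub>0 nat) \<Rightarrow> 'k::comm_ring_1" and val :: "'v \<Rightarrow> 'k poly"
  assumes V: "finite V" and s: "(\<Sum>v\<in>V. val v) = 0"
  shows "(\<Sum>a\<in>expo V (e + 1). [:lmul V F a:] * (\<Prod>v\<in>V. val v ^ Poly_Mapping.lookup a v)) = 0"
proof -
  define w where "w a = (\<Prod>v\<in>V. val v ^ lk a v)" for a
  have w: "w (b + sg j 1) = w b * val j" if "j \<in> V" for b j
  proof -
    have "w (b + sg j 1) = (\<Prod>v\<in>V. val v ^ lk b v * (if v = j then val j else 1))"
      unfolding w_def by (rule prod.cong) (auto simp: lookup_add lookup_single when_def power_add)
    also have "\<dots> = w b * val j" unfolding w_def prod.distrib using V that by simp
    finally show ?thesis .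
  qed
  have lift: "[:\<Sum>j\<in>S. h j:] = (\<Sum>j\<in>S. [:h j:])" for S and h :: "'v \<Rightarrow> 'k"
  proof (induction S rule: infinite_finite_induct)
    case (insert j S)
    have "[:h j + sum h S:] = [:h j:] + [:sum h S:]" by simp
    then show ?case by (simp only: sum.insert[OF insert(1,2)] insert(3))
  qed auto
  have "(\<Sum>a\<in>expo V (e + 1). [:lmul V F a:] * w a)
      = (\<Sum>a\<in>expo V (e + 1). \<Sum>j\<in>V. if lk a j > 0 then [:F (a - sg j 1):] * w a else 0)"
    unfolding lmul_def lift sum_distrib_right by (intro sum.cong refl) auto
  also have "\<dots> = (\<Sum>j\<in>V. \<Sum>a\<in>expo V (e + 1). if lk a j > 0 then [:F (a - sg j 1):] * w a else 0)"
    by (rule sum.swap)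
  also have "\<dots> = (\<Sum>j\<in>V. \<Sum>b\<in>expo V e. [:F b:] * w b * val j)"
  proof (rule sum.cong[OF refl])
    fix j assume j: "j \<in> V"
    have "(\<Sum>a\<in>expo V (e + 1). if lk a j > 0 then [:F (a - sg j 1):] * w a else 0)
        = (\<Sum>a\<in>{a \<in> expo V (e + 1). lk a j > 0}. [:F (a - sg j 1):] * w a)"
      by (rule sum.inter_filter[symmetric]) (rule finite_expo[OF V])
    also have "\<dots> = (\<Sum>b\<in>expo V e. [:F (b + sg j 1 - sg j 1):] * w (b + sg j 1))"
      by (rule sum.reindex_bij_betw[OF bij_betw_expo_shift[OF V j], symmetric])
    finally show "(\<Sum>a\<in>expo V (e + 1). if lk a j > 0 then [:F (a - sg j 1):] * w a else 0)
        = (\<Sum>b\<in>expo V e. [:F b:] * w b * val j)" by (simp only: w[OF j] add_single_minus mult.assoc)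
  qed
  also have "\<dots> = (\<Sum>b\<in>expo V e. [:F b:] * w b * (\<Sum>j\<in>V. val j))"
    by (subst sum.swap) (simp add: sum_distrib_left)
  finally show ?thesis using s by (simp add: w_def)
qed

text \<open>The coefficient of \<open>Y ^ i\<close> in \<open>Y ^ b (1 + Y) ^ c\<close>; the case
  distinction keeps the truncated \<open>i - b\<close> from counting when
  \<open>b > i\<close>.\<close>

definition kbin :: "nat \<Rightarrow> nat \<Rightarrow> nat \<Rightarrow> nat" where
  "kbin c i b = (if b \<le> i then c choose (i - b) else 0)"

lemma coeff_one_plus_power: "coeff ([:1, 1:] ^ c :: 'k::comm_ring_1 poly) i = of_nat (c choose i)"
proof -
  have "[:1, 1:] ^ c = (\<Sum>k\<le>c. of_nat (c choose k) * [:0, 1:] ^ k * 1 ^ (c - k) :: 'k poly)"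
    by (subst binomial_ring[symmetric]) (simp add: one_pCons)
  also have "\<dots> = (\<Sum>k\<le>c. monom (of_nat (c choose k)) k)"
    by (rule sum.cong) (simp_all add: of_nat_poly monom_altdef)
  finally have "coeff ([:1, 1:] ^ c :: 'k poly) i = (\<Sum>k\<le>c. if k = i then of_nat (c choose k) else 0)"
    by (simp add: coeff_sum)
  also have "\<dots> = of_nat (c choose i)" by (cases "i \<le> c") (auto simp: binomial_eq_0)
  finally show ?thesis .
qed

lemma coeff_term:
  "coeff ([:g:] * ([:0, 1:] ^ b * [:-1, -1:] ^ c) :: 'k::comm_ring_1 poly) i = g * (-1) ^ c * of_nat (kbin c i b)"
proof -
  have m: "[:-1, -1:] ^ c = [:(-1 :: 'k) ^ c:] * [:1, 1:] ^ c" for c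
  proof -
    have "[:-1, -1:] = [:-1 :: 'k:] * [:1, 1:]" by simp
    then have "[:-1, -1:] ^ c = [:-1 :: 'k:] ^ c * [:1, 1:] ^ c" by (simp only: power_mult_distrib)
    moreover have "[:-1 :: 'k:] ^ c = [:(-1) ^ c:]" by (induction c) auto
    ultimately show ?thesis by (simp only:)
  qed
  have "[:g:] * ([:0, 1:] ^ b * [:-1, -1:] ^ c) = smult (g * (-1) ^ c) (monom 1 b * [:1, 1:] ^ c)"
    unfolding m by (simp add: monom_altdef mult_ac)
  then have "coeff ([:g:] * ([:0, 1:] ^ b * [:-1, -1:] ^ c)) i
     = g * (-1) ^ c * coeff (monom 1 b * [:1, 1:] ^ c) i" by (simp only: coeff_smult)
  then show ?thesis by (simp add: coeff_monom_mult coeff_one_plus_power kbin_def)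
qed

abbreviation tri :: "'v \<Rightarrow> 'v \<Rightarrow> 'v \<Rightarrow> nat \<Rightarrow> nat \<Rightarrow> nat \<Rightarrow> ('v \<Rightarrow>\<^sub>0 nat)" where
  "tri x y z a b c \<equiv> Poly_Mapping.single x a + Poly_Mapping.single y b + Poly_Mapping.single z c"

lemma in_expo_tri:
  assumes "distinct [x, y, z]" "a \<in> expo {x, y, z} d"
  shows "a = tri x y z (Poly_Mapping.lookup a x) (Poly_Mapping.lookup a y) (Poly_Mapping.lookup a z)"
    "Poly_Mapping.lookup a x + Poly_Mapping.lookup a y + Poly_Mapping.lookup a z = d"
proof -
  have k: "Poly_Mapping.keys a \<subseteq> {x, y, z}" "mdeg a = d" using assms(2) by (auto simp: expo_def)
  show "a = tri x y z (lk a x) (lk a y) (lk a z)"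
  proof (rule poly_mapping_eqI)
    fix v show "lk a v = lk (tri x y z (lk a x) (lk a y) (lk a z)) v"
      using k(1) assms(1) by (cases "v \<in> {x, y, z}") (auto simp: lookup_add lookup_single when_def in_keys_iff)
  qed
  show "lk a x + lk a y + lk a z = d"
    using mdeg_eq_sum[OF _ k(1)] k(2) assms(1) by simp
qed

text \<open>Substituting \<open>(x, y, z) = (1, Y, -1 - Y)\<close> and comparing the coefficients of \<open>Y ^ i\<close>.\<close>

lemma substitution_coeff:
  fixes F :: "('v \<Rightarrow>\<^sub>0 nat) \<Rightarrow> 'k::comm_ring_1"
  assumes V: "finite V" "x \<in> V" "y \<in> V" "z \<in> V" "distinct [x, y, z]"
    and h: "homog V e F" and S: "finite S" "lsupp V F \<subseteq> S" "\<And>a v. a \<in> S \<Longrightarrow> v \<in> V - {x, y, z} \<Longrightarrow> Poly_Mapping.lookup a v = 0"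
  shows "(\<Sum>a\<in>S. lmul V F a * (-1) ^ Poly_Mapping.lookup a z
            * of_nat (kbin (Poly_Mapping.lookup a z) i (Poly_Mapping.lookup a y))) = 0"
proof -
  \<comment> \<open>The three values add up to \<open>1 + Y + (-1 - Y) = 0\<close>; the remaining
    variables get 0 so that the whole sum vanishes.\<close>
  define val :: "'v \<Rightarrow> 'k poly" where
    "val v = (if v = x then 1 else if v = y then [:0, 1:] else if v = z then [:-1, -1:] else 0)" for v
  have V3: "{x, y, z} \<subseteq> V" using V by auto
  have ne: "x \<noteq> y" "x \<noteq> z" "y \<noteq> z" "y \<noteq> x" "z \<noteq> x" "z \<noteq> y" using V(5) by auto
  have "(\<Sum>v\<in>V. val v) = (\<Sum>v\<in>{x, y, z}. val v)"
    by (rule sum.mono_neutral_right[OF V(1) V3]) (auto simp: val_def)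
  also have "\<dots> = 0" using ne by (simp add: val_def one_pCons)
  finally have 0: "(\<Sum>a\<in>expo V (e + 1). [:lmul V F a:] * (\<Prod>v\<in>V. val v ^ lk a v)) = 0"
    by (rule lmul_eval_zero[OF V(1)])
  have pr: "(\<Prod>v\<in>V. val v ^ lk a v) = [:0, 1:] ^ lk a y * [:-1, -1:] ^ lk a z" if "a \<in> S" for a
  proof -
    have "(\<Prod>v\<in>V. val v ^ lk a v) = (\<Prod>v\<in>{x, y, z}. val v ^ lk a v)"
      by (rule prod.mono_neutral_right[OF V(1) V3]) (use S(3)[OF that] in auto)
    also have "\<dots> = [:0, 1:] ^ lk a y * [:-1, -1:] ^ lk a z" using ne by (simp add: val_def)
    finally show ?thesis .
  qed
  have L0: "lmul V F a = 0" if "a \<notin> lsupp V F" for a using that by (simp add: lsupp_def)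
  have "(\<Sum>a\<in>S. [:lmul V F a:] * ([:0, 1:] ^ lk a y * [:-1, -1:] ^ lk a z))
      = (\<Sum>a\<in>S. [:lmul V F a:] * (\<Prod>v\<in>V. val v ^ lk a v))"
    by (rule sum.cong) (simp_all add: pr)
  also have "\<dots> = (\<Sum>a\<in>lsupp V F. [:lmul V F a:] * (\<Prod>v\<in>V. val v ^ lk a v))"
    by (rule sum.mono_neutral_right[OF S(1,2)]) (simp add: L0)
  also have "\<dots> = (\<Sum>a\<in>expo V (e + 1). [:lmul V F a:] * (\<Prod>v\<in>V. val v ^ lk a v))"
    by (rule sum.mono_neutral_left[OF finite_expo[OF V(1)] lsupp_subset_expo[OF h]]) (simp add: L0)
  finally have "coeff (\<Sum>a\<in>S. [:lmul V F a:] * ([:0, 1:] ^ lk a y * [:-1, -1:] ^ lk a z)) i = 0"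
    using 0 by simp
  then show ?thesis by (simp only: coeff_sum coeff_term)
qed

text \<open>A Fermat form in three variables has no linear factor.\<close>

lemma lsupp_pure_powers_empty:
  fixes F :: "('v \<Rightarrow>\<^sub>0 nat) \<Rightarrow> 'k::field_char_0"
  assumes V: "finite V" "card V \<ge> 3" and e: "e \<ge> 1" and h: "homog V e F"
    and S: "lsupp V F \<subseteq> (\<lambda>i. Poly_Mapping.single i (e + 1)) ` V"
  shows "lsupp V F = {}"
proof (rule ccontr)
  assume "lsupp V F \<noteq> {}"
  then obtain z where z: "z \<in> V" "sg z (e + 1) \<in> lsupp V F" using S by blast
  have "card (V - {z}) \<ge> 2" using V z by simp
  then obtain T where "T \<subseteq> V - {z}" "card T = 2" by (meson obtain_subset_with_card_n)
  then obtain x y where xy: "x \<in> V" "y \<in> V" "x \<noteq> y" "x \<noteq> z" "y \<noteq> z" by (auto simp: card_2_iff)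
  \<comment> \<open>All variables except \<open>x\<close>, \<open>y\<close>, \<open>z\<close> are
    set to zero, where \<open>z\<close> is chosen such that its power occurs in the product.\<close>
  define S' where "S' = (\<lambda>i. sg i (e + 1)) ` {x, y, z}"
  define F' where "F' m = (if Poly_Mapping.keys m \<subseteq> {x, y, z} then F m else 0)" for m
  have h': "homog {x, y, z} e F'" using h by (auto simp: homog_def F'_def expo_def)
  have eq: "lmul {x, y, z} F' a = lmul V F a" if "Poly_Mapping.keys a \<subseteq> {x, y, z}" for a
    unfolding lmul_def
  proof (rule sum.mono_neutral_cong_left[OF V(1)])
    show "{x, y, z} \<subseteq> V" using xy z by auto
    show "\<forall>j\<in>V - {x, y, z}. (if 0 < lk a j then F (a - sg j 1) else 0) = 0"
      using that by (auto simp: subset_iff in_keys_iff)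
    fix j
    have "Poly_Mapping.keys (a - sg j 1) \<subseteq> {x, y, z}" using keys_diff_nat[of a "sg j 1"] that by (rule subset_trans)
    then show "(if 0 < lk a j then F' (a - sg j 1) else 0) = (if 0 < lk a j then F (a - sg j 1) else 0)"
      by (simp add: F'_def)
  qed
  have sub: "lsupp {x, y, z} F' \<subseteq> S'"
  proof
    fix a assume a: "a \<in> lsupp {x, y, z} F'"
    then have k: "Poly_Mapping.keys a \<subseteq> {x, y, z}" using lsupp_subset_expo[OF h'] by (auto simp: expo_def)
    have "a \<in> lsupp V F" using a eq[OF k] by (simp add: lsupp_def)
    then show "a \<in> S'" using S k by (auto simp: S'_def)
  qed
  have inj: "inj_on (\<lambda>i. sg i (e + 1)) {x, y, z}"
    by (rule inj_onI) (metis lookup_single_eq lookup_single_not_eq Suc_eq_plus1 nat.distinct(1))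
  \<comment> \<open>In the coefficient of \<open>Y\<close> the powers of \<open>x\<close> and
    \<open>y\<close> contribute only 0, because \<open>e + 1 > 1\<close>; the power of
    \<open>z\<close> contributes the binomial coefficient \<open>e + 1\<close>, which is nonzero in
    characteristic zero.\<close>
  have "(\<Sum>a\<in>S'. lmul {x, y, z} F' a * (-1) ^ lk a z * of_nat (kbin (lk a z) 1 (lk a y))) = 0"
    by (rule substitution_coeff[OF _ _ _ _ _ h' _ sub, of x y z]) (use xy in \<open>auto simp: S'_def lookup_single when_def\<close>)
  then have "lmul {x, y, z} F' (sg z (e + 1)) * (-1) ^ (e + 1) * of_nat (e + 1) = 0"
    unfolding S'_def sum.reindex[OF inj] using xy e
    by (simp add: lookup_single when_def kbin_def binomial_eq_0)
  then have "lmul {x, y, z} F' (sg z (e + 1)) = 0" by (simp del: of_nat_Suc)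
  then show False using z eq[of "sg z (e + 1)"] by (simp add: lsupp_def)
qed

definition pure :: "('v \<Rightarrow>\<^sub>0 nat) \<Rightarrow> bool" where
  "pure a \<longleftrightarrow> (\<exists>i k. a = Poly_Mapping.single i k)"

lemma pure_in_expo: "pure a \<Longrightarrow> a \<in> expo V d \<Longrightarrow> d > 0 \<Longrightarrow> \<exists>i\<in>V. a = Poly_Mapping.single i d"
  by (auto simp: pure_def expo_def split: if_splits)

lemma nonpureE:
  assumes "\<not> pure a" "a \<in> expo V d"
  obtains i j where "i \<in> V" "j \<in> V" "i \<noteq> j" "Poly_Mapping.lookup a i > 0" "Poly_Mapping.lookup a j > 0"
proof -
  have "Poly_Mapping.keys a \<noteq> {}" using assms by (metis keys_eq_empty pure_def single_zero)
  then obtain i where i: "i \<in> Poly_Mapping.keys a" by blast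
  have "\<exists>j\<in>Poly_Mapping.keys a. j \<noteq> i"
  proof (rule ccontr)
    assume "\<not> ?thesis"
    then have "a = sg i (lk a i)"
      by (intro poly_mapping_eqI) (auto simp: lookup_single when_def in_keys_iff)
    then show False using assms by (auto simp: pure_def)
  qed
  then show ?thesis using that i assms by (auto simp: expo_def in_keys_iff subset_iff)
qed

lemma pure_lookup: "pure a \<Longrightarrow> i \<noteq> j \<Longrightarrow> Poly_Mapping.lookup a i = 0 \<or> Poly_Mapping.lookup a j = 0"
  by (auto simp: pure_def lookup_single when_def)

text \<open>Once common variables are cancelled, equality in \<open>card_lsupp_ge\<close> lets each
  variable occur in at most one product monomial. This forces all of them to be pure powers, which
  is impossible in three or more variables. In two variables
  \<open>(x + y) (x - y) = x ^ 2 - y ^ 2\<close> is a counterexample.\<close>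

lemma lsupp_eq_card_imp_monomial:
  fixes F :: "('v \<Rightarrow>\<^sub>0 nat) \<Rightarrow> 'k::field_char_0"
  assumes V: "finite V" "card V \<ge> 3"
  shows "homog V e F \<Longrightarrow> F m0 \<noteq> 0 \<Longrightarrow> card (lsupp V F) = card V \<Longrightarrow> F m1 \<noteq> 0 \<Longrightarrow> m0 = m1"
proof (induction e arbitrary: F m0 m1)
  case 0
  have "m = 0" if "F m \<noteq> 0" for m
  proof -
    have "m \<in> expo V 0" using 0(1) that unfolding homog_def by iprover
    then show "m = 0" by (simp add: expo_def mdeg_eq_0_iff)
  qed
  from this[OF 0(2)] this[OF 0(4)] show ?case by simp
next
  case (Suc e)
  show ?case
  proof (cases "\<exists>i\<in>V. \<forall>m. F m \<noteq> 0 \<longrightarrow> lk m i > 0")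
    case True
    then obtain i where i: "i \<in> V" "\<And>m. F m \<noteq> 0 \<Longrightarrow> lk m i > 0" by blast
    let ?F' = "\<lambda>m. F (m + sg i 1)"
    note dv = divide_variable[OF Suc.prems(1) i(2)]
    have "card (lsupp V F) = card ((\<lambda>a. a + sg i 1) ` lsupp V ?F')"
      by (rule arg_cong[OF dv(3)[OF _ Suc.prems(2)]])
    also have "\<dots> = card (lsupp V ?F')" by (rule card_image) (auto simp: inj_on_def)
    finally have c: "card (lsupp V ?F') = card V" using Suc.prems(3) by simp
    have "m0 - sg i 1 = m1 - sg i 1"
    proof (rule Suc.IH[where F = ?F'])
      show "homog V e ?F'" using dv(2)[OF _ Suc.prems(2)] by simp
      show "?F' (m0 - sg i 1) \<noteq> 0" by (rule dv(4)[OF _ Suc.prems(2)])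
      show "?F' (m1 - sg i 1) \<noteq> 0" by (rule dv(4)[OF _ Suc.prems(4)])
    qed (rule c)
    then show ?thesis using minus_single_add[OF i(2)[OF Suc.prems(2)]] minus_single_add[OF i(2)[OF Suc.prems(4)]]
      by metis
  next
    case False
    have fin: "finite (lsupp V F)" by (rule finite_lsupp[OF V(1) Suc.prems(1)])
    \<comment> \<open>At least \<open>card V - 1\<close> of the \<open>card V\<close> product
      monomials avoid \<open>i\<close>.\<close>
    have res: "card {a \<in> lsupp V F. lk a i > 0} \<le> 1" if i: "i \<in> V" for i
    proof -
      from False i have "\<not> (\<forall>m. F m \<noteq> 0 \<longrightarrow> lk m i > 0)" by blast
      from vrestrict_neq_0[OF this] obtain m where m: "vrestrict i F m \<noteq> 0" by (rule exE)
      have cV: "card (V - {i}) = card V - 1" using i by (rule card_Diff_singleton)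
      have "V - {i} \<noteq> {}" using cV V by (metis card.empty diff_is_0_eq numeral_le_one_iff order_trans semiring_norm(70))
      then have "card (V - {i}) \<le> card (lsupp (V - {i}) (vrestrict i F))"
        using card_lsupp_ge[OF _ _ homog_vrestrict[OF Suc.prems(1)] m] V(1) by blast
      then have 1: "card V - 1 \<le> card {a \<in> lsupp V F. lk a i = 0}"
        unfolding cV lsupp_vrestrict[OF V(1) Suc.prems(1)] .
      have "card (lsupp V F) = card {a \<in> lsupp V F. lk a i > 0} + card {a \<in> lsupp V F. lk a i = 0}"
        using fin by (subst card_Un_disjoint[symmetric]) (auto intro!: arg_cong[where f = card])
      then show ?thesis using 1 Suc.prems(3) V(2) by linarith
    qed
    have "pure a" if a: "a \<in> lsupp V F" for a
    proof (rule ccontr)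
      assume np: "\<not> pure a"
      have aV: "a \<in> expo V (Suc e + 1)" using a lsupp_subset_expo[OF Suc.prems(1)] by blast
      obtain i j where ij: "i \<in> V" "j \<in> V" "i \<noteq> j" "lk a i > 0" "lk a j > 0"
        using nonpureE[OF np aV] .
      \<comment> \<open>The monomial \<open>a\<close> uses up \<open>i\<close> and \<open>j\<close>,
        so every other product monomial needs a variable outside \<open>{i, j}\<close>, and distinct
        monomials need distinct ones. But \<open>card V - 1\<close> monomials compete for
        \<open>card V - 2\<close> variables.\<close>
      have "\<exists>v\<in>V - {i, j}. lk b v > 0" if b: "b \<in> lsupp V F - {a}" for b
      proof -
        have bV: "b \<in> expo V (Suc e + 1)" using b lsupp_subset_expo[OF Suc.prems(1)] by blast
        have "b \<noteq> 0" using bV by (auto simp: expo_def)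
        then obtain v where v: "v \<in> Poly_Mapping.keys b" by (metis all_not_in_conv keys_eq_empty)
        have vV: "v \<in> V" using v bV by (auto simp: expo_def)
        have "v \<notin> {i, j}"
        proof
          assume "v \<in> {i, j}"
          then have "{a, b} \<subseteq> {c \<in> lsupp V F. lk c v > 0}" using a b v ij by (auto simp: in_keys_iff)
          then have "card {a, b} \<le> 1" using res[OF vV] fin by (metis (no_types, lifting) card_mono finite_subset mem_Collect_eq order_trans subsetI)
          then show False using b by auto
        qed
        then show ?thesis using v vV by (auto simp: in_keys_iff)
      qed
      then obtain f where f: "\<And>b. b \<in> lsupp V F - {a} \<Longrightarrow> f b \<in> V - {i, j} \<and> lk b (f b) > 0" by metis
      have "inj_on f (lsupp V F - {a})"
      proof (rule inj_onI)
        fix b c assume bc: "b \<in> lsupp V F - {a}" "c \<in> lsupp V F - {a}" "f b = f c"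
        have "{b, c} \<subseteq> {c \<in> lsupp V F. lk c (f b) > 0}" using f[OF bc(1)] f[OF bc(2)] bc by auto
        moreover have "finite {c \<in> lsupp V F. lk c (f b) > 0}" using fin by simp
        ultimately have "card {b, c} \<le> 1" using res[of "f b"] f[OF bc(1)] card_mono by (metis (no_types, lifting) DiffE order_trans)
        then show "b = c" by (cases "b = c") auto
      qed
      then have "card (lsupp V F - {a}) \<le> card (V - {i, j})"
        using f V(1) by (intro card_inj_on_le[of f]) auto
      moreover have "card (V - {i, j}) = card V - 2" using ij V(1) by (subst card_Diff_subset) auto
      ultimately show False using a fin Suc.prems(3) V(2) by simp
    qed
    then have "lsupp V F \<subseteq> (\<lambda>i. sg i (Suc e + 1)) ` V"
      using pure_in_expo lsupp_subset_expo[OF Suc.prems(1)] by fastforce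
    from lsupp_pure_powers_empty[OF V _ Suc.prems(1) this] have "lsupp V F = {}" by simp
    then show ?thesis using Suc.prems(3) V(2) by simp
  qed
qed

section \<open>Identities between binomial coefficients\<close>

lemma of_nat_choose_two: "2 * of_nat (c choose 2) = (of_nat c * (of_nat c - 1) :: 'k::field_char_0)"
proof (induction c)
  case (Suc c)
  have "Suc c choose 2 = c + (c choose 2)"
    by (simp add: eval_nat_numeral)
  then have "2 * of_nat (Suc c choose 2) = 2 * of_nat c + 2 * (of_nat (c choose 2) :: 'k)"
    by simp
  then show ?case unfolding Suc.IH by (simp add: algebra_simps)
qed simp

lemma of_nat_choose_three:
  "6 * of_nat (c choose 3) = (of_nat c * (of_nat c - 1) * (of_nat c - 2) :: 'k::field_char_0)"
proof (induction c)
  case (Suc c)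
  have "Suc c choose 3 = (c choose 2) + (c choose 3)"
    by (simp add: eval_nat_numeral)
  then have "6 * of_nat (Suc c choose 3) = 3 * (2 * of_nat (c choose 2)) + 6 * (of_nat (c choose 3) :: 'k)"
    by simp
  then show ?case unfolding of_nat_choose_two Suc.IH by (simp add: algebra_simps)
qed simp

text \<open>The hypothesis \<open>id\<close> says \<open>(1 + Y) ^ d - 1 - Y ^ d = A Y (1 + Y) ^ (d
  - a - 1) + B Y ^ b' (1 + Y) ^ (d - a' - b')\<close>. The coefficients at 1, 2, 3 and at
  \<open>d - 1\<close>, \<open>d - 2\<close> are enough: each is a polynomial of degree at most
  three in \<open>d\<close> or the exponents, and near the ends most of the \<open>kbin\<close> are
  0 or 1.\<close>

lemma binomial_identity_cases:
  fixes A B :: "'k::field_char_0"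
  assumes d: "d \<ge> 4" and pos: "a \<ge> 1" "a' \<ge> 1" "b' \<ge> 1" "a + 1 \<le> d" "a' + b' \<le> d"
    and id: "\<And>i. 1 \<le> i \<Longrightarrow> i \<le> d - 1 \<Longrightarrow>
      of_nat (d choose i) = A * of_nat (kbin (d - a - 1) i 1) + B * of_nat (kbin (d - a' - b') i b')"
  shows "A \<noteq> 0 \<and> B \<noteq> 0 \<and> (a = 1 \<and> a' = 2 \<and> b' = 2 \<and> (d = 4 \<or> d = 5) \<or>
     d = 5 \<and> a = 2 \<and> a' = 1 \<and> b' = 3 \<or> d = 5 \<and> a = 3 \<and> a' = 1 \<and> b' = 2)"
proof -
  define c where "c = d - a - 1"
  define c' where "c' = d - a' - b'"
  \<comment> \<open>The equations live in the field; characteristic zero allows \<open>D\<close> to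
    be cancelled and the results to be read as equations between natural numbers.\<close>
  define D :: 'k where "D = of_nat d"
  have D0: "D \<noteq> 0" using d by (simp add: D_def)
  have "D \<noteq> of_nat 3" unfolding D_def of_nat_eq_iff using d by simp
  then have D3: "D \<noteq> 3" by simp
  have ch1: "of_nat (d choose 1) = D" by (simp add: D_def)
  have ch2: "2 * of_nat (d choose 2) = D * (D - 1)" by (simp add: of_nat_choose_two D_def)
  have ch3: "6 * of_nat (d choose 3) = D * (D - 1) * (D - 2)" by (simp add: of_nat_choose_three D_def)
  have sym1: "d choose (d - 1) = d choose 1" using d by (subst binomial_symmetric) auto
  have sym2: "d choose (d - 2) = d choose 2" using d by (subst binomial_symmetric) auto
  have K1: "kbin e 1 b = (if b = 1 then 1 else 0)" if "b \<ge> 1" for e b using that by (auto simp: kbin_def)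
  have K2: "kbin e 2 b = (if b = 1 then e else if b = 2 then 1 else 0)" if "b \<ge> 1" for e b
    using that by (auto simp: kbin_def)
  have K3: "kbin e 3 b = (if b = 1 then e choose 2 else if b = 2 then e else if b = 3 then 1 else 0)" if "b \<ge> 1" for e b
    using that by (auto simp: kbin_def)
  have Kd1: "kbin (d - p - q) (d - 1) q = (if p = 1 then 1 else 0)" if "p \<ge> 1" "q \<ge> 1" "p + q \<le> d" for p q
    using that by (auto simp: kbin_def binomial_eq_0)
  have Kd2: "kbin (d - p - q) (d - 2) q = (if p = 1 then d - p - q else if p = 2 then 1 else 0)"
    if "p \<ge> 1" "q \<ge> 1" "p + q \<le> d" for p q
  proof (cases "p = 1")
    case True
    show ?thesis
    proof (cases "q \<le> d - 2")
      case le: True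
      then have "d - p - q = Suc (d - 2 - q)" using True d by simp
      then show ?thesis using True le by (simp add: kbin_def binomial_Suc_n)
    next
      case False
      then have "d - p - q = 0" using True that by simp
      then show ?thesis using True False by (simp add: kbin_def)
    qed
  qed (use that in \<open>auto simp: kbin_def binomial_eq_0\<close>)
  have r: "1 \<le> d - 1" "1 \<le> (1::nat)" "1 \<le> (2::nat)" "1 \<le> (3::nat)" "2 \<le> d - 1" "3 \<le> d - 1" "1 \<le> d - 2" "d - 2 \<le> d - 1"
    "d - 1 \<le> d - 1" using d by auto
  note K1s = K1[OF r(2)] K1[OF pos(3)] and K2s = K2[OF r(2)] K2[OF pos(3)] and K3s = K3[OF r(2)] K3[OF pos(3)]
  note Kd1s = Kd1[OF pos(1) r(2) pos(4)] Kd1[OF pos(2,3,5)] and Kd2s = Kd2[OF pos(1) r(2) pos(4)] Kd2[OF pos(2,3,5)]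
  have i1: "D = A + B * (if b' = 1 then 1 else 0)"
    using id[OF r(2) r(1)] unfolding ch1 K1s by (simp split: if_splits)
  have id1: "D = A * (if a = 1 then 1 else 0) + B * (if a' = 1 then 1 else 0)"
    using id[OF r(1) r(9)] unfolding sym1 ch1 Kd1s by (simp split: if_splits)
  have i2: "D * (D - 1) = 2 * A * of_nat c + 2 * B * (if b' = 1 then of_nat c' else if b' = 2 then 1 else 0)"
    using id[OF r(3) r(5)] unfolding ch2[symmetric] K2s c_def[symmetric] c'_def[symmetric]
    by (simp add: algebra_simps split: if_splits)
  have id2: "D * (D - 1) = 2 * A * (if a = 1 then of_nat c else if a = 2 then 1 else 0)
       + 2 * B * (if a' = 1 then of_nat c' else if a' = 2 then 1 else 0)"
    using id[OF r(7) r(8)] unfolding sym2 Kd2s unfolding ch2[symmetric] c_def[symmetric] c'_def[symmetric]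
    by (simp add: algebra_simps split: if_splits)
  have i3: "D * (D - 1) * (D - 2) = 3 * A * (of_nat c * (of_nat c - 1))
      + 3 * B * (if b' = 1 then of_nat c' * (of_nat c' - 1) else if b' = 2 then 2 * of_nat c' else if b' = 3 then 2 else 0)"
  proof -
    have "of_nat (d choose 3) = A * of_nat (c choose 2)
        + B * (if b' = 1 then of_nat (c' choose 2) else if b' = 2 then of_nat c' else if b' = 3 then 1 else 0)"
      using id[OF r(4) r(6)] unfolding K3s unfolding c_def[symmetric] c'_def[symmetric] by (simp split: if_splits)
    then have "6 * of_nat (d choose 3) = 3 * A * (2 * of_nat (c choose 2))
        + 3 * B * (if b' = 1 then 2 * of_nat (c' choose 2) else if b' = 2 then 2 * of_nat c' else if b' = 3 then 2 else 0)"
      by (simp add: distrib_left)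
    then show ?thesis unfolding ch3 of_nat_choose_two .
  qed
  show ?thesis
  proof (cases "a = 1")
    case a1: True
    have c: "of_nat c = D - 2" using a1 d by (simp add: c_def D_def of_nat_diff numeral_2_eq_2)
    show ?thesis
    proof (cases "b' = 1")
      case b1: True
      have AB: "A + B = D" using i1 b1 by simp
      show ?thesis
      proof (cases "a' = 1")
        case True
        then have c': "of_nat c' = D - 2" using b1 d by (simp add: c'_def D_def of_nat_diff numeral_2_eq_2)
        \<comment> \<open>The contradiction that recurs below:
          \<open>D (D - 1) = 2 D (D - 2)\<close> means \<open>D = 3\<close>, while
          \<open>d \<ge> 4\<close>.\<close>
        have "D * (D - 1) = 2 * (A + B) * (D - 2)" using i2 b1 c c' by (simp add: algebra_simps)
        then have "D * (D - 3) = 0" unfolding AB by (simp add: algebra_simps)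
        then show ?thesis using D0 D3 by simp
      next
        case False
        then have "A = D" using id1 a1 by simp
        moreover have "B = 0" using AB calculation by simp
        ultimately have "D * (D - 1) = 2 * D * (D - 2)" using i2 c by simp
        then have "D * (D - 3) = 0" by (simp add: algebra_simps)
        then show ?thesis using D0 D3 by simp
      qed
    next
      case b1: False
      have A: "A = D" using i1 b1 by simp
      have nB: "B \<noteq> 0"
      proof
        assume "B = 0"
        then have "D * (D - 1) = 2 * D * (D - 2)" using i2 c A by simp
        then have "D * (D - 3) = 0" by (simp add: algebra_simps)
        then show False using D0 D3 by simp
      qed
      have a'1: "a' \<noteq> 1" using id1 a1 A nB by auto
      have b'2: "b' = 2"
      proof (rule ccontr)
        assume "b' \<noteq> 2"
        then have "D * (D - 1) = 2 * D * (D - 2)" using i2 c A b1 by simp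
        then have "D * (D - 3) = 0" by (simp add: algebra_simps)
        then show False using D0 D3 by simp
      qed
      have a'2: "a' = 2"
      proof (rule ccontr)
        assume "a' \<noteq> 2"
        then have "D * (D - 1) = 2 * D * (D - 2)" using id2 c A a1 a'1 by simp
        then have "D * (D - 3) = 0" by (simp add: algebra_simps)
        then show False using D0 D3 by simp
      qed
      have c': "of_nat c' = D - 4" using b'2 a'2 d by (simp add: c'_def D_def of_nat_diff)
      have B: "2 * B = D * (D - 1) - 2 * D * (D - 2)" using i2 c A b'2 by (simp add: algebra_simps)
      \<comment> \<open>With \<open>A\<close> from the coefficient of \<open>Y\<close> and
        \<open>B\<close> from that of \<open>Y ^ 2\<close>, the coefficient of \<open>Y ^ 3\<close>
        becomes a quadratic equation for \<open>D\<close> with roots 4 and 5.\<close>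
      have "D * (D - 1) * (D - 2) = 3 * D * ((D - 2) * (D - 3)) + 3 * (2 * B) * (D - 4)"
        using i3 b'2 unfolding A c c' by (simp add: algebra_simps)
      then have "D * ((D - 4) * (D - 5)) = 0" unfolding B by (simp add: algebra_simps)
      then have "D = 4 \<or> D = 5" using D0 by simp
      then have "d = 4 \<or> d = 5" unfolding D_def by (metis of_nat_eq_iff of_nat_numeral)
      then show ?thesis using a1 a'2 b'2 A D0 nB by simp
    qed
  next
    case a1: False
    \<comment> \<open>The coefficient of \<open>Y ^ (d - 1)\<close> on the left is \<open>d\<close>,
      and only a term with first exponent 1 reaches that degree.\<close>
    have a'1: "a' = 1" using id1 a1 D0 by (cases "a' = 1") simp_all
    have B: "B = D" using id1 a1 a'1 by simp
    have c': "c' = d - 1 - b'" using a'1 by (simp add: c'_def)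
    have cc: "c + a + 1 = d" using pos(4) by (simp add: c_def)
    show ?thesis
    proof (cases "b' = 1")
      case True
      then have A: "A = 0" using i1 B by simp
      have c'': "of_nat c' = D - 2" using True c' d by (simp add: D_def of_nat_diff numeral_2_eq_2)
      have "D * (D - 1) = 2 * D * (D - 2)" using i2 True c'' A B by simp
      then have "D * (D - 3) = 0" by (simp add: algebra_simps)
      then show ?thesis using D0 D3 by simp
    next
      case b1: False
      have A: "A = D" using i1 b1 by simp
      \<comment> \<open>With \<open>A = B = D\<close> the factor \<open>D\<close> cancels from the
        coefficients of \<open>Y ^ 2\<close> and \<open>Y ^ (d - 2)\<close>, and linear equations
        \<open>n2\<close>, \<open>n3\<close> between natural numbers remain.\<close>
      have "D * (D - 1) = D * of_nat (2 * c + 2 * (if b' = 2 then 1 else 0))"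
        using i2 b1 unfolding A B by (cases "b' = 2") (simp_all add: algebra_simps)
      then have "D - 1 = of_nat (2 * c + 2 * (if b' = 2 then 1 else 0))"
        using mult_left_cancel[OF D0] by blast
      then have "D = of_nat (2 * c + 2 * (if b' = 2 then 1 else 0)) + 1" by (simp only: diff_eq_eq)
      then have "of_nat d = (of_nat (2 * c + 2 * (if b' = 2 then 1 else 0) + 1) :: 'k)"
        unfolding D_def of_nat_add of_nat_1 .
      then have n2: "d = 2 * c + 2 * (if b' = 2 then 1 else 0) + 1" by (simp only: of_nat_eq_iff)
      have "D * (D - 1) = D * of_nat (2 * c' + 2 * (if a = 2 then 1 else 0))"
        using id2 a1 a'1 unfolding A B by (cases "a = 2") (simp_all add: algebra_simps)
      then have "D - 1 = of_nat (2 * c' + 2 * (if a = 2 then 1 else 0))"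
        using mult_left_cancel[OF D0] by blast
      then have "D = of_nat (2 * c' + 2 * (if a = 2 then 1 else 0)) + 1" by (simp only: diff_eq_eq)
      then have "of_nat d = (of_nat (2 * c' + 2 * (if a = 2 then 1 else 0) + 1) :: 'k)"
        unfolding D_def of_nat_add of_nat_1 .
      then have n3: "d = 2 * c' + 2 * (if a = 2 then 1 else 0) + 1" by (simp only: of_nat_eq_iff)
      have n3t: "d = 2 * c' + 3" if "a = 2" by (subst n3) (simp add: that)
      have n3f: "d = 2 * c' + 1" if "a \<noteq> 2" by (subst n3) (simp add: that)
      have AB: "A \<noteq> 0" "B \<noteq> 0" using A B D0 by auto
      consider "b' = 2" | "b' = 3" | "b' \<ge> 4" using b1 pos by linarith
      then show ?thesis
      proof cases
        case 1
        have c'3: "c' + 3 = d" using c' 1 d by simp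
        have n2': "d = 2 * c + 3" by (subst n2) (simp add: 1)
        then have "d = 5 \<and> a = 3"
        proof (cases "a = 2")
          case True
          show ?thesis using n3t[OF True] n2' c'3 d cc True by linarith
        next
          case False
          show ?thesis using n3f[OF False] n2' c'3 d cc by linarith
        qed
        then show ?thesis using AB a'1 1 by simp
      next
        case 2
        have c'4: "c' + 4 = d" using c' 2 d by simp
        have n2': "d = 2 * c + 1" by (subst n2) (simp add: 2)
        have "d = 5 \<and> a = 2 \<or> d = 7 \<and> c = 3"
        proof (cases "a = 2")
          case True
          show ?thesis using n3t[OF True] n2' c'4 d cc True by linarith
        next
          case False
          show ?thesis using n3f[OF False] n2' c'4 d cc by linarith
        qed
        \<comment> \<open>This solution passes the tests at both ends in degrees 1 and 2; the
          coefficient of \<open>Y ^ 3\<close> excludes it, since 210 differs from 168.\<close>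
        moreover have "\<not> (d = 7 \<and> c = 3)"
        proof
          assume "d = 7 \<and> c = 3"
          then have "(7::'k) * 6 * 5 = 3 * 7 * (3 * 2) + 3 * 7 * 2" using i3 2 unfolding A B D_def by simp
          then show False by simp
        qed
        ultimately show ?thesis using AB a'1 2 by simp
      next
        case 3
        have n2': "d = 2 * c + 1" using 3 by (subst n2) simp
        then have Dc: "D = 2 * of_nat c + 1" by (simp add: D_def)
        \<comment> \<open>For \<open>b' \<ge> 4\<close> the second term does not reach
          \<open>Y ^ 3\<close>. With \<open>d = 2 c + 1\<close> the coefficient there gives
          \<open>c (c + 1) = 0\<close>.\<close>
        have "D * ((D - 1) * (D - 2)) = D * (3 * (of_nat c * (of_nat c - 1)))"
          using i3 3 unfolding A B by (simp add: algebra_simps)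
        then have "(D - 1) * (D - 2) = 3 * (of_nat c * (of_nat c - 1))" using D0 by simp
        then have "of_nat c * (of_nat c + 1) = (0 :: 'k)" unfolding Dc by (simp add: algebra_simps)
        then have "of_nat (c * (c + 1)) = (0 :: 'k)" by (simp add: algebra_simps)
        then have "c = 0" by (simp only: of_nat_eq_0_iff) simp
        then show ?thesis using n2' d by simp
      qed
    qed
  qed
qed

text \<open>The coefficient of \<open>Y\<close> is \<open>d\<close>, and only a term with
  \<open>Y\<close>-exponent 1 can produce it. So one of the two terms has this form, and by symmetry
  it may be the first.\<close>

lemma binomial_identity_solve:
  fixes A B :: "'k::field_char_0"
  assumes d: "d \<ge> 4" and pos: "a \<ge> 1" "b \<ge> 1" "a' \<ge> 1" "b' \<ge> 1" "a + b \<le> d" "a' + b' \<le> d"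
    and id: "\<And>i. 1 \<le> i \<Longrightarrow> i \<le> d - 1 \<Longrightarrow>
      of_nat (d choose i) = A * of_nat (kbin (d - a - b) i b) + B * of_nat (kbin (d - a' - b') i b')"
  shows "A \<noteq> 0" "B \<noteq> 0" "{(a, b), (a', b')} = {(1, 1), (2, 2)} \<and> (d = 4 \<or> d = 5) \<or>
     d = 5 \<and> ({(a, b), (a', b')} = {(2, 1), (1, 3)} \<or> {(a, b), (a', b')} = {(3, 1), (1, 2)})"
proof -
  have "b = 1 \<or> b' = 1"
  proof (rule ccontr)
    assume "\<not> (b = 1 \<or> b' = 1)"
    then have "kbin (d - a - b) 1 b = 0" "kbin (d - a' - b') 1 b' = 0" using pos by (auto simp: kbin_def)
    moreover have "1 \<le> d - 1" using d by simp
    ultimately have "of_nat (d choose 1) = (0::'k)" using id[of 1] by simp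
    then show False using d by simp
  qed
  then have *: "A \<noteq> 0 \<and> B \<noteq> 0 \<and> ({(a, b), (a', b')} = {(1, 1), (2, 2)} \<and> (d = 4 \<or> d = 5) \<or>
     d = 5 \<and> ({(a, b), (a', b')} = {(2, 1), (1, 3)} \<or> {(a, b), (a', b')} = {(3, 1), (1, 2)}))"
  proof
    assume b: "b = 1"
    have "A \<noteq> 0 \<and> B \<noteq> 0 \<and> (a = 1 \<and> a' = 2 \<and> b' = 2 \<and> (d = 4 \<or> d = 5) \<or>
     d = 5 \<and> a = 2 \<and> a' = 1 \<and> b' = 3 \<or> d = 5 \<and> a = 3 \<and> a' = 1 \<and> b' = 2)"
      using pos id b by (intro binomial_identity_cases[OF d]) auto
    then show ?thesis using b by auto
  next
    assume b: "b' = 1"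
    have "B \<noteq> 0 \<and> A \<noteq> 0 \<and> (a' = 1 \<and> a = 2 \<and> b = 2 \<and> (d = 4 \<or> d = 5) \<or>
     d = 5 \<and> a' = 2 \<and> a = 1 \<and> b = 3 \<or> d = 5 \<and> a' = 3 \<and> a = 1 \<and> b = 2)"
      using pos id b by (intro binomial_identity_cases[OF d]) (auto simp: add.commute)
    then show ?thesis using b by (auto simp: insert_commute)
  qed
  show "A \<noteq> 0" by (rule conjunct1[OF *])
  show "B \<noteq> 0" by (rule conjunct1[OF conjunct2[OF *]])
  show "{(a, b), (a', b')} = {(1, 1), (2, 2)} \<and> (d = 4 \<or> d = 5) \<or>
     d = 5 \<and> ({(a, b), (a', b')} = {(2, 1), (1, 3)} \<or> {(a, b), (a', b')} = {(3, 1), (1, 2)})"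
    by (rule conjunct2[OF conjunct2[OF *]])
qed

text \<open>Here \<open>(1 + Y) ^ d - 1 - Y ^ d = A Y ^ a + B Y ^ a' (1 + Y) ^ (d - a')\<close> in
  the degrees 1 to \<open>d - 1\<close>. At most one of the degrees 1, 2, 3 equals \<open>a\<close>;
  the other two give incompatible conditions on \<open>B\<close>.\<close>

lemma binomial_identity_impossible:
  fixes A B :: "'k::field_char_0"
  assumes d: "d \<ge> 4" and pos: "a' \<ge> 1" "a' \<le> d"
    and id: "\<And>i. 1 \<le> i \<Longrightarrow> i \<le> d - 1 \<Longrightarrow>
      of_nat (d choose i) = A * (if i = a then 1 else 0) + B * of_nat (kbin (d - a') i a')"
  shows False
proof -
  define D :: 'k where "D = of_nat d"
  have D0: "D \<noteq> 0" using d by (simp add: D_def)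
  have "D \<noteq> of_nat 1" "D \<noteq> of_nat 2" unfolding D_def of_nat_eq_iff using d by simp_all
  then have D1: "D \<noteq> 1" and D2: "D \<noteq> 2" by simp_all
  have ch2: "2 * of_nat (d choose 2) = D * (D - 1)" by (simp add: of_nat_choose_two D_def)
  have ch3: "6 * of_nat (d choose 3) = D * (D - 1) * (D - 2)" by (simp add: of_nat_choose_three D_def)
  have i1: "D = A * (if 1 = a then 1 else 0) + B * of_nat (kbin (d - a') 1 a')"
    using id[of 1] d by (simp add: D_def)
  have i2: "D * (D - 1) = 2 * (A * (if 2 = a then 1 else 0) + B * of_nat (kbin (d - a') 2 a'))"
    using id[of 2] d by (simp flip: ch2)
  have i3: "D * (D - 1) * (D - 2) = 6 * (A * (if 3 = a then 1 else 0) + B * of_nat (kbin (d - a') 3 a'))"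
    using id[of 3] d by (simp flip: ch3)
  consider "a' = 1" | "a' = 2" | "a' \<ge> 3" using pos by linarith
  then show False
  proof cases
    case 1
    have e: "of_nat (d - a') = D - 1" using 1 d by (simp add: D_def of_nat_diff)
    have k2: "of_nat (kbin (d - a') 2 a') = D - 1" using 1 e by (simp add: kbin_def)
    have k3: "2 * of_nat (kbin (d - a') 3 a') = (D - 1) * (D - 2)"
      using 1 of_nat_choose_two[of "d - a'", where 'k = 'k] e by (simp add: kbin_def)
    \<comment> \<open>For \<open>a' = 1\<close> the degrees 1, 2, 3 ask for \<open>B = D\<close>,
      \<open>2 B = D\<close>, \<open>3 B = D\<close>, and at least two of these must hold.\<close>
    have j1: "a \<noteq> 1 \<Longrightarrow> B = D" using i1 1 by (simp add: kbin_def)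
    have j2: "a \<noteq> 2 \<Longrightarrow> 2 * B = D"
    proof -
      assume "a \<noteq> 2"
      then have "D * (D - 1) = (2 * B) * (D - 1)" using i2 k2 by simp
      then show ?thesis using D1 by simp
    qed
    have j3: "a \<noteq> 3 \<Longrightarrow> 3 * B = D"
    proof -
      assume "a \<noteq> 3"
      then have "D * (D - 1) * (D - 2) = 3 * B * (2 * of_nat (kbin (d - a') 3 a'))" using i3 by simp
      then have "D * ((D - 1) * (D - 2)) = (3 * B) * ((D - 1) * (D - 2))" unfolding k3 by (simp only: mult.assoc)
      then show ?thesis using D1 D2 by simp
    qed
    show False
    proof (cases "a = 1")
      case True
      then have "3 * B = 2 * B" using j2 j3 by simp
      moreover have "3 * B - 2 * B = B" by (simp flip: left_diff_distrib)
      ultimately have "B = 0" by simp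
      then show False using j2 True D0 by simp
    next
      case False
      then have B: "B = D" by (rule j1)
      show False using j2 j3 D0 unfolding B by (cases "a = 2") auto
    qed
  next
    case 2
    have a: "a = 1" using i1 2 D0 by (cases "a = 1") (auto simp: kbin_def)
    have B: "D * (D - 1) = 2 * B" using i2 2 a by (simp add: kbin_def)
    have e: "of_nat (d - a') = D - 2" using 2 d by (simp add: D_def of_nat_diff)
    have "D * (D - 1) * (D - 2) = 3 * ((2 * B) * (D - 2))" using i3 2 a e by (simp add: kbin_def)
    then show False unfolding B[symmetric] using D0 D1 D2 by simp
  next
    case 3
    then have "kbin (d - a') 1 a' = 0" "kbin (d - a') 2 a' = 0" by (auto simp: kbin_def)
    then show False using i1 i2 D0 D1 by (cases "a = 1") auto
  qed
qed

section \<open>Forms in three variables and the lower bound\<close>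

definition mixed :: "'v set \<Rightarrow> (('v \<Rightarrow>\<^sub>0 nat) \<Rightarrow> 'k::comm_ring_1) \<Rightarrow> ('v \<Rightarrow>\<^sub>0 nat) set" where
  "mixed V F = {a \<in> lsupp V F. \<not> pure a}"

text \<open>In degree 5 \<open>z\<close> is the coordinate with exponents 3 and 1, called
  \<open>x_0\<close> in the exceptional system; in degree 4 it is the one called
  \<open>x_2\<close>.\<close>

definition exc_support :: "'v set \<Rightarrow> nat \<Rightarrow> ('v \<Rightarrow>\<^sub>0 nat) set \<Rightarrow> bool" where
  "exc_support V d U \<longleftrightarrow> (\<exists>x y z. distinct [x, y, z] \<and> V = {x, y, z} \<and>
     (d = 5 \<and> U = {tri x y z 1 1 3, tri x y z 2 2 1} \<or> d = 4 \<and> U = {tri x y z 1 1 2, tri x y z 2 2 0}))"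

lemma exc_supportI:
  "distinct [x, y, z] \<Longrightarrow> V = {x, y, z} \<Longrightarrow>
    d = 5 \<and> U = {tri x y z 1 1 3, tri x y z 2 2 1} \<or> d = 4 \<and> U = {tri x y z 1 1 2, tri x y z 2 2 0} \<Longrightarrow>
    exc_support V d U"
  unfolding exc_support_def by (rule exI[of _ x], rule exI[of _ y], rule exI[of _ z]) (intro conjI)

lemma kbin_0_0: "kbin 0 i b = (if i = b then 1 else 0)"
  by (auto simp: kbin_def binomial_eq_0)

text \<open>The substitution for a product with at most two mixed monomials, where \<open>u\<close>
  and \<open>v\<close> may coincide or may not occur at all: their coefficients are then 0. The
  powers of \<open>x\<close> and \<open>y\<close> are visible only in the degrees 0 and
  \<open>d\<close>.\<close>

lemma ternary_identity:
  fixes F :: "('v \<Rightarrow>\<^sub>0 nat) \<Rightarrow> 'k::comm_ring_1"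
  assumes xyz: "distinct [x, y, z]" and d: "d \<ge> 1" and h: "homog {x, y, z} (d - 1) F"
    and U: "mixed {x, y, z} F \<subseteq> {u, v}" and np: "\<not> pure u" "\<not> pure v"
    and uv: "u \<in> expo {x, y, z} d" "v \<in> expo {x, y, z} d"
  shows "\<exists>A B. (A \<noteq> 0 \<longrightarrow> u \<in> mixed {x, y, z} F) \<and> (B \<noteq> 0 \<longrightarrow> v \<in> mixed {x, y, z} F \<and> u \<noteq> v) \<and>
    (\<forall>i. lmul {x, y, z} F (Poly_Mapping.single x d) * (if i = 0 then 1 else 0)
       + lmul {x, y, z} F (Poly_Mapping.single y d) * (if i = d then 1 else 0)
       + lmul {x, y, z} F (Poly_Mapping.single z d) * (-1) ^ d * of_nat (d choose i)
       + A * of_nat (kbin (Poly_Mapping.lookup u z) i (Poly_Mapping.lookup u y))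
       + B * of_nat (kbin (Poly_Mapping.lookup v z) i (Poly_Mapping.lookup v y)) = 0)"
proof -
  let ?V = "{x, y, z}" and ?g = "lmul {x, y, z} F"
  define P where "P = {sg x d, sg y d, sg z d}"
  define t where "t i a = ?g a * (-1) ^ lk a z * of_nat (kbin (lk a z) i (lk a y))" for i a
  have ne: "x \<noteq> y" "x \<noteq> z" "y \<noteq> z" "y \<noteq> x" "z \<noteq> x" "z \<noteq> y" using xyz by auto
  have h1: "d - 1 + 1 = d" using d by simp
  have fin: "finite ?V" by simp
  have PU: "P \<inter> {u, v} = {}" using np by (auto simp: P_def pure_def)
  have L: "lsupp ?V F \<subseteq> P \<union> {u, v}"
  proof
    fix a assume a: "a \<in> lsupp ?V F"
    show "a \<in> P \<union> {u, v}"
    proof (cases "pure a")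
      case True
      have "a \<in> expo ?V d" using a lsupp_subset_expo[OF h] unfolding h1 by (rule rev_subsetD)
      from pure_in_expo[OF True this] show ?thesis using d by (auto simp: P_def)
    next
      case False
      then have "a \<in> mixed ?V F" using a by (simp add: mixed_def)
      then show ?thesis using U by auto
    qed
  qed
  \<comment> \<open>For \<open>u = v\<close> the monomial must be counted once, so its second copy
    gets the coefficient 0.\<close>
  define B where "B = (if u = v then 0 else ?g v * (-1) ^ lk v z)"
  define A where "A = ?g u * (-1) ^ lk u z"
  have neP: "sg x d \<noteq> sg y d" "sg x d \<noteq> sg z d" "sg y d \<noteq> sg z d"
    using ne d by (metis lookup_single_eq lookup_single_not_eq not_one_le_zero)+
  have id: "?g (sg x d) * (if i = 0 then 1 else 0) + ?g (sg y d) * (if i = d then 1 else 0)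
       + ?g (sg z d) * (-1) ^ d * of_nat (d choose i)
       + A * of_nat (kbin (lk u z) i (lk u y)) + B * of_nat (kbin (lk v z) i (lk v y)) = 0" for i
  proof -
    have "(\<Sum>a\<in>P \<union> {u, v}. t i a) = 0"
      unfolding t_def
    proof (rule substitution_coeff[OF fin _ _ _ xyz h _ L])
      fix a w assume "w \<in> ?V - {x, y, z}" then show "lk a w = 0" by simp
    qed (simp_all add: P_def)
    moreover have "(\<Sum>a\<in>P \<union> {u, v}. t i a) = (\<Sum>a\<in>P. t i a) + (\<Sum>a\<in>{u, v}. t i a)"
      by (rule sum.union_disjoint[OF _ _ PU]) (simp_all add: P_def)
    moreover have "(\<Sum>a\<in>{u, v}. t i a) = A * of_nat (kbin (lk u z) i (lk u y)) + B * of_nat (kbin (lk v z) i (lk v y))"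
      by (cases "u = v") (simp_all add: t_def A_def B_def)
    moreover have "(\<Sum>a\<in>P. t i a) = t i (sg x d) + t i (sg y d) + t i (sg z d)"
      unfolding P_def using neP by (simp add: add.assoc)
    moreover have "t i (sg x d) = ?g (sg x d) * (if i = 0 then 1 else 0)"
      using ne by (simp add: t_def lookup_single when_def kbin_0_0)
    moreover have "t i (sg y d) = ?g (sg y d) * (if i = d then 1 else 0)"
      using ne by (simp add: t_def lookup_single when_def kbin_0_0)
    moreover have "t i (sg z d) = ?g (sg z d) * (-1) ^ d * of_nat (d choose i)"
      using ne by (simp add: t_def lookup_single when_def kbin_def)
    ultimately show ?thesis by (simp only: add.assoc)
  qed
  have 1: "u \<in> mixed ?V F" if "A \<noteq> 0"
  proof -
    have "?g u \<noteq> 0" using that unfolding A_def by auto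
    then show ?thesis using np by (simp add: mixed_def lsupp_def)
  qed
  have 2: "v \<in> mixed ?V F \<and> u \<noteq> v" if "B \<noteq> 0"
  proof -
    have "u \<noteq> v" "?g v \<noteq> 0" using that unfolding B_def by (auto split: if_splits)
    then show ?thesis using np by (simp add: mixed_def lsupp_def)
  qed
  show ?thesis using 1 2 id by (intro exI[of _ A] exI[of _ B]) simp
qed

text \<open>Both mixed monomials involve \<open>x\<close> and \<open>y\<close>, so the edges
  \<open>x = 0\<close> and \<open>y = 0\<close> of the triangle carry pure powers only. After
  division by the coefficient of \<open>z ^ d\<close> the substitution is an instance of
  \<open>binomial_identity_solve\<close>.\<close>

lemma ternary_two_clean_edges:
  fixes F :: "('v \<Rightarrow>\<^sub>0 nat) \<Rightarrow> 'k::field_char_0"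
  assumes xyz: "distinct [x, y, z]" and d: "d \<ge> 4" and h: "homog {x, y, z} (d - 1) F"
    and U: "mixed {x, y, z} F \<subseteq> {u, v}" and uv: "u \<in> expo {x, y, z} d" "v \<in> expo {x, y, z} d"
    and pos: "Poly_Mapping.lookup u x \<ge> 1" "Poly_Mapping.lookup u y \<ge> 1"
      "Poly_Mapping.lookup v x \<ge> 1" "Poly_Mapping.lookup v y \<ge> 1"
    and face: "a0 \<in> lsupp {x, y, z} F" "Poly_Mapping.lookup a0 y = 0"
  shows "exc_support {x, y, z} d (mixed {x, y, z} F)"
proof -
  let ?V = "{x, y, z}" and ?g = "lmul {x, y, z} F"
  have ne: "x \<noteq> y" "x \<noteq> z" "y \<noteq> z" "y \<noteq> x" "z \<noteq> x" "z \<noteq> y" using xyz by auto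
  have np: "\<not> pure u" "\<not> pure v" using pure_lookup[OF _ ne(1)] pos by fastforce+
  have d1: "d \<ge> 1" "d - 1 + 1 = d" using d by auto
  obtain A B where A: "A \<noteq> 0 \<longrightarrow> u \<in> mixed ?V F" and B: "B \<noteq> 0 \<longrightarrow> v \<in> mixed ?V F \<and> u \<noteq> v"
    and id_all: "\<forall>i. ?g (sg x d) * (if i = 0 then 1 else 0) + ?g (sg y d) * (if i = d then 1 else 0)
       + ?g (sg z d) * (-1) ^ d * of_nat (d choose i)
       + A * of_nat (kbin (lk u z) i (lk u y)) + B * of_nat (kbin (lk v z) i (lk v y)) = 0"
  proof -
    from ternary_identity[OF xyz d1(1) h U np uv] show thesis
      by (elim exE conjE) (rule that; assumption)
  qed
  note id = spec[OF id_all]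
  define c where "c = ?g (sg z d) * (-1) ^ d"
  have k0: "kbin (lk u z) 0 (lk u y) = 0" "kbin (lk v z) 0 (lk v y) = 0" using pos by (auto simp: kbin_def)
  have xz: "?g (sg x d) + c = 0" using id[of 0] d unfolding k0 c_def by simp
  \<comment> \<open>Degree 0 of the substitution ties the coefficient of \<open>x ^ d\<close> to
    that of \<open>z ^ d\<close>. If both were 0, the edge \<open>y = 0\<close> would contain no
    product monomial, against \<open>face\<close>.\<close>
  have "c \<noteq> 0"
  proof
    assume "c = 0"
    then have g0: "?g (sg x d) = 0" "?g (sg z d) = 0" using xz by (auto simp: c_def)
    show False
    proof (cases "pure a0")
      case True
      have "a0 \<in> expo ?V d" using face(1) lsupp_subset_expo[OF h] unfolding d1(2) by (rule rev_subsetD)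
      from pure_in_expo[OF True this] obtain i where i: "i \<in> ?V" "a0 = sg i d" using d by auto
      then have "i \<noteq> y" using face(2) d by auto
      then show False using i g0 face(1) by (auto simp: lsupp_def)
    next
      case False
      then have "a0 \<in> mixed ?V F" using face by (simp add: mixed_def)
      then have "a0 = u \<or> a0 = v" using U by auto
      then show False using face(2) pos by auto
    qed
  qed
  note tu = in_expo_tri[OF xyz uv(1)] and tv = in_expo_tri[OF xyz uv(2)]
  have uz: "lk u z = d - lk u x - lk u y" and vz: "lk v z = d - lk v x - lk v y" using tu(2) tv(2) by auto
  have le: "lk u x + lk u y \<le> d" "lk v x + lk v y \<le> d" using tu(2) tv(2) by auto
  have ident: "of_nat (d choose i) = (- A / c) * of_nat (kbin (d - lk u x - lk u y) i (lk u y))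
      + (- B / c) * of_nat (kbin (d - lk v x - lk v y) i (lk v y))" if "1 \<le> i" "i \<le> d - 1" for i
  proof -
    have id0: "i \<noteq> 0" "i \<noteq> d" using that d by auto
    have "c * of_nat (d choose i) + A * of_nat (kbin (lk u z) i (lk u y)) + B * of_nat (kbin (lk v z) i (lk v y)) = 0"
      using id[of i] id0 by (simp add: c_def)
    then have "c * of_nat (d choose i) = - A * of_nat (kbin (lk u z) i (lk u y)) - B * of_nat (kbin (lk v z) i (lk v y))"
      by (simp add: algebra_simps eq_neg_iff_add_eq_0)
    then show ?thesis using \<open>c \<noteq> 0\<close> unfolding uz vz by (simp add: field_simps)
  qed
  note sol = binomial_identity_solve[OF d pos le ident]
  have mem: "u \<in> mixed ?V F" "v \<in> mixed ?V F" using sol(1,2) A B by auto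
  have Ueq: "mixed ?V F = {u, v}" using U mem by auto
  have ueq: "u = tri x y z (lk u x) (lk u y) (d - lk u x - lk u y)"
    and veq: "v = tri x y z (lk v x) (lk v y) (d - lk v x - lk v y)"
    using tu(1) tv(1) unfolding uz vz by simp_all
  have set_eq: "{u, v} = (\<lambda>(a, b). tri x y z a b (d - a - b)) ` {(lk u x, lk u y), (lk v x, lk v y)}"
    using ueq veq by simp
  consider "{(lk u x, lk u y), (lk v x, lk v y)} = {(1, 1), (2, 2)}" "d = 4 \<or> d = 5"
    | "{(lk u x, lk u y), (lk v x, lk v y)} = {(2, 1), (1, 3)}" "d = 5"
    | "{(lk u x, lk u y), (lk v x, lk v y)} = {(3, 1), (1, 2)}" "d = 5"
    using sol(3) by auto
  then show ?thesis
  proof cases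
    case 1
    have e: "mixed ?V F = {tri x y z 1 1 (d - 1 - 1), tri x y z 2 2 (d - 2 - 2)}" unfolding Ueq set_eq 1(1) by simp
    show ?thesis using 1(2)
    proof
      assume d4: "d = 4"
      have "mixed ?V F = {tri x y z 1 1 2, tri x y z 2 2 0}" using e unfolding d4 by (simp add: eval_nat_numeral)
      then show ?thesis using d4 xyz by (intro exc_supportI[OF xyz refl]) simp
    next
      assume d5: "d = 5"
      have "mixed ?V F = {tri x y z 1 1 3, tri x y z 2 2 1}" using e unfolding d5 by (simp add: eval_nat_numeral)
      then show ?thesis using d5 xyz by (intro exc_supportI[OF xyz refl]) simp
    qed
  next
    case 2
    have e: "mixed ?V F = {tri x y z 2 1 (5 - 2 - 1), tri x y z 1 3 (5 - 1 - 3)}" unfolding Ueq set_eq 2 by simp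
    \<comment> \<open>The solution is renamed so that the coordinate with exponents 3 and 1 comes
      last.\<close>
    have p: "tri x y z 2 1 (5 - 2 - 1) = tri x z y 2 2 1" "tri x y z 1 3 (5 - 1 - 3) = tri x z y 1 1 3"
      by (simp_all add: add.assoc add.commute[of "sg y _"] eval_nat_numeral)
    have "mixed ?V F = {tri x z y 1 1 3, tri x z y 2 2 1}" unfolding e p by (rule insert_commute)
    then show ?thesis using 2(2) ne by (intro exc_supportI[of x z y]) auto
  next
    case 3
    have e: "mixed ?V F = {tri x y z 3 1 (5 - 3 - 1), tri x y z 1 2 (5 - 1 - 2)}" unfolding Ueq set_eq 3 by simp
    have p: "tri x y z 3 1 (5 - 3 - 1) = tri y z x 1 1 3" "tri x y z 1 2 (5 - 1 - 2) = tri y z x 2 2 1"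
      by (simp_all add: add.assoc add.commute[of "sg x _"] eval_nat_numeral)
    have "mixed ?V F = {tri y z x 1 1 3, tri y z x 2 2 1}" unfolding e p ..
    then show ?thesis using 3(2) ne by (intro exc_supportI[of y z x]) auto
  qed
qed

text \<open>The mixed monomials lie on the edges \<open>z = 0\<close> and \<open>y = 0\<close>. With
  the values \<open>y = 1\<close>, \<open>x = Y\<close>, \<open>z = -1 - Y\<close> the monomial
  \<open>u\<close> becomes a single power of \<open>Y\<close>, which leads to
  \<open>binomial_identity_impossible\<close>.\<close>

lemma ternary_one_clean_edge:
  fixes F :: "('v \<Rightarrow>\<^sub>0 nat) \<Rightarrow> 'k::field_char_0"
  assumes xyz: "distinct [x, y, z]" and d: "d \<ge> 4" and h: "homog {x, y, z} (d - 1) F"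
    and U: "mixed {x, y, z} F \<subseteq> {u, v}" and uv: "u \<in> expo {x, y, z} d" "v \<in> expo {x, y, z} d"
    and pos: "Poly_Mapping.lookup u x \<ge> 1" "Poly_Mapping.lookup u y \<ge> 1" "Poly_Mapping.lookup u z = 0"
      "Poly_Mapping.lookup v x \<ge> 1" "Poly_Mapping.lookup v z \<ge> 1" "Poly_Mapping.lookup v y = 0"
    and face: "a0 \<in> lsupp {x, y, z} F" "Poly_Mapping.lookup a0 x = 0"
  shows False
proof -
  have V: "{x, y, z} = {y, x, z}" by auto
  let ?V = "{y, x, z}" and ?g = "lmul {y, x, z} F"
  have ne: "x \<noteq> y" "x \<noteq> z" "y \<noteq> z" "y \<noteq> x" "z \<noteq> x" "z \<noteq> y" using xyz by auto
  have yxz: "distinct [y, x, z]" using ne by auto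
  have np: "\<not> pure u" "\<not> pure v" using pure_lookup[OF _ ne(1)] pure_lookup[OF _ ne(2)] pos by fastforce+
  have d1: "d \<ge> 1" "d - 1 + 1 = d" using d by auto
  obtain A B where A: "A \<noteq> 0 \<longrightarrow> u \<in> mixed ?V F" and B: "B \<noteq> 0 \<longrightarrow> v \<in> mixed ?V F \<and> u \<noteq> v"
    and id_all: "\<forall>i. ?g (sg y d) * (if i = 0 then 1 else 0) + ?g (sg x d) * (if i = d then 1 else 0)
       + ?g (sg z d) * (-1) ^ d * of_nat (d choose i)
       + A * of_nat (kbin (lk u z) i (lk u x)) + B * of_nat (kbin (lk v z) i (lk v x)) = 0"
  proof -
    from ternary_identity[OF yxz d1(1) h[unfolded V] U[unfolded V] np uv[unfolded V]] show thesis
      by (elim exE conjE) (rule that; assumption)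
  qed
  note id = spec[OF id_all]
  define c where "c = ?g (sg z d) * (-1) ^ d"
  have k0: "kbin (lk u z) 0 (lk u x) = 0" "kbin (lk v z) 0 (lk v x) = 0" using pos by (auto simp: kbin_def)
  have xz: "?g (sg y d) + c = 0" using id[of 0] d unfolding k0 c_def by simp
  have "c \<noteq> 0"
  proof
    assume "c = 0"
    then have g0: "?g (sg y d) = 0" "?g (sg z d) = 0" using xz by (auto simp: c_def)
    show False
    proof (cases "pure a0")
      case True
      have "a0 \<in> expo {x, y, z} d" using face(1) lsupp_subset_expo[OF h] unfolding d1(2) by (rule rev_subsetD)
      from pure_in_expo[OF True this] obtain i where i: "i \<in> {x, y, z}" "a0 = sg i d" using d by auto
      then have "i \<noteq> x" using face(2) d by auto
      then show False using i g0 face(1) unfolding V by (auto simp: lsupp_def)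
    next
      case False
      then have "a0 \<in> mixed {x, y, z} F" using face by (simp add: mixed_def)
      then have "a0 = u \<or> a0 = v" using U by auto
      then show False using face(2) pos by auto
    qed
  qed
  have vz: "lk v z = d - lk v x" "lk v x \<le> d" using in_expo_tri(2)[OF xyz uv(2)] pos(6) by auto
  show False
  proof (rule binomial_identity_impossible[OF d pos(4) vz(2)])
    fix i :: nat assume i: "1 \<le> i" "i \<le> d - 1"
    have id0: "i \<noteq> 0" "i \<noteq> d" using i d by auto
    have "c * of_nat (d choose i) + A * of_nat (kbin (lk u z) i (lk u x)) + B * of_nat (kbin (lk v z) i (lk v x)) = 0"
      using id[of i] id0 by (simp add: c_def)
    then have "c * of_nat (d choose i) = - A * of_nat (kbin (lk u z) i (lk u x)) - B * of_nat (kbin (lk v z) i (lk v x))"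
      by (simp add: algebra_simps eq_neg_iff_add_eq_0)
    then show "of_nat (d choose i) = (- A / c) * (if i = lk u x then 1 else 0) + (- B / c) * of_nat (kbin (d - lk v x) i (lk v x))"
      using \<open>c \<noteq> 0\<close> unfolding pos(3) vz kbin_0_0 by (simp add: field_simps)
  qed
qed

lemma card_lsupp_face:
  fixes F :: "('v \<Rightarrow>\<^sub>0 nat) \<Rightarrow> 'k::comm_ring_1"
  assumes "finite V" "card V \<ge> 2" "i \<in> V" "homog V e F" "\<not> (\<forall>m. F m \<noteq> 0 \<longrightarrow> Poly_Mapping.lookup m i > 0)"
  shows "card V - 1 \<le> card {a \<in> lsupp V F. Poly_Mapping.lookup a i = 0}"
proof -
  from vrestrict_neq_0[OF assms(5)] obtain m where m: "vrestrict i F m \<noteq> 0" by (rule exE)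
  have cV: "card (V - {i}) = card V - 1" using assms(3) by (rule card_Diff_singleton)
  then have "V - {i} \<noteq> {}" using assms(2) by (metis card.empty One_nat_def Suc_1 diff_is_0_eq not_less_eq_eq order_refl)
  then have "card (V - {i}) \<le> card (lsupp (V - {i}) (vrestrict i F))"
    using card_lsupp_ge[OF _ _ homog_vrestrict[OF assms(4)] m] assms(1) by blast
  then show ?thesis unfolding cV lsupp_vrestrict[OF assms(1,4)] .
qed

text \<open>A mixed monomial in three variables contains at least two of them. So \<open>u\<close>
  and \<open>v\<close> either have two variables in common, or they lie on two different edges and
  share exactly one.\<close>

lemma ternary_case:
  fixes F :: "('v \<Rightarrow>\<^sub>0 nat) \<Rightarrow> 'k::field_char_0"
  assumes V: "finite V" "card V = 3" and d: "d \<ge> 4" and h: "homog V (d - 1) F"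
    and nd: "\<And>i. i \<in> V \<Longrightarrow> \<not> (\<forall>m. F m \<noteq> 0 \<longrightarrow> Poly_Mapping.lookup m i > 0)"
    and c: "card (mixed V F) \<le> 2"
  shows "exc_support V d (mixed V F)"
proof -
  have d1: "d - 1 + 1 = d" using d by simp
  have face: "\<exists>a\<in>lsupp V F. lk a i = 0" if "i \<in> V" for i
  proof -
    have "{a \<in> lsupp V F. lk a i = 0} \<noteq> {}"
      using card_lsupp_face[OF V(1) _ that h nd[OF that]] V(2) by (auto simp del: Collect_empty_eq)
    then show ?thesis by auto
  qed
  obtain x0 y0 z0 where V0: "V = {x0, y0, z0}" "distinct [x0, y0, z0]" using V(2) by (auto simp: card_3_iff)
  \<comment> \<open>A mixed monomial that stands in for \<open>u\<close> and \<open>v\<close> when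
    the product has no mixed monomial of its own.\<close>
  define w where "w = sg x0 1 + sg y0 (d - 1)"
  have w: "w \<in> expo V d" "\<not> pure w"
  proof -
    have "w \<in> expo V (1 + (d - 1))" unfolding w_def by (rule expo_add; rule expo_single) (use V0 in auto)
    then show "w \<in> expo V d" using d by simp
    show "\<not> pure w"
    proof
      assume "pure w"
      from pure_lookup[OF this, of x0 y0] show False using V0 d by (auto simp: w_def lookup_add lookup_single when_def)
    qed
  qed
  have sub: "mixed V F \<subseteq> {a \<in> expo V d. \<not> pure a}"
    using lsupp_subset_expo[OF h] unfolding d1 by (auto simp: mixed_def)
  have fin: "finite (mixed V F)" using finite_subset[OF sub] finite_expo[OF V(1)] by simp
  have "\<exists>u v. mixed V F \<subseteq> {u, v} \<and> u \<in> expo V d \<and> v \<in> expo V d \<and> \<not> pure u \<and> \<not> pure v"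
  proof -
    consider "mixed V F = {}" | u where "mixed V F = {u}" | u v where "mixed V F = {u, v}"
      using c fin by (metis (full_types) card_1_singletonE card_2_iff card_eq_0_iff le_SucE le_zero_eq One_nat_def Suc_1)
    then show ?thesis
    proof cases
      case 1 then show ?thesis using w by auto
    next
      case (2 u) then show ?thesis using sub by (intro exI[of _ u]) auto
    next
      case (3 u v) then show ?thesis using sub by (intro exI[of _ u] exI[of _ v]) auto
    qed
  qed
  then obtain u v where U: "mixed V F \<subseteq> {u, v}" and uv: "u \<in> expo V d" "v \<in> expo V d" and np: "\<not> pure u" "\<not> pure v"
    by blast
  have third: "\<exists>k. V = {i, j, k} \<and> distinct [i, j, k]" if "i \<in> V" "j \<in> V" "i \<noteq> j" for i j
    using that V0 by (auto simp: insert_commute)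
  have AB: ?thesis if ij: "i \<in> V" "j \<in> V" "i \<noteq> j" "lk u i > 0" "lk u j > 0" "lk v i > 0" "lk v j > 0" for i j
  proof -
    obtain k where k: "V = {i, j, k}" "distinct [i, j, k]" using third[OF ij(1-3)] by auto
    obtain a0 where a0: "a0 \<in> lsupp V F" "lk a0 j = 0" using face[OF ij(2)] by auto
    show ?thesis unfolding k(1)
      by (rule ternary_two_clean_edges[OF k(2) d h[unfolded k(1)] U[unfolded k(1)] uv[unfolded k(1)] _ _ _ _ a0[unfolded k(1)]])
        (use ij in auto)
  qed
  have C: ?thesis if ij: "i \<in> V" "j \<in> V" "i \<noteq> j" "lk u i > 0" "lk u j > 0" "lk v j = 0" for i j
  proof -
    obtain k where k: "V = {i, j, k}" "distinct [i, j, k]" using third[OF ij(1-3)] by auto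
    obtain p q where pq: "p \<in> V" "q \<in> V" "p \<noteq> q" "lk v p > 0" "lk v q > 0" using nonpureE[OF np(2) uv(2)] .
    have vp: "lk v i > 0" "lk v k > 0" using pq ij k by auto
    show ?thesis
    proof (cases "lk u k = 0")
      case True
      obtain a0 where a0: "a0 \<in> lsupp V F" "lk a0 i = 0" using face[OF ij(1)] by auto
      have False
        by (rule ternary_one_clean_edge[OF k(2) d h[unfolded k(1)] U[unfolded k(1)] uv[unfolded k(1)] _ _ _ _ _ _ a0[unfolded k(1)]])
          (use ij vp True in auto)
      then show ?thesis ..
    next
      case False
      show ?thesis by (rule AB[of i k]) (use k vp ij False in auto)
    qed
  qed
  obtain i j where ij: "i \<in> V" "j \<in> V" "i \<noteq> j" "lk u i > 0" "lk u j > 0" using nonpureE[OF np(1) uv(1)] .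
  show ?thesis
  proof (cases "lk v j = 0")
    case True then show ?thesis by (rule C[OF ij])
  next
    case vj: False
    show ?thesis
    proof (cases "lk v i = 0")
      case True then show ?thesis using C[of j i] ij by simp
    next
      case False then show ?thesis using AB[of i j] ij vj by simp
    qed
  qed
qed

text \<open>If a variable divides \<open>F\<close>, at most one product monomial is pure and the
  count of all product monomials suffices. If none does, every restriction is nonzero and obeys the
  bound for \<open>n - 1\<close>; from \<open>n = 3\<close> on, the incidence count then makes the
  inequality strict, so equality without a common variable is left to
  \<open>ternary_case\<close>.\<close>

theorem mixed_lower_bound:
  fixes F :: "('v \<Rightarrow>\<^sub>0 nat) \<Rightarrow> 'k::field_char_0"
  assumes "finite V" "card V = n + 1" "n \<ge> 2" "d \<ge> 4" "homog V (d - 1) F" "F m0 \<noteq> 0"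
  shows "n \<le> card (mixed V F) \<and> (card (mixed V F) = n \<longrightarrow>
    (\<exists>i\<in>V. \<forall>m. F m \<noteq> 0 \<longrightarrow> m = Poly_Mapping.single i (d - 1)) \<or> exc_support V d (mixed V F))"
  using assms
proof (induction n arbitrary: V F m0 rule: less_induct)
  case (less n)
  note V = less.prems(1,2) and n = less.prems(3) and d = less.prems(4) and h = less.prems(5) and F0 = less.prems(6)
  have d1: "d - 1 + 1 = d" using d by simp
  have fin: "finite (lsupp V F)" by (rule finite_lsupp[OF V(1) h])
  have finm: "finite (mixed V F)" using fin by (simp add: mixed_def)
  have Vne: "V \<noteq> {}" using V by auto
  have sub: "lsupp V F \<subseteq> expo V d" using lsupp_subset_expo[OF h] unfolding d1 .
  have ge: "n + 1 \<le> card (lsupp V F)" using card_lsupp_ge[OF V(1) Vne h F0] V(2) by simp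
  show ?case
  proof (cases "\<exists>i\<in>V. \<forall>m. F m \<noteq> 0 \<longrightarrow> lk m i > 0")
    case True
    then obtain i where i: "i \<in> V" "\<forall>m. F m \<noteq> 0 \<longrightarrow> lk m i > 0" by (rule bexE)
    have li: "lk a i > 0" if "a \<in> lsupp V F" for a
      by (rule lmul_divides[of F i V]) (use i(2) that in \<open>auto simp: lsupp_def\<close>)
    \<comment> \<open>All product monomials contain \<open>i\<close>, so the \<open>d\<close>-th
      power of \<open>i\<close> is the only pure one possible.\<close>
    have m1: "lsupp V F - {sg i d} \<subseteq> mixed V F"
    proof
      fix a assume a: "a \<in> lsupp V F - {sg i d}"
      have "\<not> pure a"
      proof
        assume "pure a"
        then obtain j where j: "a = sg j d" using pure_in_expo[of a V d] a sub d by auto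
        then have "j = i" using li[of a] a by (auto simp: lookup_single when_def split: if_splits)
        then show False using a j by simp
      qed
      then show "a \<in> mixed V F" using a by (simp add: mixed_def)
    qed
    have "card (lsupp V F) - 1 \<le> card (lsupp V F - {sg i d})" by (simp add: card_Diff_singleton_if)
    also have "\<dots> \<le> card (mixed V F)" by (rule card_mono[OF finm m1])
    finally have c1: "card (lsupp V F) - 1 \<le> card (mixed V F)" .
    have "(\<forall>m. F m \<noteq> 0 \<longrightarrow> m = sg i (d - 1))" if eq: "card (mixed V F) = n"
    proof -
      have cl: "card (lsupp V F) = card V" using c1 eq ge V(2) by linarith
      have V3: "card V \<ge> 3" using V(2) n by simp
      have one: "m = m0" if "F m \<noteq> 0" for m
        by (rule lsupp_eq_card_imp_monomial[OF V(1) V3 h that cl F0])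
      \<comment> \<open>A second variable dividing the monomial \<open>m0\<close> would divide the
        whole product and leave no pure power in it, hence \<open>n + 1\<close> mixed
        monomials.\<close>
      have div1: "j = i" if j: "j \<in> V" "lk m0 j > 0" for j
      proof (rule ccontr)
        assume ji: "j \<noteq> i"
        have "lk m j > 0" if "F m \<noteq> 0" for m using one[OF that] j by simp
        then have lj: "lk a j > 0" if "a \<in> lsupp V F" for a
          by (rule lmul_divides[of F j V]) (use that in \<open>auto simp: lsupp_def\<close>)
        have "lsupp V F \<subseteq> mixed V F"
        proof
          fix a assume a: "a \<in> lsupp V F"
          have "\<not> pure a" using pure_lookup[of a j i] ji li[OF a] lj[OF a] by auto
          then show "a \<in> mixed V F" using a by (simp add: mixed_def)
        qed
        then have "card (lsupp V F) \<le> card (mixed V F)" by (rule card_mono[OF finm])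
        then show False using eq ge by simp
      qed
      have m0: "m0 \<in> expo V (d - 1)" using h F0 by (simp add: homog_def)
      have m0s: "m0 = sg i (lk m0 i)"
      proof (rule poly_mapping_eqI)
        fix j show "lk m0 j = lk (sg i (lk m0 i)) j"
          using div1[of j] m0 by (cases "j = i") (auto simp: lookup_single when_def expo_def in_keys_iff subset_iff)
      qed
      have "mdeg m0 = d - 1" using m0 by (simp add: expo_def)
      then have "m0 = sg i (d - 1)" using m0s by (metis mdeg_single)
      then show ?thesis using one by auto
    qed
    then show ?thesis using c1 ge i(1) by auto
  next
    case False
    then have nd: "\<not> (\<forall>m. F m \<noteq> 0 \<longrightarrow> lk m i > 0)" if "i \<in> V" for i using that by (rule_tac notI) (erule notE, erule bexI)
    show ?thesis
    proof (cases "n = 2")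
      case True
      then have V3: "card V = 3" using V(2) by simp
      have exc: "exc_support V d (mixed V F)" if "card (mixed V F) \<le> 2"
        by (rule ternary_case[OF V(1) V3 d h nd that])
      moreover have "card U = 2" if "exc_support V d U" for U
        using that by (auto simp: exc_support_def card_insert_if poly_mapping_eq_iff fun_eq_iff lookup_add lookup_single when_def)
      ultimately show ?thesis using True by (cases "card (mixed V F) \<le> 2") auto
    next
      case n3: False
      have "card (mixed V F) > n"
      proof (rule ccontr)
        assume "\<not> card (mixed V F) > n"
        then have le: "card (mixed V F) \<le> n" by simp
        have IH: "n - 1 \<le> card {a \<in> mixed V F. lk a i = 0}" if i: "i \<in> V" for i
        proof -
          from vrestrict_neq_0[OF nd[OF i]] obtain m where m: "vrestrict i F m \<noteq> 0" by (rule exE)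
          have "n - 1 \<le> card (mixed (V - {i}) (vrestrict i F))"
          proof (rule conjunct1[OF less.IH])
            show "homog (V - {i}) (d - 1) (vrestrict i F)" by (rule homog_vrestrict[OF h])
            show "vrestrict i F m \<noteq> 0" by (rule m)
          qed (use n n3 V i d in auto)
          also have "mixed (V - {i}) (vrestrict i F) = {a \<in> mixed V F. lk a i = 0}"
            unfolding mixed_def lsupp_vrestrict[OF V(1) h] by auto
          finally show ?thesis .
        qed
        have split: "card (mixed V F) = card {a \<in> mixed V F. lk a i > 0} + card {a \<in> mixed V F. lk a i = 0}" for i
          using finm by (subst card_Un_disjoint[symmetric]) (auto intro!: arg_cong[where f = card])
        have "card {a \<in> mixed V F. lk a i > 0} \<le> 1 + card (mixed V F) - n" if "i \<in> V" for i
          using split[of i] IH[OF that] n by linarith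
        then have "(\<Sum>i\<in>V. card {a \<in> mixed V F. lk a i > 0}) \<le> (\<Sum>i\<in>V. 1 + card (mixed V F) - n)"
          by (rule sum_mono)
        also have "\<dots> = (n + 1) * (1 + card (mixed V F) - n)" using V(2) by simp
        finally have up: "(\<Sum>i\<in>V. card {a \<in> mixed V F. lk a i > 0}) \<le> (n + 1) * (1 + card (mixed V F) - n)" .
        have "(\<Sum>i\<in>V. card {a \<in> mixed V F. lk a i > 0}) = (\<Sum>i\<in>V. \<Sum>a\<in>mixed V F. if lk a i > 0 then 1 else 0)"
          using finm by (simp add: sum.If_cases Int_def)
        also have "\<dots> = (\<Sum>a\<in>mixed V F. \<Sum>i\<in>V. if lk a i > 0 then 1 else 0)" by (rule sum.swap)
        also have "\<dots> \<ge> (\<Sum>a\<in>mixed V F. 2)"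
        proof (rule sum_mono)
          fix a assume a: "a \<in> mixed V F"
          then have np: "\<not> pure a" "a \<in> expo V d" using sub by (auto simp: mixed_def)
          obtain i j where ij: "i \<in> V" "j \<in> V" "i \<noteq> j" "lk a i > 0" "lk a j > 0" using nonpureE[OF np] .
          have "2 = (\<Sum>i\<in>{i, j}. if lk a i > 0 then 1 else (0::nat))" using ij by simp
          also have "\<dots> \<le> (\<Sum>i\<in>V. if lk a i > 0 then 1 else 0)" by (rule sum_mono2[OF V(1)]) (use ij in auto)
          finally show "2 \<le> (\<Sum>i\<in>V. if lk a i > 0 then 1 else (0::nat))" .
        qed
        finally have lo: "2 * card (mixed V F) \<le> (\<Sum>i\<in>V. card {a \<in> mixed V F. lk a i > 0})" by simp
        obtain i where i: "i \<in> V" using Vne by auto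
        have "n - 1 \<le> card (mixed V F)" using IH[OF i] split[of i] by linarith
        \<comment> \<open>In the first case the upper bound on the incidences is 0, in the second it
          is \<open>n + 1\<close>, which is less than \<open>2 n\<close>.\<close>
        then consider "card (mixed V F) = n - 1" | "card (mixed V F) = n" using le by linarith
        then show False
        proof cases
          case 1
          then have "(n + 1) * (1 + card (mixed V F) - n) = 0" using n by simp
          then show False using lo up 1 n n3 by linarith
        next
          case 2
          then have "(n + 1) * (1 + card (mixed V F) - n) = n + 1" by simp
          then show False using lo up 2 n n3 by linarith
        qed
      qed
      then show ?thesis by simp
    qed
  qed
qed

section \<open>Monomial ideals\<close>

lemma single_Suc_inj [simp]: "Poly_Mapping.single i (Suc k) = Poly_Mapping.single j (Suc k) \<longleftrightarrow> i = j"
  by (metis lookup_single_eq lookup_single_not_eq nat.distinct(1))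

lemma poly_mapping_sum_singles: "f = (\<Sum>m\<in>Poly_Mapping.keys f. Poly_Mapping.single m (Poly_Mapping.lookup f m))"
proof (rule poly_mapping_eqI)
  fix k
  have "lk (\<Sum>m\<in>Poly_Mapping.keys f. sg m (lk f m)) k = (\<Sum>m\<in>Poly_Mapping.keys f. if m = k then lk f m else 0)"
    unfolding lookup_sum by (rule sum.cong) (auto simp: lookup_single when_def)
  then show "lk f k = lk (\<Sum>m\<in>Poly_Mapping.keys f. sg m (lk f m)) k"
    by (simp add: in_keys_iff)
qed

lemma lookup_single_mult:
  fixes f :: "('v, 'k::comm_ring_1) mpoly"
  shows "Poly_Mapping.lookup (Poly_Mapping.single q c * f) (q + m) = c * Poly_Mapping.lookup f m"
proof -
  have "sg q c * f = (\<Sum>b\<in>Poly_Mapping.keys f. sg (q + b) (c * lk f b))"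
    by (subst (1) poly_mapping_sum_singles[of f]) (simp add: sum_distrib_left mult_single)
  then have "lk (sg q c * f) (q + m) = (\<Sum>b\<in>Poly_Mapping.keys f. if b = m then c * lk f b else 0)"
    by (simp add: lookup_sum lookup_single when_def)
  then show ?thesis by (simp add: in_keys_iff)
qed

lemma lookup_single_mult_eq_0:
  fixes f :: "('v, 'k::comm_ring_1) mpoly"
  assumes "\<And>m. a \<noteq> q + m"
  shows "Poly_Mapping.lookup (Poly_Mapping.single q c * f) a = 0"
proof -
  have "sg q c * f = (\<Sum>b\<in>Poly_Mapping.keys f. sg (q + b) (c * lk f b))"
    by (subst (1) poly_mapping_sum_singles[of f]) (simp add: sum_distrib_left mult_single)
  then have "lk (sg q c * f) a = (\<Sum>b\<in>Poly_Mapping.keys f. if q + b = a then c * lk f b else 0)"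
    by (simp add: lookup_sum lookup_single when_def)
  also have "\<dots> = 0" by (rule sum.neutral) (use assms in auto)
  finally show ?thesis .
qed

lemma lookup_Var_mult:
  fixes f :: "('v, 'k::comm_ring_1) mpoly"
  shows "Poly_Mapping.lookup (Poly_Mapping.single (Poly_Mapping.single i 1) c * f) a
    = (if Poly_Mapping.lookup a i > 0 then c * Poly_Mapping.lookup f (a - Poly_Mapping.single i 1) else 0)"
proof (cases "lk a i > 0")
  case True
  have eq: "sg i 1 + (a - sg i 1) = a" using minus_single_add[OF True] by (simp only: add.commute)
  show ?thesis using lookup_single_mult[of "sg i 1" c f "a - sg i 1"] True unfolding eq by simp
next
  case False
  have "lk (sg (sg i 1) c * f) a = 0"
    by (rule lookup_single_mult_eq_0) (use False in \<open>auto simp: lookup_add\<close>)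
  then show ?thesis using False by simp
qed

lemma keys_mult_subset: "(m :: 'v \<Rightarrow>\<^sub>0 nat) \<in> Poly_Mapping.keys (f * g :: ('v, 'k::comm_ring_1) mpoly) \<Longrightarrow>
    \<exists>a\<in>Poly_Mapping.keys f. \<exists>b\<in>Poly_Mapping.keys g. m = a + b"
  using subsetD[OF Poly_Mapping.keys_mult[of f g]] by blast

lemma carrier_mpoly_ring: "f \<in> carrier (mpoly_ring V) \<longleftrightarrow> (\<forall>m\<in>Poly_Mapping.keys f. Poly_Mapping.keys m \<subseteq> V)"
  by (simp add: mpoly_ring_def)

lemma mpoly_ring_simps [simp]:
  "x \<otimes>\<^bsub>mpoly_ring V\<^esub> y = x * y" "x \<oplus>\<^bsub>mpoly_ring V\<^esub> y = x + y" "\<one>\<^bsub>mpoly_ring V\<^esub> = 1" "\<zero>\<^bsub>mpoly_ring V\<^esub> = 0"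
  by (simp_all add: mpoly_ring_def)

lemma carrier_add: "f \<in> carrier (mpoly_ring V) \<Longrightarrow> g \<in> carrier (mpoly_ring V) \<Longrightarrow> f + g \<in> carrier (mpoly_ring V)"
  using Poly_Mapping.keys_add[of f g] by (auto simp: carrier_mpoly_ring)

lemma carrier_mult: "f \<in> carrier (mpoly_ring V) \<Longrightarrow> g \<in> carrier (mpoly_ring V) \<Longrightarrow> f * g \<in> carrier (mpoly_ring V)"
  unfolding carrier_mpoly_ring by (fastforce dest!: keys_mult_subset simp: keys_add_nat)

lemma keys_minus_subset: "Poly_Mapping.keys (f - g :: 'a \<Rightarrow>\<^sub>0 'k::ab_group_add) \<subseteq> Poly_Mapping.keys f \<union> Poly_Mapping.keys g"
  by (auto simp: in_keys_iff lookup_minus)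

lemma carrier_uminus: "f \<in> carrier (mpoly_ring V) \<Longrightarrow> - f \<in> carrier (mpoly_ring V)"
  by (simp add: carrier_mpoly_ring)

lemma carrier_single: "Poly_Mapping.keys m \<subseteq> V \<Longrightarrow> Poly_Mapping.single m c \<in> carrier (mpoly_ring V)"
  by (auto simp: carrier_mpoly_ring)

lemma cring_mpoly_ring: "cring (mpoly_ring V :: ('v, 'k::comm_ring_1) mpoly ring)"
proof (rule cringI)
  show "abelian_group (mpoly_ring V :: ('v, 'k) mpoly ring)"
  proof (rule abelian_groupI)
    fix x :: "('v, 'k) mpoly" assume x: "x \<in> carrier (mpoly_ring V)"
    show "\<exists>y\<in>carrier (mpoly_ring V). y \<oplus>\<^bsub>mpoly_ring V\<^esub> x = \<zero>\<^bsub>mpoly_ring V\<^esub>"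
      by (rule bexI[of _ "- x"]) (use carrier_uminus[OF x] in auto)
  qed (auto simp: carrier_add ac_simps carrier_mpoly_ring[of 0])
  show "comm_monoid (mpoly_ring V :: ('v, 'k) mpoly ring)"
    by (rule comm_monoidI) (auto simp: carrier_mult ac_simps carrier_mpoly_ring[of 1])
qed (auto simp: algebra_simps)

lemma mpoly_ring_uminus: "x \<in> carrier (mpoly_ring V) \<Longrightarrow> \<ominus>\<^bsub>mpoly_ring V\<^esub> x = - x"
proof -
  assume x: "x \<in> carrier (mpoly_ring V)"
  interpret cring "mpoly_ring V :: ('a, 'b) mpoly ring" by (rule cring_mpoly_ring)
  show ?thesis using minus_equality[of "- x" x] x carrier_uminus[OF x] by simp
qed

lemma forms_iff: "f \<in> forms V t \<longleftrightarrow> Poly_Mapping.keys f \<subseteq> expo V t"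
  by (auto simp: forms_def carrier_mpoly_ring expo_def)

lemma forms_carrier: "f \<in> forms V t \<Longrightarrow> f \<in> carrier (mpoly_ring V)"
  by (simp add: forms_def)

lemma forms_mult: "f \<in> forms V s \<Longrightarrow> g \<in> forms V t \<Longrightarrow> f * g \<in> forms V (s + t)"
  unfolding forms_iff by (fastforce dest!: keys_mult_subset intro: expo_add)

lemma forms_pow: "f \<in> forms V s \<Longrightarrow> f ^ k \<in> forms V (k * s)"
proof (induction k)
  case 0 show ?case by (simp add: forms_iff expo_def)
next
  case (Suc k) then show ?case using forms_mult[of f V s "f ^ k" "k * s"] by simp
qed

lemma forms_power: "f \<in> forms V 1 \<Longrightarrow> f ^ k \<in> forms V k"
  using forms_pow[of f V 1 k] by simp

lemma forms_minus: "f \<in> forms V t \<Longrightarrow> g \<in> forms V t \<Longrightarrow> f - g \<in> forms V t"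
  unfolding forms_iff using keys_minus_subset[of f g] by blast

lemma forms_add: "f \<in> forms V t \<Longrightarrow> g \<in> forms V t \<Longrightarrow> f + g \<in> forms V t"
  unfolding forms_iff using Poly_Mapping.keys_add[of f g] by blast

lemma forms_homog: "f \<in> forms V t \<Longrightarrow> homog V t (Poly_Mapping.lookup f)"
  unfolding forms_iff homog_def by (auto simp: in_keys_iff)

lemma homog_form:
  assumes "finite V" "homog V t F"
  shows "\<exists>f \<in> forms V t. Poly_Mapping.lookup f = F"
proof -
  have "{m. F m \<noteq> 0} \<subseteq> expo V t" using assms(2) by (auto simp: homog_def)
  then have fin: "finite {m. F m \<noteq> 0}" using finite_expo[OF assms(1)] by (rule finite_subset)
  then have l: "lk (Abs_poly_mapping F) = F" by simp
  moreover have "Abs_poly_mapping F \<in> forms V t" using assms(2) unfolding forms_iff homog_def by (auto simp: in_keys_iff l)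
  ultimately show ?thesis by blast
qed

definition monic :: "('v \<Rightarrow>\<^sub>0 nat) \<Rightarrow> ('v, 'k::comm_ring_1) mpoly" where
  "monic m = Poly_Mapping.single m 1"

lemma lookup_monic: "Poly_Mapping.lookup (monic m) a = (if a = m then 1 else 0)"
  by (auto simp: monic_def lookup_single when_def)

lemma keys_monic [simp]: "Poly_Mapping.keys (monic m :: ('v, 'k::comm_ring_1) mpoly) = {m}"
  by (simp add: monic_def)

definition multiples :: "'v set \<Rightarrow> ('v \<Rightarrow>\<^sub>0 nat) set \<Rightarrow> ('v \<Rightarrow>\<^sub>0 nat) set" where
  "multiples V E = {m. Poly_Mapping.keys m \<subseteq> V \<and> (\<exists>e\<in>E. \<exists>q. m = e + q)}"

text \<open>A monomial ideal is described by supports: a polynomial belongs to it iff all its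
  monomials do. Membership thus becomes a statement about exponents.\<close>

definition mon_ideal :: "'v set \<Rightarrow> ('v \<Rightarrow>\<^sub>0 nat) set \<Rightarrow> ('v, 'k::comm_ring_1) mpoly set" where
  "mon_ideal V E = {f. Poly_Mapping.keys f \<subseteq> multiples V E}"

lemma mon_ideal_carrier: "mon_ideal V E \<subseteq> carrier (mpoly_ring V)"
proof
  fix f :: "('a, 'b) mpoly" assume "f \<in> mon_ideal V E"
  then show "f \<in> carrier (mpoly_ring V)" unfolding mon_ideal_def multiples_def carrier_mpoly_ring by blast
qed

lemma mon_ideal_add: "f \<in> mon_ideal V E \<Longrightarrow> g \<in> mon_ideal V E \<Longrightarrow> f + g \<in> mon_ideal V E"
  using Poly_Mapping.keys_add[of f g] by (auto simp: mon_ideal_def)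

lemma mon_ideal_zero: "0 \<in> mon_ideal V E"
  by (simp add: mon_ideal_def)

lemma mon_ideal_mult: "f \<in> carrier (mpoly_ring V) \<Longrightarrow> g \<in> mon_ideal V E \<Longrightarrow> f * g \<in> mon_ideal V E"
  unfolding mon_ideal_def
proof safe
  fix m assume f: "f \<in> carrier (mpoly_ring V)" and g: "Poly_Mapping.keys g \<subseteq> multiples V E"
    and m: "m \<in> Poly_Mapping.keys (f * g)"
  obtain a b where ab: "a \<in> Poly_Mapping.keys f" "b \<in> Poly_Mapping.keys g" "m = a + b" using keys_mult_subset[OF m] by blast
  have "b \<in> multiples V E" using ab(2) g by (rule rev_subsetD)
  then obtain e q where e: "e \<in> E" "b = e + q" "Poly_Mapping.keys b \<subseteq> V" by (auto simp: multiples_def)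
  have "m = e + (a + q)" using ab e by (simp add: ac_simps)
  moreover have "Poly_Mapping.keys m \<subseteq> V" using ab e f by (auto simp: keys_add_nat carrier_mpoly_ring)
  ultimately show "m \<in> multiples V E" using e(1) by (auto simp: multiples_def)
qed

lemma ideal_mpoly_ringI:
  fixes J :: "('v, 'k::comm_ring_1) mpoly set"
  assumes "J \<subseteq> carrier (mpoly_ring V)" "0 \<in> J" "\<And>f g. f \<in> J \<Longrightarrow> g \<in> J \<Longrightarrow> f + g \<in> J"
    "\<And>f g. f \<in> carrier (mpoly_ring V) \<Longrightarrow> g \<in> J \<Longrightarrow> f * g \<in> J"
  shows "ideal J (mpoly_ring V)"
proof -
  interpret cring "mpoly_ring V :: ('v, 'k) mpoly ring" by (rule cring_mpoly_ring)
  have "- f \<in> J" if "f \<in> J" for f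
  proof -
    have "- 1 \<in> carrier (mpoly_ring V :: ('v, 'k) mpoly ring)" by (simp add: carrier_mpoly_ring)
    from assms(4)[OF this that] show ?thesis by simp
  qed
  then have "\<ominus>\<^bsub>mpoly_ring V\<^esub> f \<in> J" if "f \<in> J" for f
    using mpoly_ring_uminus[of f V] that assms(1) by auto
  then have "subgroup J (add_monoid (mpoly_ring V))"
    using assms(1-3) by (intro subgroup.intro) (auto simp: a_inv_def)
  moreover have "a * x \<in> J" if "a \<in> J" "x \<in> carrier (mpoly_ring V)" for a x
    using assms(4)[OF that(2,1)] by (simp only: mult.commute)
  ultimately show ?thesis
    using assms(4) by (intro idealI[OF ring_axioms]) auto
qed

lemma ideal_mon_ideal: "ideal (mon_ideal V E :: ('v, 'k::comm_ring_1) mpoly set) (mpoly_ring V)"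
  by (rule ideal_mpoly_ringI) (auto simp: mon_ideal_add mon_ideal_mult mon_ideal_zero dest: subsetD[OF mon_ideal_carrier])

lemma genideal_monic:
  assumes E: "\<And>e. e \<in> E \<Longrightarrow> Poly_Mapping.keys e \<subseteq> V"
  shows "Idl\<^bsub>mpoly_ring V\<^esub> (monic ` E) = (mon_ideal V E :: ('v, 'k::comm_ring_1) mpoly set)"
proof
  interpret cring "mpoly_ring V :: ('v, 'k) mpoly ring" by (rule cring_mpoly_ring)
  have car: "monic ` E \<subseteq> carrier (mpoly_ring V :: ('v, 'k) mpoly ring)"
    using E by (auto simp: carrier_mpoly_ring)
  have "e \<in> multiples V E" if "e \<in> E" for e
    using E[OF that] that unfolding multiples_def by (auto intro: bexI[of _ e] exI[of _ 0])
  then have "monic ` E \<subseteq> (mon_ideal V E :: ('v, 'k) mpoly set)" by (auto simp: mon_ideal_def)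
  then show "Idl\<^bsub>mpoly_ring V\<^esub> (monic ` E) \<subseteq> (mon_ideal V E :: ('v, 'k) mpoly set)"
    by (rule genideal_minimal[OF ideal_mon_ideal])
  let ?J = "Idl\<^bsub>mpoly_ring V\<^esub> (monic ` E) :: ('v, 'k) mpoly set"
  show "(mon_ideal V E :: ('v, 'k) mpoly set) \<subseteq> ?J"
  proof
    interpret I: ideal ?J "mpoly_ring V :: ('v, 'k) mpoly ring"
      by (rule genideal_ideal[OF car])
    fix f :: "('v, 'k) mpoly" assume "f \<in> mon_ideal V E"
    then have f: "Poly_Mapping.keys f \<subseteq> multiples V E" by (simp add: mon_ideal_def)
    have sing: "sg m c \<in> ?J" if "m \<in> multiples V E" for m and c :: 'k
    proof -
      obtain e q where e: "e \<in> E" "m = e + q" "Poly_Mapping.keys m \<subseteq> V" using \<open>m \<in> multiples V E\<close> by (auto simp: multiples_def)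
      have "sg m c = sg q c \<otimes>\<^bsub>mpoly_ring V\<^esub> monic e" by (simp add: monic_def mult_single e(2) add.commute)
      moreover have "sg q c \<in> carrier (mpoly_ring V)" using e by (auto simp: carrier_mpoly_ring keys_add_nat)
      moreover have "monic e \<in> ?J" by (rule subsetD[OF genideal_self[OF car] imageI[OF e(1)]])
      ultimately show ?thesis using I.I_l_closed by simp
    qed
    have "(\<Sum>m\<in>S. sg m (lk f m)) \<in> ?J" if "finite S" "S \<subseteq> multiples V E" for S
      using that
    proof (induction S rule: finite_induct)
      case empty show ?case using I.zero_closed by simp
    next
      case (insert m S)
      then have "sg m (lk f m) \<oplus>\<^bsub>mpoly_ring V\<^esub> (\<Sum>m\<in>S. sg m (lk f m)) \<in> ?J"
        by (intro I.a_closed sing) auto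
      then show ?case using insert by simp
    qed
    from this[OF finite_keys f] show "f \<in> ?J"
      using poly_mapping_sum_singles[of f] by simp
  qed
qed

text \<open>The generators all have degree \<open>d\<close>, so a multiple of degree
  \<open>d\<close> has cofactor 1.\<close>

lemma multiples_same_degree:
  assumes "E \<subseteq> expo V d" shows "multiples V E \<inter> expo V d = E"
proof safe
  fix m assume m: "m \<in> multiples V E" "m \<in> expo V d"
  then obtain e q where e: "e \<in> E" "m = e + q" by (auto simp: multiples_def)
  then have "mdeg q = 0" using m assms by (auto simp: expo_def mdeg_add)
  then show "m \<in> E" using e by (simp add: mdeg_eq_0_iff)
next
  fix m assume m: "m \<in> E"
  then show "m \<in> expo V d" using assms by auto
  then show "m \<in> multiples V E" using m unfolding multiples_def expo_def by (auto intro: bexI[of _ m] exI[of _ 0])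
qed

lemma multiples_degree_ge: "E \<subseteq> expo V d \<Longrightarrow> m \<in> multiples V E \<Longrightarrow> mdeg m \<ge> d"
  by (auto simp: multiples_def mdeg_add expo_def)

lemma form_in_mon_ideal:
  assumes "E \<subseteq> expo V d" "f \<in> forms V d"
  shows "f \<in> mon_ideal V E \<longleftrightarrow> Poly_Mapping.keys f \<subseteq> E"
  using multiples_same_degree[OF assms(1)] assms(2) unfolding mon_ideal_def forms_iff by blast

lemma low_form_in_mon_ideal:
  assumes "E \<subseteq> expo V d" "f \<in> forms V t" "t < d" "f \<in> mon_ideal V E"
  shows "f = 0"
proof -
  have "Poly_Mapping.keys f = {}"
    using assms multiples_degree_ge[OF assms(1)] unfolding mon_ideal_def forms_iff expo_def by fastforce
  then show ?thesis by simp
qed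

section \<open>The quotient by a monomial ideal\<close>

lemma coset_eq_iff:
  fixes I :: "('v, 'k::comm_ring_1) mpoly set"
  assumes I: "ideal I (mpoly_ring V)" and fg: "f \<in> carrier (mpoly_ring V)" "g \<in> carrier (mpoly_ring V)"
  shows "I +>\<^bsub>mpoly_ring V\<^esub> f = I +>\<^bsub>mpoly_ring V\<^esub> g \<longleftrightarrow> f - g \<in> I"
proof -
  interpret cring "mpoly_ring V :: ('v, 'k) mpoly ring" by (rule cring_mpoly_ring)
  have "f \<ominus>\<^bsub>mpoly_ring V\<^esub> g = f - g" using mpoly_ring_uminus[OF fg(2)] by (simp add: a_minus_def)
  then show ?thesis using quotient_eq_iff_same_a_r_cos[OF I fg] by simp
qed

lemma mult_map_coset:
  fixes I :: "(nat, 'k::comm_ring_1) mpoly set"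
  assumes I: "ideal I (polyR n)" and fg: "L \<in> carrier (polyR n)" "f \<in> carrier (polyR n)"
  shows "mult_map n I L (I +>\<^bsub>polyR n\<^esub> f) = I +>\<^bsub>polyR n\<^esub> (L * f)"
  using ideal.rcoset_mult_add[OF I fg] by (simp add: mult_map_def FactRing_def)

text \<open>The map is additive on residue classes, so injectivity is a condition on its kernel;
  this removes the cosets from the question.\<close>

lemma mult_map_inj_iff:
  fixes I :: "(nat, 'k::comm_ring_1) mpoly set"
  assumes I: "ideal I (polyR n)" and L: "L \<in> carrier (polyR n)"
  shows "inj_on (mult_map n I L) (quot_comp n I t) \<longleftrightarrow> (\<forall>f\<in>forms {..n} t. L * f \<in> I \<longrightarrow> f \<in> I)"
proof -
  have eq: "mult_map n I L (I +>\<^bsub>polyR n\<^esub> f) = mult_map n I L (I +>\<^bsub>polyR n\<^esub> g) \<longleftrightarrow> L * (f - g) \<in> I"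
    if "f \<in> forms {..n} t" "g \<in> forms {..n} t" for f g
    unfolding mult_map_coset[OF I L forms_carrier[OF that(1)]] mult_map_coset[OF I L forms_carrier[OF that(2)]]
    by (subst coset_eq_iff[OF I carrier_mult[OF L forms_carrier[OF that(1)]] carrier_mult[OF L forms_carrier[OF that(2)]]])
      (simp add: algebra_simps)
  have eq': "I +>\<^bsub>polyR n\<^esub> f = I +>\<^bsub>polyR n\<^esub> g \<longleftrightarrow> f - g \<in> I"
    if "f \<in> forms {..n} t" "g \<in> forms {..n} t" for f g
    by (rule coset_eq_iff[OF I forms_carrier[OF that(1)] forms_carrier[OF that(2)]])
  have z: "(0 :: (nat, 'k) mpoly) \<in> forms {..n} t" by (simp add: forms_iff)
  show ?thesis
  proof
    assume inj: "inj_on (mult_map n I L) (quot_comp n I t)"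
    show "\<forall>f\<in>forms {..n} t. L * f \<in> I \<longrightarrow> f \<in> I"
    proof (intro ballI impI)
      fix f assume f: "f \<in> forms {..n} t" "L * f \<in> I"
      have "mult_map n I L (I +>\<^bsub>polyR n\<^esub> f) = mult_map n I L (I +>\<^bsub>polyR n\<^esub> 0)"
        unfolding eq[OF f(1) z] using f(2) by simp
      then have "I +>\<^bsub>polyR n\<^esub> f = I +>\<^bsub>polyR n\<^esub> 0"
        by (rule inj_onD[OF inj]) (unfold quot_comp_def, rule imageI[OF f(1)], rule imageI[OF z])
      then show "f \<in> I" unfolding eq'[OF f(1) z] by simp
    qed
  next
    assume R: "\<forall>f\<in>forms {..n} t. L * f \<in> I \<longrightarrow> f \<in> I"
    show "inj_on (mult_map n I L) (quot_comp n I t)"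
      unfolding quot_comp_def
    proof (rule inj_onI, elim imageE)
      fix x y f g
      assume fg: "mult_map n I L x = mult_map n I L y" "x = I +>\<^bsub>polyR n\<^esub> f" "y = I +>\<^bsub>polyR n\<^esub> g"
        "f \<in> forms {..n} t" "g \<in> forms {..n} t"
      have "L * (f - g) \<in> I" using fg(1) unfolding fg(2,3) eq[OF fg(4,5)] .
      then have "f - g \<in> I" using R forms_minus[OF fg(4,5)] by blast
      then show "x = y" unfolding fg(2,3) eq'[OF fg(4,5)] .
    qed
  qed
qed

lemma mult_map_surjD:
  fixes I :: "(nat, 'k::comm_ring_1) mpoly set"
  assumes I: "ideal I (polyR n)" and L: "L \<in> forms {..n} 1"
    and surj: "mult_map n I L ` quot_comp n I t = quot_comp n I (t + 1)" and g: "g \<in> forms {..n} (t + 1)"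
  shows "\<exists>f\<in>forms {..n} t. g - L * f \<in> I"
proof -
  have "I +>\<^bsub>polyR n\<^esub> g \<in> mult_map n I L ` quot_comp n I t" unfolding surj unfolding quot_comp_def by (rule imageI[OF g])
  then obtain f where f: "f \<in> forms {..n} t" "I +>\<^bsub>polyR n\<^esub> g = mult_map n I L (I +>\<^bsub>polyR n\<^esub> f)"
    unfolding quot_comp_def by auto
  have "I +>\<^bsub>polyR n\<^esub> g = I +>\<^bsub>polyR n\<^esub> (L * f)"
    unfolding f(2) by (rule mult_map_coset[OF I forms_carrier[OF L] forms_carrier[OF f(1)]])
  then have "g - L * f \<in> I"
    by (subst (asm) coset_eq_iff[OF I forms_carrier[OF g] carrier_mult[OF forms_carrier[OF L] forms_carrier[OF f(1)]]])
  then show ?thesis using f(1) by blast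
qed

section \<open>The weak Lefschetz property for monomial ideals\<close>

text \<open>Gaussian elimination: each induction step removes one equation together with one
  unknown, or an equation all of whose coefficients vanish.\<close>

lemma homogeneous_system_solution:
  fixes a :: "'e \<Rightarrow> 'u \<Rightarrow> 'k::field"
  assumes "finite E"
  shows "finite U \<Longrightarrow> card E < card U \<Longrightarrow> \<exists>x. (\<exists>u\<in>U. x u \<noteq> 0) \<and> (\<forall>e\<in>E. (\<Sum>u\<in>U. a e u * x u) = 0)"
  using assms
proof (induction E arbitrary: U a rule: finite_induct)
  case empty
  then obtain u where "u \<in> U" by fastforce
  then show ?case by (intro exI[of _ "\<lambda>_. 1"]) auto
next
  case (insert e E)
  show ?case
  proof (cases "\<forall>u\<in>U. a e u = 0")
    case True
    have "card E < card U" using insert by simp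
    from insert.IH[OF insert.prems(1) this, of a] obtain x where x: "\<exists>u\<in>U. x u \<noteq> 0" "\<forall>e\<in>E. (\<Sum>u\<in>U. a e u * x u) = 0"
      by blast
    have "(\<Sum>u\<in>U. a e u * x u) = 0" by (rule sum.neutral) (use True in simp)
    then show ?thesis using x by (intro exI[of _ x]) simp
  next
    case False
    then obtain u0 where u0: "u0 \<in> U" "a e u0 \<noteq> 0" by blast
    \<comment> \<open>The column of \<open>u0\<close> is used to eliminate the equation
      \<open>e\<close>; the value at \<open>u0\<close> is recovered in \<open>y\<close>.\<close>
    define b where "b f u = a f u - a f u0 * (a e u / a e u0)" for f u
    have "card E < card (U - {u0})" using insert u0 by simp
    from insert.IH[OF _ this, of b] insert.prems(1) obtain x
      where x: "\<exists>u\<in>U - {u0}. x u \<noteq> 0" "\<forall>f\<in>E. (\<Sum>u\<in>U - {u0}. b f u * x u) = 0" by blast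
    define s where "s = (\<Sum>u\<in>U - {u0}. (a e u / a e u0) * x u)"
    define y where "y = x(u0 := - s)"
    have split: "(\<Sum>u\<in>U. a f u * y u) = (\<Sum>u\<in>U - {u0}. a f u * x u) - a f u0 * s" for f
    proof -
      have "(\<Sum>u\<in>U. a f u * y u) = a f u0 * y u0 + (\<Sum>u\<in>U - {u0}. a f u * y u)"
        by (rule sum.remove[OF insert.prems(1) u0(1)])
      also have "(\<Sum>u\<in>U - {u0}. a f u * y u) = (\<Sum>u\<in>U - {u0}. a f u * x u)"
        by (rule sum.cong) (auto simp: y_def)
      finally show ?thesis by (simp add: y_def)
    qed
    have "(\<Sum>u\<in>U. a f u * y u) = 0" if "f \<in> E" for f
    proof -
      have "(\<Sum>u\<in>U - {u0}. b f u * x u) = (\<Sum>u\<in>U - {u0}. a f u * x u) - a f u0 * s"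
        unfolding b_def s_def sum_distrib_left sum_subtractf[symmetric] by (rule sum.cong) (auto simp: algebra_simps)
      then show ?thesis using x(2) that unfolding split by simp
    qed
    moreover have "(\<Sum>u\<in>U. a e u * y u) = 0"
    proof -
      have "a e u0 * s = (\<Sum>u\<in>U - {u0}. a e u * x u)"
        unfolding s_def sum_distrib_left using u0(2) by (intro sum.cong) auto
      then show ?thesis unfolding split by simp
    qed
    moreover have "\<exists>u\<in>U. y u \<noteq> 0" using x(1) by (auto simp: y_def)
    ultimately show ?thesis by (intro exI[of _ y]) simp
  qed
qed

text \<open>The relation \<open>x\<close> between the columns makes the equation of the column
  \<open>b0\<close> a consequence of the others, so for the left kernel there are fewer equations
  than unknowns.\<close>

lemma left_kernel_from_right_kernel:
  fixes c :: "'a \<Rightarrow> 'b \<Rightarrow> 'k::field"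
  assumes A: "finite A" and B: "finite B" and card: "card B \<le> card A"
    and x: "b0 \<in> B" "x b0 \<noteq> 0" "\<And>a. a \<in> A \<Longrightarrow> (\<Sum>b\<in>B. c a b * x b) = 0"
  shows "\<exists>y. (\<exists>a\<in>A. y a \<noteq> 0) \<and> (\<forall>b\<in>B. (\<Sum>a\<in>A. c a b * y a) = 0)"
proof -
  have "card (B - {b0}) < card B" by (rule card_Diff1_less[OF B x(1)])
  then have "card (B - {b0}) < card A" using card by simp
  from homogeneous_system_solution[OF _ A this, of "\<lambda>b a. c a b"] B
  obtain y where y: "\<exists>a\<in>A. y a \<noteq> 0" "\<forall>b\<in>B - {b0}. (\<Sum>a\<in>A. c a b * y a) = 0" by blast
  have "0 = (\<Sum>a\<in>A. y a * (\<Sum>b\<in>B. c a b * x b))" using x(3) by simp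
  also have "\<dots> = (\<Sum>b\<in>B. x b * (\<Sum>a\<in>A. c a b * y a))"
    unfolding sum_distrib_left by (subst sum.swap) (simp add: mult_ac)
  also have "\<dots> = x b0 * (\<Sum>a\<in>A. c a b0 * y a) + (\<Sum>b\<in>B - {b0}. x b * (\<Sum>a\<in>A. c a b * y a))"
    by (rule sum.remove[OF B x(1)])
  also have "(\<Sum>b\<in>B - {b0}. x b * (\<Sum>a\<in>A. c a b * y a)) = 0" using y(2) by simp
  finally have "(\<Sum>a\<in>A. c a b0 * y a) = 0" using x(2) by simp
  then show ?thesis using y by (intro exI[of _ y]) auto
qed

lemma nonroot_exists:
  fixes p :: "'k::field_char_0 poly" assumes "p \<noteq> 0" shows "\<exists>t. t \<noteq> 0 \<and> poly p t \<noteq> 0"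
proof -
  have "p * [:0, 1:] \<noteq> 0" using assms by simp
  then have "finite {t. poly (p * [:0, 1:]) t = 0}" by (rule poly_roots_finite)
  then have "\<exists>t. t \<notin> {t. poly (p * [:0, 1:]) t = 0}" by (rule ex_new_if_finite[OF infinite_UNIV_char_0])
  then show ?thesis by auto
qed

text \<open>A nonzero polynomial is nonzero at some point of the torus. Induction on the variables;
  the first hypothesis on \<open>S\<close> keeps exponents distinct when only their values on
  \<open>V\<close> are looked at.\<close>

lemma nonvanishing_point_aux:
  fixes c :: "('v \<Rightarrow> nat) \<Rightarrow> 'k::field_char_0"
  assumes "finite V"
  shows "finite S \<Longrightarrow> (\<And>m m'. m \<in> S \<Longrightarrow> m' \<in> S \<Longrightarrow> (\<And>v. v \<in> V \<Longrightarrow> m v = m' v) \<Longrightarrow> m = m') \<Longrightarrow> m0 \<in> S \<Longrightarrow> c m0 \<noteq> 0 \<Longrightarrow>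
     \<exists>p. (\<forall>v. p v \<noteq> 0) \<and> (\<Sum>m\<in>S. c m * (\<Prod>v\<in>V. p v ^ m v)) \<noteq> 0"
  using assms
proof (induction V arbitrary: S m0 rule: finite_induct)
  case empty
  have "S = {m0}" using empty.prems by auto
  then show ?case using empty.prems by (intro exI[of _ "\<lambda>_. 1"]) simp
next
  case (insert w V)
  define T where "T k = {m \<in> S. m w = k}" for k
  have finT: "finite (T k)" for k using insert.prems(1) by (simp add: T_def)
  have injT: "m = m'" if "m \<in> T (m0 w)" "m' \<in> T (m0 w)" "\<And>v. v \<in> V \<Longrightarrow> m v = m' v" for m m'
    using that by (intro insert.prems(2)) (auto simp: T_def)
  have m0T: "m0 \<in> T (m0 w)" using insert.prems(3) by (simp add: T_def)
  obtain p where p: "\<forall>v. p v \<noteq> 0" "(\<Sum>m\<in>T (m0 w). c m * (\<Prod>v\<in>V. p v ^ m v)) \<noteq> 0"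
    using insert.IH[OF finT injT m0T insert.prems(4)] by blast
  \<comment> \<open>The polynomial in the new variable \<open>w\<close> after the others have been
    specialised; its coefficient at \<open>m0 w\<close> is nonzero by the induction
    hypothesis.\<close>
  define q where "q = (\<Sum>m\<in>S. monom (c m * (\<Prod>v\<in>V. p v ^ m v)) (m w))"
  have "coeff q (m0 w) = (\<Sum>m\<in>S. if m w = m0 w then c m * (\<Prod>v\<in>V. p v ^ m v) else 0)"
    unfolding q_def coeff_sum coeff_monom by (rule sum.cong) auto
  also have "\<dots> = (\<Sum>m\<in>T (m0 w). c m * (\<Prod>v\<in>V. p v ^ m v))"
    unfolding T_def by (rule sum.inter_filter[OF insert.prems(1), symmetric])
  finally have "coeff q (m0 w) \<noteq> 0" using p(2) by simp
  then have "q \<noteq> 0" by auto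
  then obtain t where t: "t \<noteq> 0" "poly q t \<noteq> 0" using nonroot_exists by blast
  have "(\<Prod>v\<in>insert w V. (p(w := t)) v ^ m v) = t ^ m w * (\<Prod>v\<in>V. p v ^ m v)" for m :: "'v \<Rightarrow> nat"
  proof -
    have "(\<Prod>v\<in>V. (p(w := t)) v ^ m v) = (\<Prod>v\<in>V. p v ^ m v)"
      by (rule prod.cong) (use insert.hyps in auto)
    then show ?thesis using insert.hyps by simp
  qed
  then have "(\<Sum>m\<in>S. c m * (\<Prod>v\<in>insert w V. (p(w := t)) v ^ m v)) = poly q t"
    unfolding q_def poly_sum poly_monom by (intro sum.cong) auto
  then show ?case using t p(1) by (intro exI[of _ "p(w := t)"]) auto
qed

lemma mon_eval_eq: "finite V \<Longrightarrow> Poly_Mapping.keys m \<subseteq> V \<Longrightarrow> mon_eval m p = (\<Prod>v\<in>V. p v ^ Poly_Mapping.lookup m v)"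
  unfolding mon_eval_def by (rule prod.mono_neutral_left) (auto simp: in_keys_iff)

lemma mpoly_nonvanishing_point:
  fixes g :: "('v, 'k::field_char_0) mpoly"
  assumes "finite V" "g \<in> carrier (mpoly_ring V)" "g \<noteq> 0"
  shows "\<exists>p. (\<forall>v. p v \<noteq> 0) \<and> mpoly_eval g p \<noteq> 0"
proof -
  have kV: "Poly_Mapping.keys m \<subseteq> V" if "m \<in> Poly_Mapping.keys g" for m using that assms(2) by (simp add: carrier_mpoly_ring)
  have "Poly_Mapping.keys g \<noteq> {}" using assms(3) by simp
  then obtain m0 where m0: "m0 \<in> Poly_Mapping.keys g" by blast
  define c where "c m = lk g (Abs_poly_mapping m)" for m :: "'v \<Rightarrow> nat"
  have inj: "inj_on lk (Poly_Mapping.keys g)" by (rule inj_onI) (rule poly_mapping_eqI, simp)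
  have ex: "\<exists>p. (\<forall>v. p v \<noteq> 0) \<and> (\<Sum>m\<in>lk ` Poly_Mapping.keys g. c m * (\<Prod>v\<in>V. p v ^ m v)) \<noteq> 0"
  proof (rule nonvanishing_point_aux[OF assms(1)])
    show "lk m0 \<in> lk ` Poly_Mapping.keys g" using m0 by simp
    show "c (lk m0) \<noteq> 0" using m0 by (simp add: c_def in_keys_iff)
    fix m m' assume mm: "m \<in> lk ` Poly_Mapping.keys g" "m' \<in> lk ` Poly_Mapping.keys g" "\<And>v. v \<in> V \<Longrightarrow> m v = m' v"
    obtain a b where ab: "a \<in> Poly_Mapping.keys g" "b \<in> Poly_Mapping.keys g" "m = lk a" "m' = lk b" using mm(1,2) by auto
    show "m = m'"
    proof
      fix v show "m v = m' v"
      proof (cases "v \<in> V")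
        case True then show ?thesis by (rule mm(3))
      next
        case False
        have "v \<notin> Poly_Mapping.keys a" "v \<notin> Poly_Mapping.keys b" using False kV[OF ab(1)] kV[OF ab(2)] by blast+
        then show ?thesis by (simp add: ab(3,4) in_keys_iff)
      qed
    qed
  qed simp
  then obtain p where p: "\<forall>v. p v \<noteq> 0" "(\<Sum>m\<in>lk ` Poly_Mapping.keys g. c m * (\<Prod>v\<in>V. p v ^ m v)) \<noteq> 0" by blast
  have "(\<Sum>m\<in>lk ` Poly_Mapping.keys g. c m * (\<Prod>v\<in>V. p v ^ m v)) = mpoly_eval g p"
    unfolding sum.reindex[OF inj] mpoly_eval_def
    by (rule sum.cong) (auto simp: c_def mon_eval_eq[OF assms(1) kV])
  then show ?thesis using p by auto
qed

lemma mpoly_eval_cong: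
  assumes "g \<in> carrier (mpoly_ring V)" "\<And>v. v \<in> V \<Longrightarrow> p v = q v"
  shows "mpoly_eval g p = mpoly_eval g q"
  unfolding mpoly_eval_def mon_eval_def
  by (intro sum.cong prod.cong refl arg_cong2[where f = "(*)"] arg_cong2[where f = "(^)"])
    (use assms in \<open>auto simp: carrier_mpoly_ring subset_iff\<close>)

lemma card_expo_recursion:
  "card (expo {..<Suc n} (Suc d)) = card (expo {..<Suc n} d) + card (expo {..<n} (Suc d))"
proof -
  have "expo {..<Suc n} (Suc d) = {a \<in> expo {..<Suc n} (Suc d). lk a n > 0} \<union> {a \<in> expo {..<Suc n} (Suc d). lk a n = 0}"
    by auto
  then have "card (expo {..<Suc n} (Suc d)) = card {a \<in> expo {..<Suc n} (Suc d). lk a n > 0} + card {a \<in> expo {..<Suc n} (Suc d). lk a n = 0}"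
    by (subst card_Un_disjoint[symmetric]) (auto simp: finite_expo)
  moreover have "card {a \<in> expo {..<Suc n} (Suc d). lk a n > 0} = card (expo {..<Suc n} d)"
    using bij_betw_same_card[OF bij_betw_expo_shift[of "{..<Suc n}" n d]] by simp
  moreover have "{a \<in> expo {..<Suc n} (Suc d). lk a n = 0} = expo {..<n} (Suc d)"
  proof safe
    fix a assume a: "a \<in> expo {..<Suc n} (Suc d)" "lk a n = 0"
    have "i < n" if "i \<in> Poly_Mapping.keys a" for i
    proof -
      have "i \<noteq> n" using that a(2) by (auto simp: in_keys_iff)
      moreover have "i < Suc n" using that a(1) by (auto simp: expo_def)
      ultimately show ?thesis by simp
    qed
    then show "a \<in> expo {..<n} (Suc d)" using a(1) by (auto simp: expo_def)
  next
    fix a assume a: "a \<in> expo {..<n} (Suc d)"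
    then have "n \<notin> Poly_Mapping.keys a" by (auto simp: expo_def)
    then show "lk a n = 0" by (simp add: in_keys_iff)
    show "a \<in> expo {..<Suc n} (Suc d)" using a by (auto simp: expo_def)
  qed
  ultimately show ?thesis by simp
qed

lemma card_expo: "card (expo {..<Suc n} d) = (n + d) choose n"
proof (induction n arbitrary: d)
  case 0
  show ?case
  proof (induction d)
    case 0
    have "expo {..<Suc 0} 0 = {0}" by (auto simp: expo_def mdeg_eq_0_iff)
    then show ?case by simp
  next
    case (Suc d)
    have "expo {..<0::nat} (Suc d) = {}" by (auto simp: expo_def)
    then show ?case using card_expo_recursion[of 0 d] Suc by simp
  qed
next
  case (Suc n)
  show ?case
  proof (induction d)
    case 0
    have "expo {..<Suc (Suc n)} 0 = {0}" by (auto simp: expo_def mdeg_eq_0_iff)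
    then show ?case by simp
  next
    case (Suc d)
    then show ?case using card_expo_recursion[of "Suc n" d] Suc.IH \<open>\<And>d. card (expo {..<Suc n} d) = n + d choose n\<close> by simp
  qed
qed

text \<open>The binomial coefficient that bounds the number of generators is the difference between
  the dimensions of the forms of degree \<open>d\<close> and \<open>d - 1\<close>.\<close>

lemma card_expo_diff:
  assumes "n \<ge> 1" "d \<ge> 1"
  shows "card (expo {..n} d) = card (expo {..n} (d - 1)) + ((n + d - 1) choose (n - 1))"
proof -
  obtain n' d' where nd: "n = Suc n'" "d = Suc d'" using assms by (metis Suc_le_D One_nat_def)
  show ?thesis using card_expo_recursion[of n d'] card_expo[of n' d] unfolding lessThan_Suc_atMost nd by simp
qed

text \<open>The factor by which the coefficient of \<open>m\<close> changes when each variable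
  \<open>i\<close> is replaced by its multiple by \<open>p i\<close>.\<close>

definition weighted :: "nat \<Rightarrow> (nat \<Rightarrow> 'k::comm_ring_1) \<Rightarrow> (nat \<Rightarrow>\<^sub>0 nat) \<Rightarrow> 'k" where
  "weighted n p m = (\<Prod>i\<le>n. p i ^ Poly_Mapping.lookup m i)"

lemma linear_form_eq:
  assumes "L \<in> forms {..n::nat} 1"
  shows "L = (\<Sum>i\<le>n. Poly_Mapping.single (Poly_Mapping.single i 1) (Poly_Mapping.lookup L (Poly_Mapping.single i 1)))"
proof (rule poly_mapping_eqI)
  fix m
  show "lk L m = lk (\<Sum>i\<le>n. sg (sg i 1) (lk L (sg i 1))) m"
  proof (cases "\<exists>i\<le>n. m = sg i 1")
    case True
    then obtain i where i: "i \<le> n" "m = sg i 1" by auto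
    have "lk (\<Sum>j\<le>n. sg (sg j 1) (lk L (sg j 1))) m = (\<Sum>j\<le>n. if j = i then lk L (sg i 1) else 0)"
      unfolding lookup_sum i(2) by (rule sum.cong) (auto simp: lookup_single when_def)
    then show ?thesis using i by simp
  next
    case False
    have "m \<notin> expo {..n} 1"
    proof
      assume m: "m \<in> expo {..n} 1"
      then have "m \<noteq> 0" by (auto simp: expo_def)
      then obtain i where i: "i \<in> Poly_Mapping.keys m" by (metis all_not_in_conv keys_eq_empty)
      then have e: "m - sg i 1 + sg i 1 = m" by (intro minus_single_add) (simp add: in_keys_iff)
      have "mdeg (m - sg i 1) + 1 = mdeg m" using arg_cong[OF e, of mdeg] by (simp add: mdeg_add)
      then have "mdeg (m - sg i 1) = 0" using m by (simp add: expo_def)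
      then have "m = sg i 1" using e by (simp add: mdeg_eq_0_iff)
      then show False using False i m by (auto simp: expo_def)
    qed
    then have "lk L m = 0" using assms by (auto simp: forms_iff in_keys_iff)
    moreover have "lk (\<Sum>j\<le>n. sg (sg j 1) (lk L (sg j 1))) m = 0"
      unfolding lookup_sum by (rule sum.neutral) (use False in \<open>auto simp: lookup_single when_def\<close>)
    ultimately show ?thesis by simp
  qed
qed

text \<open>Rescaling the variables turns a linear form with nonzero coefficients into \<open>x_0 + \<dots> + x_n\<close>.\<close>

lemma lookup_linear_mult:
  fixes L f :: "(nat, 'k::comm_ring_1) mpoly"
  assumes L: "L \<in> forms {..n} 1" and p: "\<And>i. i \<le> n \<Longrightarrow> p i = Poly_Mapping.lookup L (Poly_Mapping.single i 1)"
    and fG: "\<And>m. Poly_Mapping.lookup f m = weighted n p m * G m"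
  shows "Poly_Mapping.lookup (L * f) a = weighted n p a * lmul {..n} G a"
proof -
  have w: "p i * weighted n p (a - sg i 1) = weighted n p a" if "i \<le> n" "lk a i > 0" for i
  proof -
    have "a = (a - sg i 1) + sg i 1" by (rule minus_single_add[OF that(2), symmetric])
    then have "weighted n p a = weighted n p ((a - sg i 1) + sg i 1)" by (rule arg_cong)
    also have "\<dots> = (\<Prod>j\<le>n. p j ^ lk (a - sg i 1) j * (if j = i then p i else 1))"
      unfolding weighted_def by (rule prod.cong) (auto simp: lookup_add lookup_single when_def power_add)
    also have "\<dots> = weighted n p (a - sg i 1) * p i"
      unfolding weighted_def prod.distrib using that by simp
    finally show ?thesis by (simp add: mult.commute)
  qed
  have "L * f = (\<Sum>i\<le>n. sg (sg i 1) (p i) * f)"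
    by (subst linear_form_eq[OF L]) (simp add: sum_distrib_right p)
  then have "lk (L * f) a = (\<Sum>i\<le>n. if lk a i > 0 then p i * lk f (a - sg i 1) else 0)"
    by (simp only: lookup_sum lookup_Var_mult)
  also have "\<dots> = (\<Sum>i\<le>n. weighted n p a * (if lk a i > 0 then G (a - sg i 1) else 0))"
  proof (rule sum.cong[OF refl])
    fix i assume "i \<in> {..n}"
    then have "p i * lk f (a - sg i 1) = weighted n p a * G (a - sg i 1)" if "lk a i > 0"
      using w[of i] that by (simp only: fG mult.assoc[symmetric] atMost_iff)
    then show "(if lk a i > 0 then p i * lk f (a - sg i 1) else 0) = weighted n p a * (if lk a i > 0 then G (a - sg i 1) else 0)"
      by (cases "lk a i > 0") simp_all
  qed
  finally show ?thesis by (simp add: lmul_def sum_distrib_left)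
qed

lemma weighted_nonzero: "(\<And>i. i \<le> n \<Longrightarrow> p i \<noteq> (0::'k::field)) \<Longrightarrow> weighted n p m \<noteq> 0"
  by (simp add: weighted_def)

text \<open>The general linear form may be chosen with all coefficients nonzero. An element of the
  kernel of multiplication by it, rescaled by \<open>weighted\<close>, is the form whose multiple by
  the sum of the variables has support in \<open>E\<close>.\<close>

lemma fails_WLP_imp:
  fixes E :: "(nat \<Rightarrow>\<^sub>0 nat) set"
  assumes d: "d \<ge> 1" and E: "E \<subseteq> expo {..n} d"
    and f: "fails_WLP n (mon_ideal {..n} E :: (nat, 'k::field_char_0) mpoly set) (d - 1)"
  shows "\<exists>G :: (nat \<Rightarrow>\<^sub>0 nat) \<Rightarrow> 'k. homog {..n} (d - 1) G \<and> (\<exists>m. G m \<noteq> 0) \<and> lsupp {..n} G \<subseteq> E"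
proof -
  let ?I = "mon_ideal {..n} E :: (nat, 'k) mpoly set"
  obtain g :: "(nat, 'k) mpoly" where g: "g \<in> carrier (polyR n)" "g \<noteq> 0"
    and gL: "\<And>L. L \<in> forms {..n} 1 \<Longrightarrow> mpoly_eval g (\<lambda>i. lk L (sg i 1)) \<noteq> 0 \<Longrightarrow>
      \<not> inj_on (mult_map n ?I L) (quot_comp n ?I (d - 1))"
    using f unfolding fails_WLP_def general_linear_form_def by blast
  obtain p where p: "\<forall>v. p v \<noteq> 0" "mpoly_eval g p \<noteq> 0"
    using mpoly_nonvanishing_point[OF _ g] by auto
  define F1 where "F1 m = (if \<exists>i\<le>n. m = sg i 1 then p (SOME i. m = sg i (1::nat)) else 0)" for m
  have F1: "F1 (sg i 1) = p i" if "i \<le> n" for i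
  proof -
    have "(SOME j. sg i (1::nat) = sg j 1) = i" by (rule some_equality) auto
    then show ?thesis using that unfolding F1_def by auto
  qed
  have "homog {..n} 1 F1" unfolding homog_def F1_def by (auto simp: expo_single)
  then obtain L where L: "L \<in> forms {..n} 1" "lk L = F1" using homog_form by blast
  have "mpoly_eval g (\<lambda>i. lk L (sg i 1)) = mpoly_eval g p"
    by (rule mpoly_eval_cong[OF g(1)]) (simp only: L(2) F1 atMost_iff)
  then have "\<not> inj_on (mult_map n ?I L) (quot_comp n ?I (d - 1))" using gL[OF L(1)] p(2) by simp
  then obtain h where h: "h \<in> forms {..n} (d - 1)" "L * h \<in> ?I" "h \<notin> ?I"
    unfolding mult_map_inj_iff[OF ideal_mon_ideal forms_carrier[OF L(1)]] by blast
  have pn: "p i \<noteq> 0" for i using p(1) by simp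
  have wn: "weighted n p m \<noteq> 0" for m by (rule weighted_nonzero) (rule pn)
  define G where "G m = lk h m / weighted n p m" for m
  have hG: "lk h m = weighted n p m * G m" for m using wn by (simp add: G_def)
  have lh: "lk (L * h) a = weighted n p a * lmul {..n} G a" for a
    by (rule lookup_linear_mult[OF L(1) _ hG]) (simp only: L(2) F1)
  have "homog {..n} (d - 1) G" using forms_homog[OF h(1)] unfolding homog_def G_def by auto
  moreover have "\<exists>m. G m \<noteq> 0"
  proof -
    have "h \<noteq> 0" using h(3) mon_ideal_zero by metis
    then obtain m where "m \<in> Poly_Mapping.keys h" by (metis all_not_in_conv keys_eq_empty)
    then have "G m \<noteq> 0" using wn by (simp add: G_def in_keys_iff)
    then show ?thesis ..
  qed
  moreover have "lsupp {..n} G \<subseteq> E"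
  proof
    fix a assume "a \<in> lsupp {..n} G"
    then have "a \<in> Poly_Mapping.keys (L * h)" unfolding in_keys_iff lh lsupp_def using wn by simp
    moreover have "L * h \<in> forms {..n} d" using forms_mult[OF L(1) h(1)] d by simp
    ultimately show "a \<in> E" using h(2) form_in_mon_ideal[OF E] by blast
  qed
  ultimately show ?thesis by blast
qed

lemma mon_eval_const_one: "mon_eval (\<Sum>i\<le>n::nat. Poly_Mapping.single i 1) p = (\<Prod>i\<le>n. p i)"
proof -
  let ?m = "\<Sum>i\<le>n::nat. sg i (1::nat)"
  have l: "lk ?m i = (if i \<le> n then 1 else 0)" for i
  proof -
    have "lk ?m i = (\<Sum>j\<le>n. if j = i then 1 else 0)" unfolding lookup_sum by (rule sum.cong) (auto simp: lookup_single when_def)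
    then show ?thesis by simp
  qed
  then have "Poly_Mapping.keys ?m \<subseteq> {..n}" by (auto simp: in_keys_iff split: if_splits)
  then have "mon_eval ?m p = (\<Prod>i\<le>n. p i ^ lk ?m i)" by (intro mon_eval_eq) auto
  also have "\<dots> = (\<Prod>i\<le>n. p i)" by (rule prod.cong) (simp_all only: l atMost_iff if_True power_one_right)
  finally show ?thesis .
qed

text \<open>For every linear form without zero coefficients the rescaled \<open>G\<close>
  contradicts injectivity, since the ideal is zero in degree \<open>d - 1\<close>. The bound on
  \<open>card E\<close> then contradicts surjectivity through
  \<open>left_kernel_from_right_kernel\<close>.\<close>

lemma fails_WLP_I:
  fixes E :: "(nat \<Rightarrow>\<^sub>0 nat) set" and G :: "(nat \<Rightarrow>\<^sub>0 nat) \<Rightarrow> 'k::field_char_0"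
  assumes nd: "n \<ge> 1" "d \<ge> 1" and E: "E \<subseteq> expo {..n} d" and c: "card E \<le> (n + d - 1) choose (n - 1)"
    and G: "homog {..n} (d - 1) G" "G m0 \<noteq> 0" "lsupp {..n} G \<subseteq> E"
  shows "fails_WLP n (mon_ideal {..n} E :: (nat, 'k) mpoly set) (d - 1)"
proof -
  let ?I = "mon_ideal {..n} E :: (nat, 'k) mpoly set"
  \<comment> \<open>The product of all variables; it is nonzero exactly on the coefficient vectors
    without a zero entry.\<close>
  let ?m = "\<Sum>i\<le>n. sg i (1::nat)"
  let ?g = "monic ?m :: (nat, 'k) mpoly"
  have d1: "d - 1 + 1 = d" using nd by simp
  have km: "Poly_Mapping.keys ?m \<subseteq> {..n}"
    using Poly_Mapping.keys_sum[of "\<lambda>i. sg i (1::nat)" "{..n}"] by auto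
  have g: "?g \<in> carrier (polyR n)" using km by (simp add: carrier_mpoly_ring)
  have "lk ?g ?m = 1" by (simp add: lookup_monic)
  then have g0: "?g \<noteq> 0" by (metis lookup_zero zero_neq_one)
  have main: "\<not> inj_on (mult_map n ?I L) (quot_comp n ?I (d - 1)) \<and>
     mult_map n ?I L ` quot_comp n ?I (d - 1) \<noteq> quot_comp n ?I (d - 1 + 1)"
    if L: "L \<in> forms {..n} 1" and nz: "mpoly_eval ?g (\<lambda>i. lk L (sg i 1)) \<noteq> 0" for L
  proof -
    define p where "p i = lk L (sg i 1)" for i
    have "mpoly_eval ?g p = (\<Prod>i\<le>n. p i)"
      unfolding mpoly_eval_def keys_monic using mon_eval_const_one[of n p] by (simp add: lookup_monic)
    then have pn: "p i \<noteq> 0" if "i \<le> n" for i using nz that unfolding p_def by auto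
    have wn: "weighted n p m \<noteq> 0" for m by (rule weighted_nonzero) (rule pn)
    have "homog {..n} (d - 1) (\<lambda>m. weighted n p m * G m)" using G(1) by (auto simp: homog_def)
    then obtain f where f: "f \<in> forms {..n} (d - 1)" "lk f = (\<lambda>m. weighted n p m * G m)" using homog_form by blast
    have lf: "lk (L * f) a = weighted n p a * lmul {..n} G a" for a
      by (rule lookup_linear_mult[OF L]) (simp_all add: p_def f(2))
    have LfE: "Poly_Mapping.keys (L * f) \<subseteq> E"
      using G(3) unfolding lsupp_def by (auto simp: in_keys_iff lf)
    have Lff: "L * f \<in> forms {..n} d" using forms_mult[OF L f(1)] nd by simp
    have LfI: "L * f \<in> ?I" unfolding form_in_mon_ideal[OF E Lff] by (rule LfE)
    have f0: "lk f m0 \<noteq> 0" using f(2) wn G(2) by simp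
    have fI: "f \<notin> ?I"
    proof
      assume "f \<in> ?I"
      then have "f = 0" using nd by (intro low_form_in_mon_ideal[OF E f(1)]) auto
      then show False using f0 by simp
    qed
    have ninj: "\<not> inj_on (mult_map n ?I L) (quot_comp n ?I (d - 1))"
      unfolding mult_map_inj_iff[OF ideal_mon_ideal forms_carrier[OF L]] using f(1) LfI fI by blast
    have "mult_map n ?I L ` quot_comp n ?I (d - 1) \<noteq> quot_comp n ?I (d - 1 + 1)"
    proof
      assume surj: "mult_map n ?I L ` quot_comp n ?I (d - 1) = quot_comp n ?I (d - 1 + 1)"
      define A where "A = expo {..n} d - E"
      define B where "B = expo {..n} (d - 1)"
      \<comment> \<open>The matrix of multiplication by \<open>L\<close>: columns are the monomials
        of degree \<open>d - 1\<close>, rows those of degree \<open>d\<close>, of which only the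
        ones outside \<open>E\<close> survive in the quotient.\<close>
      define C :: "(nat \<Rightarrow>\<^sub>0 nat) \<Rightarrow> (nat \<Rightarrow>\<^sub>0 nat) \<Rightarrow> 'k" where "C a b = (\<Sum>i\<le>n. if lk a i > 0 \<and> b = a - sg i 1 then p i else 0)" for a b
      have fin: "finite A" "finite B" by (simp_all add: A_def B_def finite_expo)
      have finE: "finite E" using E finite_expo[of "{..n}" d] finite_subset by blast
      have "card A = card (expo {..n} d) - card E" unfolding A_def by (rule card_Diff_subset[OF finE E])
      then have cAB: "card B \<le> card A" using card_expo_diff[OF nd] c unfolding B_def by linarith
      have mat: "lk (L * h) a = (\<Sum>b\<in>B. C a b * lk h b)" if h: "h \<in> forms {..n} (d - 1)" for h a
      proof -
        have "L * h = (\<Sum>i\<le>n. sg (sg i 1) (p i) * h)"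
          by (subst linear_form_eq[OF L]) (simp add: sum_distrib_right p_def)
        then have "lk (L * h) a = (\<Sum>i\<le>n. if lk a i > 0 then p i * lk h (a - sg i 1) else 0)"
          by (simp only: lookup_sum lookup_Var_mult)
        also have "\<dots> = (\<Sum>i\<le>n. \<Sum>b\<in>B. if lk a i > 0 \<and> b = a - sg i 1 then p i * lk h b else 0)"
        proof (rule sum.cong[OF refl])
          fix i
          have "(\<Sum>b\<in>B. if b = a - sg i 1 then p i * lk h b else 0) = p i * lk h (a - sg i 1)"
            using h fin(2) by (auto simp: forms_iff B_def in_keys_iff)
          then show "(if lk a i > 0 then p i * lk h (a - sg i 1) else 0)
             = (\<Sum>b\<in>B. if lk a i > 0 \<and> b = a - sg i 1 then p i * lk h b else 0)" by (cases "lk a i > 0") auto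
        qed
        also have "\<dots> = (\<Sum>b\<in>B. \<Sum>i\<le>n. if lk a i > 0 \<and> b = a - sg i 1 then p i * lk h b else 0)" by (rule sum.swap)
        also have "\<dots> = (\<Sum>b\<in>B. C a b * lk h b)"
          unfolding C_def sum_distrib_right by (intro sum.cong refl) auto
        finally show ?thesis .
      qed
      have m0B: "m0 \<in> B" using G(1,2) unfolding B_def homog_def by blast
      have ker: "(\<Sum>b\<in>B. C a b * lk f b) = 0" if "a \<in> A" for a
      proof -
        have "a \<notin> Poly_Mapping.keys (L * f)" using LfE that by (auto simp: A_def)
        then show ?thesis using mat[OF f(1), of a] by (simp add: in_keys_iff)
      qed
      obtain y where y: "\<exists>a\<in>A. y a \<noteq> 0" "\<forall>b\<in>B. (\<Sum>a\<in>A. C a b * y a) = 0"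
        using left_kernel_from_right_kernel[where c = C and x = "lk f", OF fin cAB m0B f0 ker] by blast
      obtain a0 where a0: "a0 \<in> A" "y a0 \<noteq> 0" using y(1) by blast
      have mf: "(monic a0 :: (nat, 'k) mpoly) \<in> forms {..n} (d - 1 + 1)" using a0(1) unfolding forms_iff d1 by (simp add: A_def)
      obtain h where h: "h \<in> forms {..n} (d - 1)" "monic a0 - L * h \<in> ?I"
        using mult_map_surjD[OF ideal_mon_ideal L surj mf] by blast
      have Lh: "L * h \<in> forms {..n} (d - 1 + 1)" using forms_mult[OF L h(1)] nd by simp
      have "monic a0 - L * h \<in> forms {..n} d" using forms_minus[OF mf Lh] unfolding d1 .
      then have "Poly_Mapping.keys (monic a0 - L * h) \<subseteq> E" using h(2) form_in_mon_ideal[OF E] by blast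
      then have eqA: "lk (monic a0 :: (nat, 'k) mpoly) a = lk (L * h) a" if "a \<in> A" for a
        using that by (auto simp: A_def subset_iff in_keys_iff lookup_minus)
      \<comment> \<open>The functional \<open>y\<close> kills the image of the multiplication, while
        surjectivity puts the class of \<open>a0\<close> into this image.\<close>
      have "y a0 = (\<Sum>a\<in>A. y a * lk (monic a0 :: (nat, 'k) mpoly) a)"
        using a0(1) fin(1) by (simp add: lookup_monic if_distrib cong: if_cong)
      also have "\<dots> = (\<Sum>a\<in>A. y a * (\<Sum>b\<in>B. C a b * lk h b))"
        by (rule sum.cong) (simp_all add: eqA mat[OF h(1)])
      also have "\<dots> = (\<Sum>b\<in>B. lk h b * (\<Sum>a\<in>A. C a b * y a))"
        unfolding sum_distrib_left by (subst sum.swap) (simp add: mult_ac)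
      also have "\<dots> = 0" using y(2) by simp
      finally show False using a0(2) by simp
    qed
    then show ?thesis using ninj by blast
  qed
  show ?thesis
    unfolding fails_WLP_def general_linear_form_def
    by (rule bexI[of _ ?g]) (use main g0 g in auto)
qed

section \<open>Artinian quotients and minimal generators\<close>

lemma decreasing_finite_sets_stabilise:
  fixes P :: "nat \<Rightarrow> 'a set"
  assumes dec: "\<And>i. P (Suc i) \<subseteq> P i" and fin: "finite (P 0)"
  shows "\<exists>N. \<forall>i\<ge>N. P i = P N"
proof -
  have mono: "P j \<subseteq> P i" if "i \<le> j" for i j using that dec by (rule lift_Suc_antimono_le[rotated])
  have finP: "finite (P i)" for i using finite_subset[OF mono[of 0 i] fin] by simp
  obtain N where N: "\<And>i. card (P N) \<le> card (P i)" using ex_has_least_nat[of "\<lambda>_. True" 0 "\<lambda>i. card (P i)"] by auto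
  have "P i = P N" if "i \<ge> N" for i using card_seteq[OF finP mono[OF that] N] by simp
  then show ?thesis by blast
qed

text \<open>The set of pivots replaces the dimension in the descending chain argument.\<close>

definition pivots :: "('m \<Rightarrow> nat) \<Rightarrow> ('m \<Rightarrow>\<^sub>0 'k::zero) set \<Rightarrow> nat set" where
  "pivots \<rho> W = (\<lambda>f. Min (\<rho> ` Poly_Mapping.keys f)) ` (W - {0})"

text \<open>The echelon form argument: some \<open>g\<close> in \<open>W'\<close> has the same pivot
  as \<open>f\<close>, and subtracting a multiple of it raises the pivot, which is bounded by
  \<open>N\<close>. Products with \<open>Poly_Mapping.single 0 c\<close> are scalar
  multiples.\<close>

lemma subspace_eq_of_pivots_eq:
  fixes W W' :: "('v, 'k::field) mpoly set"
  assumes \<rho>: "inj_on \<rho> B" "\<rho> ` B \<subseteq> {i. i < N}" and W: "W' \<subseteq> W" "\<And>f. f \<in> W \<Longrightarrow> Poly_Mapping.keys f \<subseteq> B"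
    and cl: "\<And>f g c. f \<in> W \<Longrightarrow> g \<in> W \<Longrightarrow> f - Poly_Mapping.single 0 c * g \<in> W"
    and cl': "0 \<in> W'" "\<And>f g c. f \<in> W' \<Longrightarrow> g \<in> W' \<Longrightarrow> f + Poly_Mapping.single 0 c * g \<in> W'"
    and piv: "pivots \<rho> W \<subseteq> pivots \<rho> W'"
  shows "f \<in> W \<Longrightarrow> f \<in> W'"
proof (induction "N - Min (\<rho> ` Poly_Mapping.keys f)" arbitrary: f rule: less_induct)
  case (less f)
  show ?case
  proof (cases "f = 0")
    case True then show ?thesis using cl' by simp
  next
    case False
    define j where "j = Min (\<rho> ` Poly_Mapping.keys f)"
    have "j \<in> pivots \<rho> W'" using piv less.prems False unfolding pivots_def j_def by blast
    then obtain g where g: "g \<in> W'" "g \<noteq> 0" "j = Min (\<rho> ` Poly_Mapping.keys g)" unfolding pivots_def by auto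
    have gW: "g \<in> W" using g(1) W(1) by blast
    have "j \<in> \<rho> ` Poly_Mapping.keys f" unfolding j_def by (rule Min_in) (use False in simp_all)
    then obtain m where m: "m \<in> Poly_Mapping.keys f" "j = \<rho> m" by blast
    have "j \<in> \<rho> ` Poly_Mapping.keys g" unfolding g(3) by (rule Min_in) (use g in simp_all)
    then obtain m' where m': "m' \<in> Poly_Mapping.keys g" "j = \<rho> m'" by blast
    have "m' = m" using inj_onD[OF \<rho>(1), of m' m] m m' W(2)[OF less.prems] W(2)[OF gW] by auto
    then have mg: "m \<in> Poly_Mapping.keys g" using m' by simp
    define c where "c = lk f m / lk g m"
    define h where "h = f - sg 0 c * g"
    have lh: "lk h a = lk f a - c * lk g a" for a
      using lookup_single_mult[of 0 c g a] by (simp add: h_def lookup_minus)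
    have hW: "h \<in> W" unfolding h_def by (rule cl[OF less.prems gW])
    have hW': "h \<in> W'"
    proof (cases "h = 0")
      case True then show ?thesis using cl' by simp
    next
      case h0: False
      have "j < Min (\<rho> ` Poly_Mapping.keys h)"
      proof -
        have "Min (\<rho> ` Poly_Mapping.keys h) \<in> \<rho> ` Poly_Mapping.keys h" by (rule Min_in) (use h0 in simp_all)
        then obtain a where a: "a \<in> Poly_Mapping.keys h" "Min (\<rho> ` Poly_Mapping.keys h) = \<rho> a" by blast
        have "a \<in> Poly_Mapping.keys f \<or> a \<in> Poly_Mapping.keys g" using a(1) lh[of a] by (auto simp: in_keys_iff)
        then have "j \<le> \<rho> a"
        proof
          assume "a \<in> Poly_Mapping.keys f" then show ?thesis unfolding j_def by (intro Min_le) auto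
        next
          assume "a \<in> Poly_Mapping.keys g" then show ?thesis unfolding g(3) by (intro Min_le) auto
        qed
        moreover have "\<rho> a \<noteq> j"
        proof
          assume "\<rho> a = j"
          then have "a = m" using inj_onD[OF \<rho>(1), of a m] m a W(2)[OF less.prems] W(2)[OF hW] by auto
          then have "lk h a = 0" using mg by (simp add: lh c_def in_keys_iff)
          then show False using a(1) by (simp add: in_keys_iff)
        qed
        ultimately show ?thesis using a(2) by simp
      qed
      moreover have "j < N" using m \<rho>(2) W(2)[OF less.prems] by auto
      ultimately have "N - Min (\<rho> ` Poly_Mapping.keys h) < N - j" by simp
      then show ?thesis using less.hyps[of h] hW unfolding j_def by simp
    qed
    have "f = h + sg 0 c * g" by (simp add: h_def)
    then show ?thesis using cl'(2)[OF hW' g(1)] by simp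
  qed
qed

text \<open>The chain of the ideals generated by \<open>I\<close> and a power \<open>x_i ^ k\<close>
  becomes constant, so some \<open>x_i ^ N\<close> lies in the ideal of \<open>E\<close> and
  \<open>x_i ^ (N + 1)\<close>. Hence an element of \<open>E\<close> divides \<open>x_i ^ N\<close>;
  being of degree \<open>d\<close>, it is \<open>x_i ^ d\<close>.\<close>

lemma artinian_mon_ideal_imp:
  assumes E: "E \<subseteq> expo {..n} d"
    and art: "artinian_ring (polyR n Quot (mon_ideal {..n} E :: (nat, 'k::field) mpoly set))" and i: "i \<le> n"
  shows "Poly_Mapping.single i d \<in> E"
proof -
  let ?I = "mon_ideal {..n} E :: (nat, 'k) mpoly set"
  interpret R: cring "polyR n :: (nat, 'k) mpoly ring" by (rule cring_mpoly_ring)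
  define K :: "nat \<Rightarrow> (nat, 'k) mpoly set" where "K k = mon_ideal {..n} (E \<union> {sg i k})" for k
  define J where "J k = (+>\<^bsub>polyR n\<^esub>) ?I ` K k" for k
  have idJ: "ideal (J k) (polyR n Quot ?I)" for k
    unfolding J_def by (rule R.ring_ideal_imp_quot_ideal[OF ideal_mon_ideal]) (simp add: K_def ideal_mon_ideal)
  have mult: "multiples {..n} (E \<union> {sg i (Suc k)}) \<subseteq> multiples {..n} (E \<union> {sg i k})" for k
  proof
    fix m assume m: "m \<in> multiples {..n} (E \<union> {sg i (Suc k)})"
    then obtain e q where eq: "e \<in> E \<union> {sg i (Suc k)}" "m = e + q" by (auto simp: multiples_def)
    have "\<exists>e\<in>E \<union> {sg i k}. \<exists>q. m = e + q"
    proof (cases "e \<in> E")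
      case True then show ?thesis using eq by auto
    next
      case False
      then have "m = sg i k + (sg i 1 + q)" using eq by (simp add: add.assoc[symmetric] single_add[symmetric])
      then show ?thesis by blast
    qed
    then show "m \<in> multiples {..n} (E \<union> {sg i k})" using m by (simp add: multiples_def)
  qed
  have "K (Suc k) \<subseteq> K k" for k unfolding K_def mon_ideal_def using mult[of k] by blast
  then have "J (Suc k) \<subseteq> J k" for k unfolding J_def by (rule image_mono)
  then obtain N where N: "\<And>j. j \<ge> N \<Longrightarrow> J j = J N" using art idJ unfolding artinian_ring_def by meson
  have k: "Poly_Mapping.keys (sg i N) \<subseteq> {..n}" using i by simp
  have "sg i N \<in> multiples {..n} (E \<union> {sg i N})"
    unfolding multiples_def using k by (auto intro!: bexI[of _ "sg i N"] exI[of _ 0])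
  then have "monic (sg i N) \<in> K N" by (simp add: K_def mon_ideal_def)
  then have "?I +>\<^bsub>polyR n\<^esub> monic (sg i N) \<in> J N" unfolding J_def by (rule imageI)
  then have "?I +>\<^bsub>polyR n\<^esub> monic (sg i N) \<in> J (Suc N)" using N[of "Suc N"] by simp
  then obtain g where g: "g \<in> K (Suc N)" "?I +>\<^bsub>polyR n\<^esub> monic (sg i N) = ?I +>\<^bsub>polyR n\<^esub> g" unfolding J_def by blast
  have gc: "g \<in> carrier (polyR n)" using g(1) mon_ideal_carrier unfolding K_def by blast
  have mc: "(monic (sg i N) :: (nat, 'k) mpoly) \<in> carrier (polyR n)" using i by (simp add: carrier_mpoly_ring)
  have "monic (sg i N) - g \<in> ?I" using g(2) unfolding coset_eq_iff[OF ideal_mon_ideal mc gc] .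
  moreover have "?I \<subseteq> K (Suc N)" unfolding K_def mon_ideal_def multiples_def by blast
  ultimately have "(monic (sg i N) - g) + g \<in> K (Suc N)" using g(1) unfolding K_def by (intro mon_ideal_add) auto
  then have "sg i N \<in> multiples {..n} (E \<union> {sg i (Suc N)})" by (simp add: K_def mon_ideal_def)
  then obtain e q where eq: "e \<in> E \<union> {sg i (Suc N)}" "sg i N = e + q" by (auto simp: multiples_def)
  have "e \<noteq> sg i (Suc N)"
  proof
    assume "e = sg i (Suc N)"
    then have "mdeg (sg i N) = Suc N + mdeg q" using eq(2) by (simp add: mdeg_add)
    then show False by simp
  qed
  then have eE: "e \<in> E" using eq(1) by simp
  have "Poly_Mapping.keys e \<subseteq> Poly_Mapping.keys (sg i N)" unfolding eq(2) by (simp add: keys_add_nat)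
  then have ke: "Poly_Mapping.keys e \<subseteq> {i}" by (rule order_trans) simp
  have "e = sg i (lk e i)"
    by (rule poly_mapping_eqI) (use ke in \<open>auto simp: lookup_single when_def in_keys_iff subset_iff\<close>)
  moreover have "mdeg e = d" using eE E by (auto simp: expo_def)
  ultimately have "e = sg i d" by (metis mdeg_single)
  then show ?thesis using eE by simp
qed

text \<open>Modulo the pure powers every polynomial is represented by one with all exponents below
  \<open>d\<close>. A descending chain of ideals gives a descending chain of subspaces of this
  finite-dimensional space, and it stops when the pivots do.\<close>

lemma artinian_mon_ideal:
  assumes E: "\<And>i. i \<le> n \<Longrightarrow> Poly_Mapping.single i d \<in> E"
  shows "artinian_ring (polyR n Quot (mon_ideal {..n} E :: (nat, 'k::field) mpoly set))"
  unfolding artinian_ring_def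
proof (intro allI impI)
  let ?R = "polyR n :: (nat, 'k) mpoly ring"
  let ?I = "mon_ideal {..n} E :: (nat, 'k) mpoly set"
  fix J :: "nat \<Rightarrow> (nat, 'k) mpoly set set"
  assume J: "(\<forall>i. ideal (J i) (?R Quot ?I)) \<and> (\<forall>i. J (Suc i) \<subseteq> J i)"
  interpret R: cring ?R by (rule cring_mpoly_ring)
  interpret I: ideal ?I ?R by (rule ideal_mon_ideal)
  define B where "B = {m. Poly_Mapping.keys m \<subseteq> {..n} \<and> (\<forall>i\<le>n. lk m i < d)}"
  \<comment> \<open>\<open>U\<close> consists of the preimages of the ideals in the polynomial ring,
    \<open>W\<close> of their elements supported in the box \<open>B\<close>; \<open>W\<close>
    determines the ideal.\<close>
  define U where "U k = {r \<in> carrier ?R. ?I +>\<^bsub>?R\<^esub> r \<in> J k}" for k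
  define W where "W k = {f \<in> U k. Poly_Mapping.keys f \<subseteq> B}" for k
  have idU: "ideal (U k) ?R" for k
    unfolding U_def using J by (intro ring_hom_ring.ideal_vimage[OF I.rcos_ring_hom_ring]) auto
  have UC: "f \<in> carrier ?R" if "f \<in> U k" for f k using that by (simp add: U_def)
  have Uadd: "f + g \<in> U k" if "f \<in> U k" "g \<in> U k" for f g k
    using additive_subgroup.a_closed[OF ideal.axioms(1)[OF idU] that] by simp
  have Umul: "sg 0 c * f \<in> U k" if "f \<in> U k" for f k c
    using ideal.I_l_closed[OF idU that, of "sg 0 c"] by (simp add: carrier_single)
  have U0: "0 \<in> U k" for k using additive_subgroup.zero_closed[OF ideal.axioms(1)[OF idU]] by simp
  have finB: "finite B"
  proof -
    have "finite {f. \<forall>x. (x \<in> {..n} \<longrightarrow> f x \<in> {..<d}) \<and> (x \<notin> {..n} \<longrightarrow> f x = (0::nat))}"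
      by (rule finite_set_of_finite_funs) auto
    moreover have "lk ` B \<subseteq> {f. \<forall>x. (x \<in> {..n} \<longrightarrow> f x \<in> {..<d}) \<and> (x \<notin> {..n} \<longrightarrow> f x = (0::nat))}"
      unfolding B_def by (auto simp: subset_iff in_keys_iff)
    ultimately have "finite (lk ` B)" by (rule finite_subset[rotated])
    then show ?thesis by (rule finite_imageD) (rule inj_onI, rule poly_mapping_eqI, simp)
  qed
  obtain \<rho> :: "(nat \<Rightarrow>\<^sub>0 nat) \<Rightarrow> nat" and N where \<rho>: "\<rho> ` B = {i. i < N}" "inj_on \<rho> B"
    using finite_imp_inj_to_nat_seg[OF finB] by blast
  have Wdec: "W (Suc k) \<subseteq> W k" for k using J unfolding W_def U_def by blast
  have Wmono: "W j \<subseteq> W i" if "i \<le> j" for i j using that Wdec by (rule lift_Suc_antimono_le[rotated])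
  have WB: "Poly_Mapping.keys f \<subseteq> B" if "f \<in> W k" for f k using that by (simp add: W_def)
  have kmul: "Poly_Mapping.keys (sg 0 c * f) \<subseteq> B" if "Poly_Mapping.keys f \<subseteq> B" for f :: "(nat, 'k) mpoly" and c
    using lookup_single_mult[of 0 c f] that by (auto simp: in_keys_iff subset_iff)
  have Wplus: "f + sg 0 c * g \<in> W k" if "f \<in> W k" "g \<in> W k" for f g c k
  proof -
    have "Poly_Mapping.keys (f + sg 0 c * g) \<subseteq> B"
      using Poly_Mapping.keys_add[of f "sg 0 c * g"] kmul[OF WB[OF that(2)], of c] WB[OF that(1)] by blast
    then show ?thesis using Uadd[of f k "sg 0 c * g"] Umul[of g k c] that by (simp add: W_def)
  qed
  have Wminus: "f - sg 0 c * g \<in> W k" if "f \<in> W k" "g \<in> W k" for f g c k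
  proof -
    have "f + sg 0 (- c) * g = f - sg 0 c * g" by (simp add: single_uminus)
    then show ?thesis using Wplus[OF that, of "- c"] by simp
  qed
  have W0: "0 \<in> W k" for k using U0 by (simp add: W_def)
  have pdec: "pivots \<rho> (W (Suc k)) \<subseteq> pivots \<rho> (W k)" for k unfolding pivots_def using Wdec[of k] by blast
  have "pivots \<rho> (W 0) \<subseteq> \<rho> ` B"
  proof
    fix j assume "j \<in> pivots \<rho> (W 0)"
    then obtain f where f: "f \<in> W 0" "f \<noteq> 0" "j = Min (\<rho> ` Poly_Mapping.keys f)" unfolding pivots_def by auto
    have "j \<in> \<rho> ` Poly_Mapping.keys f" unfolding f(3) by (rule Min_in) (use f in simp_all)
    then show "j \<in> \<rho> ` B" using WB[OF f(1)] by blast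
  qed
  then have "finite (pivots \<rho> (W 0))" using finB by (meson finite_imageI finite_subset)
  then obtain K where K: "\<And>i. i \<ge> K \<Longrightarrow> pivots \<rho> (W i) = pivots \<rho> (W K)"
    using decreasing_finite_sets_stabilise[where P = "\<lambda>i. pivots \<rho> (W i)", OF pdec] by blast
  have Weq: "W i = W K" if i: "i \<ge> K" for i
  proof
    show "W i \<subseteq> W K" by (rule Wmono[OF i])
    show "W K \<subseteq> W i"
    proof
      fix f assume f: "f \<in> W K"
      show "f \<in> W i"
        by (rule subspace_eq_of_pivots_eq[where N = N, OF \<rho>(2) _ Wmono[OF i] WB Wminus W0 Wplus _ f]) (simp_all add: \<rho>(1) K[OF i])
    qed
  qed
  have sub: "J i \<subseteq> J j" if W: "W i = W j" for i j
  proof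
    fix X assume X: "X \<in> J i"
    then have "X \<in> carrier (?R Quot ?I)" using ideal.Icarr[of "J i"] J by blast
    then obtain r where r: "r \<in> carrier ?R" "X = ?I +>\<^bsub>?R\<^esub> r" unfolding FactRing_def A_RCOSETS_def' by auto
    \<comment> \<open>The representative of the residue class obtained by deleting the monomials
      outside the box.\<close>
    define r1 where "r1 = Abs_poly_mapping (\<lambda>m. if m \<in> B then lk r m else 0)"
    have l1: "lk r1 = (\<lambda>m. if m \<in> B then lk r m else 0)"
      unfolding r1_def by (rule lookup_Abs_poly_mapping) (rule finite_subset[OF _ finB], auto)
    have k1: "Poly_Mapping.keys r1 \<subseteq> B" by (auto simp: in_keys_iff l1 split: if_splits)
    have r1c: "r1 \<in> carrier ?R" using k1 unfolding carrier_mpoly_ring B_def by blast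
    have "r - r1 \<in> ?I"
      unfolding mon_ideal_def
    proof safe
      fix m assume "m \<in> Poly_Mapping.keys (r - r1)"
      then have m: "m \<in> Poly_Mapping.keys r" "m \<notin> B" by (auto simp: in_keys_iff lookup_minus l1 split: if_splits)
      have km: "Poly_Mapping.keys m \<subseteq> {..n}" using m r(1) by (simp add: carrier_mpoly_ring)
      then obtain j where j: "j \<le> n" "d \<le> lk m j" using m(2) unfolding B_def by (auto simp: not_less)
      have "m = sg j d + (m - sg j d)"
        by (rule poly_mapping_eqI) (use j(2) in \<open>auto simp: lookup_add lookup_minus lookup_single when_def\<close>)
      then show "m \<in> multiples {..n} E" using km E[OF j(1)] unfolding multiples_def by blast
    qed
    then have eq: "?I +>\<^bsub>?R\<^esub> r = ?I +>\<^bsub>?R\<^esub> r1" by (simp add: coset_eq_iff[OF ideal_mon_ideal r(1) r1c])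
    then have "r1 \<in> W i" using X r r1c k1 by (simp add: W_def U_def)
    then have "r1 \<in> W j" unfolding W .
    then show "X \<in> J j" using eq r by (simp add: W_def U_def)
  qed
  show "\<exists>N. \<forall>i\<ge>N. J i = J N"
    using sub Weq by (intro exI[of _ K]) blast
qed

text \<open>Arbitrary, also inhomogeneous, generating sets are allowed. If \<open>G\<close> has
  fewer than \<open>card E\<close> elements, some nonzero functional on the coefficients at
  \<open>E\<close> kills \<open>G\<close>; its kernel inside the ideal is again an ideal, hence
  everything, although it misses a generator.\<close>

lemma min_gens_mon_ideal:
  assumes E: "E \<subseteq> expo {..n} d"
  shows "min_gens n (mon_ideal {..n} E :: (nat, 'k::field) mpoly set) = card E"
  unfolding min_gens_def
proof (rule Least_equality)
  let ?I = "mon_ideal {..n} E :: (nat, 'k) mpoly set"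
  let ?R = "polyR n :: (nat, 'k) mpoly ring"
  interpret R: cring ?R by (rule cring_mpoly_ring)
  have finE: "finite E" using finite_subset[OF E finite_expo] by simp
  have Ek: "Poly_Mapping.keys e \<subseteq> {..n}" if "e \<in> E" for e using that E by (auto simp: expo_def)
  have inj: "inj_on (monic :: _ \<Rightarrow> (nat, 'k) mpoly) E"
  proof (rule inj_onI)
    fix a b assume "monic a = (monic b :: (nat, 'k) mpoly)"
    then have "Poly_Mapping.keys (monic a :: (nat, 'k) mpoly) = Poly_Mapping.keys (monic b :: (nat, 'k) mpoly)" by simp
    then show "a = b" by simp
  qed
  show "\<exists>G\<subseteq>carrier ?R. finite G \<and> card G = card E \<and> ?I = Idl\<^bsub>?R\<^esub> G"
    by (rule exI[of _ "monic ` E"])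
      (use finE card_image[OF inj] genideal_monic[OF Ek] Ek in \<open>auto simp: carrier_mpoly_ring\<close>)
  fix r assume "\<exists>G\<subseteq>carrier ?R. finite G \<and> card G = r \<and> ?I = Idl\<^bsub>?R\<^esub> G"
  then obtain G where G: "G \<subseteq> carrier ?R" "finite G" "card G = r" "?I = Idl\<^bsub>?R\<^esub> G" by blast
  have GI: "G \<subseteq> ?I" unfolding G(4) by (rule R.genideal_self[OF G(1)])
  show "card E \<le> r"
  proof (rule ccontr)
    assume "\<not> card E \<le> r"
    then have "card G < card E" using G(3) by simp
    from homogeneous_system_solution[OF G(2) finE this, of "\<lambda>g e. lk g e"]
    obtain y where y: "\<exists>e\<in>E. y e \<noteq> 0" "\<forall>g\<in>G. (\<Sum>e\<in>E. lk g e * y e) = 0" by blast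
    \<comment> \<open>Elements of the ideal have no monomial of degree below \<open>d\<close>, so in
      degree \<open>d\<close> only the constant term of the cofactor acts.\<close>
    have low: "lk (f * g) e = lk f 0 * lk g e" if g: "g \<in> ?I" and e: "e \<in> E" for f g e
    proof -
      have de: "mdeg e = d" using e E by (auto simp: expo_def)
      have t: "lk (sg q (lk f q) * g) e = (if q = 0 then lk f 0 * lk g e else 0)" for q
      proof (cases "q = 0")
        case True then show ?thesis using lookup_single_mult[of 0 "lk f 0" g e] by simp
      next
        case False
        have "lk (sg q (lk f q) * g) e = 0"
        proof (cases "\<exists>m. e = q + m")
          case True
          then obtain m where m: "e = q + m" by blast
          have "mdeg q > 0" using False by (simp add: mdeg_eq_0_iff[symmetric])
          then have "mdeg m < d" using de m by (simp add: mdeg_add)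
          then have "m \<notin> Poly_Mapping.keys g" using g multiples_degree_ge[OF E, of m] unfolding mon_ideal_def by auto
          then show ?thesis unfolding m lookup_single_mult by (simp add: in_keys_iff)
        next
          case False then show ?thesis by (intro lookup_single_mult_eq_0) auto
        qed
        then show ?thesis using False by simp
      qed
      have "f * g = (\<Sum>q\<in>Poly_Mapping.keys f. sg q (lk f q) * g)"
        by (subst (1) poly_mapping_sum_singles[of f]) (rule sum_distrib_right)
      then have "lk (f * g) e = (\<Sum>q\<in>Poly_Mapping.keys f. if q = 0 then lk f 0 * lk g e else 0)"
        by (simp only: lookup_sum t)
      then show ?thesis by (simp add: in_keys_iff)
    qed
    define S where "S = {f \<in> ?I. (\<Sum>e\<in>E. lk f e * y e) = 0}"
    have "ideal S ?R"
    proof (rule ideal_mpoly_ringI)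
      show "S \<subseteq> carrier ?R" using mon_ideal_carrier unfolding S_def by blast
      show "0 \<in> S" by (simp add: S_def mon_ideal_zero)
      show "f + g \<in> S" if "f \<in> S" "g \<in> S" for f g
        using that by (simp add: S_def mon_ideal_add lookup_add distrib_right sum.distrib)
      show "f * g \<in> S" if f: "f \<in> carrier ?R" and g: "g \<in> S" for f g
      proof -
        have gI: "g \<in> ?I" using g by (simp add: S_def)
        have "(\<Sum>e\<in>E. lk (f * g) e * y e) = lk f 0 * (\<Sum>e\<in>E. lk g e * y e)"
          unfolding sum_distrib_left by (rule sum.cong) (simp_all add: low[OF gI])
        then show ?thesis using g mon_ideal_mult[OF f gI] by (simp add: S_def)
      qed
    qed
    moreover have "G \<subseteq> S" using GI y(2) by (auto simp: S_def)
    ultimately have IS: "?I \<subseteq> S" unfolding G(4) by (rule R.genideal_minimal)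
    obtain e where e: "e \<in> E" "y e \<noteq> 0" using y(1) by blast
    have "(monic e :: (nat, 'k) mpoly) \<in> ?I"
      using e(1) multiples_same_degree[OF E] by (auto simp: mon_ideal_def)
    then have "(\<Sum>a\<in>E. lk (monic e :: (nat, 'k) mpoly) a * y a) = 0" using IS by (auto simp: S_def)
    then show False using e finE by (simp add: lookup_monic if_distrib if_distribR cong: if_cong)
  qed
qed

section \<open>The structure of small monomial Togliatti systems\<close>

lemma monic_set_exponents:
  assumes "M \<subseteq> (monomials n \<inter> forms {..n} d :: (nat, 'k::comm_ring_1) mpoly set)"
  shows "\<exists>E \<subseteq> expo {..n} d. M = monic ` E"
proof (intro exI conjI)
  let ?E = "{m \<in> expo {..n} d. monic m \<in> M}"
  show "?E \<subseteq> expo {..n} d" by blast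
  show "M = monic ` ?E"
  proof
    show "M \<subseteq> monic ` ?E"
    proof
      fix f assume f: "f \<in> M"
      then obtain m where m: "f = monic m" using assms unfolding monomials_def monic_def by blast
      have "f \<in> forms {..n} d" using f assms by blast
      then have "m \<in> expo {..n} d" unfolding forms_iff m by simp
      then show "f \<in> monic ` ?E" using f m by blast
    qed
  qed blast
qed

lemma monic_monomials: "E \<subseteq> expo {..n} d \<Longrightarrow> monic ` E \<subseteq> (monomials n \<inter> forms {..n} d :: (nat, 'k::comm_ring_1) mpoly set)"
proof
  assume E: "E \<subseteq> expo {..n} d"
  fix f :: "(nat, 'k) mpoly" assume "f \<in> monic ` E"
  then obtain e where e: "e \<in> E" "f = monic e" by blast
  have eE: "e \<in> expo {..n} d" using E e by blast
  then have "f \<in> forms {..n} d" unfolding forms_iff e(2) by simp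
  moreover have "f \<in> monomials n" using eE unfolding monomials_def e(2) monic_def expo_def by blast
  ultimately show "f \<in> monomials n \<inter> forms {..n} d" by blast
qed

lemma expo_keys: "E \<subseteq> expo V d \<Longrightarrow> e \<in> E \<Longrightarrow> Poly_Mapping.keys e \<subseteq> V"
  by (auto simp: expo_def)

lemma inj_monic: "inj (monic :: ('v \<Rightarrow>\<^sub>0 nat) \<Rightarrow> ('v, 'k::comm_ring_1) mpoly)"
proof (rule injI)
  fix a b :: "'v \<Rightarrow>\<^sub>0 nat" assume "monic a = (monic b :: ('v, 'k) mpoly)"
  then have "Poly_Mapping.keys (monic a :: ('v, 'k) mpoly) = Poly_Mapping.keys (monic b :: ('v, 'k) mpoly)" by simp
  then show "a = b" by simp
qed

lemma togliatti_mon_idealD: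
  assumes d: "d \<ge> 1" and E: "E \<subseteq> expo {..n} d" and t: "togliatti n d (mon_ideal {..n} E :: (nat, 'k::field_char_0) mpoly set)"
  shows "(\<lambda>i. Poly_Mapping.single i d) ` {..n} \<subseteq> E"
    "\<exists>G :: (nat \<Rightarrow>\<^sub>0 nat) \<Rightarrow> 'k. homog {..n} (d - 1) G \<and> (\<exists>m. G m \<noteq> 0) \<and> lsupp {..n} G \<subseteq> E"
proof -
  have "artinian_ring (polyR n Quot (mon_ideal {..n} E :: (nat, 'k) mpoly set))" using t by (simp add: togliatti_def)
  from artinian_mon_ideal_imp[OF E this] show "(\<lambda>i. Poly_Mapping.single i d) ` {..n} \<subseteq> E" by auto
  have "fails_WLP n (mon_ideal {..n} E :: (nat, 'k) mpoly set) (d - 1)" using t by (simp add: togliatti_def)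
  from fails_WLP_imp[OF d E this]
  show "\<exists>G :: (nat \<Rightarrow>\<^sub>0 nat) \<Rightarrow> 'k. homog {..n} (d - 1) G \<and> (\<exists>m. G m \<noteq> 0) \<and> lsupp {..n} G \<subseteq> E" .
qed

lemma monomial_togliatti_mon_idealI:
  fixes G :: "(nat \<Rightarrow>\<^sub>0 nat) \<Rightarrow> 'k::field_char_0"
  assumes nd: "n \<ge> 1" "d \<ge> 1" and E: "E \<subseteq> expo {..n} d" and c: "card E \<le> (n + d - 1) choose (n - 1)"
    and P: "(\<lambda>i. Poly_Mapping.single i d) ` {..n} \<subseteq> E"
    and G: "homog {..n} (d - 1) G" "G m0 \<noteq> 0" "lsupp {..n} G \<subseteq> E"
  shows "monomial_togliatti n d (mon_ideal {..n} E :: (nat, 'k) mpoly set)"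
proof -
  let ?I = "mon_ideal {..n} E :: (nat, 'k) mpoly set"
  have finE: "finite E" using finite_subset[OF E finite_expo] by simp
  have I: "?I = Idl\<^bsub>polyR n\<^esub> (monic ` E)" by (rule genideal_monic[OF expo_keys[OF E], symmetric])
  have mm: "monic ` E \<subseteq> (monomials n \<inter> forms {..n} d :: (nat, 'k) mpoly set)" by (rule monic_monomials[OF E])
  have "artinian_ring (polyR n Quot ?I)" by (rule artinian_mon_ideal) (use P in auto)
  moreover have "fails_WLP n ?I (d - 1)" by (rule fails_WLP_I[OF nd E c G])
  moreover have "\<exists>F\<subseteq>forms {..n} d. finite F \<and> card F \<le> n + d - 1 choose (n - 1) \<and> ?I = Idl\<^bsub>polyR n\<^esub> F"
  proof (intro exI[of _ "monic ` E"] conjI)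
    have "card (monic ` E :: (nat, 'k) mpoly set) = card E"
      by (rule card_image[OF inj_on_subset[OF inj_monic subset_UNIV]])
    then show "card (monic ` E :: (nat, 'k) mpoly set) \<le> n + d - 1 choose (n - 1)" using c by simp
  qed (use mm finE I in auto)
  ultimately have "togliatti n d ?I" by (simp add: togliatti_def)
  then show ?thesis using mm I by (auto simp: monomial_togliatti_def)
qed

text \<open>It makes \<open>2 n + 1\<close> an admissible number of generators; for
  \<open>n = 2\<close> and \<open>d = 4\<close> both sides are 5.\<close>

lemma choose_lower_bound: "n \<ge> 2 \<Longrightarrow> d \<ge> 4 \<Longrightarrow> 2 * n + 1 \<le> (n + d - 1) choose (n - 1)"
proof -
  assume n: "n \<ge> 2" and d: "d \<ge> 4"
  have "2 * n + 1 \<le> (n + 3) choose 4" using n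
  proof (induction n rule: dec_induct)
    case base show ?case by (simp add: eval_nat_numeral)
  next
    case (step m)
    have e: "(Suc m + 3) choose 4 = ((m + 3) choose 3) + ((m + 3) choose 4)" by (simp add: eval_nat_numeral)
    have c3: "2 \<le> (m + 3) choose 3"
    proof -
      have "(m + 3) choose 3 = ((m + 2) choose 2) + ((m + 2) choose 3)" by (simp add: eval_nat_numeral)
      moreover have "(m + 2) choose 2 = (m + 1) + ((m + 1) choose 2)" by (simp add: eval_nat_numeral)
      ultimately show ?thesis using step by linarith
    qed
    have "2 * Suc m + 1 = 2 + (2 * m + 1)" by simp
    also have "\<dots> \<le> ((m + 3) choose 3) + ((m + 3) choose 4)" by (rule add_mono[OF c3 step.IH])
    also have "\<dots> = (Suc m + 3) choose 4" by (rule e[symmetric])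
    finally show ?case .
  qed
  also have "(n + 3) choose 4 = (n + 3) choose (n - 1)" using n by (subst binomial_symmetric) auto
  also have "\<dots> \<le> (n + d - 1) choose (n - 1)" by (rule binomial_right_mono) (use d in simp)
  finally show ?thesis .
qed

definition pures :: "nat \<Rightarrow> nat \<Rightarrow> (nat \<Rightarrow>\<^sub>0 nat) set" where
  "pures n d = (\<lambda>i. Poly_Mapping.single i d) ` {..n}"

text \<open>The trivial system belonging to \<open>x_i ^ (d - 1)\<close>: the pure powers and the
  monomials of \<open>x_i ^ (d - 1) (x_0 + ... + x_n)\<close>, which have only
  \<open>x_i ^ d\<close> in common.\<close>

definition triv :: "nat \<Rightarrow> nat \<Rightarrow> nat \<Rightarrow> (nat \<Rightarrow>\<^sub>0 nat) set" where
  "triv n d i = pures n d \<union> (\<lambda>j. Poly_Mapping.single i (d - 1) + Poly_Mapping.single j 1) ` ({..n} - {i})"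

lemma pures_expo: "pures n d \<subseteq> expo {..n} d"
  by (auto simp: pures_def expo_single)

lemma card_pures: "d > 0 \<Longrightarrow> card (pures n d) = n + 1"
proof -
  assume "d > 0"
  then obtain k where k: "d = Suc k" by (cases d) auto
  have "inj_on (\<lambda>i. Poly_Mapping.single i d) {..n}" by (rule inj_onI) (simp add: k)
  then show ?thesis by (simp add: pures_def card_image)
qed

lemma near_pure_not_pure:
  assumes "d \<ge> 2" "j \<noteq> i" shows "\<not> pure (Poly_Mapping.single i (d - 1) + Poly_Mapping.single j 1)"
proof
  assume "pure (Poly_Mapping.single i (d - 1) + Poly_Mapping.single j 1)"
  from pure_lookup[OF this, of j i] assms show False by (simp add: lookup_add lookup_single when_def)
qed

lemma pures_are_pure: "a \<in> pures n d \<Longrightarrow> pure a"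
  by (auto simp: pures_def pure_def)

lemma near_pure_expo: "d \<ge> 1 \<Longrightarrow> i \<le> n \<Longrightarrow> j \<le> n \<Longrightarrow> Poly_Mapping.single i (d - 1) + Poly_Mapping.single j 1 \<in> expo {..n} d"
  using expo_add[OF expo_single[of i "{..n}" "d - 1"] expo_single[of j "{..n}" 1]] by simp

lemma triv_expo: "d \<ge> 1 \<Longrightarrow> i \<le> n \<Longrightarrow> triv n d i \<subseteq> expo {..n} d"
  unfolding triv_def using pures_expo near_pure_expo by blast

lemma card_near_pures: "i \<le> n \<Longrightarrow> card ((\<lambda>j. Poly_Mapping.single i (d - 1) + Poly_Mapping.single j (1::nat)) ` ({..n} - {i})) = n"
  by (subst card_image) (auto simp: inj_on_def)

lemma card_triv: assumes "d \<ge> 2" "i \<le> n" shows "card (triv n d i) = 2 * n + 1"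
proof -
  let ?N = "(\<lambda>j. Poly_Mapping.single i (d - 1) + Poly_Mapping.single j (1::nat)) ` ({..n} - {i})"
  have "\<not> pure a" if aN: "a \<in> ?N" for a 
  proof -
    obtain j where "j \<noteq> i" "a = sg i (d - 1) + sg j 1" using aN by auto
    then show ?thesis using near_pure_not_pure[OF assms(1), of j i] by simp
  qed
  then have "pures n d \<inter> ?N = {}" using pures_are_pure[of _ n d] by auto
  then have "card (pures n d \<union> ?N) = card (pures n d) + card ?N"
    by (intro card_Un_disjoint) (simp_all add: pures_def)
  then show ?thesis unfolding triv_def card_near_pures[OF assms(2)] using card_pures[of d n] assms(1) by simp
qed

text \<open>The set \<open>E\<close> contains the pure powers and, disjoint from them, the mixed
  monomials of a multiple of the sum of the variables. When \<open>card E\<close> is minimal there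
  is no room for anything else, so the equality case of \<open>mixed_lower_bound\<close> determines
  \<open>E\<close>.\<close>

lemma togliatti_structure:
  assumes nd: "n \<ge> 2" "d \<ge> 4" and E: "E \<subseteq> expo {..n} d"
    and t: "togliatti n d (mon_ideal {..n} E :: (nat, 'k::field_char_0) mpoly set)"
  shows "2 * n + 1 \<le> card E"
    "card E = 2 * n + 1 \<Longrightarrow> (\<exists>i\<le>n. E = triv n d i) \<or> (\<exists>U. exc_support {..n} d U \<and> E = pures n d \<union> U)"
proof -
  have d1: "d \<ge> 1" using nd by simp
  have finE: "finite E" using finite_subset[OF E finite_expo] by simp
  obtain F :: "(nat \<Rightarrow>\<^sub>0 nat) \<Rightarrow> 'k" and m0 where F: "homog {..n} (d - 1) F" "F m0 \<noteq> 0" "lsupp {..n} F \<subseteq> E"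
    using togliatti_mon_idealD(2)[OF d1 E t] by blast
  define M where "M = mixed {..n} F"
  have P: "pures n d \<subseteq> E" using togliatti_mon_idealD(1)[OF d1 E t] by (simp add: pures_def)
  have ME: "M \<subseteq> E" using F(3) by (auto simp: M_def mixed_def)
  have "pures n d \<inter> M = {}" using pures_are_pure by (auto simp: M_def mixed_def)
  then have cPM: "card (pures n d \<union> M) = (n + 1) + card M"
    using card_pures[of d n] d1 finite_subset[OF P finE] finite_subset[OF ME finE] by (simp add: card_Un_disjoint)
  have PME: "pures n d \<union> M \<subseteq> E" using P ME by blast
  have le: "card (pures n d \<union> M) \<le> card E" by (rule card_mono[OF finE PME])
  have low: "n \<le> card M" and cases: "card M = n \<Longrightarrow> (\<exists>i\<in>{..n}. \<forall>m. F m \<noteq> 0 \<longrightarrow> m = sg i (d - 1)) \<or> exc_support {..n} d M"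
    using mixed_lower_bound[of "{..n}" n d F m0] nd F unfolding M_def by auto
  show "2 * n + 1 \<le> card E" using le low cPM by linarith
  assume c: "card E = 2 * n + 1"
  have cM: "card M = n" using le low cPM c by linarith
  have EM: "pures n d \<union> M = E" by (rule card_seteq[OF finE PME]) (use cPM cM c in simp)
  from cases[OF cM] show "(\<exists>i\<le>n. E = triv n d i) \<or> (\<exists>U. exc_support {..n} d U \<and> E = pures n d \<union> U)"
  proof
    assume "\<exists>i\<in>{..n}. \<forall>m. F m \<noteq> 0 \<longrightarrow> m = sg i (d - 1)"
    then obtain i where i: "i \<le> n" "\<And>m. F m \<noteq> 0 \<Longrightarrow> m = sg i (d - 1)" by auto
    have Fi: "F (sg i (d - 1)) \<noteq> 0" using i(2)[OF F(2)] F(2) by simp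
    let ?N = "(\<lambda>j. sg i (d - 1) + sg j (1::nat)) ` ({..n} - {i})"
    have "?N \<subseteq> M"
    proof safe
      fix j assume j: "j \<le> n" "sg i (d - 1) + sg j 1 \<notin> M"
      show "j = i"
      proof (rule ccontr)
        assume ji: "j \<noteq> i"
        let ?a = "sg i (d - 1) + sg j (1::nat)"
        have t: "(if lk ?a k > 0 then F (?a - sg k 1) else 0) = (if k = j then F (sg i (d - 1)) else 0)" for k
        proof (cases "k = j")
          case True then show ?thesis by (simp add: lookup_add)
        next
          case False
          have "?a - sg k 1 \<noteq> sg i (d - 1)"
          proof
            assume "?a - sg k 1 = sg i (d - 1)"
            then have "lk (?a - sg k 1) j = lk (sg i (d - 1)) j" by simp
            then show False using False ji by (simp add: lookup_add lookup_minus lookup_single when_def)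
          qed
          then have "F (?a - sg k 1) = 0" using i(2) by blast
          then show ?thesis using False by simp
        qed
        have "lmul {..n} F ?a = F (sg i (d - 1))" unfolding lmul_def t using j(1) by simp
        then have "?a \<in> M" using Fi near_pure_not_pure[of d j i] ji nd unfolding M_def mixed_def lsupp_def by simp
        then show False using j(2) by simp
      qed
    qed
    moreover have "finite M" by (rule finite_subset[OF ME finE])
    ultimately have "?N = M" using card_near_pures[OF i(1), of d] cM by (intro card_seteq) auto
    then have "E = triv n d i" using EM by (simp add: triv_def)
    then show ?thesis using i(1) by blast
  next
    assume "exc_support {..n} d M"
    then show ?thesis using EM by blast
  qed
qed

lemma minimal_monomial_togliattiD:
  assumes "I \<in> (minimal_monomial_togliatti n d :: (nat, 'k::field_char_0) mpoly set set)"
  shows "\<exists>E \<subseteq> expo {..n} d. I = mon_ideal {..n} E \<and> togliatti n d I \<and> min_gens n I = card E"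
proof -
  obtain M where M: "M \<subseteq> monomials n \<inter> forms {..n} d" "I = Idl\<^bsub>polyR n\<^esub> M" and t: "togliatti n d I"
    using assms unfolding minimal_monomial_togliatti_def monomial_togliatti_def by blast
  obtain E where E: "E \<subseteq> expo {..n} d" "M = monic ` E" using monic_set_exponents[OF M(1)] by blast
  have I: "I = mon_ideal {..n} E" unfolding M(2) E(2) by (rule genideal_monic[OF expo_keys[OF E(1)]])
  have "min_gens n I = card E" unfolding I by (rule min_gens_mon_ideal[OF E(1)])
  then show ?thesis using E(1) I t by blast
qed

text \<open>At the lower bound minimality is automatic: a proper subset has too few elements to
  generate a Togliatti system.\<close>

lemma minimal_monomial_togliattiI:
  assumes nd: "n \<ge> 2" "d \<ge> 4" and E: "E \<subseteq> expo {..n} d" "card E = 2 * n + 1"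
    and t: "monomial_togliatti n d (mon_ideal {..n} E :: (nat, 'k::field_char_0) mpoly set)"
  shows "(mon_ideal {..n} E :: (nat, 'k) mpoly set) \<in> minimal_monomial_togliatti n d"
  unfolding minimal_monomial_togliatti_def
proof (intro CollectI conjI exI[of _ "monic ` E"] allI impI)
  show "monic ` E \<subseteq> (monomials n \<inter> forms {..n} d :: (nat, 'k) mpoly set)" by (rule monic_monomials[OF E(1)])
  show "(mon_ideal {..n} E :: (nat, 'k) mpoly set) = Idl\<^bsub>polyR n\<^esub> (monic ` E)"
    by (rule genideal_monic[OF expo_keys[OF E(1)], symmetric])
  fix M' :: "(nat, 'k) mpoly set" assume M': "M' \<subset> monic ` E"
  then obtain E' where E': "E' \<subseteq> E" "M' = monic ` E'" using subset_imageE[OF psubset_imp_subset[OF M']] by blast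
  then have "E' \<subset> E" using M' by blast
  moreover have "finite E" using finite_subset[OF E(1) finite_expo] by simp
  ultimately have c: "card E' < 2 * n + 1" using E(2) psubset_card_mono[of E E'] by simp
  have E'e: "E' \<subseteq> expo {..n} d" using E' E by blast
  have eq: "Idl\<^bsub>polyR n\<^esub> (monic ` E') = (mon_ideal {..n} E' :: (nat, 'k) mpoly set)"
    by (rule genideal_monic) (rule expo_keys[OF E'e])
  show "\<not> monomial_togliatti n d (Idl\<^bsub>polyR n\<^esub> M')"
  proof
    assume "monomial_togliatti n d (Idl\<^bsub>polyR n\<^esub> M')"
    then have "togliatti n d (mon_ideal {..n} E' :: (nat, 'k) mpoly set)"
      unfolding E'(2) eq monomial_togliatti_def by blast
    from togliatti_structure(1)[OF nd E'e this] c show False by simp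
  qed
qed (rule t)

lemma Var_mult_monic: "Var j * monic m = (monic (m + Poly_Mapping.single j 1) :: ('v, 'k::comm_ring_1) mpoly)"
  by (simp add: Var_def monic_def mult_single add.commute)

lemma triv_minimal:
  assumes nd: "n \<ge> 2" "d \<ge> 4" and i: "i \<le> n"
  shows "(mon_ideal {..n} (triv n d i) :: (nat, 'k::field_char_0) mpoly set) \<in> minimal_monomial_togliatti n d"
proof (rule minimal_monomial_togliattiI[OF nd])
  have d1: "d \<ge> 1" using nd by simp
  show E: "triv n d i \<subseteq> expo {..n} d" by (rule triv_expo[OF d1 i])
  show c: "card (triv n d i) = 2 * n + 1" by (rule card_triv[OF _ i]) (use nd in simp)
  define G :: "(nat \<Rightarrow>\<^sub>0 nat) \<Rightarrow> 'k" where "G m = (if m = sg i (d - 1) then 1 else 0)" for m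
  have "lsupp {..n} G \<subseteq> triv n d i"
  proof
    fix a assume "a \<in> lsupp {..n} G"
    then have "lmul {..n} G a \<noteq> 0" by (simp add: lsupp_def)
    then obtain j where j: "j \<in> {..n}" "lk a j > 0" "G (a - sg j 1) \<noteq> 0" by (rule lmul_nonzeroE)
    have "a - sg j 1 = sg i (d - 1)" using j(3) by (auto simp: G_def split: if_splits)
    then have a: "a = sg i (d - 1) + sg j 1" using minus_single_add[OF j(2)] by simp
    show "a \<in> triv n d i"
    proof (cases "j = i")
      case True
      then have "a = sg i d" using d1 unfolding a by (simp add: single_add[symmetric])
      then show ?thesis using i by (simp add: triv_def pures_def)
    next
      case False then show ?thesis using j(1) a by (auto simp: triv_def)
    qed
  qed
  moreover have "homog {..n} (d - 1) G" using i by (auto simp: homog_def G_def expo_single)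
  moreover have "G (sg i (d - 1)) \<noteq> 0" by (simp add: G_def)
  moreover have "(\<lambda>i. sg i d) ` {..n} \<subseteq> triv n d i" by (auto simp: triv_def pures_def)
  ultimately show "monomial_togliatti n d (mon_ideal {..n} (triv n d i) :: (nat, 'k) mpoly set)"
    using nd E c choose_lower_bound[OF nd] by (intro monomial_togliatti_mon_idealI) auto
qed

lemma triv_trivial:
  assumes d: "d \<ge> 1" and i: "i \<le> n"
  shows "trivial_togliatti n d (mon_ideal {..n} (triv n d i) :: (nat, 'k::field_char_0) mpoly set)"
  unfolding trivial_togliatti_def
proof (intro bexI conjI allI impI)
  let ?F = "monic (sg i (d - 1)) :: (nat, 'k) mpoly"
  show "?F \<in> forms {..n} (d - 1)" using i by (simp add: forms_iff expo_single)
  have "lk ?F (sg i (d - 1)) \<noteq> 0" by (simp add: lookup_monic)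
  then show "?F \<noteq> 0" by auto
  fix j assume j: "j \<le> n"
  have "sg i (d - 1) + sg j 1 \<in> triv n d i"
  proof (cases "j = i")
    case True
    then have "sg i (d - 1) + sg j 1 = sg i d" using d by (simp add: single_add[symmetric])
    then show ?thesis using i by (simp add: triv_def pures_def)
  next
    case False then show ?thesis using j by (simp add: triv_def)
  qed
  then have "sg i (d - 1) + sg j 1 \<in> multiples {..n} (triv n d i)" using multiples_same_degree[OF triv_expo[OF d i]] by blast
  then show "Var j * ?F \<in> mon_ideal {..n} (triv n d i)" unfolding Var_mult_monic mon_ideal_def by simp
qed

section \<open>The two exceptional systems\<close>

definition tmon :: "'v \<Rightarrow> 'v \<Rightarrow> 'v \<Rightarrow> nat \<Rightarrow> nat \<Rightarrow> nat \<Rightarrow> ('v \<Rightarrow>\<^sub>0 nat)" where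
  "tmon x y z a b c = Poly_Mapping.single x a + Poly_Mapping.single y b + Poly_Mapping.single z c"

lemma lookup_tmon:
  assumes "distinct [x, y, z]"
  shows "Poly_Mapping.lookup (tmon x y z a b c) x = a" "Poly_Mapping.lookup (tmon x y z a b c) y = b"
    "Poly_Mapping.lookup (tmon x y z a b c) z = c"
  using assms by (auto simp: tmon_def lookup_add lookup_single when_def)

text \<open>\<open>tri\<close> is an abbreviation, \<open>tmon\<close> a definition: with this rule
  equations between monomials in three variables reduce to equations between exponents without
  unfolding into sums.\<close>

lemma tmon_eq_iff:
  assumes "distinct [x, y, z]"
  shows "tmon x y z a b c = tmon x y z a' b' c' \<longleftrightarrow> a = a' \<and> b = b' \<and> c = c'"
proof
  assume eq: "tmon x y z a b c = tmon x y z a' b' c'"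
  have "lk (tmon x y z a b c) v = lk (tmon x y z a' b' c') v" for v by (simp only: eq)
  from this[of x] this[of y] this[of z] show "a = a' \<and> b = b' \<and> c = c'" by (simp only: lookup_tmon[OF assms] simp_thms)
qed simp

lemma tmon_expo: "x \<in> V \<Longrightarrow> y \<in> V \<Longrightarrow> z \<in> V \<Longrightarrow> a + b + c = d \<Longrightarrow> tmon x y z a b c \<in> expo V d"
  unfolding tmon_def using expo_add[OF expo_add[OF expo_single[of x V a] expo_single[of y V b]] expo_single[of z V c]] by simp

definition exc5 :: "nat \<Rightarrow> nat \<Rightarrow> nat \<Rightarrow> (nat \<Rightarrow>\<^sub>0 nat) set" where
  "exc5 x y z = {tmon x y z 5 0 0, tmon x y z 0 5 0, tmon x y z 0 0 5, tmon x y z 3 1 1, tmon x y z 1 2 2}"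

definition exc4 :: "nat \<Rightarrow> nat \<Rightarrow> nat \<Rightarrow> (nat \<Rightarrow>\<^sub>0 nat) set" where
  "exc4 x y z = {tmon x y z 4 0 0, tmon x y z 0 4 0, tmon x y z 0 0 4, tmon x y z 1 1 2, tmon x y z 2 2 0}"

lemma Var_power: "Var v ^ k = (monic (Poly_Mapping.single v k) :: ('v, 'k::comm_ring_1) mpoly)"
proof (induction k)
  case 0 show ?case by (simp add: monic_def)
next
  case (Suc k)
  have "Var v ^ Suc k = (Var v * monic (sg v k) :: ('v, 'k) mpoly)" by (simp add: Suc)
  also have "\<dots> = monic (sg v k + sg v 1)" by (rule Var_mult_monic)
  also have "sg v k + sg v 1 = sg v (Suc k)" by (simp add: single_add[symmetric])
  finally show ?case .
qed

lemma monic_mult: "monic a * monic b = (monic (a + b) :: ('v, 'k::comm_ring_1) mpoly)"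
  by (simp add: monic_def mult_single)

lemma Var_monic: "Var v = (monic (Poly_Mapping.single v 1) :: ('v, 'k::comm_ring_1) mpoly)"
  by (simp add: Var_def monic_def)

lemma permutes_012:
  assumes "\<pi> permutes {0, 1, 2::nat}"
  shows "distinct [\<pi> 0, \<pi> 1, \<pi> 2]" "{\<pi> 0, \<pi> 1, \<pi> 2} = {..2}"
proof -
  have "\<pi> ` {0, 1, 2} = {0, 1, 2}" by (rule permutes_image[OF assms])
  then show "{\<pi> 0, \<pi> 1, \<pi> 2} = {..2}" by auto
  have "inj \<pi>" by (rule permutes_inj[OF assms])
  then show "distinct [\<pi> 0, \<pi> 1, \<pi> 2]" by (simp add: inj_eq)
qed

lemma ex_permutation_012:
  assumes "distinct [x, y, z]" "{x, y, z} = {..2::nat}"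
  shows "\<exists>\<pi>. \<pi> permutes {0, 1, 2} \<and> \<pi> 0 = x \<and> \<pi> 1 = y \<and> \<pi> 2 = z"
proof -
  define \<pi> where "\<pi> i = (if i = 0 then x else if i = 1 then y else if i = 2 then z else i)" for i :: nat
  have "bij_betw \<pi> {0, 1, 2} {0, 1, 2}"
  proof -
    have "inj_on \<pi> {0, 1, 2}" using assms(1) by (auto simp: inj_on_def \<pi>_def)
    moreover have "\<pi> ` {0, 1, 2} = {x, y, z}" by (auto simp: \<pi>_def)
    moreover have "{..2::nat} = {0, 1, 2}" by auto
    ultimately show ?thesis using assms(2) by (simp add: bij_betw_def)
  qed
  then have "\<pi> permutes {0, 1, 2}" by (rule bij_imp_permutes) (auto simp: \<pi>_def)
  then show ?thesis by (intro exI[of _ \<pi>]) (simp add: \<pi>_def)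
qed

lemma exc5_expo: assumes "{x, y, z} = {..2}" shows "exc5 x y z \<subseteq> expo {..2} 5"
  unfolding exc5_def assms[symmetric] by (intro insert_subsetI empty_subsetI tmon_expo) simp_all

lemma exc4_expo: assumes "{x, y, z} = {..2}" shows "exc4 x y z \<subseteq> expo {..2} 4"
  unfolding exc4_def assms[symmetric] by (intro insert_subsetI empty_subsetI tmon_expo) simp_all

lemma exceptional_2_5_eq:
  assumes "\<pi> permutes {0, 1, 2}"
  shows "exceptional_2_5 \<pi> = (mon_ideal {..2} (exc5 (\<pi> 0) (\<pi> 1) (\<pi> 2)) :: (nat, 'k::comm_ring_1) mpoly set)"
proof -
  let ?x = "\<pi> 0" and ?y = "\<pi> 1" and ?z = "\<pi> 2"
  note p = permutes_012[OF assms]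
  have "{Var ?x ^ 5, Var ?y ^ 5, Var ?z ^ 5, Var ?x ^ 3 * Var ?y * Var ?z, Var ?x * Var ?y ^ 2 * Var ?z ^ 2}
      = (monic ` exc5 ?x ?y ?z :: (nat, 'k) mpoly set)"
    unfolding exc5_def Var_power tmon_def by (simp add: Var_monic monic_mult)
  then have "exceptional_2_5 \<pi> = Idl\<^bsub>polyR 2\<^esub> (monic ` exc5 ?x ?y ?z :: (nat, 'k) mpoly set)"
    unfolding exceptional_2_5_def Let_def by simp
  then show ?thesis using genideal_monic[of "exc5 ?x ?y ?z" "{..2}"] expo_keys[OF exc5_expo[OF p(2)]] by simp
qed

lemma exceptional_2_4_eq:
  assumes "\<pi> permutes {0, 1, 2}"
  shows "exceptional_2_4 \<pi> = (mon_ideal {..2} (exc4 (\<pi> 0) (\<pi> 1) (\<pi> 2)) :: (nat, 'k::comm_ring_1) mpoly set)"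
proof -
  let ?x = "\<pi> 0" and ?y = "\<pi> 1" and ?z = "\<pi> 2"
  note p = permutes_012[OF assms]
  have "{Var ?x ^ 4, Var ?y ^ 4, Var ?z ^ 4, Var ?x * Var ?y * Var ?z ^ 2, Var ?x ^ 2 * Var ?y ^ 2}
      = (monic ` exc4 ?x ?y ?z :: (nat, 'k) mpoly set)"
    unfolding exc4_def Var_power tmon_def by (simp add: Var_monic monic_mult)
  then have "exceptional_2_4 \<pi> = Idl\<^bsub>polyR 2\<^esub> (monic ` exc4 ?x ?y ?z :: (nat, 'k) mpoly set)"
    unfolding exceptional_2_4_def Let_def by simp
  then show ?thesis using genideal_monic[of "exc4 ?x ?y ?z" "{..2}"] expo_keys[OF exc4_expo[OF p(2)]] by simp
qed

lemma exc_support_cases: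
  assumes "exc_support {..n} d U"
  shows "\<exists>\<pi>. \<pi> permutes {0, 1, 2} \<and> (n = 2 \<and> d = 5 \<and> pures n d \<union> U = exc5 (\<pi> 0) (\<pi> 1) (\<pi> 2) \<or>
     n = 2 \<and> d = 4 \<and> pures n d \<union> U = exc4 (\<pi> 0) (\<pi> 1) (\<pi> 2))"
proof -
  obtain x y z where xyz: "distinct [x, y, z]" "{..n} = {x, y, z}"
    and U: "d = 5 \<and> U = {tri x y z 1 1 3, tri x y z 2 2 1} \<or> d = 4 \<and> U = {tri x y z 1 1 2, tri x y z 2 2 0}"
    using assms unfolding exc_support_def by blast
  have "card {..n} = 3" unfolding xyz(2) using xyz(1) by simp
  then have n: "n = 2" by simp
  have V: "{x, y, z} = {..2}" "{z, x, y} = {..2}" using xyz(2) n by auto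
  have pu: "pures n d = {sg x d, sg y d, sg z d}" unfolding pures_def xyz(2) by simp
  from U show ?thesis
  proof
    assume d: "d = 5 \<and> U = {tri x y z 1 1 3, tri x y z 2 2 1}"
    have "distinct [z, x, y]" using xyz(1) by auto
    from ex_permutation_012[OF this V(2)] obtain \<pi> where \<pi>: "\<pi> permutes {0, 1, 2}" "\<pi> 0 = z" "\<pi> 1 = x" "\<pi> 2 = y" by blast
    \<comment> \<open>The distinguished coordinate is last in \<open>exc_support\<close> and first
      in \<open>exc5\<close>, hence the cyclic rotation of the variables.\<close>
    have "pures n d \<union> U = exc5 z x y"
      unfolding pu exc5_def tmon_def using d by (auto simp: ac_simps)
    then show ?thesis using \<pi> n d by (intro exI[of _ \<pi>]) simp
  next
    assume d: "d = 4 \<and> U = {tri x y z 1 1 2, tri x y z 2 2 0}"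
    from ex_permutation_012[OF xyz(1) V(1)] obtain \<pi> where \<pi>: "\<pi> permutes {0, 1, 2}" "\<pi> 0 = x" "\<pi> 1 = y" "\<pi> 2 = z" by blast
    have "pures n d \<union> U = exc4 x y z"
      unfolding pu exc4_def tmon_def using d by auto
    then show ?thesis using \<pi> n d by (intro exI[of _ \<pi>]) simp
  qed
qed

text \<open>In a monomial ideal each monomial of a member is a member. A monomial \<open>m\<close>
  of the form \<open>F\<close> in the definition of triviality therefore puts \<open>m x\<close>,
  \<open>m y\<close> and \<open>m z\<close> into \<open>E\<close>, a unit simplex that can be
  excluded by inspection.\<close>

lemma nontrivial_of_no_simplex:
  fixes E :: "(nat \<Rightarrow>\<^sub>0 nat) set"
  assumes xyz: "distinct [x, y, z]" "{x, y, z} = {..2}" and E: "E \<subseteq> expo {..2} d" and d: "d \<ge> 1"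
    and no: "\<And>a b c. tmon x y z (Suc a) b c \<in> E \<Longrightarrow> tmon x y z a (Suc b) c \<in> E \<Longrightarrow> tmon x y z a b (Suc c) \<in> E \<Longrightarrow> False"
  shows "\<not> trivial_togliatti 2 d (mon_ideal {..2} E :: (nat, 'k::field_char_0) mpoly set)"
proof
  assume "trivial_togliatti 2 d (mon_ideal {..2} E :: (nat, 'k) mpoly set)"
  then obtain F :: "(nat, 'k) mpoly" where F: "F \<in> forms {..2} (d - 1)" "F \<noteq> 0" "\<And>i. i \<le> 2 \<Longrightarrow> Var i * F \<in> mon_ideal {..2} E"
    unfolding trivial_togliatti_def by blast
  obtain m where m: "m \<in> Poly_Mapping.keys F" using F(2) by (metis all_not_in_conv keys_eq_empty)
  have mE: "m + sg i 1 \<in> E" if "i \<in> {x, y, z}" for i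
  proof -
    have i: "i \<le> 2" using that unfolding xyz(2) by simp
    have "(Var i :: (nat, 'k) mpoly) \<in> forms {..2} 1" using i by (simp add: Var_monic forms_iff expo_single)
    then have "Var i * F \<in> forms {..2} d" using forms_mult[OF _ F(1), of "Var i" 1] d by simp
    then have "Poly_Mapping.keys (Var i * F) \<subseteq> E" using F(3)[OF i] form_in_mon_ideal[OF E] by blast
    moreover have "lk (Var i * F) (m + sg i 1) = lk F m"
      using lookup_single_mult[of "sg i 1" 1 F m] by (simp add: Var_def add.commute)
    ultimately show ?thesis using m by (auto simp: in_keys_iff)
  qed
  have "m \<in> expo {x, y, z} (d - 1)" using F(1) m unfolding forms_iff xyz(2) by blast
  from in_expo_tri(1)[OF xyz(1) this] obtain a b c where abc: "m = tmon x y z a b c" unfolding tmon_def by blast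
  have eqs: "m + sg x 1 = tmon x y z (Suc a) b c" "m + sg y 1 = tmon x y z a (Suc b) c" "m + sg z 1 = tmon x y z a b (Suc c)"
    unfolding abc tmon_def by (rule poly_mapping_eqI, simp add: lookup_add lookup_single when_def)+
  show False
  proof (rule no)
    show "tmon x y z (Suc a) b c \<in> E" unfolding eqs(1)[symmetric] by (rule mE) simp
    show "tmon x y z a (Suc b) c \<in> E" unfolding eqs(2)[symmetric] by (rule mE) simp
    show "tmon x y z a b (Suc c) \<in> E" unfolding eqs(3)[symmetric] by (rule mE) simp
  qed
qed

lemma exc5_nontrivial:
  assumes "distinct [x, y, z]" "{x, y, z} = {..2}"
  shows "\<not> trivial_togliatti 2 5 (mon_ideal {..2} (exc5 x y z) :: (nat, 'k::field_char_0) mpoly set)"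
  by (rule nontrivial_of_no_simplex[OF assms exc5_expo[OF assms(2)]])
    (simp, simp only: exc5_def insert_iff empty_iff tmon_eq_iff[OF assms(1)], arith)

lemma exc4_nontrivial:
  assumes "distinct [x, y, z]" "{x, y, z} = {..2}"
  shows "\<not> trivial_togliatti 2 4 (mon_ideal {..2} (exc4 x y z) :: (nat, 'k::field_char_0) mpoly set)"
  by (rule nontrivial_of_no_simplex[OF assms exc4_expo[OF assms(2)]])
    (simp, simp only: exc4_def insert_iff empty_iff tmon_eq_iff[OF assms(1)], arith)

lemma card_exc5: "distinct [x, y, z] \<Longrightarrow> card (exc5 x y z) = 5"
  unfolding exc5_def by (simp add: tmon_eq_iff card_insert_if del: distinct.simps)

lemma card_exc4: "distinct [x, y, z] \<Longrightarrow> card (exc4 x y z) = 5"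
  unfolding exc4_def by (simp add: tmon_eq_iff card_insert_if del: distinct.simps)

lemma forms_numeral: "numeral k \<in> forms V 0"
proof -
  have "Poly_Mapping.keys (sg 0 (numeral k) :: ('a, 'b) mpoly) \<subseteq> {0}"
    by (rule keys_single_subset)
  then have "Poly_Mapping.keys (numeral k :: ('a, 'b) mpoly) \<subseteq> {0}" by (simp only: single_numeral)
  then show ?thesis unfolding forms_iff by (rule order_trans) (simp add: expo_def)
qed

lemma Var_powers_mult: "Var x ^ a * Var y ^ b * Var z ^ c = (Poly_Mapping.single (tmon x y z a b c) 1 :: ('v, 'k::comm_ring_1) mpoly)"
  unfolding Var_power monic_mult by (simp add: tmon_def monic_def)

lemma numeral_mult_single: "numeral k * Poly_Mapping.single m 1 = (Poly_Mapping.single m (numeral k) :: ('v, 'k::comm_ring_1) mpoly)"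
proof -
  have "sg 0 (numeral k) * sg m 1 = (sg m (numeral k) :: ('v, 'k) mpoly)" by (simp only: mult_single) simp
  then show ?thesis by (simp only: single_numeral)
qed

lemma minimal_of_multiple_of_sum:
  fixes Q :: "(nat, 'k::field_char_0) mpoly"
  assumes xyz: "distinct [x, y, z]" "{x, y, z} = {..2}" and d: "d \<ge> 4"
    and E: "E \<subseteq> expo {..2} d" "card E = 5" "{tmon x y z d 0 0, tmon x y z 0 d 0, tmon x y z 0 0 d} \<subseteq> E"
    and Q: "Q \<in> forms {..2} (d - 1)" "Poly_Mapping.keys ((Var x + Var y + Var z) * Q) \<subseteq> E"
    "(Var x + Var y + Var z) * Q \<noteq> 0"
  shows "(mon_ideal {..2} E :: (nat, 'k) mpoly set) \<in> minimal_monomial_togliatti 2 d"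
proof (rule minimal_monomial_togliattiI)
  let ?L = "Var x + Var y + Var z :: (nat, 'k) mpoly"
  have V: "(Var i :: (nat, 'k) mpoly) \<in> forms {..2} 1" if "i \<in> {x, y, z}" for i
    using that unfolding xyz(2) by (simp add: Var_monic forms_iff expo_single)
  have L: "?L \<in> forms {..2} 1" using V by (intro forms_add) auto
  have p: "1 = lk ?L (sg i 1)" if "i \<le> 2" for i
  proof -
    have "i \<in> {x, y, z}" using that unfolding xyz(2) by simp
    then show ?thesis using xyz(1) by (auto simp: Var_monic lookup_add lookup_monic)
  qed
  have w: "weighted 2 (\<lambda>_. 1) m = (1::'k)" for m by (simp add: weighted_def)
  have lm: "lk (?L * Q) a = lmul {..2} (lk Q) a" for a
    using lookup_linear_mult[OF L p, of Q "lk Q" a] by (simp add: w)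
  have "Q \<noteq> 0" using Q(3) by auto
  then obtain m0 where m0: "lk Q m0 \<noteq> 0" by (metis lookup_zero poly_mapping_eqI)
  have "lsupp {..2} (lk Q) \<subseteq> E" using Q(2) unfolding lsupp_def by (auto simp: in_keys_iff lm)
  moreover have "(\<lambda>i. sg i d) ` {..2} \<subseteq> E" using E(3) unfolding xyz(2)[symmetric] by (auto simp: tmon_def)
  ultimately show "monomial_togliatti 2 d (mon_ideal {..2} E :: (nat, 'k) mpoly set)"
    using d E choose_lower_bound[of 2 d] m0 by (intro monomial_togliatti_mon_idealI[OF _ _ _ _ _ forms_homog[OF Q(1)]]) auto
qed (use d E in auto)

text \<open>Integer multiples are expanded into repeated sums, so that both sides of the ring
  identities below normalise to the same sums of monomials.\<close>

lemma five_mult: "(5::'a::comm_ring_1) * t = t + t + t + t + t"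
proof -
  have "(5::'a) = 1 + 1 + 1 + 1 + 1" by simp
  then show ?thesis by (simp only: distrib_right mult_1_left)
qed
lemma four_mult: "(4::'a::comm_ring_1) * t = t + t + t + t"
proof -
  have "(4::'a) = 1 + 1 + 1 + 1" by simp
  then show ?thesis by (simp only: distrib_right mult_1_left)
qed
text \<open>The first two factors give \<open>(x + y) ^ 2 - z ^ 2\<close>. Multiplied by
  \<open>(x - y) ^ 2 + z ^ 2\<close> this is \<open>(x ^ 2 - y ^ 2) ^ 2 + z ^ 2 ((x + y) ^ 2 - (x -
  y) ^ 2) - z ^ 4\<close>.\<close>

lemma quartic_identity: "(x + y + z) * ((x + y - z) * ((x - y) ^ 2 + z ^ 2)) =
   x ^ 4 + y ^ 4 - z ^ 4 + 4 * (x * y * z ^ 2) - 2 * (x ^ 2 * y ^ 2)" for x y z :: "'a::comm_ring_1"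
  unfolding four_mult mult_2 by (simp add: ring_distribs eval_nat_numeral ac_simps)
lemma fifth_power_sum: "(x + y) ^ 5 = x ^ 5 + y ^ 5 + 5 * (x * y * (x + y) ^ 3) - 5 * (x ^ 2 * y ^ 2 * (x + y))" for x y :: "'a::comm_ring_1"
  unfolding five_mult by (simp add: algebra_simps eval_nat_numeral)
lemma sum_fifth_powers: "(s + z) * (s ^ 4 - s ^ 3 * z + s ^ 2 * z ^ 2 - s * z ^ 3 + z ^ 4) = s ^ 5 + z ^ 5" for s z :: "'a::comm_ring_1"
  by (simp add: algebra_simps eval_nat_numeral)
lemma sum_cubes: "(s + z) * (s ^ 2 - s * z + z ^ 2) = s ^ 3 + z ^ 3" for s z :: "'a::comm_ring_1"
  by (simp add: algebra_simps eval_nat_numeral)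
text \<open>With \<open>s = x + y\<close> one has
  \<open>x ^ 5 + y ^ 5 = s ^ 5 - 5 x y s ^ 3 + 5 x ^ 2 y ^ 2 s\<close>. Hence the right-hand side is
  \<open>(s ^ 5 + z ^ 5) - 5 x y (s ^ 3 + z ^ 3) + 5 x ^ 2 y ^ 2 (s + z)\<close>, and each summand
  is divisible by \<open>s + z\<close>.\<close>

lemma quintic_identity: "(x + y + z) * ((x + y) ^ 4 - (x + y) ^ 3 * z + (x + y) ^ 2 * z ^ 2 - (x + y) * z ^ 3 + z ^ 4
     - 5 * (x * y * ((x + y) ^ 2 - (x + y) * z + z ^ 2)) + 5 * (x ^ 2 * y ^ 2)) =
   x ^ 5 + y ^ 5 + z ^ 5 - 5 * (x * y * z ^ 3) + 5 * (x ^ 2 * y ^ 2 * z)" for x y z :: "'a::comm_ring_1"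
proof -
  let ?s = "x + y"
  have distr: "S * (A - 5 * (q * B) + 5 * C) = S * A - 5 * (q * (S * B)) + 5 * (C * S)" for S A q B C :: 'a
    by (simp add: algebra_simps)
  have "(?s + z) * (?s ^ 4 - ?s ^ 3 * z + ?s ^ 2 * z ^ 2 - ?s * z ^ 3 + z ^ 4
     - 5 * (x * y * (?s ^ 2 - ?s * z + z ^ 2)) + 5 * (x ^ 2 * y ^ 2))
    = (?s + z) * (?s ^ 4 - ?s ^ 3 * z + ?s ^ 2 * z ^ 2 - ?s * z ^ 3 + z ^ 4)
      - 5 * (x * y * ((?s + z) * (?s ^ 2 - ?s * z + z ^ 2))) + 5 * (x ^ 2 * y ^ 2 * (?s + z))"
   
    by (rule distr)
  also have "\<dots> = ?s ^ 5 + z ^ 5 - 5 * (x * y * (?s ^ 3 + z ^ 3)) + 5 * (x ^ 2 * y ^ 2 * (?s + z))"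
    unfolding sum_fifth_powers sum_cubes ..
  also have "\<dots> = x ^ 5 + y ^ 5 + z ^ 5 - 5 * (x * y * z ^ 3) + 5 * (x ^ 2 * y ^ 2 * z)"
    unfolding fifth_power_sum by (simp add: distrib_left)
  finally show ?thesis .
qed
lemma exc4_minimal:
  assumes xyz: "distinct [x, y, z]" "{x, y, z} = {..2}"
  shows "(mon_ideal {..2} (exc4 x y z) :: (nat, 'k::field_char_0) mpoly set) \<in> minimal_monomial_togliatti 2 4"
proof -
  let ?X = "Var x :: (nat, 'k) mpoly" and ?Y = "Var y :: (nat, 'k) mpoly" and ?Z = "Var z :: (nat, 'k) mpoly"
  have m: "x \<in> {..2}" "y \<in> {..2}" "z \<in> {..2}" using xyz(2) by blast+
  have V: "?X \<in> forms {..2} 1" "?Y \<in> forms {..2} 1" "?Z \<in> forms {..2} 1"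
    unfolding Var_monic forms_iff keys_monic using m by (auto intro: expo_single simp del: One_nat_def)
  let ?Q = "(?X + ?Y - ?Z) * ((?X - ?Y) ^ 2 + ?Z ^ 2)"
  have "?Q \<in> forms {..2} (1 + 2)"
    by (intro forms_mult forms_add forms_minus forms_power V)
  moreover have "1 + 2 = (4 - 1 :: nat)" by simp
  ultimately have Q: "?Q \<in> forms {..2} (4 - 1)" by (simp only:)
  have id: "(?X + ?Y + ?Z) * ?Q = sg (tmon x y z 4 0 0) 1 + sg (tmon x y z 0 4 0) 1 + sg (tmon x y z 0 0 4) (- 1)
      + sg (tmon x y z 1 1 2) 4 + sg (tmon x y z 2 2 0) (- 2)"
  proof -
    note P = Var_powers_mult[of x _ y _ z, where 'k = 'k]
    have e: "?X ^ 4 = sg (tmon x y z 4 0 0) 1" "?Y ^ 4 = sg (tmon x y z 0 4 0) 1" "?Z ^ 4 = sg (tmon x y z 0 0 4) 1"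
      "?X * ?Y * ?Z ^ 2 = sg (tmon x y z 1 1 2) 1" "?X ^ 2 * ?Y ^ 2 = sg (tmon x y z 2 2 0) 1"
      subgoal using P[of 4 0 0] by simp
      subgoal using P[of 0 4 0] by simp
      subgoal using P[of 0 0 4] by simp
      subgoal using P[of 1 1 2] by simp
      subgoal using P[of 2 2 0] by simp
      done
    show ?thesis unfolding quartic_identity e numeral_mult_single by (simp add: single_uminus)
  qed
  have "lk ((?X + ?Y + ?Z) * ?Q) (tmon x y z 4 0 0) = 1"
    unfolding id by (simp add: lookup_add lookup_single when_def tmon_eq_iff[OF xyz(1)])
  then have n0: "(?X + ?Y + ?Z) * ?Q \<noteq> 0" by (metis lookup_zero zero_neq_one)
  have "Poly_Mapping.keys ((?X + ?Y + ?Z) * ?Q) \<subseteq> exc4 x y z"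
  proof
    fix m assume "m \<in> Poly_Mapping.keys ((?X + ?Y + ?Z) * ?Q)"
    then show "m \<in> exc4 x y z" unfolding id in_keys_iff lookup_add lookup_single when_def exc4_def
      by (auto split: if_splits)
  qed
  then show ?thesis
    using exc4_expo[OF xyz(2)] card_exc4[OF xyz(1)] by (intro minimal_of_multiple_of_sum[OF xyz _ _ _ _ Q _ n0]) (auto simp: exc4_def)
qed

lemma exc5_minimal:
  assumes xyz: "distinct [x, y, z]" "{x, y, z} = {..2}"
  shows "(mon_ideal {..2} (exc5 x y z) :: (nat, 'k::field_char_0) mpoly set) \<in> minimal_monomial_togliatti 2 5"
proof -
  \<comment> \<open>The quintic identity distinguishes its last variable, \<open>exc5\<close> its
    first one.\<close>
  let ?X = "Var y :: (nat, 'k) mpoly" and ?Y = "Var z :: (nat, 'k) mpoly" and ?Z = "Var x :: (nat, 'k) mpoly"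
  have m: "x \<in> {..2}" "y \<in> {..2}" "z \<in> {..2}" using xyz(2) by blast+
  have V: "?X \<in> forms {..2} 1" "?Y \<in> forms {..2} 1" "?Z \<in> forms {..2} 1"
    unfolding Var_monic forms_iff keys_monic using m by (auto intro: expo_single simp del: One_nat_def)
  let ?Q = "(?X + ?Y) ^ 4 - (?X + ?Y) ^ 3 * ?Z + (?X + ?Y) ^ 2 * ?Z ^ 2 - (?X + ?Y) * ?Z ^ 3 + ?Z ^ 4
     - 5 * (?X * ?Y * ((?X + ?Y) ^ 2 - (?X + ?Y) * ?Z + ?Z ^ 2)) + 5 * (?X ^ 2 * ?Y ^ 2)"
  have s: "?X + ?Y \<in> forms {..2} 1" by (intro forms_add V)
  have cast: "f \<in> forms {..2} k \<Longrightarrow> k = l \<Longrightarrow> f \<in> forms {..2} l" for f :: "(nat, 'k) mpoly" and k l by simp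
  have q1: "(?X + ?Y) ^ 4 \<in> forms {..2} 4" "?Z ^ 4 \<in> forms {..2} 4" by (rule forms_power s V)+
  have q2: "(?X + ?Y) ^ 3 * ?Z \<in> forms {..2} 4" by (rule cast[OF forms_mult[OF forms_power[OF s] V(3)]]) simp
  have q3: "(?X + ?Y) ^ 2 * ?Z ^ 2 \<in> forms {..2} 4" by (rule cast[OF forms_mult[OF forms_power[OF s] forms_power[OF V(3)]]]) simp
  have q4: "(?X + ?Y) * ?Z ^ 3 \<in> forms {..2} 4" by (rule cast[OF forms_mult[OF s forms_power[OF V(3)]]]) simp
  have q5: "(?X + ?Y) ^ 2 - (?X + ?Y) * ?Z + ?Z ^ 2 \<in> forms {..2} 2"
    by (intro forms_add forms_minus forms_power V s cast[OF forms_mult[OF s V(3)]]) simp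
  have q6: "?X * ?Y * ((?X + ?Y) ^ 2 - (?X + ?Y) * ?Z + ?Z ^ 2) \<in> forms {..2} 4"
    by (rule cast[OF forms_mult[OF forms_mult[OF V(1,2)] q5]]) simp
  have q7: "?X ^ 2 * ?Y ^ 2 \<in> forms {..2} 4" by (rule cast[OF forms_mult[OF forms_power[OF V(1)] forms_power[OF V(2)]]]) simp
  have q8: "5 * f \<in> forms {..2} 4" if "f \<in> forms {..2} 4" for f :: "(nat, 'k) mpoly"
    by (rule cast[OF forms_mult[OF forms_numeral that]]) simp
  have "?Q \<in> forms {..2} 4" by (intro forms_add forms_minus q1 q2 q3 q4 q8 q6 q7)
  then have Q: "?Q \<in> forms {..2} (5 - 1)" by simp
  have comm: "Var x + Var y + Var z = ?X + ?Y + ?Z" by (simp add: ac_simps)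
  have id: "(Var x + Var y + Var z) * ?Q = sg (tmon x y z 5 0 0) 1 + sg (tmon x y z 0 5 0) 1 + sg (tmon x y z 0 0 5) 1
      + sg (tmon x y z 3 1 1) (- 5) + sg (tmon x y z 1 2 2) 5"
  proof -
    note P = Var_powers_mult[of x _ y _ z, where 'k = 'k]
    have e: "?Z ^ 5 = sg (tmon x y z 5 0 0) 1" "?X ^ 5 = sg (tmon x y z 0 5 0) 1" "?Y ^ 5 = sg (tmon x y z 0 0 5) 1"
      "?X * ?Y * ?Z ^ 3 = sg (tmon x y z 3 1 1) 1" "?X ^ 2 * ?Y ^ 2 * ?Z = sg (tmon x y z 1 2 2) 1"
      subgoal using P[of 5 0 0] by simp
      subgoal using P[of 0 5 0] by simp
      subgoal using P[of 0 0 5] by simp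
      subgoal using P[of 3 1 1] by (simp add: ac_simps)
      subgoal using P[of 1 2 2] by (simp add: ac_simps)
      done
    show ?thesis unfolding comm quintic_identity e numeral_mult_single by (simp add: single_uminus)
  qed
  have "lk ((Var x + Var y + Var z) * ?Q) (tmon x y z 5 0 0) = 1"
    unfolding id by (simp add: lookup_add lookup_single when_def tmon_eq_iff[OF xyz(1)])
  then have n0: "(Var x + Var y + Var z) * ?Q \<noteq> 0" by (metis lookup_zero zero_neq_one)
  have "Poly_Mapping.keys ((Var x + Var y + Var z) * ?Q) \<subseteq> exc5 x y z"
  proof
    fix m assume "m \<in> Poly_Mapping.keys ((Var x + Var y + Var z) * ?Q)"
    then show "m \<in> exc5 x y z" unfolding id in_keys_iff lookup_add lookup_single when_def exc5_def
      by (auto split: if_splits)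
  qed
  then show ?thesis
    using exc5_expo[OF xyz(2)] card_exc5[OF xyz(1)] by (intro minimal_of_multiple_of_sum[OF xyz _ _ _ _ Q _ n0]) (auto simp: exc5_def)
qed

section \<open>Evaluation with values in another ring\<close>

definition ring_morph :: "('k::comm_ring_1 \<Rightarrow> 'r::comm_ring_1) \<Rightarrow> bool" where
  "ring_morph \<phi> \<longleftrightarrow> \<phi> 0 = 0 \<and> \<phi> 1 = 1 \<and> (\<forall>a b. \<phi> (a + b) = \<phi> a + \<phi> b) \<and> (\<forall>a b. \<phi> (a * b) = \<phi> a * \<phi> b)"

lemma ring_morph_simps:
  assumes "ring_morph \<phi>"
  shows "\<phi> 0 = 0" "\<phi> 1 = 1" "\<phi> (a + b) = \<phi> a + \<phi> b" "\<phi> (a * b) = \<phi> a * \<phi> b"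
  using assms by (auto simp: ring_morph_def)

lemma ring_morph_sum: "ring_morph \<phi> \<Longrightarrow> \<phi> (sum f S) = (\<Sum>x\<in>S. \<phi> (f x))"
  by (induction S rule: infinite_finite_induct) (simp_all add: ring_morph_simps)

lemma ring_morph_power: "ring_morph \<phi> \<Longrightarrow> \<phi> (a ^ k) = \<phi> a ^ k"
  by (induction k) (simp_all add: ring_morph_simps)

lemma ring_morph_prod: "ring_morph \<phi> \<Longrightarrow> \<phi> (prod f S) = (\<Prod>x\<in>S. \<phi> (f x))"
  by (induction S rule: infinite_finite_induct) (simp_all add: ring_morph_simps)

text \<open>One construction serves for evaluation at points (\<open>\<phi>\<close> the identity),
  along polynomial curves (\<open>\<phi>\<close> the constant polynomials) and for the substitution
  of monomials (\<open>\<phi>\<close> the constants of a polynomial ring).\<close>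

definition eval_hom :: "('k::comm_ring_1 \<Rightarrow> 'r::comm_ring_1) \<Rightarrow> ('v, 'k) mpoly \<Rightarrow> ('v \<Rightarrow> 'r) \<Rightarrow> 'r" where
  "eval_hom \<phi> f q = (\<Sum>m\<in>Poly_Mapping.keys f. \<phi> (Poly_Mapping.lookup f m) * mon_eval m q)"

lemma mpoly_eval_eq_eval_hom: "mpoly_eval = eval_hom (\<lambda>c. c)"
  by (intro ext) (simp add: mpoly_eval_def eval_hom_def)

lemma mon_eval_add: "mon_eval (a + b) q = mon_eval a q * mon_eval b q"
proof -
  let ?V = "Poly_Mapping.keys a \<union> Poly_Mapping.keys b"
  have "mon_eval (a + b) q = (\<Prod>v\<in>?V. q v ^ lk (a + b) v)" by (rule mon_eval_eq) (simp_all add: keys_add_nat)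
  also have "\<dots> = (\<Prod>v\<in>?V. q v ^ lk a v) * (\<Prod>v\<in>?V. q v ^ lk b v)"
    by (simp add: lookup_add power_add prod.distrib)
  also have "\<dots> = mon_eval a q * mon_eval b q" by (simp add: mon_eval_eq[of ?V])
  finally show ?thesis .
qed

lemma mon_eval_zero [simp]: "mon_eval 0 q = 1"
  by (simp add: mon_eval_def)

lemma mon_eval_single [simp]: "mon_eval (Poly_Mapping.single v k) q = q v ^ k"
  by (cases "k = 0") (simp_all add: mon_eval_def)

lemma mon_eval_scale: "mon_eval m (\<lambda>v. c * q v) = c ^ mdeg m * mon_eval m q"
  by (simp add: mon_eval_def mdeg_def power_mult_distrib prod.distrib power_sum)

lemma mon_eval_cong: "(\<And>v. v \<in> Poly_Mapping.keys m \<Longrightarrow> p v = q v) \<Longrightarrow> mon_eval m p = mon_eval m q"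
  unfolding mon_eval_def by (intro prod.cong) auto

lemma ring_morph_mon_eval: "ring_morph \<psi> \<Longrightarrow> \<psi> (mon_eval m q) = mon_eval m (\<lambda>v. \<psi> (q v))"
  unfolding mon_eval_def by (simp add: ring_morph_prod ring_morph_power)

lemma eval_hom_superset:
  assumes "ring_morph \<phi>" "finite S" "Poly_Mapping.keys f \<subseteq> S"
  shows "eval_hom \<phi> f q = (\<Sum>m\<in>S. \<phi> (Poly_Mapping.lookup f m) * mon_eval m q)"
  unfolding eval_hom_def
  by (rule sum.mono_neutral_left) (use assms in \<open>auto simp: in_keys_iff ring_morph_simps\<close>)

lemma eval_hom_add:
  assumes "ring_morph \<phi>"
  shows "eval_hom \<phi> (f + g) q = eval_hom \<phi> f q + eval_hom \<phi> g q"
proof -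
  let ?S = "Poly_Mapping.keys f \<union> Poly_Mapping.keys g"
  have "eval_hom \<phi> (f + g) q = (\<Sum>m\<in>?S. \<phi> (lk (f + g) m) * mon_eval m q)"
    by (rule eval_hom_superset[OF assms]) (use Poly_Mapping.keys_add[of f g] in auto)
  also have "\<dots> = (\<Sum>m\<in>?S. \<phi> (lk f m) * mon_eval m q) + (\<Sum>m\<in>?S. \<phi> (lk g m) * mon_eval m q)"
    by (simp add: lookup_add ring_morph_simps[OF assms] distrib_right sum.distrib)
  also have "\<dots> = eval_hom \<phi> f q + eval_hom \<phi> g q" by (simp add: eval_hom_superset[OF assms, of ?S])
  finally show ?thesis .
qed

lemma eval_hom_zero [simp]: "eval_hom \<phi> 0 q = 0"
  by (simp add: eval_hom_def)

lemma eval_hom_sum: "ring_morph \<phi> \<Longrightarrow> eval_hom \<phi> (sum f S) q = (\<Sum>x\<in>S. eval_hom \<phi> (f x) q)"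
  by (induction S rule: infinite_finite_induct) (simp_all add: eval_hom_add)

lemma eval_hom_single:
  assumes "ring_morph \<phi>" shows "eval_hom \<phi> (Poly_Mapping.single m c) q = \<phi> c * mon_eval m q"
  by (subst eval_hom_superset[OF assms, of "{m}"]) auto

lemma eval_hom_mult:
  assumes "ring_morph \<phi>"
  shows "eval_hom \<phi> (f * g) q = eval_hom \<phi> f q * eval_hom \<phi> g q"
proof -
  have "f * g = (\<Sum>a\<in>Poly_Mapping.keys f. sg a (lk f a)) * (\<Sum>b\<in>Poly_Mapping.keys g. sg b (lk g b))"
    using poly_mapping_sum_singles[of f] poly_mapping_sum_singles[of g] by simp
  also have "\<dots> = (\<Sum>a\<in>Poly_Mapping.keys f. \<Sum>b\<in>Poly_Mapping.keys g. sg (a + b) (lk f a * lk g b))"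
    by (simp add: sum_product mult_single)
  finally have "eval_hom \<phi> (f * g) q = (\<Sum>a\<in>Poly_Mapping.keys f. \<Sum>b\<in>Poly_Mapping.keys g. \<phi> (lk f a * lk g b) * mon_eval (a + b) q)"
    by (simp add: eval_hom_sum[OF assms] eval_hom_single[OF assms])
  also have "\<dots> = (\<Sum>a\<in>Poly_Mapping.keys f. \<Sum>b\<in>Poly_Mapping.keys g. (\<phi> (lk f a) * mon_eval a q) * (\<phi> (lk g b) * mon_eval b q))"
    by (simp add: ring_morph_simps[OF assms] mon_eval_add mult_ac)
  also have "\<dots> = eval_hom \<phi> f q * eval_hom \<phi> g q" by (simp add: eval_hom_def sum_product)
  finally show ?thesis .
qed

lemma eval_hom_one: "ring_morph \<phi> \<Longrightarrow> eval_hom \<phi> 1 q = 1"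
  using eval_hom_single[of \<phi> 0 1 q] by (simp add: ring_morph_simps)

lemma eval_hom_morph: "ring_morph \<phi> \<Longrightarrow> ring_morph (\<lambda>f. eval_hom \<phi> f q)"
  unfolding ring_morph_def[of "\<lambda>f. eval_hom \<phi> f q"] by (simp add: eval_hom_add eval_hom_mult eval_hom_one)

lemma eval_hom_compose:
  assumes "ring_morph \<psi>" "\<And>c. \<psi> (\<phi> c) = \<chi> c"
  shows "\<psi> (eval_hom \<phi> f q) = eval_hom \<chi> f (\<lambda>v. \<psi> (q v))"
  unfolding eval_hom_def by (simp add: ring_morph_sum[OF assms(1)] ring_morph_simps[OF assms(1)] ring_morph_mon_eval[OF assms(1)] assms(2))

lemma eval_hom_scale:
  assumes "f \<in> forms V t" shows "eval_hom \<phi> f (\<lambda>v. c * q v) = c ^ t * eval_hom \<phi> f q"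
  unfolding eval_hom_def sum_distrib_left
  by (rule sum.cong) (use assms in \<open>auto simp: forms_iff expo_def mon_eval_scale mult_ac\<close>)

lemma ring_morph_id: "ring_morph (\<lambda>c. c)"
  by (simp add: ring_morph_def)

lemma ring_morph_const_poly: "ring_morph (\<lambda>c. [:c:])"
  by (simp add: ring_morph_def one_pCons)

lemma ring_morph_poly: "ring_morph (\<lambda>p. poly p t)"
  by (simp add: ring_morph_def)

lemma ring_morph_single: "ring_morph (Poly_Mapping.single 0 :: 'k::comm_ring_1 \<Rightarrow> ('v, 'k) mpoly)"
  by (simp add: ring_morph_def single_add mult_single)

lemma ring_morph_mpoly_eval: "ring_morph (\<lambda>f. mpoly_eval f q)"
  unfolding mpoly_eval_eq_eval_hom by (rule eval_hom_morph[OF ring_morph_id])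

section \<open>Curves and tangent vectors\<close>

abbreviation curve_eval :: "('v, 'k::comm_ring_1) mpoly \<Rightarrow> ('v \<Rightarrow> 'k poly) \<Rightarrow> 'k poly" where
  "curve_eval \<equiv> eval_hom (\<lambda>c. [:c:])"

lemma poly_curve_eval: "poly (curve_eval f q) t = mpoly_eval f (\<lambda>v. poly (q v) t)"
  unfolding mpoly_eval_eq_eval_hom by (rule eval_hom_compose[OF ring_morph_poly]) simp

lemma mpoly_eval_partial:
  "mpoly_eval (mpoly_partial v f) p
    = (\<Sum>m\<in>Poly_Mapping.keys f. of_nat (Poly_Mapping.lookup m v) * Poly_Mapping.lookup f m * mon_eval (m - Poly_Mapping.single v 1) p)"
  unfolding mpoly_partial_def mpoly_eval_eq_eval_hom
  by (simp add: eval_hom_sum[OF ring_morph_id] eval_hom_single[OF ring_morph_id])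

text \<open>It is used in both directions: curves on \<open>X\<close> produce tangent vectors, and
  equations differentiated along a line restrict them.\<close>

lemma chain_rule:
  fixes f :: "('v, 'k::field_char_0) mpoly"
  assumes V: "finite V" and f: "f \<in> carrier (mpoly_ring V)"
  shows "poly (pderiv (curve_eval f q)) t
    = (\<Sum>v\<in>V. mpoly_eval (mpoly_partial v f) (\<lambda>u. poly (q u) t) * poly (pderiv (q v)) t)"
proof -
  define p where "p u = poly (q u) t" for u
  have kV: "Poly_Mapping.keys m \<subseteq> V" if "m \<in> Poly_Mapping.keys f" for m using that f by (simp add: carrier_mpoly_ring)
  have one: "poly (pderiv ([:lk f m:] * mon_eval m q)) t
      = (\<Sum>v\<in>V. of_nat (lk m v) * lk f m * mon_eval (m - sg v 1) p * poly (pderiv (q v)) t)" if m: "m \<in> Poly_Mapping.keys f" for m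
  proof -
    have me: "mon_eval m q = (\<Prod>v\<in>V. q v ^ lk m v)" by (rule mon_eval_eq[OF V kV[OF m]])
    have "poly (pderiv ([:lk f m:] * mon_eval m q)) t
        = lk f m * (\<Sum>v\<in>V. (\<Prod>u\<in>V - {v}. p u ^ lk m u) * poly (pderiv (q v ^ lk m v)) t)"
      unfolding me by (simp add: pderiv_smult pderiv_prod poly_sum poly_prod p_def)
    also have "\<dots> = (\<Sum>v\<in>V. of_nat (lk m v) * lk f m * mon_eval (m - sg v 1) p * poly (pderiv (q v)) t)"
      unfolding sum_distrib_left
    proof (rule sum.cong[OF refl])
      fix v assume v: "v \<in> V"
      have "mon_eval (m - sg v 1) p = (\<Prod>u\<in>V. p u ^ lk (m - sg v 1) u)"
        by (rule mon_eval_eq[OF V]) (use keys_diff_nat[of m "sg v 1"] kV[OF m] in blast)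
      also have "\<dots> = p v ^ lk (m - sg v 1) v * (\<Prod>u\<in>V - {v}. p u ^ lk (m - sg v 1) u)" by (rule prod.remove[OF V v])
      also have "(\<Prod>u\<in>V - {v}. p u ^ lk (m - sg v 1) u) = (\<Prod>u\<in>V - {v}. p u ^ lk m u)"
        by (rule prod.cong) (auto simp: lookup_minus lookup_single when_def)
      finally have mv: "mon_eval (m - sg v 1) p = p v ^ (lk m v - 1) * (\<Prod>u\<in>V - {v}. p u ^ lk m u)"
        by (simp add: lookup_minus)
      have "poly (pderiv (q v ^ lk m v)) t = of_nat (lk m v) * p v ^ (lk m v - 1) * poly (pderiv (q v)) t"
        by (simp add: pderiv_power p_def)
      then show "lk f m * ((\<Prod>u\<in>V - {v}. p u ^ lk m u) * poly (pderiv (q v ^ lk m v)) t)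
          = of_nat (lk m v) * lk f m * mon_eval (m - sg v 1) p * poly (pderiv (q v)) t"
        unfolding mv by (simp add: mult_ac)
    qed
    finally show ?thesis .
  qed
  have "poly (pderiv (curve_eval f q)) t = (\<Sum>m\<in>Poly_Mapping.keys f. poly (pderiv ([:lk f m:] * mon_eval m q)) t)"
    unfolding eval_hom_def higher_pderiv_sum[of 1, simplified] poly_sum ..
  also have "\<dots> = (\<Sum>m\<in>Poly_Mapping.keys f. \<Sum>v\<in>V. of_nat (lk m v) * lk f m * mon_eval (m - sg v 1) p * poly (pderiv (q v)) t)"
    by (rule sum.cong[OF refl one])
  also have "\<dots> = (\<Sum>v\<in>V. mpoly_eval (mpoly_partial v f) p * poly (pderiv (q v)) t)"
    unfolding mpoly_eval_partial sum_distrib_right by (rule sum.swap)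
  finally show ?thesis by (simp add: p_def[abs_def])
qed

section \<open>The variety of a set of monomials\<close>

definition torus_set :: "nat \<Rightarrow> (nat \<Rightarrow>\<^sub>0 nat) set \<Rightarrow> ((nat \<Rightarrow>\<^sub>0 nat) \<Rightarrow> 'k::comm_ring_1) set" where
  "torus_set n A = hcoords A \<inter> (\<lambda>x m. if m \<in> A then mon_eval m x else 0) ` hcoords {..n}"

definition toric_variety :: "nat \<Rightarrow> (nat \<Rightarrow>\<^sub>0 nat) set \<Rightarrow> ((nat \<Rightarrow>\<^sub>0 nat) \<Rightarrow> 'k::comm_ring_1) set" where
  "toric_variety n A = zariski_closure A (torus_set n A)"

text \<open>Substitution of the monomials themselves for the coordinates, the ring map dual to the
  parametrisation of \<open>X\<close>.\<close>

definition pull :: "(nat \<Rightarrow>\<^sub>0 nat, 'k::comm_ring_1) mpoly \<Rightarrow> (nat, 'k) mpoly" where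
  "pull f = eval_hom (Poly_Mapping.single 0) f monic"

lemma mpoly_eval_monic: "mpoly_eval (monic m) x = mon_eval m x"
  unfolding mpoly_eval_eq_eval_hom monic_def by (simp add: eval_hom_single[OF ring_morph_id])

lemma mpoly_eval_pull: "mpoly_eval (pull f) x = mpoly_eval f (\<lambda>m. mon_eval m x)"
proof -
  have "mpoly_eval (pull f) x = eval_hom (\<lambda>c. c) f (\<lambda>v. mpoly_eval (monic v) x)"
    unfolding pull_def
    by (rule eval_hom_compose[OF ring_morph_mpoly_eval]) (simp add: mpoly_eval_eq_eval_hom eval_hom_single[OF ring_morph_id])
  then show ?thesis unfolding mpoly_eval_monic unfolding mpoly_eval_eq_eval_hom .
qed

lemma pull_add: "pull (f + g) = pull f + pull g"
  unfolding pull_def by (rule eval_hom_add[OF ring_morph_single])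

lemma pull_sum: "pull (sum f S) = (\<Sum>x\<in>S. pull (f x))"
  unfolding pull_def by (rule eval_hom_sum[OF ring_morph_single])

lemma pull_const_mult: "pull (Poly_Mapping.single 0 c * f) = Poly_Mapping.single 0 c * pull f"
  unfolding pull_def eval_hom_mult[OF ring_morph_single] by (simp add: eval_hom_single[OF ring_morph_single])

lemma forms_sum: "(\<And>x. x \<in> S \<Longrightarrow> f x \<in> forms V t) \<Longrightarrow> (\<Sum>x\<in>S. f x) \<in> forms V t"
  by (induction S rule: infinite_finite_induct) (auto intro: forms_add simp: forms_iff[of 0])

lemma forms_const: "Poly_Mapping.single 0 c \<in> forms V 0"
  unfolding forms_iff by (rule order_trans[OF keys_single_subset]) (simp add: expo_def)

lemma forms_prod: "(\<And>x. x \<in> S \<Longrightarrow> f x \<in> forms V (g x)) \<Longrightarrow> (\<Prod>x\<in>S. f x) \<in> forms V (\<Sum>x\<in>S. g x)"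
proof (induction S rule: infinite_finite_induct)
  case (insert x S) then show ?case by (auto intro: forms_mult)
qed (simp_all add: forms_iff expo_def)

lemma monic_forms: "m \<in> expo V t \<Longrightarrow> monic m \<in> forms V t"
  by (simp add: forms_iff)

lemma mon_eval_monic_forms:
  assumes A: "A \<subseteq> expo V d" and \<mu>: "\<mu> \<in> expo A t"
  shows "mon_eval \<mu> monic \<in> forms V (t * d)"
proof -
  have "mon_eval \<mu> monic \<in> forms V (\<Sum>a\<in>Poly_Mapping.keys \<mu>. lk \<mu> a * d)"
    unfolding mon_eval_def
    by (rule forms_prod, rule forms_pow, rule monic_forms) (use A \<mu> in \<open>auto simp: expo_def subset_iff\<close>)
  then show ?thesis using \<mu> by (simp add: sum_distrib_right[symmetric] expo_def mdeg_def)
qed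

lemma pull_forms:
  assumes A: "A \<subseteq> expo {..n} d" and f: "f \<in> forms A t"
  shows "pull f \<in> forms {..n} (t * d)"
  unfolding pull_def eval_hom_def
proof (rule forms_sum)
  fix \<mu> assume "\<mu> \<in> Poly_Mapping.keys f"
  then have "\<mu> \<in> expo A t" using f by (auto simp: forms_iff)
  from forms_mult[OF forms_const mon_eval_monic_forms[OF A this]]
  show "sg 0 (lk f \<mu>) * mon_eval \<mu> monic \<in> forms {..n} (t * d)" by simp
qed

text \<open>If \<open>pull f\<close> were nonzero, it would be nonzero at some point of the torus,
  and the image of this point is a point of \<open>torus_set\<close> at which \<open>f\<close> does
  not vanish.\<close>

lemma pull_eq_0_of_vanishing:
  fixes f :: "(nat \<Rightarrow>\<^sub>0 nat, 'k::field_char_0) mpoly"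
  assumes A: "A \<subseteq> expo {..n} d" "A \<noteq> {}" and f: "f \<in> vanishing_forms A (torus_set n A)"
  shows "pull f = 0"
proof (rule ccontr)
  assume "pull f \<noteq> 0"
  obtain t where t: "f \<in> forms A t" using f by (auto simp: vanishing_forms_def)
  obtain x where x: "\<forall>v. x v \<noteq> 0" "mpoly_eval (pull f) x \<noteq> 0"
    using mpoly_nonvanishing_point[OF _ forms_carrier[OF pull_forms[OF A(1) t]] \<open>pull f \<noteq> 0\<close>] by auto
  \<comment> \<open>Points of projective space are represented by vectors that are 0 outside the
    index set, so the point is cut off beyond \<open>n\<close>.\<close>
  define y where "y i = (if i \<le> n then x i else 0)" for i
  define p where "p m = (if m \<in> A then mon_eval m y else 0)" for m
  have yx: "mon_eval m y = mon_eval m x" if "m \<in> A" for m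
    by (rule mon_eval_cong) (use that A(1) in \<open>auto simp: expo_def y_def subset_iff\<close>)
  have "y \<in> hcoords {..n}" using x(1) by (auto simp: hcoords_def y_def)
  moreover have "p \<in> hcoords A"
  proof -
    obtain m where m: "m \<in> A" using A(2) by blast
    have "mon_eval m x \<noteq> 0" using x(1) by (simp add: mon_eval_def)
    then have "p m \<noteq> 0" using m by (simp add: p_def yx[OF m])
    then show ?thesis using m by (auto simp: hcoords_def p_def)
  qed
  ultimately have "p \<in> torus_set n A" unfolding torus_set_def p_def[abs_def] by blast
  then have "mpoly_eval f p = 0" using f by (simp add: vanishing_forms_def)
  moreover have "mpoly_eval f p = mpoly_eval f (\<lambda>m. mon_eval m x)"
    by (rule mpoly_eval_cong[OF forms_carrier[OF t]]) (simp add: p_def yx)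
  ultimately show False using x(2) by (simp add: mpoly_eval_pull)
qed

lemma torus_point_in:
  fixes x :: "nat \<Rightarrow> 'k::idom"
  assumes A: "A \<subseteq> expo {..n} d" "A \<noteq> {}" and x: "\<And>i. i \<le> n \<Longrightarrow> x i \<noteq> 0"
  shows "(\<lambda>m. if m \<in> A then mon_eval m x else 0) \<in> toric_variety n A"
proof -
  define y where "y i = (if i \<le> n then x i else 0)" for i
  have yx: "mon_eval m y = mon_eval m x" if "m \<in> A" for m
    by (rule mon_eval_cong) (use that A(1) in \<open>auto simp: expo_def y_def subset_iff\<close>)
  let ?p = "\<lambda>m. if m \<in> A then mon_eval m x else 0"
  have p: "?p = (\<lambda>m. if m \<in> A then mon_eval m y else 0)" using yx by auto
  have "y \<in> hcoords {..n}" using x[of 0] by (auto simp: hcoords_def y_def)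
  moreover have h: "?p \<in> hcoords A"
  proof -
    obtain m where m: "m \<in> A" using A(2) by blast
    have "Poly_Mapping.keys m \<subseteq> {..n}" using m A(1) by (auto simp: expo_def)
    then have "mon_eval m x \<noteq> 0" using x by (auto simp: mon_eval_def)
    then show ?thesis using m by (auto simp: hcoords_def)
  qed
  ultimately have "?p \<in> torus_set n A" unfolding torus_set_def using p by blast
  then show ?thesis using h unfolding toric_variety_def zariski_closure_def vanishing_forms_def by blast
qed

lemma vanishing_of_pull_eq_0:
  fixes f :: "(nat \<Rightarrow>\<^sub>0 nat, 'k::comm_ring_1) mpoly"
  assumes f: "f \<in> forms A t" "pull f = 0" and p: "p \<in> toric_variety n A"
  shows "mpoly_eval f p = 0"
proof -
  have "f \<in> vanishing_forms A (torus_set n A)"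
    unfolding vanishing_forms_def
  proof (intro CollectI conjI ballI)
    show "\<exists>t. f \<in> forms A t" using f(1) by blast
    fix q :: "(nat \<Rightarrow>\<^sub>0 nat) \<Rightarrow> 'k" assume "q \<in> torus_set n A"
    then obtain x where x: "q = (\<lambda>m. if m \<in> A then mon_eval m x else 0)" unfolding torus_set_def by blast
    have "mpoly_eval f q = mpoly_eval f (\<lambda>m. mon_eval m x)"
      by (rule mpoly_eval_cong[OF forms_carrier[OF f(1)]]) (simp add: x)
    then show "mpoly_eval f q = 0" unfolding mpoly_eval_pull[symmetric] f(2) by (simp add: mpoly_eval_def)
  qed
  then show ?thesis using p by (simp add: toric_variety_def zariski_closure_def)
qed

text \<open>Passing to the closure adds no conditions, so the equations of \<open>X\<close> are the
  forms in the kernel of a ring map; questions about \<open>X\<close> become identities between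
  polynomials in \<open>n + 1\<close> variables.\<close>

lemma vanishing_forms_toric_variety:
  fixes A :: "(nat \<Rightarrow>\<^sub>0 nat) set"
  assumes A: "A \<subseteq> expo {..n} d" "A \<noteq> {}"
  shows "vanishing_forms A (toric_variety n A :: (_ \<Rightarrow> 'k::field_char_0) set) = {f. (\<exists>t. f \<in> forms A t) \<and> pull f = 0}"
proof (intro equalityI subsetI)
  fix f :: "(nat \<Rightarrow>\<^sub>0 nat, 'k) mpoly" assume f: "f \<in> vanishing_forms A (toric_variety n A)"
  have "torus_set n A \<subseteq> (toric_variety n A :: (_ \<Rightarrow> 'k) set)"
    unfolding toric_variety_def zariski_closure_def torus_set_def vanishing_forms_def by auto
  then have "f \<in> vanishing_forms A (torus_set n A)" using f by (auto simp: vanishing_forms_def)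
  then show "f \<in> {f. (\<exists>t. f \<in> forms A t) \<and> pull f = 0}"
    using pull_eq_0_of_vanishing[OF A] f by (auto simp: vanishing_forms_def)
next
  fix f :: "(nat \<Rightarrow>\<^sub>0 nat, 'k) mpoly" assume f: "f \<in> {f. (\<exists>t. f \<in> forms A t) \<and> pull f = 0}"
  then show "f \<in> vanishing_forms A (toric_variety n A)"
    using vanishing_of_pull_eq_0[where A = A and n = n] unfolding vanishing_forms_def by blast
qed

text \<open>The number of monomials of degree \<open>e\<close> in \<open>n + 1\<close> variables grows like \<open>e ^ n\<close>, so there is an
  algebraic relation between any \<open>n + 1\<close> homogeneous rational functions of degree zero.\<close>

lemma alg_indep_bound:
  fixes A :: "(nat \<Rightarrow>\<^sub>0 nat) set"
  assumes A: "A \<subseteq> expo {..n} d"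
    and G: "G \<in> forms A e" and F: "\<And>i. i < s \<Longrightarrow> F i \<in> forms A e"
    and ind: "alg_indep_on {p \<in> (toric_variety n A :: (_ \<Rightarrow> 'k::field_char_0) set). mpoly_eval G p \<noteq> 0} s
      (\<lambda>i p. mpoly_eval (F i) p / mpoly_eval G p)"
  shows "s \<le> n"
proof (rule ccontr)
  assume "\<not> s \<le> n"
  then have s: "n < s" by simp
  \<comment> \<open>The constants are chosen for the count: \<open>(N + 1) ^ (n + 1)\<close>
    products of \<open>n + 1\<close> functions with exponents up to \<open>N\<close> have total
    degree at most \<open>D\<close>. Cleared of denominators and pulled back, they lie in a space of
    dimension at most \<open>(n + D * e * d) ^ n \<le> (C * (N + 1)) ^ n = N * (N + 1) ^ n\<close>,
    which is smaller.\<close>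
  define C where "C = n + e * (n + 1) * d"
  define N where "N = C ^ n"
  define D where "D = (n + 1) * N"
  define mk :: "(nat \<Rightarrow> nat) \<Rightarrow> (nat \<Rightarrow>\<^sub>0 nat)" where "mk g = Abs_poly_mapping (\<lambda>i. if i \<le> n then g i else 0)" for g
  have lmk: "lk (mk g) = (\<lambda>i. if i \<le> n then g i else 0)" for g
    unfolding mk_def by (rule lookup_Abs_poly_mapping) (rule finite_subset[of _ "{..n}"], auto)
  define K where "K = mk ` (PiE {..n} (\<lambda>_. {..N}))"
  have finK: "finite K" unfolding K_def by (intro finite_imageI finite_PiE) auto
  have cardK: "card K = (N + 1) ^ (n + 1)"
  proof -
    have "inj_on mk (PiE {..n} (\<lambda>_. {..N}))"
    proof (rule inj_onI)
      fix g h assume gh: "g \<in> PiE {..n} (\<lambda>_. {..N})" "h \<in> PiE {..n} (\<lambda>_. {..N})" "mk g = mk h"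
      show "g = h"
      proof
        fix i
        have "lk (mk g) i = lk (mk h) i" using gh(3) by simp
        then show "g i = h i" using gh(1,2) by (cases "i \<le> n") (auto simp: lmk PiE_def extensional_def)
      qed
    qed
    then show ?thesis by (simp add: K_def card_image card_PiE)
  qed
  have kK: "Poly_Mapping.keys \<kappa> \<subseteq> {..n}" if "\<kappa> \<in> K" for \<kappa> using that by (auto simp: K_def in_keys_iff lmk split: if_splits)
  have dK: "mdeg \<kappa> \<le> D" if "\<kappa> \<in> K" for \<kappa>
  proof -
    have "mdeg \<kappa> = (\<Sum>i\<le>n. lk \<kappa> i)" by (rule mdeg_eq_sum[OF _ kK[OF that]]) simp
    also have "\<dots> \<le> (\<Sum>i\<le>n. N)" by (rule sum_mono) (use that in \<open>auto simp: K_def lmk PiE_def Pi_def\<close>)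
    finally show ?thesis by (simp add: D_def)
  qed
  \<comment> \<open>The monomial \<open>\<kappa>\<close> in the functions \<open>F i / G\<close>,
    multiplied by \<open>G ^ D\<close> to give a form of the degree \<open>D * e\<close> common to
    all \<open>\<kappa>\<close>.\<close>
  define \<Phi> where "\<Phi> \<kappa> = mon_eval \<kappa> F * G ^ (D - mdeg \<kappa>)" for \<kappa>
  have \<Phi>: "\<Phi> \<kappa> \<in> forms A (D * e)" if "\<kappa> \<in> K" for \<kappa>
  proof -
    have "mon_eval \<kappa> F \<in> forms A (\<Sum>i\<in>Poly_Mapping.keys \<kappa>. lk \<kappa> i * e)"
      unfolding mon_eval_def by (rule forms_prod, rule forms_pow, rule F) (use kK[OF that] s in auto)
    then have "mon_eval \<kappa> F \<in> forms A (mdeg \<kappa> * e)" by (simp add: sum_distrib_right[symmetric] mdeg_def)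
    from forms_mult[OF this forms_pow[OF G, of "D - mdeg \<kappa>"]]
    have "\<Phi> \<kappa> \<in> forms A (mdeg \<kappa> * e + (D - mdeg \<kappa>) * e)" by (simp only: \<Phi>_def)
    moreover have "mdeg \<kappa> * e + (D - mdeg \<kappa>) * e = D * e" using dK[OF that] by (simp flip: distrib_right)
    ultimately show ?thesis by simp
  qed
  define B where "B = expo {..n} (D * e * d)"
  have "card B = (n + D * e * d) choose n" using card_expo[of n "D * e * d"] by (simp add: B_def lessThan_Suc_atMost)
  also have "\<dots> \<le> (n + D * e * d) ^ n" by (cases "n \<le> n + D * e * d") (auto intro: binomial_le_pow)
  also have "n + D * e * d \<le> C * (N + 1)" by (simp add: C_def D_def algebra_simps)
  then have "(n + D * e * d) ^ n \<le> (C * (N + 1)) ^ n" by (rule power_mono) simp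
  also have "\<dots> = N * (N + 1) ^ n" by (simp only: power_mult_distrib) (simp only: N_def)
  also have "\<dots> < (N + 1) ^ (n + 1)" by simp
  finally have cB: "card B < card K" unfolding cardK .
  have finB: "finite B" by (simp add: B_def finite_expo)
  from homogeneous_system_solution[OF finB finK cB, of "\<lambda>b \<kappa>. lk (pull (\<Phi> \<kappa>)) b"]
  obtain h :: "(nat \<Rightarrow>\<^sub>0 nat) \<Rightarrow> 'k" where h: "\<exists>\<kappa>\<in>K. h \<kappa> \<noteq> 0" "\<forall>b\<in>B. (\<Sum>\<kappa>\<in>K. lk (pull (\<Phi> \<kappa>)) b * h \<kappa>) = 0" by blast
  define H where "H = (\<Sum>\<kappa>\<in>K. sg \<kappa> (h \<kappa>))"
  have lH: "lk H \<kappa> = (if \<kappa> \<in> K then h \<kappa> else 0)" for \<kappa>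
  proof -
    have "lk H \<kappa> = (\<Sum>j\<in>K. if j = \<kappa> then h j else 0)" unfolding H_def lookup_sum by (rule sum.cong) (auto simp: lookup_single when_def)
    then show ?thesis using finK by simp
  qed
  have H0: "H \<noteq> 0" using h(1) lH by (metis lookup_zero)
  have "Poly_Mapping.keys H \<subseteq> K" by (auto simp: in_keys_iff lH split: if_splits)
  then have Hc: "H \<in> carrier (mpoly_ring {..<s})" using kK s unfolding carrier_mpoly_ring by fastforce
  obtain p where p: "p \<in> toric_variety n A" "mpoly_eval G p \<noteq> 0"
    "mpoly_eval H (\<lambda>i. mpoly_eval (F i) p / mpoly_eval G p) \<noteq> 0"
    using ind Hc H0 unfolding alg_indep_on_def by blast
  \<comment> \<open>The form \<open>W\<close> is \<open>G ^ D\<close> times the value of the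
    relation \<open>H\<close>; it pulls back to 0 and so vanishes on \<open>X\<close>, although
    neither factor is zero at \<open>p\<close>.\<close>
  define W where "W = (\<Sum>\<kappa>\<in>K. sg 0 (h \<kappa>) * \<Phi> \<kappa>)"
  have W: "W \<in> forms A (D * e)" unfolding W_def
    by (rule forms_sum) (use forms_mult[OF forms_const \<Phi>] in simp)
  have "pull W = 0"
  proof (rule poly_mapping_eqI)
    fix b
    have l: "lk (pull W) b = (\<Sum>\<kappa>\<in>K. h \<kappa> * lk (pull (\<Phi> \<kappa>)) b)"
      unfolding W_def pull_sum pull_const_mult lookup_sum
      by (rule sum.cong) (use lookup_single_mult[of 0 _ _ b] in simp_all)
    show "lk (pull W) b = lk 0 b"
    proof (cases "b \<in> B")
      case True then show ?thesis using h(2) unfolding l by (simp add: mult.commute)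
    next
      case False then show ?thesis using pull_forms[OF A W] unfolding forms_iff B_def by (auto simp: in_keys_iff)
    qed
  qed
  then have W0: "mpoly_eval W p = 0" by (rule vanishing_of_pull_eq_0[OF W _ p(1)])
  define g where "g = mpoly_eval G p"
  have summand: "mpoly_eval (sg 0 (h \<kappa>) * \<Phi> \<kappa>) p = g ^ D * (h \<kappa> * mon_eval \<kappa> (\<lambda>i. mpoly_eval (F i) p / g))" if "\<kappa> \<in> K" for \<kappa>
  proof -
    note m = ring_morph_simps(4)[OF ring_morph_mpoly_eval] ring_morph_power[OF ring_morph_mpoly_eval]
      ring_morph_mon_eval[OF ring_morph_mpoly_eval]
    have c: "mpoly_eval (sg 0 (h \<kappa>) :: (nat \<Rightarrow>\<^sub>0 nat, 'k) mpoly) p = h \<kappa>"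
      unfolding mpoly_eval_eq_eval_hom by (simp add: eval_hom_single[OF ring_morph_id])
    have e1: "mpoly_eval (sg 0 (h \<kappa>) * \<Phi> \<kappa>) p = h \<kappa> * (mon_eval \<kappa> (\<lambda>i. mpoly_eval (F i) p) * g ^ (D - mdeg \<kappa>))"
      unfolding \<Phi>_def m c g_def ..
    have "mon_eval \<kappa> (\<lambda>i. mpoly_eval (F i) p) = mon_eval \<kappa> (\<lambda>i. g * (mpoly_eval (F i) p / g))"
      using p(2) by (simp add: g_def)
    also have "\<dots> = g ^ mdeg \<kappa> * mon_eval \<kappa> (\<lambda>i. mpoly_eval (F i) p / g)" by (rule mon_eval_scale)
    finally have e2: "mon_eval \<kappa> (\<lambda>i. mpoly_eval (F i) p) = g ^ mdeg \<kappa> * mon_eval \<kappa> (\<lambda>i. mpoly_eval (F i) p / g)" .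
    have "g ^ D = g ^ mdeg \<kappa> * g ^ (D - mdeg \<kappa>)" using dK[OF that] by (simp flip: power_add)
    then show ?thesis unfolding e1 e2 by (simp add: mult_ac)
  qed
  have "mpoly_eval W p = (\<Sum>\<kappa>\<in>K. mpoly_eval (sg 0 (h \<kappa>) * \<Phi> \<kappa>) p)"
    unfolding W_def by (rule ring_morph_sum[OF ring_morph_mpoly_eval])
  also have "\<dots> = g ^ D * (\<Sum>\<kappa>\<in>K. h \<kappa> * mon_eval \<kappa> (\<lambda>i. mpoly_eval (F i) p / g))"
    unfolding sum_distrib_left by (rule sum.cong[OF refl summand])
  also have "(\<Sum>\<kappa>\<in>K. h \<kappa> * mon_eval \<kappa> (\<lambda>i. mpoly_eval (F i) p / g)) = mpoly_eval H (\<lambda>i. mpoly_eval (F i) p / g)"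
    unfolding H_def mpoly_eval_eq_eval_hom eval_hom_sum[OF ring_morph_id] eval_hom_single[OF ring_morph_id] ..
  finally show False using W0 p(2,3) by (simp add: g_def)
qed

lemma variety_dim_le:
  assumes "A \<subseteq> expo {..n} d"
  shows "variety_dim A (toric_variety n A :: (_ \<Rightarrow> 'k::field_char_0) set) \<le> n"
  unfolding variety_dim_def
proof -
  let ?S = "{s. \<exists>e. \<exists>G \<in> forms A e. \<exists>F. (\<exists>p\<in>(toric_variety n A :: (_ \<Rightarrow> 'k) set). mpoly_eval G p \<noteq> 0) \<and> (\<forall>i<s. F i \<in> forms A e) \<and>
        alg_indep_on {p \<in> (toric_variety n A :: (_ \<Rightarrow> 'k) set). mpoly_eval G p \<noteq> 0} s (\<lambda>i p. mpoly_eval (F i) p / mpoly_eval G p)}"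
  have b: "s \<le> n" if "s \<in> ?S" for s using that alg_indep_bound[OF assms] by blast
  show "Sup ?S \<le> n"
  proof (cases "?S = {}")
    \<comment> \<open>The supremum of the empty set of natural numbers is 0.\<close>
    case True then show ?thesis by (simp add: Sup_nat_def)
  next
    case False then show ?thesis by (rule cSup_least) (rule b)
  qed
qed

section \<open>Dimensions and equations from coordinates\<close>

lemma vector_space_fun: "vector_space (\<lambda>(c::'k::field) (w :: 'm \<Rightarrow> 'k) v. c * w v)"
  by unfold_locales (auto simp: fun_eq_iff algebra_simps)

lemma sum_fun_eval: "(sum f S :: 'm \<Rightarrow> 'k::comm_monoid_add) v = (\<Sum>x\<in>S. f x v)"
  by (induction S rule: infinite_finite_induct) simp_all

text \<open>The coordinates \<open>ch l\<close> determine the vectors of \<open>T\<close>, and in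
  them the vectors \<open>b l\<close> form a triangular matrix: \<open>s\<close> on the diagonal and
  zeros elsewhere, except for arbitrary further entries of \<open>b r\<close>.\<close>

lemma dim_from_coordinates:
  fixes T :: "('m \<Rightarrow> 'k::field) set" and b :: "'i \<Rightarrow> 'm \<Rightarrow> 'k"
  assumes L: "finite L" "r \<in> L" and s: "s \<noteq> 0"
    and bT: "\<And>l. l \<in> L \<Longrightarrow> b l \<in> T"
    and lin: "0 \<in> T" "\<And>w w' c. w \<in> T \<Longrightarrow> w' \<in> T \<Longrightarrow> (\<lambda>v. w v - c * w' v) \<in> T"
    and inj: "\<And>w. w \<in> T \<Longrightarrow> (\<And>l. l \<in> L \<Longrightarrow> w (ch l) = 0) \<Longrightarrow> w = 0"
    and b0: "b r (ch r) = s"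
    and bl: "\<And>l l'. l \<in> L \<Longrightarrow> l' \<in> L \<Longrightarrow> l \<noteq> r \<Longrightarrow> b l (ch l') = (if l = l' then s else 0)"
  shows "vector_space.dim (\<lambda>(c::'k) w v. c * w v) T = card L"
proof -
  interpret V: vector_space "\<lambda>(c::'k) (w :: 'm \<Rightarrow> 'k) v. c * w v" by (rule vector_space_fun)
  have val: "(\<Sum>l\<in>L. u l * b l (ch l')) = (if l' = r then u r * s else u r * b r (ch l') + u l' * s)" if "l' \<in> L" for u l'
  proof -
    have "(\<Sum>l\<in>L. u l * b l (ch l')) = u r * b r (ch l') + (\<Sum>l\<in>L - {r}. u l * b l (ch l'))"
      by (rule sum.remove[OF L])
    also have "(\<Sum>l\<in>L - {r}. u l * b l (ch l')) = (\<Sum>l\<in>L - {r}. if l = l' then u l' * s else 0)"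
      by (rule sum.cong[OF refl]) (use bl that in auto)
    also have "\<dots> = (if l' = r then 0 else u l' * s)" using L that by simp
    finally show ?thesis using b0 by auto
  qed
  have zero: "u l' = 0" if u: "(\<lambda>v. \<Sum>l\<in>L. u l * b l v) = 0" and l': "l' \<in> L" for u l'
  proof -
    have e: "(\<Sum>l\<in>L. u l * b l v) = 0" for v using fun_cong[OF u, of v] by simp
    have "u r = 0" using e[of "ch r"] val[OF L(2), of u] s by simp
    then show ?thesis using e[of "ch l'"] val[OF l', of u] s by (auto split: if_splits)
  qed
  have injb: "inj_on b L"
  proof (rule inj_onI)
    fix l l' assume ll: "l \<in> L" "l' \<in> L" "b l = b l'"
    show "l = l'"
    proof (rule ccontr)
      assume ne: "l \<noteq> l'"
      define u where "u k = (if k = l then 1 else if k = l' then -1 else 0 :: 'k)" for k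
      have "(\<lambda>v. \<Sum>k\<in>L. u k * b k v) = 0"
      proof
        fix v
        have "(\<Sum>k\<in>L. u k * b k v) = (\<Sum>k\<in>{l, l'}. u k * b k v)"
          by (rule sum.mono_neutral_right[OF L(1)]) (use ll in \<open>auto simp: u_def\<close>)
        also have "\<dots> = 0" using ne ll(3) by (simp add: u_def)
        finally show "(\<Sum>k\<in>L. u k * b k v) = 0 v" by simp
      qed
      from zero[OF this ll(1)] show False by (simp add: u_def)
    qed
  qed
  have ind: "V.independent (b ` L)"
  proof (rule V.independent_if_scalars_zero)
    fix f x assume f: "(\<Sum>x\<in>b ` L. (\<lambda>v. f x * x v)) = 0" and x: "x \<in> b ` L"
    have "(\<lambda>v. \<Sum>l\<in>L. f (b l) * b l v) = (\<Sum>x\<in>b ` L. (\<lambda>v. f x * x v))"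
      unfolding sum.reindex[OF injb] by (rule ext) (simp add: sum_fun_eval)
    then have "(\<lambda>v. \<Sum>l\<in>L. f (b l) * b l v) = 0" using f by simp
    from zero[OF this] x show "f x = 0" by auto
  qed (use L in simp)
  have span: "T \<subseteq> V.span (b ` L)"
  proof
    fix w assume w: "w \<in> T"
    \<comment> \<open>The triangular system is solved beginning with \<open>ch r\<close>, where all
      the other vectors vanish; the contribution of \<open>b r\<close> is then subtracted.\<close>
    define u where "u l = (if l = r then w (ch r) / s else (w (ch l) - w (ch r) / s * b r (ch l)) / s)" for l
    have sub: "(\<lambda>v. w v - (\<Sum>l\<in>S. u l * b l v)) \<in> T" if "S \<subseteq> L" for S
    proof -
      have "finite S" using that L(1) finite_subset by blast
      then show ?thesis using that
      proof (induction S rule: finite_induct)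
        case empty then show ?case using w by simp
      next
        case (insert l S)
        have "(\<lambda>v. (w v - (\<Sum>l\<in>S. u l * b l v)) - u l * b l v) \<in> T"
          by (rule lin(2)) (use insert bT in auto)
        moreover have "(\<lambda>v. (w v - (\<Sum>l\<in>S. u l * b l v)) - u l * b l v) = (\<lambda>v. w v - (\<Sum>l\<in>insert l S. u l * b l v))"
          using insert(1,2) by (auto simp: algebra_simps)
        ultimately show ?case by simp
      qed
    qed
    have "(\<lambda>v. w v - (\<Sum>l\<in>L. u l * b l v)) = 0"
    proof (rule inj[OF sub[OF order_refl]])
      fix l assume l: "l \<in> L"
      show "w (ch l) - (\<Sum>k\<in>L. u k * b k (ch l)) = 0"
        unfolding val[OF l] using s by (simp add: u_def)
    qed
    then have "w v = (\<Sum>l\<in>L. u l * b l v)" for v using fun_cong[of _ _ v] by fastforce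
    then have "w = (\<Sum>l\<in>L. (\<lambda>v. u l * b l v))" by (intro ext) (simp add: sum_fun_eval)
    also have "\<dots> \<in> V.span (b ` L)" by (intro V.span_sum V.span_scale V.span_base) auto
    finally show "w \<in> V.span (b ` L)" .
  qed
  show ?thesis
    by (rule V.dim_unique[OF _ span ind]) (use bT injb in \<open>auto simp: card_image\<close>)
qed

lemma pull_Var: "pull (Var m) = monic m"
  unfolding pull_def Var_def by (simp add: eval_hom_single[OF ring_morph_single])

lemma pull_mult: "pull (f * g) = pull f * pull g"
  unfolding pull_def by (rule eval_hom_mult[OF ring_morph_single])

lemma pull_minus: "pull (f - g) = pull f - pull g"
  using pull_add[of "f - g" g] by simp

lemma Var_forms: "m \<in> A \<Longrightarrow> Var m \<in> forms A 1"
  by (simp add: Var_monic forms_iff expo_single)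

lemma mpoly_eval_Var: "mpoly_eval (Var m) p = p m"
  using mpoly_eval_monic[of "Poly_Mapping.single m 1" p] unfolding mpoly_eval_eq_eval_hom Var_def
  by (simp add: eval_hom_single[OF ring_morph_id])

lemma curve_eval_Var: "curve_eval (Var m) q = q m"
  unfolding Var_def by (simp add: eval_hom_single[OF ring_morph_const_poly] one_pCons)

lemma ring_morph_curve: "ring_morph (\<lambda>f. curve_eval f q)"
  by (rule eval_hom_morph[OF ring_morph_const_poly])

lemma ring_morph_minus: "ring_morph \<phi> \<Longrightarrow> \<phi> (a - b) = \<phi> a - \<phi> b"
  using ring_morph_simps(3)[of \<phi> "a - b" b] by simp

lemma pull_eq_0I:
  fixes f :: "(nat \<Rightarrow>\<^sub>0 nat, 'k::field_char_0) mpoly"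
  assumes A: "A \<subseteq> expo {..n} d" and f: "f \<in> forms A t"
    and v: "\<And>x. (\<And>i. x i \<noteq> 0) \<Longrightarrow> mpoly_eval f (\<lambda>m. mon_eval m x) = 0"
  shows "pull f = 0"
  using mpoly_nonvanishing_point[OF _ forms_carrier[OF pull_forms[OF A f]]] v unfolding mpoly_eval_pull by blast

section \<open>Smoothness of varieties of truncated simplices\<close>

text \<open>For \<open>l = i\<close>, the vertex of the truncated simplex on the edge from \<open>x_i ^ d\<close> to \<open>x_j ^ d\<close>;
  the other values of \<open>l\<close> give the lattice points next to it on the \<open>n\<close> edges through this vertex.\<close>

definition chart :: "nat \<Rightarrow> (nat \<Rightarrow> nat) \<Rightarrow> nat \<Rightarrow> nat \<Rightarrow> nat \<Rightarrow> (nat \<Rightarrow>\<^sub>0 nat)" where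
  "chart d h i j l = (if l = i then Poly_Mapping.single i (h i) + Poly_Mapping.single j (d - h i)
     else if l = j then Poly_Mapping.single i (h i - 1) + Poly_Mapping.single j (d - h i + 1)
     else Poly_Mapping.single i (h i) + Poly_Mapping.single j (d - h i - 1) + Poly_Mapping.single l 1)"

text \<open>The numbers \<open>h i\<close> are the heights at which the corners of the simplex are
  cut off. \<open>chart_A\<close> makes the lattice points next to every vertex available as
  coordinates; this is what fails at \<open>x ^ 2 y ^ 2\<close> in the exceptional system of degree
  4 with \<open>h = 3\<close>. The set \<open>A\<close> may have holes elsewhere.\<close>

locale truncated_simplex =
  fixes n d :: nat and h :: "nat \<Rightarrow> nat" and A :: "(nat \<Rightarrow>\<^sub>0 nat) set"
  assumes n1: "n \<ge> 1"
    and A: "A \<subseteq> expo {..n} d"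
    and Ah: "\<And>m i. m \<in> A \<Longrightarrow> i \<le> n \<Longrightarrow> Poly_Mapping.lookup m i \<le> h i"
    and h: "\<And>i. i \<le> n \<Longrightarrow> 1 \<le> h i \<and> h i < d"
    and chart_A: "\<And>i j l. i \<le> n \<Longrightarrow> j \<le> n \<Longrightarrow> i \<noteq> j \<Longrightarrow> l \<le> n \<Longrightarrow> chart d h i j l \<in> A"
    and midpoint: "\<And>m. m \<in> A \<Longrightarrow> (\<exists>i\<le>n. \<exists>j\<le>n. i \<noteq> j \<and> m = chart d h i j i) \<or>
      (\<exists>m'\<in>A. \<exists>m''\<in>A. m' + m'' = m + m \<and> m' \<noteq> m)"
begin

abbreviation "ch \<equiv> chart d h"

text \<open>The coordinates of \<open>m\<close> in the lattice basis at the vertex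
  \<open>v = ch i j i\<close>: as integer vectors, \<open>m - v\<close> is the sum of
  \<open>crd i j m l\<close> times \<open>ch i j l - v\<close> over \<open>l \<noteq> i\<close>. By
  \<open>Ah\<close> the subtraction is not truncated on \<open>A\<close>.\<close>

definition crd :: "nat \<Rightarrow> nat \<Rightarrow> (nat \<Rightarrow>\<^sub>0 nat) \<Rightarrow> nat \<Rightarrow> nat" where
  "crd i j m l = (if l = j then h i - Poly_Mapping.lookup m i else Poly_Mapping.lookup m l)"

lemma finite_A: "finite A"
  using A finite_expo finite_subset by blast

lemma A_nonempty: "A \<noteq> {}"
  using chart_A[of 0 1 0] n1 by auto

text \<open>Among the monomials at which \<open>p\<close> is nonzero, one farthest from the origin
  is chosen. If it were a midpoint, \<open>p m ^ 2 = p m' * p m''\<close> would make both ends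
  nonzero, and by strict convexity one of them would be farther away.\<close>

lemma exists_vertex:
  fixes p :: "(nat \<Rightarrow>\<^sub>0 nat) \<Rightarrow> 'k::field_char_0"
  assumes p: "p \<in> toric_variety n A"
  shows "\<exists>i\<le>n. \<exists>j\<le>n. i \<noteq> j \<and> p (ch i j i) \<noteq> 0"
proof -
  define N where "N m = (\<Sum>i\<le>n. (lk m i)\<^sup>2)" for m :: "nat \<Rightarrow>\<^sub>0 nat"
  let ?S = "{m \<in> A. p m \<noteq> 0}"
  have "?S \<noteq> {}" "finite ?S" using p finite_A by (auto simp: toric_variety_def zariski_closure_def hcoords_def)
  then obtain m where m: "m \<in> ?S" "\<And>m'. m' \<in> ?S \<Longrightarrow> N m' \<le> N m"
    using Max_in[of "N ` ?S"] Max_ge[of "N ` ?S"] by (smt (verit) finite_imageI image_iff image_is_empty)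
  have False if m': "m' \<in> A" "m'' \<in> A" "m' + m'' = m + m" "m' \<noteq> m" for m' m''
  proof -
    let ?f = "Var m * Var m - Var m' * Var m'' :: (nat \<Rightarrow>\<^sub>0 nat, 'k) mpoly"
    have "?f \<in> forms A (1 + 1)" using m m' by (intro forms_minus forms_mult Var_forms) auto
    moreover have "pull ?f = 0"
      unfolding pull_minus pull_mult pull_Var monic_mult m'(3) by simp
    ultimately have "mpoly_eval ?f p = 0" using p by (rule vanishing_of_pull_eq_0)
    then have "p m * p m = p m' * p m''"
      by (simp add: ring_morph_minus[OF ring_morph_mpoly_eval] ring_morph_simps(4)[OF ring_morph_mpoly_eval] mpoly_eval_Var)
    then have "m' \<in> ?S" "m'' \<in> ?S" using m m' by auto
    then have le: "N m' \<le> N m" "N m'' \<le> N m" using m by auto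
    have s: "lk m' i + lk m'' i = 2 * lk m i" for i
      using arg_cong[OF m'(3), of "\<lambda>m. lk m i"] by (simp add: lookup_add)
    \<comment> \<open>With \<open>a + b = 2 c\<close> one has
      \<open>a ^ 2 + b ^ 2 = 2 c ^ 2 + 2 (a - c) ^ 2\<close>.\<close>
    have sq: "2 * (c::nat)\<^sup>2 \<le> a\<^sup>2 + b\<^sup>2 \<and> (a \<noteq> c \<longrightarrow> 2 * c\<^sup>2 < a\<^sup>2 + b\<^sup>2)" if "a + b = 2 * c" for a b c
    proof -
      have b: "int b = 2 * int c - int a" using that by linarith
      have "int (a\<^sup>2 + b\<^sup>2) = int (2 * c\<^sup>2) + 2 * (int a - int c)\<^sup>2" by (simp add: b power2_eq_square algebra_simps)
      moreover have "(int a - int c)\<^sup>2 \<ge> 0" "a \<noteq> c \<Longrightarrow> (int a - int c)\<^sup>2 > 0" by auto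
      ultimately show ?thesis by linarith
    qed
    obtain i where i: "lk m' i \<noteq> lk m i" using poly_mapping_eqI[of m' m] m'(4) by blast
    have "i \<in> Poly_Mapping.keys m \<union> Poly_Mapping.keys m'" using i by (auto simp: in_keys_iff)
    then have "i \<le> n" using m m'(1) A by (auto simp: expo_def)
    have "(\<Sum>i\<le>n. 2 * (lk m i)\<^sup>2) < (\<Sum>i\<le>n. (lk m' i)\<^sup>2 + (lk m'' i)\<^sup>2)"
      by (rule sum_strict_mono_ex1) (use sq[OF s] i \<open>i \<le> n\<close> in auto)
    then show False using le by (simp add: N_def sum.distrib sum_distrib_left[symmetric])
  qed
  then show ?thesis using midpoint[of m] m(1) by blast
qed

text \<open>The velocity at 0 of a polynomial curve through \<open>p\<close> is tangent as soon as
  the curve satisfies the equations outside a finite set of parameters, for then they hold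
  identically along it.\<close>

lemma curve_tangent:
  fixes q :: "(nat \<Rightarrow>\<^sub>0 nat) \<Rightarrow> 'k::field_char_0 poly"
  assumes q: "\<And>a. a \<notin> A \<Longrightarrow> q a = 0" "\<And>a. poly (q a) 0 = p a" and B: "finite B"
    and v: "\<And>t f s. t \<notin> B \<Longrightarrow> f \<in> forms A s \<Longrightarrow> f \<in> vanishing_forms A (toric_variety n A) \<Longrightarrow> pull f = 0 \<Longrightarrow>
      mpoly_eval f (\<lambda>a. poly (q a) t) = 0"
  shows "(\<lambda>a. poly (pderiv (q a)) 0) \<in> cone_tangent_space A (toric_variety n A) p"
  unfolding cone_tangent_space_def
proof (intro CollectI conjI allI impI ballI)
  fix a assume "a \<notin> A" then show "poly (pderiv (q a)) 0 = 0" by (simp add: q)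
next
  fix f :: "(nat \<Rightarrow>\<^sub>0 nat, 'k) mpoly" assume f: "f \<in> vanishing_forms A (toric_variety n A)"
  then obtain s where s: "f \<in> forms A s" "pull f = 0" unfolding vanishing_forms_toric_variety[OF A A_nonempty] by blast
  have "curve_eval f q = 0"
  proof (rule ccontr)
    assume "curve_eval f q \<noteq> 0"
    then have "finite {t. poly (curve_eval f q) t = 0}" by (rule poly_roots_finite)
    moreover have "UNIV \<subseteq> {t. poly (curve_eval f q) t = 0} \<union> B"
      using v[OF _ s(1) f s(2)] by (auto simp: poly_curve_eval)
    ultimately show False using B infinite_UNIV_char_0[where ?'a = 'k] by (meson finite_UnI finite_subset)
  qed
  then show "(\<Sum>v\<in>A. mpoly_eval (mpoly_partial v f) p * poly (pderiv (q v)) 0) = 0"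
    using chain_rule[OF finite_A forms_carrier[OF s(1)], of q 0] by (simp add: q(2))
qed

context
  fixes i j assumes ij: "i \<le> n" "j \<le> n" "i \<noteq> j"
begin

lemma chart_ratio:
  fixes x :: "nat \<Rightarrow> 'k::field"
  assumes x: "\<And>i. x i \<noteq> 0" and l: "l \<noteq> i"
  shows "mon_eval (ch i j l) x / mon_eval (ch i j i) x = (if l = j then x j / x i else x l / x j)"
proof -
  obtain k where k: "h i = Suc k" using h[OF ij(1)] by (cases "h i") auto
  obtain k' where k': "d - h i = Suc k'" using h[OF ij(1)] by (cases "d - h i") auto
  have v: "mon_eval (ch i j i) x = x i ^ Suc k * x j ^ Suc k'"
    unfolding chart_def mon_eval_add by (simp only: k' if_True simp_thms mon_eval_add mon_eval_single) (simp only: k)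
  show ?thesis
  proof (cases "l = j")
    case True
    have "mon_eval (ch i j l) x = x i ^ k * x j ^ Suc (Suc k')"
      using True ij(3) unfolding chart_def by (simp only: k' mon_eval_add mon_eval_single if_False if_True simp_thms) (simp add: k mon_eval_add)
    then show ?thesis using True x[of i] x[of j] unfolding v by simp
  next
    case False
    have "mon_eval (ch i j l) x = x i ^ Suc k * x j ^ k' * x l"
      using False l unfolding chart_def by (simp only: k' mon_eval_add mon_eval_single if_False simp_thms) (simp add: k)
    then show ?thesis using False x[of i] x[of j] unfolding v by simp
  qed
qed

lemma torus_relation:
  fixes x :: "nat \<Rightarrow> 'k::field"
  assumes m: "m \<in> A" and x: "\<And>i. x i \<noteq> 0"
  shows "mon_eval m x = mon_eval (ch i j i) x *
    (\<Prod>l\<in>{..n} - {i}. (mon_eval (ch i j l) x / mon_eval (ch i j i) x) ^ crd i j m l)"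
proof -
  define R where "R = {..n} - {i, j}"
  define P where "P = (\<Prod>l\<in>R. x l ^ lk m l)"
  define \<sigma> where "\<sigma> = (\<Sum>l\<in>R. lk m l)"
  define k where "k = h i - lk m i"
  have mE: "Poly_Mapping.keys m \<subseteq> {..n}" "mdeg m = d" using m A by (auto simp: expo_def)
  have set1: "{..n} - {i} = insert j R" "{..n} = insert i (insert j R)" using ij by (auto simp: R_def)
  have R: "finite R" "j \<notin> R" "i \<notin> insert j R" using ij by (auto simp: R_def)
  have "mdeg m = (\<Sum>l\<le>n. lk m l)" by (rule mdeg_eq_sum[OF _ mE(1)]) simp
  then have deg: "lk m i + (lk m j + \<sigma>) = d" using mE(2) R unfolding set1(2) \<sigma>_def by simp
  have hk: "h i = lk m i + k" using Ah[OF m ij(1)] by (simp add: k_def)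
  have "mon_eval m x = (\<Prod>l\<le>n. x l ^ lk m l)" by (rule mon_eval_eq[OF _ mE(1)]) simp
  then have L: "mon_eval m x = x i ^ lk m i * (x j ^ lk m j * P)" using R unfolding set1(2) P_def by simp
  have v: "mon_eval (ch i j i) x = x i ^ h i * x j ^ (d - h i)" by (simp add: chart_def mon_eval_add)
  have "(\<Prod>l\<in>{..n} - {i}. (mon_eval (ch i j l) x / mon_eval (ch i j i) x) ^ crd i j m l)
      = (\<Prod>l\<in>{..n} - {i}. (if l = j then x j / x i else x l / x j) ^ crd i j m l)"
    by (rule prod.cong) (auto simp: chart_ratio[OF x])
  also have "\<dots> = (x j / x i) ^ k * (\<Prod>l\<in>R. (x l / x j) ^ lk m l)"
  proof -
    have "(\<Prod>l\<in>R. (if l = j then x j / x i else x l / x j) ^ crd i j m l) = (\<Prod>l\<in>R. (x l / x j) ^ lk m l)"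
      by (rule prod.cong) (use R in \<open>auto simp: crd_def\<close>)
    then show ?thesis unfolding set1(1) using R by (simp add: crd_def k_def)
  qed
  also have "(\<Prod>l\<in>R. (x l / x j) ^ lk m l) = P / x j ^ \<sigma>"
    by (simp add: P_def \<sigma>_def power_divide prod_dividef power_sum)
  finally have Q: "(\<Prod>l\<in>{..n} - {i}. (mon_eval (ch i j l) x / mon_eval (ch i j i) x) ^ crd i j m l)
     = (x j / x i) ^ k * (P / x j ^ \<sigma>)" .
  have e: "x j ^ (d - h i) * x j ^ k = x j ^ lk m j * x j ^ \<sigma>"
    unfolding power_add[symmetric] using deg hk h[OF ij(1)] by (intro arg_cong[where f = "power (x j)"]) linarith
  have "mon_eval (ch i j i) x * ((x j / x i) ^ k * (P / x j ^ \<sigma>))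
      = x i ^ lk m i * (x j ^ (d - h i) * x j ^ k) * P / x j ^ \<sigma>"
    unfolding v hk power_add[of "x i"] power_divide using x[of i] by (simp add: field_simps)
  also have "\<dots> = mon_eval m x" unfolding e L using x[of j] by simp
  finally show ?thesis unfolding Q by simp
qed

lemma crd_chart:
  assumes "l \<in> {..n} - {i}"
  shows "crd i j (ch i j l') l = (if l = l' then 1 else 0)"
  using assms ij h[OF ij(1)] by (auto simp: crd_def chart_def lookup_add lookup_single when_def)

text \<open>\<open>torus_relation\<close> with the denominators cleared. Unlike the relation itself,
  this form makes sense on all of \<open>X\<close>.\<close>

definition rel :: "(nat \<Rightarrow>\<^sub>0 nat) \<Rightarrow> (nat \<Rightarrow>\<^sub>0 nat, 'k::field_char_0) mpoly" where
  "rel m = Var m * Var (ch i j i) ^ (\<Sum>l\<in>{..n} - {i}. crd i j m l)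
     - Var (ch i j i) * (\<Prod>l\<in>{..n} - {i}. Var (ch i j l) ^ crd i j m l)"

lemma rel_vanishing:
  assumes m: "m \<in> A"
  shows "(rel m :: (_, 'k::field_char_0) mpoly) \<in> forms A (1 + (\<Sum>l\<in>{..n} - {i}. crd i j m l))" "pull (rel m :: (_, 'k) mpoly) = 0"
proof -
  let ?k = "\<Sum>l\<in>{..n} - {i}. crd i j m l"
  have v: "Var a \<in> forms A 1" if "a \<in> A" for a using that by (rule Var_forms)
  have 1: "(Var (ch i j i) :: (_, 'k) mpoly) ^ ?k \<in> forms A ?k"
    using forms_pow[OF v[OF chart_A[OF ij ij(1)]], of ?k] by simp
  have 2: "(\<Prod>l\<in>{..n} - {i}. Var (ch i j l) ^ crd i j m l :: (_, 'k) mpoly) \<in> forms A ?k"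
    by (rule forms_prod) (use forms_pow[OF v[OF chart_A[OF ij]]] in fastforce)
  show f: "(rel m :: (_, 'k) mpoly) \<in> forms A (1 + ?k)"
    unfolding rel_def by (intro forms_minus forms_mult v 1 2 m chart_A ij)
  show "pull (rel m :: (_, 'k) mpoly) = 0"
  proof (rule pull_eq_0I[OF A f])
    fix x :: "nat \<Rightarrow> 'k" assume x: "\<And>i. x i \<noteq> 0"
    let ?v = "mon_eval (ch i j i) x"
    have v0: "?v \<noteq> 0" using x by (simp add: mon_eval_def)
    have "(\<Prod>l\<in>{..n} - {i}. (mon_eval (ch i j l) x / ?v) ^ crd i j m l) * ?v ^ ?k
        = (\<Prod>l\<in>{..n} - {i}. mon_eval (ch i j l) x ^ crd i j m l)"
      using v0 by (simp add: power_divide prod_dividef power_sum)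
    then have "mon_eval m x * ?v ^ ?k = ?v * (\<Prod>l\<in>{..n} - {i}. mon_eval (ch i j l) x ^ crd i j m l)"
      unfolding torus_relation[OF m x] by (simp only: mult.assoc)
    then show "mpoly_eval (rel m) (\<lambda>m. mon_eval m x) = 0"
      unfolding rel_def
      by (simp add: ring_morph_minus[OF ring_morph_mpoly_eval] ring_morph_simps(4)[OF ring_morph_mpoly_eval]
        ring_morph_power[OF ring_morph_mpoly_eval] ring_morph_prod[OF ring_morph_mpoly_eval] mpoly_eval_Var)
  qed
qed

text \<open>Thus the part of \<open>X\<close> where the vertex coordinate is nonzero is the graph of
  monomial functions of \<open>n\<close> local coordinates.\<close>

lemma point_coordinate:
  fixes p :: "(nat \<Rightarrow>\<^sub>0 nat) \<Rightarrow> 'k::field_char_0"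
  assumes p: "p \<in> toric_variety n A" "p (ch i j i) \<noteq> 0" and m: "m \<in> A"
  shows "p m = p (ch i j i) * (\<Prod>l\<in>{..n} - {i}. (p (ch i j l) / p (ch i j i)) ^ crd i j m l)"
proof -
  have "mpoly_eval (rel m) p = 0" by (rule vanishing_of_pull_eq_0[OF rel_vanishing[OF m] p(1)])
  then have "p m * p (ch i j i) ^ (\<Sum>l\<in>{..n} - {i}. crd i j m l) = p (ch i j i) * (\<Prod>l\<in>{..n} - {i}. p (ch i j l) ^ crd i j m l)"
    unfolding rel_def
    by (simp add: ring_morph_minus[OF ring_morph_mpoly_eval] ring_morph_simps(4)[OF ring_morph_mpoly_eval]
      ring_morph_power[OF ring_morph_mpoly_eval] ring_morph_prod[OF ring_morph_mpoly_eval] mpoly_eval_Var)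
  then show ?thesis using p(2) by (simp add: power_divide prod_dividef power_sum field_simps)
qed

text \<open>Differentiating \<open>rel m\<close> along the line \<open>p + t w\<close> leaves only
  \<open>w m\<close> times a power of the vertex coordinate, because the chart coordinates of
  \<open>w\<close> are 0. Tangent vectors are thus determined by \<open>n + 1\<close>
  coordinates.\<close>

lemma tangent_vector_eq_0:
  fixes p :: "(nat \<Rightarrow>\<^sub>0 nat) \<Rightarrow> 'k::field_char_0"
  assumes p: "p (ch i j i) \<noteq> 0"
    and w: "w \<in> cone_tangent_space A (toric_variety n A) p" "\<And>l. l \<le> n \<Longrightarrow> w (ch i j l) = 0"
  shows "w = 0"
proof
  fix m
  show "w m = 0 m"
  proof (cases "m \<in> A")
    case False then show ?thesis using w(1) by (simp add: cone_tangent_space_def)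
  next
    case True
    define q where "q a = [:p a, w a:]" for a
    let ?k = "\<Sum>l\<in>{..n} - {i}. crd i j m l"
    have "rel m \<in> vanishing_forms A (toric_variety n A :: (_ \<Rightarrow> 'k) set)"
      unfolding vanishing_forms_toric_variety[OF A A_nonempty] using rel_vanishing[OF True] by blast
    then have "(\<Sum>v\<in>A. mpoly_eval (mpoly_partial v (rel m)) p * w v) = 0" using w(1) by (simp add: cone_tangent_space_def)
    then have "poly (pderiv (curve_eval (rel m) q)) 0 = 0"
      unfolding chain_rule[OF finite_A forms_carrier[OF rel_vanishing(1)[OF True]]] by (simp add: q_def pderiv_pCons)
    moreover have "curve_eval (rel m) q = [:p m, w m:] * [:p (ch i j i) ^ ?k:]
        - [:p (ch i j i) * (\<Prod>l\<in>{..n} - {i}. p (ch i j l) ^ crd i j m l):]"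
    proof -
      have c: "q (ch i j l) = [:p (ch i j l):]" if "l \<le> n" for l using w(2)[OF that] by (simp add: q_def)
      have e: "curve_eval (rel m) q = q m * q (ch i j i) ^ ?k - q (ch i j i) * (\<Prod>l\<in>{..n} - {i}. q (ch i j l) ^ crd i j m l)"
        unfolding rel_def ring_morph_minus[OF ring_morph_curve] ring_morph_simps(4)[OF ring_morph_curve]
          ring_morph_power[OF ring_morph_curve] ring_morph_prod[OF ring_morph_curve] curve_eval_Var ..
      have "(\<Prod>l\<in>{..n} - {i}. q (ch i j l) ^ crd i j m l) = (\<Prod>l\<in>{..n} - {i}. [:p (ch i j l):] ^ crd i j m l)"
        by (rule prod.cong) (simp_all add: c)
      then show ?thesis unfolding e c[OF ij(1)]
          ring_morph_simps(4)[OF ring_morph_const_poly] ring_morph_power[OF ring_morph_const_poly] ring_morph_prod[OF ring_morph_const_poly]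
        by (simp only: q_def)
    qed
    ultimately have "w m * p (ch i j i) ^ ?k = 0"
      using p by (simp add: pderiv_diff pderiv_mult pderiv_pCons)
    then show ?thesis using p by simp
  qed
qed

text \<open>\<open>tangent_vector_eq_0\<close> bounds the dimension from above. From below there are
  \<open>n + 1\<close> tangent vectors: the point \<open>p\<close> itself, because the cone is
  stable under scaling, and the velocities of \<open>n\<close> curves that each move one local
  coordinate.\<close>

lemma dim_tangent:
  fixes p :: "(nat \<Rightarrow>\<^sub>0 nat) \<Rightarrow> 'k::field_char_0"
  assumes p: "p \<in> toric_variety n A" "p (ch i j i) \<noteq> 0"
  shows "vector_space.dim (\<lambda>(c::'k) w v. c * w v) (cone_tangent_space A (toric_variety n A) p) = n + 1"
proof -
  let ?T = "cone_tangent_space A (toric_variety n A) p"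
  let ?v = "ch i j i"
  let ?L = "{..n} - {i}"
  \<comment> \<open>The \<open>l\<close>-th local coordinate along the curve. The term
    \<open>t ^ 2\<close> leaves the velocity at 0 unchanged and keeps the polynomial nonzero, so
    that for almost all \<open>t\<close> the curve lies in the torus even if the local coordinate of
    \<open>p\<close> is 0.\<close>
  define y where "y l0 l = [:p (ch i j l) / p ?v, (if l = l0 then 1 else 0), 1:]" for l0 l
  define q where "q l0 m = (if m \<in> A then [:p ?v:] * (\<Prod>l\<in>?L. y l0 l ^ crd i j m l) else 0)" for l0 m
  define b where "b l0 = (if l0 = i then p else (\<lambda>m. poly (pderiv (q l0 m)) 0))" for l0
  have p0: "p a = 0" if "a \<notin> A" for a using p(1) that by (simp add: toric_variety_def zariski_closure_def hcoords_def)
  have pT: "p \<in> ?T"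
  proof -
    have "(\<lambda>a. poly (pderiv [:p a, p a:]) 0) \<in> ?T"
    proof (rule curve_tangent[where B = "{}"])
      fix t s and f :: "(nat \<Rightarrow>\<^sub>0 nat, 'k) mpoly"
      assume f: "f \<in> forms A s" "pull f = 0"
      have "mpoly_eval f (\<lambda>a. poly [:p a, p a:] t) = mpoly_eval f (\<lambda>a. (1 + t) * p a)" by (simp add: algebra_simps)
      also have "\<dots> = (1 + t) ^ s * mpoly_eval f p" unfolding mpoly_eval_eq_eval_hom by (rule eval_hom_scale[OF f(1)])
      finally show "mpoly_eval f (\<lambda>a. poly [:p a, p a:] t) = 0" using vanishing_of_pull_eq_0[OF f p(1)] by simp
    qed (simp_all add: p0)
    then show ?thesis by (simp add: pderiv_pCons)
  qed
  have qT: "(\<lambda>m. poly (pderiv (q l0 m)) 0) \<in> ?T" for l0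
  proof (rule curve_tangent)
    show "q l0 a = 0" if "a \<notin> A" for a using that by (simp add: q_def)
    show "poly (q l0 a) 0 = p a" for a
    proof (cases "a \<in> A")
      case True
      show ?thesis unfolding point_coordinate[OF p True] using True by (simp add: q_def y_def poly_prod)
    qed (simp add: q_def p0)
    show "finite (\<Union>l\<in>?L. {t. poly (y l0 l) t = 0})"
      by (intro finite_UN_I poly_roots_finite) (auto simp: y_def)
    fix t s and f :: "(nat \<Rightarrow>\<^sub>0 nat, 'k) mpoly"
    assume t: "t \<notin> (\<Union>l\<in>?L. {t. poly (y l0 l) t = 0})" and f: "f \<in> forms A s" "pull f = 0"
    define z where "z l = poly (y l0 l) t" for l
    have z: "z l \<noteq> 0" if "l \<in> ?L" for l using t that by (auto simp: z_def)
    \<comment> \<open>The torus point with prescribed local coordinates: those are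
      \<open>x_j / x_i\<close> and \<open>x_l / x_j\<close>, and \<open>x_i\<close> is normalised to
      1.\<close>
    define x where "x l = (if l = j then z j else if l \<in> ?L then z l * z j else 1)" for l
    have x: "x l \<noteq> 0" for l using z[of l] z[of j] ij by (auto simp: x_def)
    have r: "mon_eval (ch i j l) x / mon_eval ?v x = z l" if "l \<in> ?L" for l
      using that z[of j] ij chart_ratio[where x = x and l = l, OF x] by (auto simp: x_def)
    have v0: "mon_eval ?v x \<noteq> 0" using x by (simp add: mon_eval_def)
    have c: "poly (q l0 m) t = p ?v / mon_eval ?v x * mon_eval m x" if "m \<in> A" for m
    proof -
      have "(\<Prod>l\<in>?L. (mon_eval (ch i j l) x / mon_eval ?v x) ^ crd i j m l) = (\<Prod>l\<in>?L. z l ^ crd i j m l)"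
        by (rule prod.cong) (simp_all only: r)
      then show ?thesis using that v0 unfolding torus_relation[OF that x] by (simp add: q_def poly_prod z_def)
    qed
    have "mpoly_eval f (\<lambda>a. poly (q l0 a) t) = mpoly_eval f (\<lambda>a. p ?v / mon_eval ?v x * mon_eval a x)"
      by (rule mpoly_eval_cong[OF forms_carrier[OF f(1)]]) (rule c)
    also have "\<dots> = (p ?v / mon_eval ?v x) ^ s * mpoly_eval f (\<lambda>a. mon_eval a x)"
      unfolding mpoly_eval_eq_eval_hom by (rule eval_hom_scale[OF f(1)])
    also have "\<dots> = 0" unfolding mpoly_eval_pull[symmetric] f(2) by (simp add: mpoly_eval_def)
    finally show "mpoly_eval f (\<lambda>a. poly (q l0 a) t) = 0" .
  qed
  have q_ch: "q l0 (ch i j l') = (if l' = i then [:p ?v:] else [:p ?v:] * y l0 l')" if "l' \<le> n" for l0 l'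
  proof -
    have "(\<Prod>l\<in>?L. y l0 l ^ crd i j (ch i j l') l) = (\<Prod>l\<in>?L. if l = l' then y l0 l else 1)"
      by (rule prod.cong) (simp_all add: crd_chart)
    also have "\<dots> = (if l' \<in> ?L then y l0 l' else 1)" by (rule prod.delta) simp
    finally show ?thesis using that chart_A[OF ij that] by (simp add: q_def)
  qed
  have "vector_space.dim (\<lambda>(c::'k) w v. c * w v) ?T = card {..n}"
  proof (rule dim_from_coordinates[where b = b and ch = "ch i j" and s = "p ?v" and r = i])
    show "b l \<in> ?T" for l using pT qT by (simp add: b_def)
    show "0 \<in> ?T" by (simp add: cone_tangent_space_def)
    show "(\<lambda>v. w v - c * w' v) \<in> ?T" if "w \<in> ?T" "w' \<in> ?T" for w w' c
    proof -
      have "(\<Sum>v\<in>A. mpoly_eval (mpoly_partial v f) p * (w v - c * w' v))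
          = (\<Sum>v\<in>A. mpoly_eval (mpoly_partial v f) p * w v) - c * (\<Sum>v\<in>A. mpoly_eval (mpoly_partial v f) p * w' v)" for f
        by (simp add: sum_subtractf sum_distrib_left algebra_simps)
      then show ?thesis using that by (simp add: cone_tangent_space_def)
    qed
    show "w = 0" if "w \<in> ?T" "\<And>l. l \<in> {..n} \<Longrightarrow> w (ch i j l) = 0" for w
      by (rule tangent_vector_eq_0[OF p(2) that(1)]) (use that(2) in simp)
    show "b l (ch i j l') = (if l = l' then p ?v else 0)" if "l \<in> {..n}" "l' \<in> {..n}" "l \<noteq> i" for l l'
      using that q_ch[of l' l] by (auto simp: b_def y_def pderiv_pCons pderiv_smult)
  qed (use ij p in \<open>simp_all add: b_def\<close>)
  then show ?thesis by simp
qed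

end

text \<open>The local coordinates at one vertex take arbitrary nonzero values on \<open>X\<close>,
  so these \<open>n\<close> functions are algebraically independent.\<close>

lemma variety_dim_eq: "variety_dim A (toric_variety n A :: (_ \<Rightarrow> 'k::field_char_0) set) = n"
proof (rule antisym[OF variety_dim_le[OF A]])
  let ?X = "toric_variety n A :: (_ \<Rightarrow> 'k) set"
  let ?S = "{s. \<exists>e. \<exists>G \<in> forms A e. \<exists>F. (\<exists>p\<in>?X. mpoly_eval G p \<noteq> 0) \<and> (\<forall>i<s. F i \<in> forms A e) \<and>
        alg_indep_on {p \<in> ?X. mpoly_eval G p \<noteq> 0} s (\<lambda>i p. mpoly_eval (F i) p / mpoly_eval G p)}"
  let ?v = "ch 0 1 0"
  have i01: "0 \<le> n" "1 \<le> n" "(0::nat) \<noteq> 1" using n1 by auto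
  note vA = chart_A[OF i01]
  have pt: "\<exists>p\<in>?X. p ?v \<noteq> 0 \<and> (\<forall>l<n. p (ch 0 1 (l + 1)) / p ?v = t l)" if t: "\<And>l. t l \<noteq> 0" for t :: "nat \<Rightarrow> 'k"
  proof -
    \<comment> \<open>The parameters are numbered from 0 and the chart points next to the vertex
      from 1, hence the shift by one.\<close>
    define x where "x r = (if r = 0 then 1 else if r = 1 then t 0 else t (r - 1) * t 0)" for r
    have x: "x r \<noteq> 0" for r using t by (simp add: x_def)
    have v0: "mon_eval ?v x \<noteq> 0" using x by (simp add: mon_eval_def)
    have r: "mon_eval (ch 0 1 (l + 1)) x / mon_eval ?v x = t l" for l
      using chart_ratio[OF i01, where x = x and l = "l + 1", OF x] t[of 0] by (auto simp: x_def)
    show ?thesis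
      by (rule bexI[OF _ torus_point_in[OF A A_nonempty x]]) (use v0 r vA in auto)
  qed
  have V: "Var (ch 0 1 l) \<in> forms A 1" if "l \<le> n" for l by (rule Var_forms[OF vA[OF that]])
  have nz: "\<exists>p\<in>?X. mpoly_eval (Var ?v) p \<noteq> 0" using pt[of "\<lambda>_. 1"] by (auto simp: mpoly_eval_Var)
  have ind: "alg_indep_on {p \<in> ?X. mpoly_eval (Var ?v) p \<noteq> 0} n (\<lambda>l p. mpoly_eval (Var (ch 0 1 (l + 1))) p / mpoly_eval (Var ?v) p)"
    unfolding alg_indep_on_def
  proof (intro ballI impI)
    fix H :: "(nat, 'k) mpoly" assume H: "H \<in> carrier (mpoly_ring {..<n})" "H \<noteq> 0"
    obtain t where t: "\<And>l. t l \<noteq> 0" "mpoly_eval H t \<noteq> 0" using mpoly_nonvanishing_point[OF _ H] by blast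
    obtain p where p: "p \<in> ?X" "p ?v \<noteq> 0" "\<And>l. l < n \<Longrightarrow> p (ch 0 1 (l + 1)) / p ?v = t l" using pt[of t] t(1) by blast
    have "mpoly_eval H (\<lambda>l. p (ch 0 1 (l + 1)) / p ?v) = mpoly_eval H t"
      by (rule mpoly_eval_cong[OF H(1)]) (use p(3) in simp)
    then show "\<exists>p\<in>{p \<in> ?X. mpoly_eval (Var ?v) p \<noteq> 0}.
        mpoly_eval H (\<lambda>l. mpoly_eval (Var (ch 0 1 (l + 1))) p / mpoly_eval (Var ?v) p) \<noteq> 0"
      using p(1,2) t(2) by (auto simp: mpoly_eval_Var intro!: bexI[of _ p])
  qed
  have "n \<in> ?S"
    unfolding mem_Collect_eq
    by (rule exI[of _ 1], rule bexI[OF _ V[OF i01(1)]], rule exI[of _ "\<lambda>l. Var (ch 0 1 (l + 1))"],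
        intro conjI allI impI nz ind V) simp
  moreover have "s \<le> n" if "s \<in> ?S" for s using that alg_indep_bound[OF A] by blast
  then have "bdd_above ?S" by (rule bdd_aboveI)
  ultimately show "n \<le> variety_dim A ?X" unfolding variety_dim_def by (rule cSup_upper)
qed

lemma smooth: "smooth_variety A (toric_variety n A :: (_ \<Rightarrow> 'k::field_char_0) set)"
  unfolding smooth_variety_def variety_dim_eq
proof
  fix p :: "_ \<Rightarrow> 'k" assume p: "p \<in> toric_variety n A"
  obtain i j where "i \<le> n" "j \<le> n" "i \<noteq> j" "p (ch i j i) \<noteq> 0" using exists_vertex[OF p] by blast
  then show "vector_space.dim (\<lambda>(c::'k) w v. c * w v) (cone_tangent_space A (toric_variety n A) p) = n + 1"
    by (intro dim_tangent[OF _ _ _ p])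
qed

end

section \<open>The trivial and the exceptional systems\<close>

lemma remaining_monomials_mon_ideal:
  assumes "E \<subseteq> expo {..n} d"
  shows "remaining_monomials n d (mon_ideal {..n} E :: (nat, 'k::comm_ring_1) mpoly set) = expo {..n} d - E"
proof -
  have "Poly_Mapping.single m 1 \<in> (mon_ideal {..n} E :: (nat, 'k) mpoly set) \<longleftrightarrow> m \<in> E" if "m \<in> expo {..n} d" for m
    using form_in_mon_ideal[OF assms monic_forms[OF that], where ?'b = 'k] by (simp add: monic_def)
  then show ?thesis by (auto simp: remaining_monomials_def expo_def)
qed

lemma smooth_togliatti_iff:
  assumes "E \<subseteq> expo {..n} d"
  shows "smooth_togliatti n d (mon_ideal {..n} E :: (nat, 'k::field) mpoly set)
    \<longleftrightarrow> smooth_variety (expo {..n} d - E) (toric_variety n (expo {..n} d - E) :: (_ \<Rightarrow> 'k) set)"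
  unfolding smooth_togliatti_def togliatti_variety_def Let_def remaining_monomials_mon_ideal[OF assms]
    toric_variety_def torus_set_def ..

lemma chart_expo:
  assumes "i \<in> V" "j \<in> V" "l \<in> V" "1 \<le> h i" "h i < d"
  shows "chart d h i j l \<in> expo V d"
  unfolding chart_def using assms by (auto simp: expo_def mdeg_add keys_add_nat split: if_splits)

lemma eq_chart:
  assumes m: "m \<in> expo {..n} d" and ij: "i \<le> n" "j \<le> n" "i \<noteq> j"
    and h: "Poly_Mapping.lookup m i = h i" "Poly_Mapping.lookup m j = d - h i"
  shows "m = chart d h i j i"
proof (rule poly_mapping_eqI)
  fix l
  have k: "Poly_Mapping.keys m \<subseteq> {..n}" and d: "mdeg m = d" using m by (auto simp: expo_def)
  have le: "sum (lk m) S \<le> d" if "S \<subseteq> {..n}" for S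
    using sum_mono2[OF finite_atMost that, of "lk m"] mdeg_eq_sum[OF finite_atMost k] d by simp
  have "lk m i \<le> d" using le[of "{i}"] ij by simp
  then have "lk m l = 0" if "l \<le> n" "l \<noteq> i" "l \<noteq> j" using le[of "{i, j, l}"] that ij h by simp
  moreover have "lk m l = 0" if "\<not> l \<le> n" using k that by (auto simp: in_keys_iff)
  ultimately show "lk m l = lk (chart d h i j i) l" using ij h
    by (cases "l \<le> n") (auto simp: chart_def lookup_add lookup_single when_def)
qed

text \<open>Not only \<open>x_0 ^ d\<close> but also every \<open>x_0 ^ (d - 1) x_j\<close> is
  removed, so the corner at \<open>x_0\<close> is cut one step deeper.\<close>

definition triv_bound :: "nat \<Rightarrow> nat \<Rightarrow> nat" where
  "triv_bound d i = (if i = 0 then d - 2 else d - 1)"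

lemma triv_complement:
  assumes d: "d \<ge> 2"
  shows "expo {..n} d - triv n d 0 = {m \<in> expo {..n} d. \<forall>i\<le>n. Poly_Mapping.lookup m i \<le> triv_bound d i}"
proof -
  have "m \<in> triv n d 0 \<longleftrightarrow> (\<exists>i\<le>n. Poly_Mapping.lookup m i > triv_bound d i)" if m: "m \<in> expo {..n} d" for m
  proof
    assume "m \<in> triv n d 0"
    then consider i where "i \<le> n" "m = sg i d" | j where "j \<le> n" "j \<noteq> 0" "m = sg 0 (d - 1) + sg j 1"
      unfolding triv_def pures_def by auto
    then show "\<exists>i\<le>n. lk m i > triv_bound d i"
    proof cases
      case (1 i) then show ?thesis using d by (intro exI[of _ i]) (auto simp: triv_bound_def)
    next
      case (2 j) then show ?thesis using d by (intro exI[of _ 0]) (auto simp: triv_bound_def lookup_add lookup_single when_def)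
    qed
  next
    assume "\<exists>i\<le>n. lk m i > triv_bound d i"
    then obtain i where i: "i \<le> n" "lk m i > triv_bound d i" by blast
    have k: "Poly_Mapping.keys m \<subseteq> {..n}" and md: "mdeg m = d" using m by (auto simp: expo_def)
    have out: "lk m l = 0" if "\<not> l \<le> n" for l using k that by (auto simp: in_keys_iff)
    have le: "sum (lk m) S \<le> d" if "S \<subseteq> {..n}" for S
      using sum_mono2[OF finite_atMost that, of "lk m"] mdeg_eq_sum[OF finite_atMost k] md by simp
    have i_le: "lk m i \<le> d" using le[of "{i}"] i by simp
    show "m \<in> triv n d 0"
    proof (cases "lk m i = d")
      case True
      have "m = sg i d"
      proof (rule poly_mapping_eqI)
        fix l show "lk m l = lk (sg i d) l"
          using le[of "{i, l}"] True i out[of l] by (cases "l \<le> n"; cases "l = i") (auto simp: lookup_single when_def)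
      qed
      then show ?thesis using i by (auto simp: triv_def pures_def)
    next
      case False
      then have i0: "i = 0" "lk m 0 = d - 1" using i i_le d by (auto simp: triv_bound_def split: if_splits)
      have "(\<Sum>l\<in>{..n} - {0}. lk m l) = 1"
        using mdeg_eq_sum[OF finite_atMost k] md i0 d sum.remove[of "{..n}" 0 "lk m"] by simp
      then obtain j where j: "j \<in> {..n} - {0}" "lk m j > 0" by (metis gr0I sum.neutral zero_neq_one)
      have jd: "lk m j \<le> 1" using le[of "{0, j}"] j i0 d by simp
      have "m = sg 0 (d - 1) + sg j 1"
      proof (rule poly_mapping_eqI)
        fix l
        have "lk m l = 0" if "l \<le> n" "l \<noteq> 0" "l \<noteq> j" using le[of "{0, j, l}"] that j i0 d by simp
        then show "lk m l = lk (sg 0 (d - 1) + sg j 1) l"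
          using j jd i0 out[of l] by (cases "l \<le> n") (auto simp: lookup_add lookup_single when_def)
      qed
      then show ?thesis using j by (auto simp: triv_def)
    qed
  qed
  then show ?thesis unfolding not_less[symmetric] by blast
qed

text \<open>Replacing one factor \<open>j\<close> by \<open>i\<close>, or one factor
  \<open>i\<close> by \<open>j\<close>, moves \<open>m\<close> in opposite directions.\<close>

lemma transfer_midpoint:
  assumes m: "m \<in> expo V d" and ij: "i \<in> V" "j \<in> V" "i \<noteq> j" "0 < Poly_Mapping.lookup m i" "0 < Poly_Mapping.lookup m j"
  obtains m' m'' where "m' \<in> expo V d" "m'' \<in> expo V d" "m' + m'' = m + m" "m' \<noteq> m"
    "\<And>l. Poly_Mapping.lookup m' l \<le> (if l = i then Poly_Mapping.lookup m i + 1 else Poly_Mapping.lookup m l)"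
    "\<And>l. Poly_Mapping.lookup m'' l \<le> (if l = j then Poly_Mapping.lookup m j + 1 else Poly_Mapping.lookup m l)"
proof -
  define u where "u = m - (sg i 1 + sg j 1)"
  have m_eq: "m = u + sg i 1 + sg j 1"
    unfolding u_def using ij by (intro poly_mapping_eqI) (auto simp: lookup_add lookup_minus lookup_single when_def)
  show thesis
  proof (rule that[of "u + sg i 2" "u + sg j 2"])
    show "u + sg i 2 \<in> expo V d" "u + sg j 2 \<in> expo V d"
      using m ij unfolding m_eq by (auto simp: expo_def mdeg_add keys_add_nat)
    show "u + sg i 2 + (u + sg j 2) = m + m" "u + sg i 2 \<noteq> m"
      unfolding m_eq using ij(3) by (auto simp: poly_mapping_eq_iff fun_eq_iff lookup_add lookup_single when_def)
  qed (auto simp: m_eq lookup_add lookup_single when_def)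
qed

text \<open>If two positive exponents are below their bounds, a unit can be moved between them in
  both directions. Otherwise some exponent attains its bound, and the remaining degree, 1 or 2, must
  sit on a single variable; the monomial is then a vertex.\<close>

lemma truncated_simplex_triv:
  assumes n: "n \<ge> 1" and d: "d \<ge> 4"
  shows "truncated_simplex n d (triv_bound d) (expo {..n} d - triv n d 0)"
proof -
  let ?h = "triv_bound d"
  have hb: "1 \<le> ?h i" "?h i < d" "d - ?h i \<le> 2" "3 \<le> ?h i \<or> i = 0" "?h i \<ge> 2" "i \<noteq> 0 \<Longrightarrow> d - ?h i = 1" for i using d by (auto simp: triv_bound_def)
  have A: "expo {..n} d - triv n d 0 = {m \<in> expo {..n} d. \<forall>i\<le>n. lk m i \<le> ?h i}"
    by (rule triv_complement) (use d in simp)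
  show ?thesis
    unfolding A
  proof
    show "n \<ge> 1" by (rule n)
    show "chart d ?h i j l \<in> {m \<in> expo {..n} d. \<forall>i\<le>n. lk m i \<le> ?h i}"
      if "i \<le> n" "j \<le> n" "i \<noteq> j" "l \<le> n" for i j l
    proof (intro CollectI conjI allI impI)
      show "chart d ?h i j l \<in> expo {..n} d" by (rule chart_expo) (use that hb in auto)
      fix k
      have "lk (chart d ?h i j l) k \<le> (if k = i then ?h i else if k = j then d - ?h i + (if l = j then 1 else 0) else 1)"
        using that(3) by (auto simp: chart_def lookup_add lookup_single when_def)
      moreover have "d - ?h i + 1 \<le> ?h j" using that(3) hb(3,4,5,6)[of i] hb(3,4,5,6)[of j] by (cases "i = 0") auto
      ultimately show "lk (chart d ?h i j l) k \<le> ?h k" using hb(1)[of k] by (auto split: if_splits)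
    qed
    fix m assume m: "m \<in> {m \<in> expo {..n} d. \<forall>i\<le>n. lk m i \<le> ?h i}"
    then have mE: "m \<in> expo {..n} d" and mh: "\<And>i. i \<le> n \<Longrightarrow> lk m i \<le> ?h i" by auto
    have k: "Poly_Mapping.keys m \<subseteq> {..n}" and md: "mdeg m = d" using mE by (auto simp: expo_def)
    have tot: "(\<Sum>l\<le>n. lk m l) = d" using mdeg_eq_sum[OF finite_atMost k] md by simp
    show "(\<exists>i\<le>n. \<exists>j\<le>n. i \<noteq> j \<and> m = chart d ?h i j i) \<or>
      (\<exists>m'\<in>{m \<in> expo {..n} d. \<forall>i\<le>n. lk m i \<le> ?h i}. \<exists>m''\<in>{m \<in> expo {..n} d. \<forall>i\<le>n. lk m i \<le> ?h i}. m' + m'' = m + m \<and> m' \<noteq> m)"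
    proof (cases "\<exists>i\<le>n. \<exists>j\<le>n. i \<noteq> j \<and> 0 < lk m i \<and> lk m i < ?h i \<and> 0 < lk m j \<and> lk m j < ?h j")
      case True
      then obtain i j where ij: "i \<le> n" "j \<le> n" "i \<noteq> j" "0 < lk m i" "lk m i < ?h i" "0 < lk m j" "lk m j < ?h j" by blast
      obtain m' m'' where m': "m' \<in> expo {..n} d" "m'' \<in> expo {..n} d" "m' + m'' = m + m" "m' \<noteq> m"
        and b: "\<And>l. lk m' l \<le> (if l = i then lk m i + 1 else lk m l)" "\<And>l. lk m'' l \<le> (if l = j then lk m j + 1 else lk m l)"
        using transfer_midpoint[OF mE, of i j] ij by auto
      have "lk m' l \<le> ?h l" "lk m'' l \<le> ?h l" if "l \<le> n" for l
        using b[of l] mh[OF that] ij by (auto split: if_splits)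
      then show ?thesis using m' by blast
    next
      case False
      have "\<exists>i\<le>n. lk m i = ?h i"
      proof (rule ccontr)
        assume "\<not> (\<exists>i\<le>n. lk m i = ?h i)"
        then have lt: "lk m i < ?h i" if "i \<le> n" for i using mh[OF that] that by (metis le_neq_implies_less)
        have "\<exists>i\<le>n. lk m i > 0" using tot d by (metis atMost_iff gr0I not_numeral_le_zero sum.neutral)
        then obtain i where i: "i \<le> n" "lk m i > 0" by blast
        have "lk m l = 0" if "l \<in> {..n} - {i}" for l using False i lt that by (metis Diff_iff atMost_iff gr0I singletonI)
        then have "(\<Sum>l\<le>n. lk m l) = lk m i" using sum.remove[of "{..n}" i "lk m"] i by simp
        then show False using tot lt[OF i(1)] hb(2)[of i] by simp
      qed
      then obtain i where i: "i \<le> n" "lk m i = ?h i" by blast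
      have rest: "(\<Sum>l\<in>{..n} - {i}. lk m l) = d - ?h i" using sum.remove[of "{..n}" i "lk m"] i tot by simp
      then obtain j where j: "j \<in> {..n} - {i}" "lk m j > 0" using hb(2)[of i] by (metis gr0I sum.neutral zero_less_diff less_numeral_extra(3))
      have rest': "lk m j + (\<Sum>l\<in>{..n} - {i} - {j}. lk m l) = d - ?h i"
        using sum.remove[of "{..n} - {i}" j "lk m"] j rest by simp
      \<comment> \<open>Two further variables would each have exponent 1, below every bound because
        \<open>h i \<ge> 2\<close>, and could exchange a unit.\<close>
      have "lk m j = d - ?h i"
      proof (rule ccontr)
        assume ne: "lk m j \<noteq> d - ?h i"
        then obtain l where l: "l \<in> {..n} - {i} - {j}" "lk m l > 0" using rest' by (metis add.right_neutral gr0I sum.neutral)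
        have "lk m l \<le> (\<Sum>l\<in>{..n} - {i} - {j}. lk m l)" by (rule member_le_sum[OF l(1)]) auto
        then have one: "lk m j = 1" "lk m l = 1" "d - ?h i = 2" using rest' l j hb(3)[of i] by auto
        then have "lk m j < ?h j" "lk m l < ?h l" using hb(5)[of j] hb(5)[of l] by auto
        moreover have "j \<le> n" "l \<le> n" "j \<noteq> l" using j l by auto
        ultimately show False using False j(2) l(2) by blast
      qed
      then have "m = chart d ?h i j i" using eq_chart[where h = ?h, OF mE i(1) _ _ i(2), of j] j by auto
      then show ?thesis using i(1) j by blast
    qed
  qed (use hb in auto)
qed

lemma smooth_triv:
  assumes "n \<ge> 1" "d \<ge> 4"
  shows "smooth_togliatti n d (mon_ideal {..n} (triv n d 0) :: (nat, 'k::field_char_0) mpoly set)"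
proof -
  have E: "triv n d 0 \<subseteq> expo {..n} d" by (rule triv_expo) (use assms in auto)
  show ?thesis unfolding smooth_togliatti_iff[OF E] by (rule truncated_simplex.smooth[OF truncated_simplex_triv[OF assms]])
qed

section \<open>Smoothness of the exceptional system of degree 5\<close>

lemma in_expo_tmon:
  assumes "distinct [x, y, z]" "m \<in> expo {x, y, z} d"
  obtains a b c where "m = tmon x y z a b c" "a + b + c = d"
proof -
  obtain a b c where abc: "m = tmon x y z a b c" using in_expo_tri(1)[OF assms] unfolding tmon_def by blast
  have "mdeg m = a + b + c" unfolding abc tmon_def by (simp add: mdeg_add)
  then have "a + b + c = d" using assms(2) by (simp add: expo_def)
  then show thesis using that abc by blast
qed

lemma quintic_exponents: "a + b + c = (5::nat) \<Longrightarrow> \<not> (a = 5 \<and> b = 0 \<and> c = 0) \<Longrightarrow> \<not> (a = 0 \<and> b = 5 \<and> c = 0) \<Longrightarrow> \<not> (a = 0 \<and> b = 0 \<and> c = 5) \<Longrightarrow>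
  \<not> (a = 3 \<and> b = 1 \<and> c = 1) \<Longrightarrow> \<not> (a = 1 \<and> b = 2 \<and> c = 2) \<Longrightarrow>
  a = 4 \<or> b = 4 \<or> c = 4 \<or> a = 3 \<and> b = 2 \<or> a = 2 \<and> b = 3 \<or> a = 3 \<and> b = 0 \<or> a = 2 \<and> b = 0 \<or> a = 0 \<and> b = 3 \<or> a = 0 \<and> b = 2 \<or> a = 1 \<and> b = 3 \<or> a = 1 \<and> b = 1 \<or> a = 2 \<and> b = 2 \<or> a = 2 \<and> b = 1"
  by presburger

text \<open>The two mixed generators are interior points of the triangle and not next to any vertex,
  so the truncated simplex of height 4 keeps all the points needed for charts.\<close>

lemma truncated_simplex_exc5:
  assumes xyz: "distinct [x, y, z]" "{x, y, z} = {..2}"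
  shows "truncated_simplex 2 5 (\<lambda>_. 4) (expo {..2} 5 - exc5 x y z)"
proof -
  define A where "A = expo {..2} 5 - exc5 x y z"
  note lk_t = lookup_tmon[OF xyz(1)]
  have inA: "tmon x y z a b c \<in> A \<longleftrightarrow> a + b + c = 5 \<and> \<not> (a = 5 \<and> b = 0 \<and> c = 0) \<and> \<not> (a = 0 \<and> b = 5 \<and> c = 0) \<and> \<not> (a = 0 \<and> b = 0 \<and> c = 5)
      \<and> \<not> (a = 3 \<and> b = 1 \<and> c = 1) \<and> \<not> (a = 1 \<and> b = 2 \<and> c = 2)" for a b c
  proof -
    have "tmon x y z a b c \<in> expo {..2} 5 \<longleftrightarrow> a + b + c = 5"
      unfolding xyz(2)[symmetric] by (auto simp: expo_def tmon_def mdeg_add keys_add_nat)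
    then show ?thesis unfolding A_def exc5_def by (simp only: Diff_iff insert_iff empty_iff tmon_eq_iff[OF xyz(1)]) blast
  qed
  have coords: "\<exists>a b c. m = tmon x y z a b c \<and> a + b + c = 5 \<and> \<not> (a = 5 \<and> b = 0 \<and> c = 0) \<and> \<not> (a = 0 \<and> b = 5 \<and> c = 0) \<and> \<not> (a = 0 \<and> b = 0 \<and> c = 5)
      \<and> \<not> (a = 3 \<and> b = 1 \<and> c = 1) \<and> \<not> (a = 1 \<and> b = 2 \<and> c = 2)" if m: "m \<in> A" for m
  proof -
    have "m \<in> expo {x, y, z} 5" using m unfolding A_def xyz(2) by blast
    then obtain a b c where abc: "m = tmon x y z a b c" by (rule in_expo_tmon[OF xyz(1)])
    from m[unfolded abc inA] show ?thesis
      by (intro exI[of _ a] exI[of _ b] exI[of _ c]) (use abc in blast)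
  qed
  have V: "i \<in> {x, y, z}" if "i \<le> 2" for i using that unfolding xyz(2) by simp
  have le2: "x \<le> 2" "y \<le> 2" "z \<le> 2" using xyz(2)[THEN equalityD1] by simp_all
  have "truncated_simplex 2 5 (\<lambda>_. 4) A"
  proof
    show "A \<subseteq> expo {..2} 5" by (auto simp: A_def)
    show "lk m i \<le> 4" if mA: "m \<in> A" and i2: "i \<le> 2" for m i
    proof -
      obtain a b c where abc: "m = tmon x y z a b c" "a + b + c = 5" "\<not> (a = 5 \<and> b = 0 \<and> c = 0)" "\<not> (a = 0 \<and> b = 5 \<and> c = 0)" "\<not> (a = 0 \<and> b = 0 \<and> c = 5)"
        using coords[OF mA] by blast
      have "a \<le> 4 \<and> b \<le> 4 \<and> c \<le> 4" using abc(2-) by linarith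
      then show ?thesis using V[OF i2] lk_t[of a b c] unfolding abc(1) by (elim insertE emptyE) simp_all
    qed
    show "chart 5 (\<lambda>_. 4) i j l \<in> A" if ij: "i \<le> 2" "j \<le> 2" "i \<noteq> j" "l \<le> 2" for i j l
    proof -
      let ?m = "chart 5 (\<lambda>_. 4) i j l"
      have "?m \<in> expo {..2} 5" by (rule chart_expo) (use ij in auto)
      moreover have "lk ?m i = 4 \<or> lk ?m i = 3 \<and> lk ?m j = 2" using ij by (auto simp: chart_def lookup_add lookup_single when_def)
      moreover have "lk m i \<noteq> 4 \<and> \<not> (lk m i = 3 \<and> lk m j = 2)" if "m \<in> exc5 x y z" for m
        using that V[OF ij(1)] V[OF ij(2)] ij(3) unfolding exc5_def by (auto simp: lk_t)
      ultimately show ?thesis unfolding A_def by blast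
    qed
    fix m assume m: "m \<in> A"
    obtain a b c where abc: "m = tmon x y z a b c" and s: "a + b + c = 5" and ne: "\<not> (a = 5 \<and> b = 0 \<and> c = 0)" "\<not> (a = 0 \<and> b = 5 \<and> c = 0)" "\<not> (a = 0 \<and> b = 0 \<and> c = 5)"
      "\<not> (a = 3 \<and> b = 1 \<and> c = 1)" "\<not> (a = 1 \<and> b = 2 \<and> c = 2)" using coords[OF m] by blast
    \<comment> \<open>Trading one unit between two variables can hit a removed monomial, so each
      remaining point gets its own explicit pair.\<close>
    have mid: "\<exists>m'\<in>A. \<exists>m''\<in>A. m' + m'' = m + m \<and> m' \<noteq> m"
      if "tmon x y z p q r \<in> A" "tmon x y z p' q' r' \<in> A" "p + p' = a + a" "q + q' = b + b" "r + r' = c + c" "p \<noteq> a \<or> q \<noteq> b"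
      for p q r p' q' r'
    proof (intro bexI conjI)
      have "tmon x y z p q r + tmon x y z p' q' r' = tmon x y z (p + p') (q + q') (r + r')"
        by (simp add: tmon_def single_add ac_simps)
      also have "\<dots> = m + m" unfolding that abc by (simp add: tmon_def single_add ac_simps)
      finally show "tmon x y z p q r + tmon x y z p' q' r' = m + m" .
      show "tmon x y z p q r \<noteq> m" unfolding abc tmon_eq_iff[OF xyz(1)] using that(6) by blast
    qed (use that in auto)
    have ver: "\<exists>i\<le>2. \<exists>j\<le>2. i \<noteq> j \<and> m = chart 5 (\<lambda>_. 4) i j i" if "i \<le> 2" "j \<le> 2" "i \<noteq> j" "lk m i = 4" "lk m j = 1" for i j
      using eq_chart[where h = "\<lambda>_. 4" and i = i and j = j and n = 2 and d = 5 and m = m] m that by (auto simp: A_def)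
    note lk_m = lk_t[of a b c, folded abc]
    have xyz_ne: "x \<noteq> y" "x \<noteq> z" "y \<noteq> z" using xyz(1) by auto
    from quintic_exponents[OF s ne]
    show "(\<exists>i\<le>2. \<exists>j\<le>2. i \<noteq> j \<and> m = chart 5 (\<lambda>_. 4) i j i) \<or> (\<exists>m'\<in>A. \<exists>m''\<in>A. m' + m'' = m + m \<and> m' \<noteq> m)" (is ?G)
    proof (elim disjE)
      assume e: "a = 4"
      then have "b = 1 \<or> c = 1" using s by auto
      then show ?G using ver[OF le2(1,2) xyz_ne(1)] ver[OF le2(1,3) xyz_ne(2)] e lk_m by metis
    next
      assume e: "b = 4"
      then have "a = 1 \<or> c = 1" using s by auto
      then show ?G using ver[OF le2(2,1) xyz_ne(1)[symmetric]] ver[OF le2(2,3) xyz_ne(3)] e lk_m by metis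
    next
      assume e: "c = 4"
      then have "a = 1 \<or> b = 1" using s by auto
      then show ?G using ver[OF le2(3,1) xyz_ne(2)[symmetric]] ver[OF le2(3,2) xyz_ne(3)[symmetric]] e lk_m by metis
    next
      assume e: "a = 3 \<and> b = 2"
      then show ?G using s mid[of 4 1 0 2 3 0] by (simp add: inA)
    next
      assume e: "a = 2 \<and> b = 3"
      then show ?G using s mid[of 3 2 0 1 4 0] by (simp add: inA)
    next
      assume e: "a = 3 \<and> b = 0"
      then show ?G using s mid[of 4 0 1 2 0 3] by (simp add: inA)
    next
      assume e: "a = 2 \<and> b = 0"
      then show ?G using s mid[of 3 0 2 1 0 4] by (simp add: inA)
    next
      assume e: "a = 0 \<and> b = 3"
      then show ?G using s mid[of 0 4 1 0 2 3] by (simp add: inA)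
    next
      assume e: "a = 0 \<and> b = 2"
      then show ?G using s mid[of 0 3 2 0 1 4] by (simp add: inA)
    next
      assume e: "a = 1 \<and> b = 3"
      then show ?G using s mid[of 2 3 0 0 3 2] by (simp add: inA)
    next
      assume e: "a = 1 \<and> b = 1"
      then show ?G using s mid[of 2 0 3 0 2 3] by (simp add: inA)
    next
      assume e: "a = 2 \<and> b = 2"
      then show ?G using s mid[of 3 0 2 1 4 0] by (simp add: inA)
    next
      assume e: "a = 2 \<and> b = 1"
      then show ?G using s mid[of 3 2 0 1 0 4] by (simp add: inA)
    qed
  qed auto
  then show ?thesis by (simp add: A_def)
qed

lemma smooth_exc5:
  assumes xyz: "distinct [x, y, z]" "{x, y, z} = {..2}"
  shows "smooth_togliatti 2 5 (mon_ideal {..2} (exc5 x y z) :: (nat, 'k::field_char_0) mpoly set)"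
  unfolding smooth_togliatti_iff[OF exc5_expo[OF xyz(2)]] by (rule truncated_simplex.smooth[OF truncated_simplex_exc5[OF xyz]])

text \<open>The coefficient of \<open>pull f\<close> at the image of \<open>\<mu>\<close> is the sum
  of the coefficients of \<open>f\<close> over all its monomials with this image. If
  \<open>\<mu>\<close> is alone there, no equation of \<open>X\<close> of this degree can contain
  it.\<close>

lemma lookup_eq_0_of_pull_eq_0:
  fixes f :: "(nat \<Rightarrow>\<^sub>0 nat, 'k::comm_ring_1) mpoly"
  assumes A: "finite A" and f: "f \<in> forms A t" "pull f = 0"
    and uniq: "\<And>\<nu>. \<nu> \<in> expo A t \<Longrightarrow> (\<And>i. (\<Sum>a\<in>A. Poly_Mapping.lookup \<nu> a * Poly_Mapping.lookup a i) = (\<Sum>a\<in>A. Poly_Mapping.lookup \<mu> a * Poly_Mapping.lookup a i)) \<Longrightarrow> \<nu> = \<mu>"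
  shows "Poly_Mapping.lookup f \<mu> = 0"
proof (cases "\<mu> \<in> Poly_Mapping.keys f")
  case True
  define wt where "wt \<nu> = (\<Sum>a\<in>A. \<Sum>k<lk \<nu> a. a)" for \<nu> :: "(nat \<Rightarrow>\<^sub>0 nat) \<Rightarrow>\<^sub>0 nat"
  have lk_wt: "lk (wt \<nu>) i = (\<Sum>a\<in>A. lk \<nu> a * lk a i)" for \<nu> i
    unfolding wt_def lookup_sum by simp
  have monic_sum: "monic (sum g S) = (\<Prod>x\<in>S. monic (g x) :: (nat, 'k) mpoly)" for g :: "'i \<Rightarrow> (nat \<Rightarrow>\<^sub>0 nat)" and S
    by (induction S rule: infinite_finite_induct) (simp_all add: monic_mult[symmetric], simp_all add: monic_def)
  have kf: "\<nu> \<in> expo A t" if "\<nu> \<in> Poly_Mapping.keys f" for \<nu> using f(1) that by (auto simp: forms_iff)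
  have me: "mon_eval \<nu> monic = (monic (wt \<nu>) :: (nat, 'k) mpoly)" if "\<nu> \<in> Poly_Mapping.keys f" for \<nu>
  proof -
    have "mon_eval \<nu> monic = (\<Prod>a\<in>A. (monic a :: (nat, 'k) mpoly) ^ lk \<nu> a)"
      by (rule mon_eval_eq[OF A]) (use kf[OF that] in \<open>auto simp: expo_def\<close>)
    also have "\<dots> = monic (wt \<nu>)" unfolding wt_def monic_sum by simp
    finally show ?thesis .
  qed
  have pf: "pull f = (\<Sum>\<nu>\<in>Poly_Mapping.keys f. sg (wt \<nu>) (lk f \<nu>))"
    unfolding pull_def eval_hom_def by (rule sum.cong[OF refl]) (simp add: me monic_def mult_single)
  have "lk (pull f) (wt \<mu>) = (\<Sum>\<nu>\<in>Poly_Mapping.keys f. if \<nu> = \<mu> then lk f \<nu> else 0)"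
    unfolding pf lookup_sum
  proof (intro sum.cong refl)
    fix \<nu> assume \<nu>: "\<nu> \<in> Poly_Mapping.keys f"
    have "\<nu> = \<mu>" if "wt \<nu> = wt \<mu>"
    proof (rule uniq[OF kf[OF \<nu>]])
      fix i show "(\<Sum>a\<in>A. lk \<nu> a * lk a i) = (\<Sum>a\<in>A. lk \<mu> a * lk a i)" unfolding lk_wt[symmetric] that ..
    qed
    then show "lk (sg (wt \<nu>) (lk f \<nu>)) (wt \<mu>) = (if \<nu> = \<mu> then lk f \<nu> else 0)"
      by (auto simp: lookup_single when_def)
  qed
  also have "\<dots> = lk f \<mu>" using True by simp
  finally show ?thesis using f(2) by simp
qed (simp add: in_keys_iff)

text \<open>Independence of the unit vectors is clear; the finite index set \<open>A\<close> ensures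
  that a basis of \<open>T\<close> is finite, so that its cardinality bounds independent
  sets.\<close>

lemma dim_ge_card_units:
  fixes T :: "('m \<Rightarrow> 'k::field) set"
  assumes A: "finite A" and T: "\<And>w v. w \<in> T \<Longrightarrow> v \<notin> A \<Longrightarrow> w v = 0"
    and M: "finite M" "\<And>m. m \<in> M \<Longrightarrow> (\<lambda>a. if a = m then 1 else 0) \<in> T"
  shows "card M \<le> vector_space.dim (\<lambda>(c::'k) w v. c * w v) T"
proof -
  interpret V: vector_space "\<lambda>(c::'k) (w :: 'm \<Rightarrow> 'k) v. c * w v" by (rule vector_space_fun)
  define u where "u m = (\<lambda>a. if a = m then 1 else 0 :: 'k)" for m :: 'm
  have inj: "inj_on u S" for S by (rule inj_onI) (auto simp: u_def fun_eq_iff split: if_splits)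
  have ind: "V.independent (u ` M)"
  proof (rule V.independent_if_scalars_zero)
    fix f w assume f: "(\<Sum>x\<in>u ` M. (\<lambda>v. f x * x v)) = 0" and w: "w \<in> u ` M"
    then obtain m where m: "m \<in> M" "w = u m" by blast
    have "(\<Sum>x\<in>u ` M. (\<lambda>v. f x * x v)) m = (\<Sum>l\<in>M. f (u l) * u l m)"
      unfolding sum.reindex[OF inj] by (simp add: sum_fun_eval)
    also have "\<dots> = (\<Sum>l\<in>M. if l = m then f (u l) else 0)" by (rule sum.cong) (auto simp: u_def)
    also have "\<dots> = f w" using m M(1) by simp
    finally show "f w = 0" using f by simp
  qed (use M in simp)
  have spanA: "T \<subseteq> V.span (u ` A)"
  proof
    fix w assume w: "w \<in> T"
    have "w = (\<Sum>a\<in>A. (\<lambda>v. w a * u a v))"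
    proof
      fix v
      have "(\<Sum>a\<in>A. w a * u a v) = (\<Sum>a\<in>A. if a = v then w a else 0)" by (rule sum.cong) (auto simp: u_def)
      also have "\<dots> = w v" using A T[OF w] by auto
      finally show "w v = (\<Sum>a\<in>A. (\<lambda>v. w a * u a v)) v" by (simp add: sum_fun_eval)
    qed
    also have "\<dots> \<in> V.span (u ` A)" by (intro V.span_sum V.span_scale V.span_base) auto
    finally show "w \<in> V.span (u ` A)" .
  qed
  obtain B where B: "B \<subseteq> T" "V.independent B" "T \<subseteq> V.span B" "card B = V.dim T" using V.basis_exists by blast
  have "finite B" by (rule V.independent_span_bound[THEN conjunct1, OF finite_imageI[OF A] B(2)]) (use B(1) spanA in blast)
  then have "card (u ` M) \<le> card B"
    by (rule V.independent_span_bound[THEN conjunct2, OF _ ind]) (use M(2) B(3) in \<open>auto simp: u_def\<close>)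
  then show ?thesis using inj by (simp add: card_image B(4))
qed

lemma mon_eval_unit:
  assumes "mon_eval \<kappa> (\<lambda>a. if a = v then 1 else 0 :: 'k::idom) \<noteq> 0"
  shows "\<kappa> = Poly_Mapping.single v (Poly_Mapping.lookup \<kappa> v)"
proof (rule poly_mapping_eqI)
  fix a
  have "lk \<kappa> a = 0" if "a \<noteq> v"
  proof (rule ccontr)
    assume a: "lk \<kappa> a \<noteq> 0"
    have "mon_eval \<kappa> (\<lambda>a. if a = v then 1 else 0 :: 'k) = 0"
      unfolding mon_eval_def by (rule prod_zero[OF finite_keys], rule bexI[of _ a]) (use that a in \<open>simp_all add: in_keys_iff power_0_left\<close>)
    then show False using assms by blast
  qed
  then show "lk \<kappa> a = lk (sg v (lk \<kappa> v)) a" by (auto simp: lookup_single when_def)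
qed

lemma exc4_complement:
  assumes xyz: "distinct [x, y, z]" "{x, y, z} = {..2}"
  shows "expo {..2} 4 - exc4 x y z = {tmon x y z 3 1 0, tmon x y z 1 3 0, tmon x y z 3 0 1, tmon x y z 2 1 1, tmon x y z 0 3 1,
    tmon x y z 1 0 3, tmon x y z 0 1 3, tmon x y z 2 0 2, tmon x y z 0 2 2, tmon x y z 1 2 1}" (is "?A = ?S")
proof (intro equalityI subsetI)
  fix m assume m: "m \<in> ?A"
  then have "m \<in> expo {x, y, z} 4" unfolding xyz(2) by blast
  then obtain a b c where abc: "m = tmon x y z a b c" "a + b + c = 4" by (rule in_expo_tmon[OF xyz(1)])
  have "\<not> (a = 4 \<and> b = 0 \<and> c = 0) \<and> \<not> (a = 0 \<and> b = 4 \<and> c = 0) \<and> \<not> (a = 0 \<and> b = 0 \<and> c = 4) \<and> \<not> (a = 1 \<and> b = 1 \<and> c = 2) \<and> \<not> (a = 2 \<and> b = 2 \<and> c = 0)"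
    using m unfolding abc(1) exc4_def Diff_iff insert_iff empty_iff tmon_eq_iff[OF xyz(1)] by blast
  with abc(2) have "a = 3 \<and> b = 1 \<and> c = 0 \<or> a = 1 \<and> b = 3 \<and> c = 0 \<or> a = 3 \<and> b = 0 \<and> c = 1 \<or> a = 2 \<and> b = 1 \<and> c = 1 \<or> a = 0 \<and> b = 3 \<and> c = 1 \<or>
    a = 1 \<and> b = 0 \<and> c = 3 \<or> a = 0 \<and> b = 1 \<and> c = 3 \<or> a = 2 \<and> b = 0 \<and> c = 2 \<or> a = 0 \<and> b = 2 \<and> c = 2 \<or> a = 1 \<and> b = 2 \<and> c = 1"
    by presburger
  then show "m \<in> ?S" unfolding abc(1) by (elim disjE conjE) simp_all
next
  fix m assume m: "m \<in> ?S"
  have "?S \<subseteq> expo {..2} 4" unfolding xyz(2)[symmetric] by (auto intro!: tmon_expo)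
  moreover have "m \<notin> exc4 x y z" using m by (elim insertE emptyE) (simp_all add: exc4_def tmon_eq_iff[OF xyz(1)])
  ultimately show "m \<in> ?A" using m by blast
qed

text \<open>The lattice points next to the vertex \<open>x ^ 3 y\<close> that are indecomposable in the semigroup generated by the
  polytope at this vertex: the tangent space there has dimension 3.\<close>

definition exc4_corner :: "nat \<Rightarrow> nat \<Rightarrow> nat \<Rightarrow> (nat \<Rightarrow>\<^sub>0 nat) set" where
  "exc4_corner x y z = {tmon x y z 3 1 0, tmon x y z 1 3 0, tmon x y z 3 0 1, tmon x y z 2 1 1}"

text \<open>Measured by (3 minus the exponent of \<open>x\<close>, exponent of \<open>z\<close>),
  the vertex has value (0, 0) and the other corner points (2, 0), (0, 1), (1, 1). Splitting one of
  these into nonzero values would need (1, 0), which is the removed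
  \<open>x ^ 2 y ^ 2\<close>.\<close>

lemma exc4_unique:
  assumes xyz: "distinct [x, y, z]" "{x, y, z} = {..2}"
    and A: "A = expo {..2} 4 - exc4 x y z" and m: "m \<in> exc4_corner x y z"
    and \<mu>: "\<mu> = Poly_Mapping.single (tmon x y z 3 1 0) s + Poly_Mapping.single m 1" and \<nu>: "\<nu> \<in> expo A (s + 1)"
    and eq: "\<And>i. (\<Sum>a\<in>A. Poly_Mapping.lookup \<nu> a * Poly_Mapping.lookup a i) = (\<Sum>a\<in>A. Poly_Mapping.lookup \<mu> a * Poly_Mapping.lookup a i)"
  shows "\<nu> = \<mu>"
proof -
  note AS = A[unfolded exc4_complement[OF xyz]]
  note t = tmon_eq_iff[OF xyz(1)]
  note l = lookup_tmon[OF xyz(1)]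
  define N where "N a b c = lk \<nu> (tmon x y z a b c)" for a b c
  define P where "P a b c = lk \<mu> (tmon x y z a b c)" for a b c
  have sumA: "(\<Sum>a\<in>A. g a) = g (tmon x y z 3 1 0) + g (tmon x y z 1 3 0) + g (tmon x y z 3 0 1) + g (tmon x y z 2 1 1) + g (tmon x y z 0 3 1)
    + g (tmon x y z 1 0 3) + g (tmon x y z 0 1 3) + g (tmon x y z 2 0 2) + g (tmon x y z 0 2 2) + g (tmon x y z 1 2 1)" for g :: "_ \<Rightarrow> nat"
    unfolding AS by (simp add: t add.assoc)
  have e1: "3 * N 3 1 0 + N 1 3 0 + 3 * N 3 0 1 + 2 * N 2 1 1 + N 1 0 3 + 2 * N 2 0 2 + N 1 2 1
      = 3 * P 3 1 0 + P 1 3 0 + 3 * P 3 0 1 + 2 * P 2 1 1 + P 1 0 3 + 2 * P 2 0 2 + P 1 2 1"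
    using eq[of x] unfolding sumA l N_def[symmetric] P_def[symmetric] by linarith
  have e2: "N 3 0 1 + N 2 1 1 + N 0 3 1 + 3 * N 1 0 3 + 3 * N 0 1 3 + 2 * N 2 0 2 + 2 * N 0 2 2 + N 1 2 1
      = P 3 0 1 + P 2 1 1 + P 0 3 1 + 3 * P 1 0 3 + 3 * P 0 1 3 + 2 * P 2 0 2 + 2 * P 0 2 2 + P 1 2 1"
    using eq[of z] unfolding sumA l N_def[symmetric] P_def[symmetric] by linarith
  have finA: "finite A" unfolding AS by simp
  have kv: "Poly_Mapping.keys \<nu> \<subseteq> A" "mdeg \<nu> = s + 1" using \<nu> by (auto simp: expo_def)
  have e3: "N 3 1 0 + N 1 3 0 + N 3 0 1 + N 2 1 1 + N 0 3 1 + N 1 0 3 + N 0 1 3 + N 2 0 2 + N 0 2 2 + N 1 2 1 = s + 1"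
    using mdeg_eq_sum[OF finA kv(1)] kv(2) unfolding sumA N_def[symmetric] by simp
  have Pv: "P a b c = (if a = 3 \<and> b = 1 \<and> c = 0 then s else 0) + (if m = tmon x y z a b c then 1 else 0)" for a b c
    unfolding P_def \<mu> by (auto simp: lookup_add lookup_single when_def t)
  \<comment> \<open>Three times the number of factors minus the degree in \<open>x\<close>: each
    monomial is weighted by 3 minus its exponent of \<open>x\<close>.\<close>
  have f1: "2 * N 1 3 0 + N 2 1 1 + 2 * N 1 2 1 + 3 * N 0 3 1 + 2 * N 1 0 3 + 3 * N 0 1 3 + N 2 0 2 + 3 * N 0 2 2 + (3 * P 3 1 0 + P 1 3 0 + 3 * P 3 0 1 + 2 * P 2 1 1 + P 1 0 3 + 2 * P 2 0 2 + P 1 2 1) = 3 * (s + 1)"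
    unfolding e1[symmetric] e3[symmetric] by simp
  have mA: "m \<in> A" "tmon x y z 3 1 0 \<in> A" using m unfolding AS exc4_corner_def by auto
  have NP: "N 3 1 0 = P 3 1 0 \<and> N 1 3 0 = P 1 3 0 \<and> N 3 0 1 = P 3 0 1 \<and> N 2 1 1 = P 2 1 1 \<and> N 0 3 1 = P 0 3 1 \<and> N 1 0 3 = P 1 0 3
    \<and> N 0 1 3 = P 0 1 3 \<and> N 2 0 2 = P 2 0 2 \<and> N 0 2 2 = P 0 2 2 \<and> N 1 2 1 = P 1 2 1"
  proof -
    consider "m = tmon x y z 3 1 0" | "m = tmon x y z 1 3 0" | "m = tmon x y z 3 0 1" | "m = tmon x y z 2 1 1"
      using m unfolding exc4_corner_def by blast
    then show ?thesis
    proof cases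
      case 1
      have f: "2 * N 1 3 0 + N 2 1 1 + 2 * N 1 2 1 + 3 * N 0 3 1 + 2 * N 1 0 3 + 3 * N 0 1 3 + N 2 0 2 + 3 * N 0 2 2 = 0" and g: "N 3 0 1 + N 2 1 1 + N 0 3 1 + 3 * N 1 0 3 + 3 * N 0 1 3 + 2 * N 2 0 2 + 2 * N 0 2 2 + N 1 2 1 = 0"
        using f1 e2 unfolding Pv 1 t by simp_all
      have z: "N 1 3 0 = 0" "N 3 0 1 = 0" "N 2 1 1 = 0" "N 0 3 1 = 0" "N 1 0 3 = 0" "N 0 1 3 = 0" "N 2 0 2 = 0" "N 0 2 2 = 0" "N 1 2 1 = 0" using f g by linarith+
      show ?thesis using f g e3 unfolding Pv 1 t z by simp
    next
      case 2
      have f: "2 * N 1 3 0 + N 2 1 1 + 2 * N 1 2 1 + 3 * N 0 3 1 + 2 * N 1 0 3 + 3 * N 0 1 3 + N 2 0 2 + 3 * N 0 2 2 = 2" and g: "N 3 0 1 + N 2 1 1 + N 0 3 1 + 3 * N 1 0 3 + 3 * N 0 1 3 + 2 * N 2 0 2 + 2 * N 0 2 2 + N 1 2 1 = 0"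
        using f1 e2 unfolding Pv 2 t by simp_all
      have z: "N 3 0 1 = 0" "N 2 1 1 = 0" "N 0 3 1 = 0" "N 1 0 3 = 0" "N 0 1 3 = 0" "N 2 0 2 = 0" "N 0 2 2 = 0" "N 1 2 1 = 0" using f g by linarith+
      show ?thesis using f g e3 unfolding Pv 2 t z by simp
    next
      case 3
      have f: "2 * N 1 3 0 + N 2 1 1 + 2 * N 1 2 1 + 3 * N 0 3 1 + 2 * N 1 0 3 + 3 * N 0 1 3 + N 2 0 2 + 3 * N 0 2 2 = 0" and g: "N 3 0 1 + N 2 1 1 + N 0 3 1 + 3 * N 1 0 3 + 3 * N 0 1 3 + 2 * N 2 0 2 + 2 * N 0 2 2 + N 1 2 1 = 1"
        using f1 e2 unfolding Pv 3 t by simp_all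
      have z: "N 1 3 0 = 0" "N 2 1 1 = 0" "N 0 3 1 = 0" "N 1 0 3 = 0" "N 0 1 3 = 0" "N 2 0 2 = 0" "N 0 2 2 = 0" "N 1 2 1 = 0" using f g by linarith+
      show ?thesis using f g e3 unfolding Pv 3 t z by simp
    next
      case 4
      have f: "2 * N 1 3 0 + N 2 1 1 + 2 * N 1 2 1 + 3 * N 0 3 1 + 2 * N 1 0 3 + 3 * N 0 1 3 + N 2 0 2 + 3 * N 0 2 2 = 1" and g: "N 3 0 1 + N 2 1 1 + N 0 3 1 + 3 * N 1 0 3 + 3 * N 0 1 3 + 2 * N 2 0 2 + 2 * N 0 2 2 + N 1 2 1 = 1"
        using f1 e2 unfolding Pv 4 t by simp_all
      have z: "N 1 3 0 = 0" "N 0 3 1 = 0" "N 1 0 3 = 0" "N 0 1 3 = 0" "N 2 0 2 = 0" "N 0 2 2 = 0" "N 1 2 1 = 0" using f g by linarith+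
      show ?thesis using f g e3 unfolding Pv 4 t z by simp
    qed
  qed
  show "\<nu> = \<mu>"
  proof (rule poly_mapping_eqI)
    fix a show "lk \<nu> a = lk \<mu> a"
    proof (cases "a \<in> A")
      case True
      then show ?thesis using NP unfolding AS N_def P_def by (elim insertE emptyE) simp_all
    next
      case False
      then have "lk \<mu> a = 0" using mA unfolding \<mu> by (auto simp: lookup_add lookup_single when_def)
      then show ?thesis using kv False by (auto simp: in_keys_iff)
    qed
  qed
qed

text \<open>At the unit vector of the vertex \<open>x ^ 3 y\<close> the four unit vectors of
  \<open>exc4_corner\<close> are tangent to the cone, while a smooth point of a surface allows only
  three dimensions.\<close>

lemma not_smooth_exc4:
  assumes xyz: "distinct [x, y, z]" "{x, y, z} = {..2}"
  shows "\<not> smooth_togliatti 2 4 (mon_ideal {..2} (exc4 x y z) :: (nat, 'k::field_char_0) mpoly set)"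
proof
  assume "smooth_togliatti 2 4 (mon_ideal {..2} (exc4 x y z) :: (nat, 'k) mpoly set)"
  define A where "A = expo {..2} 4 - exc4 x y z"
  let ?X = "toric_variety 2 A :: (_ \<Rightarrow> 'k) set"
  have sm: "smooth_variety A ?X"
    using \<open>smooth_togliatti _ _ _\<close> unfolding smooth_togliatti_iff[OF exc4_expo[OF xyz(2)]] A_def .
  define v where "v = tmon x y z 3 1 0"
  define e where "e m = (\<lambda>a. if a = m then 1 else 0 :: 'k)" for m :: "nat \<Rightarrow>\<^sub>0 nat"
  have AE: "A \<subseteq> expo {..2} 4" by (auto simp: A_def)
  have finA: "finite A" using AE finite_expo finite_subset by blast
  have cA: "m \<in> A" if "m \<in> exc4_corner x y z" for m
    using that unfolding A_def exc4_complement[OF xyz] exc4_corner_def by blast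
  have vc: "v \<in> exc4_corner x y z" by (simp add: v_def exc4_corner_def)
  have vA: "v \<in> A" by (rule cA[OF vc])
  then have A0: "A \<noteq> {}" by blast
  have coeff: "lk f (sg v s + sg m 1) = 0" if f: "f \<in> forms A (s + 1)" "pull f = 0" and m: "m \<in> exc4_corner x y z" for f :: "(nat \<Rightarrow>\<^sub>0 nat, 'k) mpoly" and s m
    by (rule lookup_eq_0_of_pull_eq_0[OF finA f]) (rule exc4_unique[OF xyz A_def m, where s = s], simp_all add: v_def)
  have coeff0: "lk f 0 = 0" if f: "f \<in> forms A 0" "pull f = 0" for f :: "(nat \<Rightarrow>\<^sub>0 nat, 'k) mpoly"
  proof (rule lookup_eq_0_of_pull_eq_0[OF finA f])
    fix \<nu> assume "\<nu> \<in> expo A 0"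
    then have "lk \<nu> a = 0" for a using lookup_le_mdeg[of \<nu> a] by (auto simp: expo_def)
    then show "\<nu> = 0" by (intro poly_mapping_eqI) simp
  qed
  \<comment> \<open>At this point only powers of the coordinate \<open>v\<close> are nonzero, and
    they do not occur in the equations.\<close>
  have van: "mpoly_eval f (e v) = 0" if f: "f \<in> forms A t" "pull f = 0" for f t
    unfolding mpoly_eval_def
  proof (rule sum.neutral, rule ballI)
    fix \<mu> assume \<mu>: "\<mu> \<in> Poly_Mapping.keys f"
    show "lk f \<mu> * mon_eval \<mu> (e v) = 0"
    proof (cases "mon_eval \<mu> (e v) = 0")
      case False
      then have eq: "\<mu> = sg v (lk \<mu> v)" unfolding e_def by (rule mon_eval_unit)
      have "mdeg \<mu> = t" using f(1) \<mu> by (auto simp: forms_iff expo_def)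
      then have \<mu>t: "\<mu> = sg v t" using eq by (metis mdeg_single)
      show ?thesis
      proof (cases t)
        case 0 then show ?thesis using coeff0 f \<mu>t by simp
      next
        case (Suc s)
        then have "lk f (sg v s + sg v 1) = 0" by (intro coeff vc) (use f in simp_all)
        then show ?thesis using \<mu>t Suc by (simp add: single_add[symmetric])
      qed
    qed simp
  qed
  have vX: "e v \<in> ?X"
    unfolding toric_variety_def zariski_closure_def
  proof (intro CollectI conjI ballI)
    show "e v \<in> hcoords A" using vA by (auto simp: hcoords_def e_def)
    fix f :: "(nat \<Rightarrow>\<^sub>0 nat, 'k) mpoly" assume f: "f \<in> vanishing_forms A (torus_set 2 A)"
    then obtain t where "f \<in> forms A t" by (auto simp: vanishing_forms_def)
    then show "mpoly_eval f (e v) = 0" using pull_eq_0_of_vanishing[OF AE A0 f] by (rule van)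
  qed
  \<comment> \<open>The partial derivative in the direction \<open>m\<close> at the unit vector only
    sees the coefficients of \<open>v ^ s m\<close>, which are 0 by \<open>coeff\<close>.\<close>
  have unit: "e m \<in> cone_tangent_space A ?X (e v)" if m: "m \<in> exc4_corner x y z" for m
    unfolding cone_tangent_space_def
  proof (intro CollectI conjI allI impI ballI)
    show "e m a = 0" if "a \<notin> A" for a using cA[OF m] that by (auto simp: e_def)
    fix f :: "(nat \<Rightarrow>\<^sub>0 nat, 'k) mpoly" assume "f \<in> vanishing_forms A ?X"
    then obtain t where f: "f \<in> forms A t" "pull f = 0" unfolding vanishing_forms_toric_variety[OF AE A0] by blast
    have "mpoly_eval (mpoly_partial m f) (e v) = 0"
      unfolding mpoly_eval_partial
    proof (rule sum.neutral, rule ballI)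
      fix \<mu> assume \<mu>: "\<mu> \<in> Poly_Mapping.keys f"
      show "of_nat (lk \<mu> m) * lk f \<mu> * mon_eval (\<mu> - sg m 1) (e v) = 0"
      proof (cases "lk \<mu> m = 0 \<or> mon_eval (\<mu> - sg m 1) (e v) = 0")
        case False
        define s where "s = lk (\<mu> - sg m 1) v"
        have s: "\<mu> - sg m 1 = sg v s" unfolding s_def by (rule mon_eval_unit[where ?'k = 'k]) (use False in \<open>simp add: e_def\<close>)
        have "\<mu> = (\<mu> - sg m 1) + sg m 1"
          using False by (intro poly_mapping_eqI) (auto simp: lookup_add lookup_minus lookup_single when_def)
        then have eq: "\<mu> = sg v s + sg m 1" unfolding s .
        have "mdeg \<mu> = t" using f(1) \<mu> by (auto simp: forms_iff expo_def)
        then have "t = s + 1" unfolding eq by (simp add: mdeg_add)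
        then have "f \<in> forms A (s + 1)" using f(1) by simp
        then have "lk f \<mu> = 0" unfolding eq by (rule coeff[OF _ f(2) m])
        then show ?thesis by simp
      qed auto
    qed
    moreover have "(\<Sum>a\<in>A. mpoly_eval (mpoly_partial a f) (e v) * e m a) = (\<Sum>a\<in>A. if a = m then mpoly_eval (mpoly_partial a f) (e v) else 0)"
      by (rule sum.cong) (auto simp: e_def)
    ultimately show "(\<Sum>a\<in>A. mpoly_eval (mpoly_partial a f) (e v) * e m a) = 0" using finA by simp
  qed
  have "card (exc4_corner x y z) \<le> vector_space.dim (\<lambda>(c::'k) w v. c * w v) (cone_tangent_space A ?X (e v))"
  proof (rule dim_ge_card_units[OF finA])
    show "w a = 0" if "w \<in> cone_tangent_space A ?X (e v)" "a \<notin> A" for w a using that by (simp add: cone_tangent_space_def)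
    show "finite (exc4_corner x y z)" by (simp add: exc4_corner_def)
  qed (use unit in \<open>simp add: e_def\<close>)
  moreover have "card (exc4_corner x y z) = 4" by (simp add: exc4_corner_def card_insert_if tmon_eq_iff[OF xyz(1)])
  moreover have "vector_space.dim (\<lambda>(c::'k) w v. c * w v) (cone_tangent_space A ?X (e v)) = variety_dim A ?X + 1"
    using sm vX unfolding smooth_variety_def by blast
  ultimately show False using variety_dim_le[OF AE, where ?'k = 'k] by simp
qed

theorem theorem3p9:
  fixes n d :: nat
  assumes "n \<ge> 2" and "d \<ge> 4"
  shows "(smooth_minimal_monomial_togliatti n d :: (nat, 'k::{alg_closed_field, field_char_0}) mpoly set set) \<noteq> {}
    \<and> mu_smooth TYPE('k) n d = 2 * n + 1
    \<and> mu TYPE('k) n d = 2 * n + 1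
    \<and> (\<forall>I :: (nat, 'k) mpoly set.
          (I \<in> minimal_monomial_togliatti n d \<longrightarrow> min_gens n I \<ge> 2 * n + 1) \<and>
          (I \<in> smooth_minimal_monomial_togliatti n d \<longrightarrow> min_gens n I \<ge> 2 * n + 1))
    \<and> (\<forall>I :: (nat, 'k) mpoly set.
          I \<in> minimal_monomial_togliatti n d \<and> min_gens n I = 2 * n + 1 \<and>
            \<not> trivial_togliatti n d I \<longleftrightarrow>
          (\<exists>\<pi>. \<pi> permutes {0, 1, 2} \<and>
             (n = 2 \<and> d = 5 \<and> I = exceptional_2_5 \<pi> \<or>
              n = 2 \<and> d = 4 \<and> I = exceptional_2_4 \<pi>)))
    \<and> (\<forall>\<pi>. \<pi> permutes {0, 1, 2} \<longrightarrow>
          smooth_togliatti 2 5 (exceptional_2_5 \<pi> :: (nat, 'k) mpoly set) \<and>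
          \<not> smooth_togliatti 2 4 (exceptional_2_4 \<pi> :: (nat, 'k) mpoly set))"
proof -
  \<comment> \<open>The trivial system of \<open>x_0 ^ (d - 1)\<close> is smooth and attains the
    lower bound, which settles both minima at once.\<close>
  let ?J = "mon_ideal {..n} (triv n d 0) :: (nat, 'k) mpoly set"
  have J: "?J \<in> minimal_monomial_togliatti n d" using triv_minimal[OF assms] by blast
  have sJ: "?J \<in> smooth_minimal_monomial_togliatti n d"
    unfolding smooth_minimal_monomial_togliatti_def using J smooth_triv[of n d] assms by auto
  have gJ: "min_gens n ?J = 2 * n + 1"
    using min_gens_mon_ideal[OF triv_expo[of d 0 n], where ?'k = 'k] card_triv[of d 0 n] assms by simp
  have lower: "min_gens n I \<ge> 2 * n + 1" if I: "I \<in> minimal_monomial_togliatti n d" for I :: "(nat, 'k) mpoly set"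
  proof -
    obtain E where E: "E \<subseteq> expo {..n} d" "I = mon_ideal {..n} E" "togliatti n d I" "min_gens n I = card E"
      using minimal_monomial_togliattiD[OF I] by blast
    then show ?thesis using togliatti_structure(1)[OF assms E(1), where ?'k = 'k] by simp
  qed
  have sub: "(smooth_minimal_monomial_togliatti n d :: (nat, 'k) mpoly set set) \<subseteq> minimal_monomial_togliatti n d"
    by (auto simp: smooth_minimal_monomial_togliatti_def)
  have mu: "mu TYPE('k) n d = 2 * n + 1"
    unfolding mu_def by (rule cInf_eq_minimum) (use J gJ lower in force)+
  have mu_s: "mu_smooth TYPE('k) n d = 2 * n + 1"
    unfolding mu_smooth_def by (rule cInf_eq_minimum) (use sJ gJ lower sub in force)+
  have classify: "\<exists>\<pi>. \<pi> permutes {0, 1, 2} \<and> (n = 2 \<and> d = 5 \<and> I = exceptional_2_5 \<pi> \<or> n = 2 \<and> d = 4 \<and> I = exceptional_2_4 \<pi>)"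
    if I: "I \<in> minimal_monomial_togliatti n d" "min_gens n I = 2 * n + 1" "\<not> trivial_togliatti n d I" for I :: "(nat, 'k) mpoly set"
  proof -
    obtain E where E: "E \<subseteq> expo {..n} d" "I = mon_ideal {..n} E" "togliatti n d I" "min_gens n I = card E"
      using minimal_monomial_togliattiD[OF I(1)] by blast
    have "card E = 2 * n + 1" using I(2) E(4) by simp
    from togliatti_structure(2)[OF assms E(1) E(3)[unfolded E(2)] this]
    have "\<exists>U. exc_support {..n} d U \<and> E = pures n d \<union> U"
    proof
      assume "\<exists>i\<le>n. E = triv n d i"
      then show ?thesis using I(3) E(2) triv_trivial[of d _ n, where ?'k = 'k] assms by auto
    qed
    then obtain U where U: "exc_support {..n} d U" "E = pures n d \<union> U" by blast
    obtain \<pi> where \<pi>: "\<pi> permutes {0, 1, 2}" "n = 2 \<and> d = 5 \<and> E = exc5 (\<pi> 0) (\<pi> 1) (\<pi> 2) \<or> n = 2 \<and> d = 4 \<and> E = exc4 (\<pi> 0) (\<pi> 1) (\<pi> 2)"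
      using exc_support_cases[OF U(1)] unfolding U(2) by blast
    then show ?thesis
      unfolding E(2) using exceptional_2_5_eq[OF \<pi>(1), where ?'k = 'k] exceptional_2_4_eq[OF \<pi>(1), where ?'k = 'k] by auto
  qed
  have exc5: "exceptional_2_5 \<pi> \<in> (minimal_monomial_togliatti 2 5 :: (nat, 'k) mpoly set set)"
    "min_gens 2 (exceptional_2_5 \<pi> :: (nat, 'k) mpoly set) = 5" "\<not> trivial_togliatti 2 5 (exceptional_2_5 \<pi> :: (nat, 'k) mpoly set)"
    "smooth_togliatti 2 5 (exceptional_2_5 \<pi> :: (nat, 'k) mpoly set)" if "\<pi> permutes {0, 1, 2}" for \<pi>
    unfolding exceptional_2_5_eq[OF that] min_gens_mon_ideal[OF exc5_expo[OF permutes_012(2)[OF that]]]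
    using exc5_minimal card_exc5 exc5_nontrivial smooth_exc5 permutes_012[OF that] by blast+
  have exc4: "exceptional_2_4 \<pi> \<in> (minimal_monomial_togliatti 2 4 :: (nat, 'k) mpoly set set)"
    "min_gens 2 (exceptional_2_4 \<pi> :: (nat, 'k) mpoly set) = 5" "\<not> trivial_togliatti 2 4 (exceptional_2_4 \<pi> :: (nat, 'k) mpoly set)"
    "\<not> smooth_togliatti 2 4 (exceptional_2_4 \<pi> :: (nat, 'k) mpoly set)" if "\<pi> permutes {0, 1, 2}" for \<pi>
    unfolding exceptional_2_4_eq[OF that] min_gens_mon_ideal[OF exc4_expo[OF permutes_012(2)[OF that]]]
    using exc4_minimal card_exc4 exc4_nontrivial not_smooth_exc4 permutes_012[OF that] by blast+
  have iff: "I \<in> minimal_monomial_togliatti n d \<and> min_gens n I = 2 * n + 1 \<and> \<not> trivial_togliatti n d I \<longleftrightarrow>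
    (\<exists>\<pi>. \<pi> permutes {0, 1, 2} \<and> (n = 2 \<and> d = 5 \<and> I = exceptional_2_5 \<pi> \<or> n = 2 \<and> d = 4 \<and> I = exceptional_2_4 \<pi>))" (is "?L \<longleftrightarrow> ?R")
    for I :: "(nat, 'k) mpoly set"
  proof
    assume ?L then show ?R by (intro classify) auto
  next
    assume ?R
    then obtain \<pi> where \<pi>: "\<pi> permutes {0, 1, 2}" and c: "n = 2 \<and> d = 5 \<and> I = exceptional_2_5 \<pi> \<or> n = 2 \<and> d = 4 \<and> I = exceptional_2_4 \<pi>" by blast
    from c show ?L by (elim disjE conjE) (simp_all add: exc5[OF \<pi>] exc4[OF \<pi>])
  qed
  show ?thesis
  proof (intro conjI allI impI)
    show "(smooth_minimal_monomial_togliatti n d :: (nat, 'k) mpoly set set) \<noteq> {}" using sJ by blast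
    show "mu_smooth TYPE('k) n d = 2 * n + 1" "mu TYPE('k) n d = 2 * n + 1" by (rule mu_s, rule mu)
    fix I :: "(nat, 'k) mpoly set"
    show "2 * n + 1 \<le> min_gens n I" if "I \<in> minimal_monomial_togliatti n d" by (rule lower[OF that])
    show "2 * n + 1 \<le> min_gens n I" if "I \<in> smooth_minimal_monomial_togliatti n d" using lower that sub by blast
    show "I \<in> minimal_monomial_togliatti n d \<and> min_gens n I = 2 * n + 1 \<and> \<not> trivial_togliatti n d I \<longleftrightarrow>
      (\<exists>\<pi>. \<pi> permutes {0, 1, 2} \<and> (n = 2 \<and> d = 5 \<and> I = exceptional_2_5 \<pi> \<or> n = 2 \<and> d = 4 \<and> I = exceptional_2_4 \<pi>))" by (rule iff)
  next
    fix \<pi> :: "nat \<Rightarrow> nat" assume \<pi>: "\<pi> permutes {0, 1, 2}"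
    show "smooth_togliatti 2 5 (exceptional_2_5 \<pi> :: (nat, 'k) mpoly set)" by (rule exc5(4)[OF \<pi>])
    show "\<not> smooth_togliatti 2 4 (exceptional_2_4 \<pi> :: (nat, 'k) mpoly set)" by (rule exc4(4)[OF \<pi>])
  qed
qed

end
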